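(* Let $A$ be a $C^*$-algebra and let $C$ be a Frobenius $C^*$-algebra over $A$. There is a local adjunction of $C^*$-correspondences $\phi:{}_A F_B\to {}_B E_A$ (for some $C^*$-algebra $B$, some $C^*$-correspondence ${}_AF_B$ from $A$ to $B$, and some $C^*$-correspondence ${}_BE_A$ from $B$ to $A$) such that $C\cong \mathrm{Frob}(\phi)$ as Frobenius $C^*$-algebras over $A$.
   Context: Hilbert modules: a Hilbert $B$-module $F$ is a right $B$-module with a $B$-valued inner product $\langle\,|\,\rangle$ (conjugate-linear in the first variable), complete in the norm $\|f\|=\|\langle f|f\rangle\|^{1/2}$. $\mathrm{L}_B(X,Y)$ is the space of adjointable maps between Hilbert $B$-modules and $\mathrm{L}_B(X)=\mathrm{L}_B(X,X)$. For $x\in X$, $|x\rangle\in \mathrm{L}_B(B,X)$ is $b\mapsto xb$ and $\langle x|=|x\rangle^*$ is $x'\mapsto\langle x|x'\rangle$. The compact operators are $\mathrm{K}_B(X,Y)=\overline{\mathrm{span}}\{|y\rangle\langle x| : x\in X,\ y\in Y\}$, and $\mathrm{K}_B(X)=\mathrm{K}_B(X,X)$. $\mathrm{M}(C)$ is the multiplier algebra of a $C^*$-algebra $C$; the action of $\mathrm{L}_B(X)$ on $\mathrm{K}_B(X)$ by left multiplication gives an isomorphism $\mathrm{L}_B(X)\cong \mathrm{M}(\mathrm{K}_B(X))$. The matrix space $M_n(X)$ is normed as a Hilbert $M_n(B)$-module. A $C^*$-correspondence ${}_A F_B$ from $A$ to $B$ is a Hilbert $B$-module $F$ with a $*$-homomorphism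 $\eta_F:A\to \mathrm{L}_B(F)$ that is nondegenerate: $F=\{\eta_F(a)(f) : a\in A, f\in F\}$. One writes $af=\eta_F(a)(f)$. A local adjunction between $C^*$-correspondences ${}_A F_B$ and ${}_B E_A$ is a completely bounded conjugate-linear isomorphism $\phi:F\to E$ satisfying $\phi(afb)=b^*\phi(f)a^*$ for all $a\in A,b\in B,f\in F$. Here a conjugate-linear map $\phi$ is completely bounded if the matrix extensions $\phi:M_n(F)\to M_n(E)$, $\phi(f)_{i,j}=\phi(f_{j,i})$ (note the transposition), are bounded uniformly in $n$, and it is a completely bounded conjugate-linear isomorphism if it has a completely bounded conjugate-linear inverse. A Frobenius $C^*$-algebra over $A$ is a $C^*$-algebra $C$ with a $*$-homomorphism $\eta:A\to \mathrm{M}(C)$ (used to regard $C$ as an $A$-bimodule, $ac=\eta(a)c$, $ca=c\,\eta(a)$) and a positive $A$-bimodule map $\epsilon:C\to A$ (i.e. linear, sending positive elements to positive elements) such that (1) the algebra $C\otimes^{\mathrm h}_A C$, with multiplication $(c_1\otimes c_2)\cdot(c_3\otimes c_4)=c_1\epsilon(c_2c_3)\otimes c_4$, has a bounded approximate identity; and (2) $C=\{\eta(a)c : a\in\overline{\epsilon(C)},\ c\in C\}$. Here $\otimes^{\mathrm h}_A$ is the ($A$-balanced) Haagerup tensor product of operator $A$-modules, i.e. the quotient of the Haagerup tensor product of operator spaces by the closed span of the elements $xa\otimes y-x\otimes ay$; positive $A$-bimodule maps are automatically completely bounded, so the multiplication extends from the algebraic tensor product. A bounded approximate identity of a Banach algebra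 is a bounded net $(x_\lambda)$ with $y=\lim_\lambda x_\lambda y=\lim_\lambda yx_\lambda$ in norm for all $y$. An isomorphism of Frobenius $C^*$-algebras over $A$, $\rho:C\to C'$, is an isomorphism of $C^*$-algebras that is an $A$-bimodule map and satisfies $\epsilon'\circ\rho=\epsilon$, where $\epsilon,\epsilon'$ are the Frobenius structure maps of $C$ and $C'$. For a local adjunction $\phi:{}_AF_B\to{}_BE_A$, $\mathrm{Frob}(\phi)$ denotes the Frobenius $C^*$-algebra over $A$ given by the $C^*$-algebra $\mathrm{K}_B(F)$, with $\eta=\eta_F:A\to \mathrm{L}_B(F)\cong \mathrm{M}(\mathrm{K}_B(F))$ and with $\epsilon=\epsilon_\phi:\mathrm{K}_B(F)\to A$ the positive $A$-bimodule map determined by $\epsilon_\phi(|f_1\rangle\langle f_2|)=\langle\phi(f_1)|\phi(f_2)\rangle$. *)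

theory Defs
  imports
    "HOL-Analysis.Abstract_Metric_Spaces"
    "HOL-Library.Poly_Mapping"
    "HOL-Algebra.AbelCoset"
    "HOL-Algebra.Module"
    "Jordan_Normal_Form.Matrix"
begin

text \<open>
  All structures are carrier-based, so that C*-algebras and Hilbert modules can be quantified
  existentially.  Complex vector spaces are HOL-Algebra modules over the field of complex
  numbers.  The HOL-Algebra records contain fields that may be meaningless for a given
  structure (\<open>mult\<close> and \<open>one\<close> for a vector space, \<open>one\<close> for a possibly non-unital C*-algebra);
  such fields are never referred to.
\<close>

section \<open>Normed spaces\<close>

definition complex_ring :: "complex ring"
  where "complex_ring = \<lparr>carrier = UNIV, monoid.mult = (*), one = 1, zero = 0, add = (+)\<rparr>"

record 'v nspace = "(complex, 'v) module" +
  nrm :: "'v \<Rightarrow> real"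

text \<open>The distance function is cut off outside the carrier because \<^locale>\<open>Metric_space\<close>
  requires it to be nonnegative and symmetric on the whole type.\<close>

definition norm_dist :: "(complex, 'v, 'm) module_scheme \<Rightarrow> ('v \<Rightarrow> real) \<Rightarrow> 'v \<Rightarrow> 'v \<Rightarrow> real"
  where "norm_dist V n x y =
    (if x \<in> carrier V \<and> y \<in> carrier V then n (x \<ominus>\<^bsub>V\<^esub> y) else 0)"

definition norm_complete :: "(complex, 'v, 'm) module_scheme \<Rightarrow> ('v \<Rightarrow> real) \<Rightarrow> bool"
  where "norm_complete V n \<longleftrightarrow> Metric_space.mcomplete (carrier V) (norm_dist V n)"

definition norm_closure :: "('v, 'm) nspace_scheme \<Rightarrow> 'v set \<Rightarrow> 'v set"
  where "norm_closure V S =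
    Metric_space.mtopology (carrier V) (norm_dist V (nrm V)) closure_of S"

definition lin_span :: "(complex, 'v, 'm) module_scheme \<Rightarrow> 'v set \<Rightarrow> 'v set"
  where "lin_span V S = \<Inter>{H. submodule H complex_ring V \<and> S \<subseteq> H}"

definition closed_span :: "('v, 'm) nspace_scheme \<Rightarrow> 'v set \<Rightarrow> 'v set"
  where "closed_span V S = norm_closure V (lin_span V S)"

definition op_norm :: "'x set \<Rightarrow> ('x \<Rightarrow> real) \<Rightarrow> ('y \<Rightarrow> real) \<Rightarrow> ('x \<Rightarrow> 'y) \<Rightarrow> real"
  where "op_norm X n n' T = (SUP x\<in>{x \<in> X. n x \<le> 1}. n' (T x))"

locale banach_space = Module.module complex_ring V
  for V :: "('v, 'm) nspace_scheme" (structure) +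
  assumes nrm_nonneg: "x \<in> carrier V \<Longrightarrow> 0 \<le> nrm V x"
    and nrm_eq_0_iff: "x \<in> carrier V \<Longrightarrow> nrm V x = 0 \<longleftrightarrow> x = \<zero>"
    and nrm_triangle:
      "\<lbrakk>x \<in> carrier V; y \<in> carrier V\<rbrakk> \<Longrightarrow> nrm V (x \<oplus> y) \<le> nrm V x + nrm V y"
    and nrm_smult: "x \<in> carrier V \<Longrightarrow> nrm V (c \<odot> x) = cmod c * nrm V x"
    and complete: "norm_complete V (nrm V)"

definition linear_map :: "(complex, 'v, 'm) module_scheme \<Rightarrow> (complex, 'w, 'n) module_scheme
    \<Rightarrow> ('v \<Rightarrow> 'w) \<Rightarrow> bool"
  where "linear_map V W f \<longleftrightarrow>
    f \<in> carrier V \<rightarrow> carrier W \<and>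
    (\<forall>x\<in>carrier V. \<forall>y\<in>carrier V. f (x \<oplus>\<^bsub>V\<^esub> y) = f x \<oplus>\<^bsub>W\<^esub> f y) \<and>
    (\<forall>c. \<forall>x\<in>carrier V. f (c \<odot>\<^bsub>V\<^esub> x) = c \<odot>\<^bsub>W\<^esub> f x)"

definition conj_linear_map :: "(complex, 'v, 'm) module_scheme
    \<Rightarrow> (complex, 'w, 'n) module_scheme \<Rightarrow> ('v \<Rightarrow> 'w) \<Rightarrow> bool"
  where "conj_linear_map V W f \<longleftrightarrow>
    f \<in> carrier V \<rightarrow> carrier W \<and>
    (\<forall>x\<in>carrier V. \<forall>y\<in>carrier V. f (x \<oplus>\<^bsub>V\<^esub> y) = f x \<oplus>\<^bsub>W\<^esub> f y) \<and>
    (\<forall>c. \<forall>x\<in>carrier V. f (c \<odot>\<^bsub>V\<^esub> x) = cnj c \<odot>\<^bsub>W\<^esub> f x)"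

text \<open>Quotient by a subspace \<open>N\<close>.  In the scalar multiplication the summand \<open>N\<close> only matters
  for the scalar \<open>0\<close>; the norm of a coset is the infimum of the norms of its elements.\<close>

definition quotient_space :: "('v, 'm) nspace_scheme \<Rightarrow> 'v set \<Rightarrow> 'v set nspace"
  where "quotient_space V N =
    \<lparr>carrier = a_rcosets\<^bsub>V\<^esub> N, monoid.mult = undefined, one = undefined, zero = N,
     add = (\<lambda>X Y. X <+>\<^bsub>V\<^esub> Y),
     smult = (\<lambda>c X. N <+>\<^bsub>V\<^esub> ((\<lambda>x. c \<odot>\<^bsub>V\<^esub> x) ` X)),
     nrm = (\<lambda>X. INF x\<in>X. nrm V x)\<rparr>"

text \<open>Completion: Cauchy sequences, seminormed by the limit of the norms, modulo null sequences.\<close>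

definition cauchy_space :: "('v, 'm) nspace_scheme \<Rightarrow> (nat \<Rightarrow> 'v) nspace"
  where "cauchy_space V =
    \<lparr>carrier = {s. Metric_space.MCauchy (carrier V) (norm_dist V (nrm V)) s},
     monoid.mult = undefined, one = undefined, zero = (\<lambda>_. \<zero>\<^bsub>V\<^esub>),
     add = (\<lambda>s t n. s n \<oplus>\<^bsub>V\<^esub> t n),
     smult = (\<lambda>c s n. c \<odot>\<^bsub>V\<^esub> s n),
     nrm = (\<lambda>s. lim (\<lambda>n. nrm V (s n)))\<rparr>"

definition null_sequences :: "('v, 'm) nspace_scheme \<Rightarrow> (nat \<Rightarrow> 'v) set"
  where "null_sequences V =
    {s \<in> carrier (cauchy_space V). (\<lambda>n. nrm V (s n)) \<longlonglongrightarrow> 0}"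

definition completion :: "('v, 'm) nspace_scheme \<Rightarrow> (nat \<Rightarrow> 'v) set nspace"
  where "completion V = quotient_space (cauchy_space V) (null_sequences V)"

definition to_completion :: "('v, 'm) nspace_scheme \<Rightarrow> 'v \<Rightarrow> (nat \<Rightarrow> 'v) set"
  where "to_completion V v = null_sequences V +>\<^bsub>cauchy_space V\<^esub> (\<lambda>_. v)"

definition bounded_bilinear_map :: "('u, 'k) nspace_scheme \<Rightarrow> ('v, 'm) nspace_scheme
    \<Rightarrow> ('w, 'n) nspace_scheme \<Rightarrow> ('u \<Rightarrow> 'v \<Rightarrow> 'w) \<Rightarrow> bool"
  where "bounded_bilinear_map U V W m \<longleftrightarrow>
    (\<forall>u\<in>carrier U. linear_map V W (m u)) \<and>
    (\<forall>v\<in>carrier V. linear_map U W (\<lambda>u. m u v)) \<and>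
    (\<exists>K. \<forall>u\<in>carrier U. \<forall>v\<in>carrier V. nrm W (m u v) \<le> K * nrm U u * nrm V v)"

text \<open>Bounded approximate identity for a multiplication \<open>m\<close> on \<open>V\<close>.  A net is given, as
  usual in Isabelle, by a filter: a bounded net in \<open>V\<close> generates a proper filter containing a
  bounded subset of \<open>V\<close>, and conversely.\<close>

definition has_bounded_approximate_identity ::
    "('v, 'm) nspace_scheme \<Rightarrow> ('v \<Rightarrow> 'v \<Rightarrow> 'v) \<Rightarrow> bool"
  where "has_bounded_approximate_identity V m \<longleftrightarrow>
    (\<exists>(\<F> :: 'v filter) K. \<F> \<noteq> bot \<and>
      (\<forall>\<^sub>F x in \<F>. x \<in> carrier V \<and> nrm V x \<le> K) \<and>
      (\<forall>y\<in>carrier V.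
        ((\<lambda>x. nrm V (m x y \<ominus>\<^bsub>V\<^esub> y)) \<longlongrightarrow> 0) \<F> \<and>
        ((\<lambda>x. nrm V (m y x \<ominus>\<^bsub>V\<^esub> y)) \<longlongrightarrow> 0) \<F>))"


section \<open>C*-algebras\<close>

record 'a cstar = "'a nspace" +
  star :: "'a \<Rightarrow> 'a"

locale cstar_algebra = banach_space A
  for A :: "('a, 'm) cstar_scheme" (structure) +
  assumes mult_closed: "\<lbrakk>x \<in> carrier A; y \<in> carrier A\<rbrakk> \<Longrightarrow> x \<otimes> y \<in> carrier A"
    and mult_assoc: "\<lbrakk>x \<in> carrier A; y \<in> carrier A; z \<in> carrier A\<rbrakk>
      \<Longrightarrow> (x \<otimes> y) \<otimes> z = x \<otimes> (y \<otimes> z)"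
    and mult_add_left: "\<lbrakk>x \<in> carrier A; y \<in> carrier A; z \<in> carrier A\<rbrakk>
      \<Longrightarrow> (x \<oplus> y) \<otimes> z = x \<otimes> z \<oplus> y \<otimes> z"
    and mult_add_right: "\<lbrakk>x \<in> carrier A; y \<in> carrier A; z \<in> carrier A\<rbrakk>
      \<Longrightarrow> x \<otimes> (y \<oplus> z) = x \<otimes> y \<oplus> x \<otimes> z"
    and smult_mult_left: "\<lbrakk>x \<in> carrier A; y \<in> carrier A\<rbrakk> \<Longrightarrow> (c \<odot> x) \<otimes> y = c \<odot> (x \<otimes> y)"
    and smult_mult_right: "\<lbrakk>x \<in> carrier A; y \<in> carrier A\<rbrakk> \<Longrightarrow> x \<otimes> (c \<odot> y) = c \<odot> (x \<otimes> y)"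
    and nrm_mult: "\<lbrakk>x \<in> carrier A; y \<in> carrier A\<rbrakk> \<Longrightarrow> nrm A (x \<otimes> y) \<le> nrm A x * nrm A y"
    and star_conj_linear: "conj_linear_map A A (star A)"
    and star_star: "x \<in> carrier A \<Longrightarrow> star A (star A x) = x"
    and star_mult: "\<lbrakk>x \<in> carrier A; y \<in> carrier A\<rbrakk>
      \<Longrightarrow> star A (x \<otimes> y) = star A y \<otimes> star A x"
    and cstar_identity: "x \<in> carrier A \<Longrightarrow> nrm A (star A x \<otimes> x) = (nrm A x)\<^sup>2"

definition positive_cone :: "('a, 'm) cstar_scheme \<Rightarrow> 'a set"
  where "positive_cone A = {star A x \<otimes>\<^bsub>A\<^esub> x | x. x \<in> carrier A}"

definition star_hom :: "('a, 'm) cstar_scheme \<Rightarrow> ('b, 'n) cstar_scheme \<Rightarrow> ('a \<Rightarrow> 'b) \<Rightarrow> bool"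
  where "star_hom A B h \<longleftrightarrow> linear_map A B h \<and>
    (\<forall>x\<in>carrier A. \<forall>y\<in>carrier A. h (x \<otimes>\<^bsub>A\<^esub> y) = h x \<otimes>\<^bsub>B\<^esub> h y) \<and>
    (\<forall>x\<in>carrier A. h (star A x) = star B (h x))"

text \<open>The multiplier algebra, realised by double centralisers \<open>(L, R)\<close>: \<open>L c\<close> is the product of
  the multiplier with \<open>c\<close> and \<open>R c\<close> the product of \<open>c\<close> with the multiplier.\<close>

definition multiplier_algebra :: "('c, 'm) cstar_scheme \<Rightarrow> (('c \<Rightarrow> 'c) \<times> ('c \<Rightarrow> 'c)) cstar"
  where "multiplier_algebra C =
    \<lparr>carrier = {(L, R). L \<in> carrier C \<rightarrow>\<^sub>E carrier C \<and> R \<in> carrier C \<rightarrow>\<^sub>E carrier C \<and>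
       (\<forall>x\<in>carrier C. \<forall>y\<in>carrier C. x \<otimes>\<^bsub>C\<^esub> L y = R x \<otimes>\<^bsub>C\<^esub> y)},
     monoid.mult = (\<lambda>(L, R) (L', R'). (compose (carrier C) L L', compose (carrier C) R' R)),
     one = (\<lambda>x\<in>carrier C. x, \<lambda>x\<in>carrier C. x),
     zero = (\<lambda>x\<in>carrier C. \<zero>\<^bsub>C\<^esub>, \<lambda>x\<in>carrier C. \<zero>\<^bsub>C\<^esub>),
     add = (\<lambda>(L, R) (L', R').
       (\<lambda>x\<in>carrier C. L x \<oplus>\<^bsub>C\<^esub> L' x, \<lambda>x\<in>carrier C. R x \<oplus>\<^bsub>C\<^esub> R' x)),
     smult = (\<lambda>c (L, R). (\<lambda>x\<in>carrier C. c \<odot>\<^bsub>C\<^esub> L x, \<lambda>x\<in>carrier C. c \<odot>\<^bsub>C\<^esub> R x)),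
     nrm = (\<lambda>(L, R). op_norm (carrier C) (nrm C) (nrm C) L),
     star = (\<lambda>(L, R).
       (\<lambda>x\<in>carrier C. star C (R (star C x)), \<lambda>x\<in>carrier C. star C (L (star C x))))\<rparr>"


section \<open>Hilbert modules\<close>

record ('b, 'x) hmod = "(complex, 'x) module" +
  ract :: "'x \<Rightarrow> 'b \<Rightarrow> 'x"
  ip :: "'x \<Rightarrow> 'x \<Rightarrow> 'b"

definition hnorm :: "('b, 'm) cstar_scheme \<Rightarrow> ('b, 'x, 'n) hmod_scheme \<Rightarrow> 'x \<Rightarrow> real"
  where "hnorm B X x = sqrt (nrm B (ip X x x))"

locale hilbert_module = B: cstar_algebra B + X: Module.module complex_ring X
  for B :: "('b, 'm) cstar_scheme" and X :: "('b, 'x, 'n) hmod_scheme" +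
  assumes ract_closed: "\<lbrakk>x \<in> carrier X; b \<in> carrier B\<rbrakk> \<Longrightarrow> ract X x b \<in> carrier X"
    and ract_linear_left: "b \<in> carrier B \<Longrightarrow> linear_map X X (\<lambda>x. ract X x b)"
    and ract_linear_right: "x \<in> carrier X \<Longrightarrow> linear_map B X (ract X x)"
    and ract_mult: "\<lbrakk>x \<in> carrier X; b \<in> carrier B; b' \<in> carrier B\<rbrakk>
      \<Longrightarrow> ract X x (b \<otimes>\<^bsub>B\<^esub> b') = ract X (ract X x b) b'"
    and ip_linear: "x \<in> carrier X \<Longrightarrow> linear_map X B (ip X x)"
    and ip_conj_linear: "y \<in> carrier X \<Longrightarrow> conj_linear_map X B (\<lambda>x. ip X x y)"
    and ip_ract: "\<lbrakk>x \<in> carrier X; y \<in> carrier X; b \<in> carrier B\<rbrakk>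
      \<Longrightarrow> ip X x (ract X y b) = ip X x y \<otimes>\<^bsub>B\<^esub> b"
    and ip_star: "\<lbrakk>x \<in> carrier X; y \<in> carrier X\<rbrakk> \<Longrightarrow> star B (ip X x y) = ip X y x"
    and ip_positive: "x \<in> carrier X \<Longrightarrow> ip X x x \<in> positive_cone B"
    and ip_definite: "\<lbrakk>x \<in> carrier X; ip X x x = \<zero>\<^bsub>B\<^esub>\<rbrakk> \<Longrightarrow> x = \<zero>\<^bsub>X\<^esub>"
    and hnorm_complete: "norm_complete X (hnorm B X)"

definition adjoint_pair :: "('b, 'x, 'm) hmod_scheme \<Rightarrow> ('b, 'y, 'n) hmod_scheme
    \<Rightarrow> ('x \<Rightarrow> 'y) \<Rightarrow> ('y \<Rightarrow> 'x) \<Rightarrow> bool"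
  where "adjoint_pair X Y T S \<longleftrightarrow>
    T \<in> carrier X \<rightarrow>\<^sub>E carrier Y \<and> S \<in> carrier Y \<rightarrow>\<^sub>E carrier X \<and>
    (\<forall>x\<in>carrier X. \<forall>y\<in>carrier Y. ip Y (T x) y = ip X x (S y))"

definition adjointable_algebra ::
    "('b, 'm) cstar_scheme \<Rightarrow> ('b, 'x, 'n) hmod_scheme \<Rightarrow> ('x \<Rightarrow> 'x) cstar"
  where "adjointable_algebra B X =
    \<lparr>carrier = {T. \<exists>S. adjoint_pair X X T S},
     monoid.mult = compose (carrier X),
     one = (\<lambda>x\<in>carrier X. x),
     zero = (\<lambda>x\<in>carrier X. \<zero>\<^bsub>X\<^esub>),
     add = (\<lambda>S T. \<lambda>x\<in>carrier X. S x \<oplus>\<^bsub>X\<^esub> T x),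
     smult = (\<lambda>c T. \<lambda>x\<in>carrier X. c \<odot>\<^bsub>X\<^esub> T x),
     nrm = op_norm (carrier X) (hnorm B X) (hnorm B X),
     star = (\<lambda>T. THE S. adjoint_pair X X T S)\<rparr>"

definition ket :: "('b, 'm) cstar_scheme \<Rightarrow> ('b, 'x, 'n) hmod_scheme \<Rightarrow> 'x \<Rightarrow> 'b \<Rightarrow> 'x"
  where "ket B X x = (\<lambda>b\<in>carrier B. ract X x b)"

definition bra :: "('b, 'x, 'n) hmod_scheme \<Rightarrow> 'x \<Rightarrow> 'x \<Rightarrow> 'b"
  where "bra X x = (\<lambda>x'\<in>carrier X. ip X x x')"

definition ketbra ::
    "('b, 'm) cstar_scheme \<Rightarrow> ('b, 'x, 'n) hmod_scheme \<Rightarrow> 'x \<Rightarrow> 'x \<Rightarrow> 'x \<Rightarrow> 'x"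
  where "ketbra B X y x = compose (carrier X) (ket B X y) (bra X x)"

definition compact_algebra ::
    "('b, 'm) cstar_scheme \<Rightarrow> ('b, 'x, 'n) hmod_scheme \<Rightarrow> ('x \<Rightarrow> 'x) cstar"
  where "compact_algebra B X = (adjointable_algebra B X)
    \<lparr>carrier := closed_span (adjointable_algebra B X)
       {ketbra B X y x | x y. x \<in> carrier X \<and> y \<in> carrier X}\<rparr>"

text \<open>The isomorphism of the adjointable operators with the multipliers of the compact ones.\<close>

definition adjointable_to_multiplier :: "('b, 'm) cstar_scheme \<Rightarrow> ('b, 'x, 'n) hmod_scheme
    \<Rightarrow> ('x \<Rightarrow> 'x) \<Rightarrow> (('x \<Rightarrow> 'x) \<Rightarrow> ('x \<Rightarrow> 'x)) \<times> (('x \<Rightarrow> 'x) \<Rightarrow> ('x \<Rightarrow> 'x))"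
  where "adjointable_to_multiplier B X T =
    (\<lambda>k\<in>carrier (compact_algebra B X). compose (carrier X) T k,
     \<lambda>k\<in>carrier (compact_algebra B X). compose (carrier X) k T)"


section \<open>Matrices\<close>

text \<open>The Hilbert module norm on columns over \<open>B\<close>, and the norm of a rectangular matrix over
  \<open>B\<close> as an operator between spaces of columns.  For square matrices the latter is the C*-norm;
  for a single row or column it is the operator space norm used in the Haagerup norm below.\<close>

definition column_norm :: "('b, 'm) cstar_scheme \<Rightarrow> 'b vec \<Rightarrow> real"
  where "column_norm B v =
    sqrt (nrm B (\<Oplus>\<^bsub>B\<^esub>i\<in>{..<dim_vec v}. star B (v $ i) \<otimes>\<^bsub>B\<^esub> (v $ i)))"

definition mat_apply :: "('b, 'm) cstar_scheme \<Rightarrow> 'b mat \<Rightarrow> 'b vec \<Rightarrow> 'b vec"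
  where "mat_apply B M v =
    vec (dim_row M) (\<lambda>i. \<Oplus>\<^bsub>B\<^esub>j\<in>{..<dim_col M}. (M $$ (i, j)) \<otimes>\<^bsub>B\<^esub> (v $ j))"

definition matrix_norm :: "('b, 'm) cstar_scheme \<Rightarrow> 'b mat \<Rightarrow> real"
  where "matrix_norm B M =
    op_norm {v \<in> carrier_vec (dim_col M). \<forall>j<dim_col M. v $ j \<in> carrier B}
      (column_norm B) (column_norm B) (mat_apply B M)"

definition matrices :: "nat \<Rightarrow> nat \<Rightarrow> 'x set \<Rightarrow> 'x mat set"
  where "matrices r s X = {M \<in> carrier_mat r s. elements_mat M \<subseteq> X}"

definition matrix_algebra :: "nat \<Rightarrow> ('b, 'm) cstar_scheme \<Rightarrow> 'b mat cstar"
  where "matrix_algebra n B =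
    \<lparr>carrier = matrices n n (carrier B),
     monoid.mult = (\<lambda>M N. mat n n (\<lambda>(i, j).
       \<Oplus>\<^bsub>B\<^esub>k\<in>{..<n}. (M $$ (i, k)) \<otimes>\<^bsub>B\<^esub> (N $$ (k, j)))),
     one = undefined,
     zero = mat n n (\<lambda>_. \<zero>\<^bsub>B\<^esub>),
     add = (\<lambda>M N. mat n n (\<lambda>ij. (M $$ ij) \<oplus>\<^bsub>B\<^esub> (N $$ ij))),
     smult = (\<lambda>c. map_mat (\<lambda>x. c \<odot>\<^bsub>B\<^esub> x)),
     nrm = matrix_norm B,
     star = (\<lambda>M. map_mat (star B) (transpose_mat M))\<rparr>"

definition matrix_module ::
    "nat \<Rightarrow> ('b, 'm) cstar_scheme \<Rightarrow> ('b, 'x, 'n) hmod_scheme \<Rightarrow> ('b mat, 'x mat) hmod"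
  where "matrix_module n B X =
    \<lparr>carrier = matrices n n (carrier X),
     monoid.mult = undefined, one = undefined,
     zero = mat n n (\<lambda>_. \<zero>\<^bsub>X\<^esub>),
     add = (\<lambda>M N. mat n n (\<lambda>ij. (M $$ ij) \<oplus>\<^bsub>X\<^esub> (N $$ ij))),
     smult = (\<lambda>c. map_mat (\<lambda>x. c \<odot>\<^bsub>X\<^esub> x)),
     ract = (\<lambda>M N. mat n n (\<lambda>(i, j).
       \<Oplus>\<^bsub>X\<^esub>k\<in>{..<n}. ract X (M $$ (i, k)) (N $$ (k, j)))),
     ip = (\<lambda>M N. mat n n (\<lambda>(i, j).
       \<Oplus>\<^bsub>B\<^esub>k\<in>{..<n}. ip X (M $$ (k, i)) (N $$ (k, j))))\<rparr>"

definition cb_conj_linear_map :: "('b, 'm) cstar_scheme \<Rightarrow> ('b, 'x, 'n) hmod_scheme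
    \<Rightarrow> ('a, 'k) cstar_scheme \<Rightarrow> ('a, 'y, 'l) hmod_scheme \<Rightarrow> ('x \<Rightarrow> 'y) \<Rightarrow> bool"
  where "cb_conj_linear_map B X A Y \<phi> \<longleftrightarrow> conj_linear_map X Y \<phi> \<and>
    (\<exists>K. \<forall>n. \<forall>M \<in> matrices n n (carrier X).
      hnorm (matrix_algebra n A) (matrix_module n A Y) (map_mat \<phi> (transpose_mat M))
        \<le> K * hnorm (matrix_algebra n B) (matrix_module n B X) M)"


section \<open>C*-correspondences and local adjunctions\<close>

record ('a, 'b, 'x) corr = "('b, 'x) hmod" +
  lact :: "'a \<Rightarrow> 'x \<Rightarrow> 'x"

locale correspondence = A: cstar_algebra A + hilbert_module B F
  for A :: "('a, 'k) cstar_scheme" and B :: "('b, 'm) cstar_scheme"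
    and F :: "('a, 'b, 'x, 'n) corr_scheme" +
  assumes lact_star_hom: "star_hom A (adjointable_algebra B F) (lact F)"
    and nondegenerate: "carrier F = {lact F a f | a f. a \<in> carrier A \<and> f \<in> carrier F}"

locale local_adjunction = F: correspondence A B F + E: correspondence B A E
  for A :: "('a, 'k) cstar_scheme" and B :: "('b, 'm) cstar_scheme"
    and F :: "('a, 'b, 'x, 'n) corr_scheme" and E :: "('b, 'a, 'y, 'l) corr_scheme"
    and \<phi> :: "'x \<Rightarrow> 'y" +
  assumes cb: "cb_conj_linear_map B F A E \<phi>"
    and cb_inverse: "\<exists>\<psi>. cb_conj_linear_map A E B F \<psi> \<and>
      (\<forall>f\<in>carrier F. \<psi> (\<phi> f) = f) \<and> (\<forall>e\<in>carrier E. \<phi> (\<psi> e) = e)"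
    and bimodule: "\<lbrakk>a \<in> carrier A; b \<in> carrier B; f \<in> carrier F\<rbrakk>
      \<Longrightarrow> \<phi> (ract F (lact F a f) b) = ract E (lact E (star B b) (\<phi> f)) (star A a)"


section \<open>The Haagerup tensor product\<close>

text \<open>The free complex vector space on pairs, and the bilinearity relations.  The norm field of
  the free space is not used.\<close>

definition pair :: "'x \<Rightarrow> 'y \<Rightarrow> ('x \<times> 'y) \<Rightarrow>\<^sub>0 complex"
  where "pair x y = Poly_Mapping.single (x, y) 1"

definition free_space :: "('x, 'm) cstar_scheme \<Rightarrow> ('y, 'n) cstar_scheme
    \<Rightarrow> (('x \<times> 'y) \<Rightarrow>\<^sub>0 complex) nspace"
  where "free_space X Y =
    \<lparr>carrier = {u. Poly_Mapping.keys u \<subseteq> carrier X \<times> carrier Y},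
     monoid.mult = undefined, one = undefined, zero = 0, add = (+),
     smult = (\<lambda>c. Poly_Mapping.map ((*) c)),
     nrm = undefined\<rparr>"

definition bilinear_relations :: "('x, 'm) cstar_scheme \<Rightarrow> ('y, 'n) cstar_scheme
    \<Rightarrow> (('x \<times> 'y) \<Rightarrow>\<^sub>0 complex) set"
  where "bilinear_relations X Y =
    {pair (x \<oplus>\<^bsub>X\<^esub> x') y - pair x y - pair x' y | x x' y.
       x \<in> carrier X \<and> x' \<in> carrier X \<and> y \<in> carrier Y} \<union>
    {pair x (y \<oplus>\<^bsub>Y\<^esub> y') - pair x y - pair x y' | x y y'.
       x \<in> carrier X \<and> y \<in> carrier Y \<and> y' \<in> carrier Y} \<union>
    {pair (c \<odot>\<^bsub>X\<^esub> x) y - Poly_Mapping.map ((*) c) (pair x y) | c x y.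
       x \<in> carrier X \<and> y \<in> carrier Y} \<union>
    {pair x (c \<odot>\<^bsub>Y\<^esub> y) - Poly_Mapping.map ((*) c) (pair x y) | c x y.
       x \<in> carrier X \<and> y \<in> carrier Y}"

text \<open>The algebraic tensor product with the Haagerup norm
  $\inf \{ \|x\| \|y\| : u = \sum_k x_{1k} \otimes y_{k1} \}$, where $x$ is a row over $X$ and
  $y$ a column over $Y$ of the same length.\<close>

definition haagerup_algebraic :: "('x, 'm) cstar_scheme \<Rightarrow> ('y, 'n) cstar_scheme
    \<Rightarrow> (('x \<times> 'y) \<Rightarrow>\<^sub>0 complex) set nspace"
  where "haagerup_algebraic X Y =
    (quotient_space (free_space X Y) (lin_span (free_space X Y) (bilinear_relations X Y)))
    \<lparr>nrm := (\<lambda>u. Inf {matrix_norm X x * matrix_norm Y y | x y p.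
       x \<in> matrices 1 p (carrier X) \<and> y \<in> matrices p 1 (carrier Y) \<and>
       (\<Sum>k<p. pair (x $$ (0, k)) (y $$ (k, 0))) \<in> u})\<rparr>"

type_synonym ('x, 'y) haagerup = "(nat \<Rightarrow> (('x \<times> 'y) \<Rightarrow>\<^sub>0 complex) set) set"

definition haagerup_space :: "('x, 'm) cstar_scheme \<Rightarrow> ('y, 'n) cstar_scheme
    \<Rightarrow> ('x, 'y) haagerup nspace"
  where "haagerup_space X Y = completion (haagerup_algebraic X Y)"

definition haagerup_elem :: "('x, 'm) cstar_scheme \<Rightarrow> ('y, 'n) cstar_scheme
    \<Rightarrow> 'x \<Rightarrow> 'y \<Rightarrow> ('x, 'y) haagerup"
  where "haagerup_elem X Y x y = to_completion (haagerup_algebraic X Y)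
    (lin_span (free_space X Y) (bilinear_relations X Y) +>\<^bsub>free_space X Y\<^esub> pair x y)"

text \<open>The balanced version, for a right action \<open>r\<close> of \<open>A\<close> on \<open>X\<close> and a left action \<open>l\<close> of
  \<open>A\<close> on \<open>Y\<close>.\<close>

definition balanced_relations :: "('a, 'k) cstar_scheme
    \<Rightarrow> ('x, 'm) cstar_scheme \<Rightarrow> ('x \<Rightarrow> 'a \<Rightarrow> 'x)
    \<Rightarrow> ('y, 'n) cstar_scheme \<Rightarrow> ('a \<Rightarrow> 'y \<Rightarrow> 'y) \<Rightarrow> ('x, 'y) haagerup set"
  where "balanced_relations A X r Y l = closed_span (haagerup_space X Y)
    {haagerup_elem X Y (r x a) y \<ominus>\<^bsub>haagerup_space X Y\<^esub> haagerup_elem X Y x (l a y) | x a y.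
       x \<in> carrier X \<and> a \<in> carrier A \<and> y \<in> carrier Y}"

definition balanced_haagerup_space :: "('a, 'k) cstar_scheme
    \<Rightarrow> ('x, 'm) cstar_scheme \<Rightarrow> ('x \<Rightarrow> 'a \<Rightarrow> 'x)
    \<Rightarrow> ('y, 'n) cstar_scheme \<Rightarrow> ('a \<Rightarrow> 'y \<Rightarrow> 'y) \<Rightarrow> ('x, 'y) haagerup set nspace"
  where "balanced_haagerup_space A X r Y l =
    quotient_space (haagerup_space X Y) (balanced_relations A X r Y l)"

definition balanced_haagerup_elem :: "('a, 'k) cstar_scheme
    \<Rightarrow> ('x, 'm) cstar_scheme \<Rightarrow> ('x \<Rightarrow> 'a \<Rightarrow> 'x)
    \<Rightarrow> ('y, 'n) cstar_scheme \<Rightarrow> ('a \<Rightarrow> 'y \<Rightarrow> 'y) \<Rightarrow> 'x \<Rightarrow> 'y \<Rightarrow> ('x, 'y) haagerup set"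
  where "balanced_haagerup_elem A X r Y l x y =
    balanced_relations A X r Y l +>\<^bsub>haagerup_space X Y\<^esub> haagerup_elem X Y x y"


section \<open>Frobenius C*-algebras\<close>

record ('a, 'c) frobenius =
  alg :: "'c cstar"
  eta :: "'a \<Rightarrow> ('c \<Rightarrow> 'c) \<times> ('c \<Rightarrow> 'c)"
  eps :: "'c \<Rightarrow> 'a"

definition left_mult :: "('a, 'c, 'm) frobenius_scheme \<Rightarrow> 'a \<Rightarrow> 'c \<Rightarrow> 'c"
  where "left_mult C a c = fst (eta C a) c"

definition right_mult :: "('a, 'c, 'm) frobenius_scheme \<Rightarrow> 'c \<Rightarrow> 'a \<Rightarrow> 'c"
  where "right_mult C c a = snd (eta C a) c"

definition positive_bimodule_map :: "('a, 'k) cstar_scheme \<Rightarrow> 'c cstar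
    \<Rightarrow> ('a \<Rightarrow> ('c \<Rightarrow> 'c) \<times> ('c \<Rightarrow> 'c)) \<Rightarrow> ('c \<Rightarrow> 'a) \<Rightarrow> bool"
  where "positive_bimodule_map A C h e \<longleftrightarrow> linear_map C A e \<and>
    e ` positive_cone C \<subseteq> positive_cone A \<and>
    (\<forall>a\<in>carrier A. \<forall>c\<in>carrier C.
      e (fst (h a) c) = a \<otimes>\<^bsub>A\<^esub> e c \<and> e (snd (h a) c) = e c \<otimes>\<^bsub>A\<^esub> a)"

definition frobenius_tensor :: "('a, 'k) cstar_scheme \<Rightarrow> ('a, 'c, 'm) frobenius_scheme
    \<Rightarrow> ('c, 'c) haagerup set nspace"
  where "frobenius_tensor A C =
    balanced_haagerup_space A (alg C) (right_mult C) (alg C) (left_mult C)"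

definition frobenius_elem :: "('a, 'k) cstar_scheme \<Rightarrow> ('a, 'c, 'm) frobenius_scheme
    \<Rightarrow> 'c \<Rightarrow> 'c \<Rightarrow> ('c, 'c) haagerup set"
  where "frobenius_elem A C =
    balanced_haagerup_elem A (alg C) (right_mult C) (alg C) (left_mult C)"

text \<open>The multiplication on the tensor product: the continuous bilinear extension of the formula
  on elementary tensors.  It is unique because elementary tensors have dense span.\<close>

definition frobenius_product :: "('a, 'k) cstar_scheme \<Rightarrow> ('a, 'c, 'm) frobenius_scheme
    \<Rightarrow> (('c, 'c) haagerup set \<Rightarrow> ('c, 'c) haagerup set \<Rightarrow> ('c, 'c) haagerup set) \<Rightarrow> bool"
  where "frobenius_product A C m \<longleftrightarrow>
    bounded_bilinear_map (frobenius_tensor A C) (frobenius_tensor A C) (frobenius_tensor A C) m \<and>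
    (\<forall>c1\<in>carrier (alg C). \<forall>c2\<in>carrier (alg C). \<forall>c3\<in>carrier (alg C). \<forall>c4\<in>carrier (alg C).
      m (frobenius_elem A C c1 c2) (frobenius_elem A C c3 c4) =
      frobenius_elem A C (right_mult C c1 (eps C (c2 \<otimes>\<^bsub>alg C\<^esub> c3))) c4)"

locale frobenius_cstar_algebra = A: cstar_algebra A + C: cstar_algebra "alg C"
  for A :: "('a, 'k) cstar_scheme" and C :: "('a, 'c, 'm) frobenius_scheme" +
  assumes eta_star_hom: "star_hom A (multiplier_algebra (alg C)) (eta C)"
    and eps_positive: "positive_bimodule_map A (alg C) (eta C) (eps C)"
    and approximate_identity:
      "\<exists>m. frobenius_product A C m \<and> has_bounded_approximate_identity (frobenius_tensor A C) m"
    and nondegenerate: "carrier (alg C) =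
      {left_mult C a c | a c. a \<in> norm_closure A (eps C ` carrier (alg C)) \<and> c \<in> carrier (alg C)}"

definition frobenius_isomorphic :: "('a, 'k) cstar_scheme \<Rightarrow> ('a, 'c, 'm) frobenius_scheme
    \<Rightarrow> ('a, 'd, 'n) frobenius_scheme \<Rightarrow> bool"
  where "frobenius_isomorphic A C D \<longleftrightarrow>
    (\<exists>\<rho>. bij_betw \<rho> (carrier (alg C)) (carrier (alg D)) \<and> star_hom (alg C) (alg D) \<rho> \<and>
      (\<forall>a\<in>carrier A. \<forall>c\<in>carrier (alg C).
        \<rho> (left_mult C a c) = left_mult D a (\<rho> c) \<and>
        \<rho> (right_mult C c a) = right_mult D (\<rho> c) a) \<and>
      (\<forall>c\<in>carrier (alg C). eps D (\<rho> c) = eps C c))"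

text \<open>Positive maps are bounded, so the structure map below is determined by its values on the
  rank-one operators.  Functions on the carrier are made unique by extensionality.\<close>

definition Frob :: "('a, 'k) cstar_scheme \<Rightarrow> ('b, 'm) cstar_scheme
    \<Rightarrow> ('a, 'b, 'x, 'n) corr_scheme \<Rightarrow> ('b, 'a, 'y, 'l) corr_scheme \<Rightarrow> ('x \<Rightarrow> 'y)
    \<Rightarrow> ('a, 'x \<Rightarrow> 'x) frobenius"
  where "Frob A B F E \<phi> =
    (let K = compact_algebra B F; h = (\<lambda>a. adjointable_to_multiplier B F (lact F a)) in
    \<lparr>alg = K,
     eta = h,
     eps = (THE e. e \<in> extensional (carrier K) \<and> positive_bimodule_map A K h e \<and>
       (\<forall>f1\<in>carrier F. \<forall>f2\<in>carrier F. e (ketbra B F f1 f2) = ip E (\<phi> f1) (\<phi> f2)))\<rparr>)"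

end

theory Submission
  imports Defs "HOL-Analysis.Analysis" "HOL-Computational_Algebra.Formal_Power_Series"
begin


text \<open>Take \<open>B = C\<close>, let \<open>F\<close> be \<open>C\<close> as a Hilbert module over itself, and let \<open>E\<close> be \<open>C\<close> with its right
  action of \<open>A\<close> and the inner product $\langle x | y \rangle = \epsilon(x^* y)$.  The compact operators
  on \<open>F\<close> are the left multiplications by elements of \<open>C\<close>, because every element of a C*-algebra is a
  product, so \<open>C\<close> is isomorphic to \<open>Frob \<phi>\<close> for $\phi(x) = x^*$, provided that \<open>\<phi>\<close> is a local adjunction.

  Complete boundedness of \<open>\<phi>\<close> comes from positivity of $\epsilon$.  For the inverse, the bounded
  approximate identity yields elements $\sum_k x_k \otimes y_k$ with row norm of \<open>x\<close> and column norm of \<open>y\<close>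
  bounded and $\sum_k x_k\,\epsilon(y_k c)\,v$ close to \<open>c v\<close>; each of these sums is bounded by the norm of
  \<open>c\<close> in \<open>E\<close>, by the Cauchy-Schwarz inequality for $\epsilon$, and the same estimate holds for matrices.
  To get back from the completed balanced tensor product to elements of \<open>C\<close>, one uses that multiplication
  is a contraction on the Haagerup tensor product.\<close>

section \<open>C*-algebras and their positive elements\<close>

text \<open>The statement speaks of carriers, but the estimates are made in type classes: a carrier
  algebra is a direct factor of a product algebra on its element type.

  \<open>C\<close> need not have a unit, yet square roots, factorizations and the contractivity of
  the action of \<open>A\<close> call for one. They are computed in a unital algebra containing
  \<open>C\<close> as an ideal, mostly from the binomial series of (1 - k)^a with 0 < a < 1, which
  converges absolutely on the closed unit ball; the decay of (1 - k) k^n brings the results back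
  into \<open>C\<close>. No spectrum occurs.

  Complete boundedness asks for a constant independent of the matrix size. Entrywise estimates grow
  with the size; the growth disappears when they are applied to the powers H^(2^m) of a self-adjoint
  matrix.

  \<open>E\<close> is normed through \<epsilon> only, so the 1 by 1 case of the estimate for the
  inverse is needed before \<open>E\<close> is known to be a Hilbert module. The completion uses
  Cauchy sequences in a metric space, so the Haagerup seminorm must be shown to be definite, and
  linear functionals are used for this.\<close>

class cstar_alg = real_normed_algebra + banach +
  fixes adj :: "'a \<Rightarrow> 'a" and imul :: "'a \<Rightarrow> 'a"
  assumes adj_add: "adj (x + y) = adj x + adj y"
    and adj_scaleR: "adj (r *\<^sub>R x) = r *\<^sub>R adj x"
    and adj_adj [simp]: "adj (adj x) = x"
    and adj_mult: "adj (x * y) = adj y * adj x"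
    and cstar_norm: "norm (adj x * x) = (norm x)\<^sup>2"
    and imul_add: "imul (x + y) = imul x + imul y"
    and imul_scaleR: "imul (r *\<^sub>R x) = r *\<^sub>R imul x"
    and imul_imul [simp]: "imul (imul x) = - x"
    and imul_mult_left: "imul x * y = imul (x * y)"
    and imul_mult_right: "x * imul y = imul (x * y)"
    and adj_imul: "adj (imul x) = - imul (adj x)"

class cstar_alg_1 = cstar_alg + real_normed_algebra_1

lemma norm_adj [simp]: "norm (adj (x::'a::cstar_alg)) = norm x"
proof -
  have le: "norm y \<le> norm (adj y)" for y :: 'a
  proof (cases "norm y = 0")
    case False
    have "norm y * norm y \<le> norm (adj y) * norm y"
      using norm_mult_ineq[of "adj y" y] cstar_norm[of y] by (simp add: power2_eq_square)
    then show ?thesis using False by (simp add: mult_le_cancel_right)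
  qed simp
  show ?thesis using le[of x] le[of "adj x"] by simp
qed

lemma bounded_linear_adj: "bounded_linear (adj :: 'a::cstar_alg \<Rightarrow> 'a)"
  by (rule bounded_linear_intro[of _ 1]) (simp_all add: adj_add adj_scaleR)

lemmas adj_0 [simp] = linear_0[OF bounded_linear.linear[OF bounded_linear_adj]]
  and adj_diff = linear_diff[OF bounded_linear.linear[OF bounded_linear_adj]]
  and adj_minus = linear_neg[OF bounded_linear.linear[OF bounded_linear_adj]]
  and adj_sum = linear_sum[OF bounded_linear.linear[OF bounded_linear_adj]]
  and tendsto_adj [tendsto_intros] = bounded_linear.tendsto[OF bounded_linear_adj]

text \<open>Not an axiom: in \<open>adj (imul x) * imul x\<close> the two imaginary units cancel,
  which leaves \<open>adj x * x\<close> for the C*-identity.\<close>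

lemma norm_imul [simp]: "norm (imul (x::'a::cstar_alg)) = norm x"
proof -
  have "imul (- imul y) = y" for y :: 'a
    using imul_scaleR[of "-1" "imul y"] by simp
  then have "adj (imul x) * imul x = adj x * x"
    by (simp add: adj_imul imul_mult_left imul_mult_right)
  then have "(norm (imul x))\<^sup>2 = (norm x)\<^sup>2" by (metis cstar_norm)
  then show ?thesis by simp
qed

lemma bounded_linear_imul: "bounded_linear (imul :: 'a::cstar_alg \<Rightarrow> 'a)"
  by (rule bounded_linear_intro[of _ 1]) (simp_all add: imul_add imul_scaleR)

lemmas imul_0 [simp] = linear_0[OF bounded_linear.linear[OF bounded_linear_imul]]
  and imul_diff = linear_diff[OF bounded_linear.linear[OF bounded_linear_imul]]
  and imul_minus = linear_neg[OF bounded_linear.linear[OF bounded_linear_imul]]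
  and tendsto_imul [tendsto_intros] = bounded_linear.tendsto[OF bounded_linear_imul]

lemma adj_one [simp]: "adj (1::'a::cstar_alg_1) = 1"
  by (metis adj_adj adj_mult mult.right_neutral)

lemma adj_power: "adj ((x::'a::cstar_alg_1) ^ n) = adj x ^ n"
  by (induction n) (simp_all add: adj_mult power_commutes)

lemma adj_of_real [simp]: "adj (of_real t :: 'a::cstar_alg_1) = of_real t"
  by (simp add: of_real_def adj_scaleR)

lemma norm_square_selfadjoint: "adj (x::'a::cstar_alg) = x \<Longrightarrow> norm (x * x) = (norm x)\<^sup>2"
  by (metis cstar_norm)

section \<open>Power series of (1 - k)^a on the closed unit ball\<close>

definition binom_coeff :: "real \<Rightarrow> nat \<Rightarrow> real"
  where "binom_coeff a n = (- 1) ^ n * (a gchoose n)"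

lemma binom_coeff_0 [simp]: "binom_coeff a 0 = 1"
  by (simp add: binom_coeff_def)

text \<open>\<open>binom_coeff a n\<close> is the coefficient of k^n in (1 - k)^a, so this is the
  coefficient form of (1 - k)^a (1 - k)^b = (1 - k)^(a + b), i.e. Vandermonde's identity.\<close>

lemma binom_coeff_convolution:
  "(\<Sum>i\<le>n. binom_coeff a i * binom_coeff b (n - i)) = binom_coeff (a + b) n"
proof -
  have "(\<Sum>i\<le>n. binom_coeff a i * binom_coeff b (n - i))
      = (\<Sum>i\<le>n. (- 1) ^ n * ((a gchoose i) * (b gchoose (n - i))))"
  proof (rule sum.cong[OF refl])
    fix i assume "i \<in> {..n}"
    then have "(- 1::real) ^ n = (- 1) ^ i * (- 1) ^ (n - i)" by (simp flip: power_add)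
    then show "binom_coeff a i * binom_coeff b (n - i) = (- 1) ^ n * ((a gchoose i) * (b gchoose (n - i)))"
      by (simp add: binom_coeff_def)
  qed
  also have "\<dots> = (- 1) ^ n * (\<Sum>i=0..n. (a gchoose i) * (b gchoose (n - i)))"
    by (simp add: sum_distrib_left atMost_atLeast0)
  also have "\<dots> = binom_coeff (a + b) n"
    by (simp add: gbinomial_Vandermonde binom_coeff_def)
  finally show ?thesis .
qed

lemma binom_coeff_Suc: "binom_coeff a (Suc n) = binom_coeff a n * ((real n - a) / (real n + 1))"
proof -
  have "(a gchoose Suc n) * (real n + 1) = (a gchoose n) * (a - real n)"
    using gbinomial_mult_1[of a n] by (simp add: algebra_simps)
  then have "a gchoose Suc n = (a gchoose n) * (- ((real n - a) / (real n + 1)))"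
    by (simp add: field_simps)
  then have "binom_coeff a (Suc n) = (- 1) ^ Suc n * ((a gchoose n) * (- ((real n - a) / (real n + 1))))"
    by (simp only: binom_coeff_def)
  then show ?thesis by (simp add: binom_coeff_def)
qed

lemma binom_coeff_zero: "binom_coeff 0 n = (if n = 0 then 1 else 0)"
  by (induction n) (simp_all add: binom_coeff_Suc)

lemma binom_coeff_one: "binom_coeff 1 n = (if n = 0 then 1 else if n = 1 then - 1 else 0)"
  by (induction n) (simp_all add: binom_coeff_Suc)

lemma binom_coeff_neg_exponent: "a < 0 \<Longrightarrow> 0 \<le> binom_coeff a n"
  by (induction n) (simp_all add: binom_coeff_Suc)

text \<open>The first coefficient after the constant one is -a, and the later factors (n - a)/(n +
  1) of the recursion are nonnegative for a < 1.\<close>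

lemma binom_coeff_nonpos:
  assumes "0 < a" "a < 1" shows "binom_coeff a (Suc n) \<le> 0"
proof (induction n)
  case (Suc n)
  moreover have "0 \<le> (real (Suc n) - a) / (real (Suc n) + 1)" using assms by simp
  ultimately show ?case unfolding binom_coeff_Suc[of a "Suc n"] by (rule mult_nonpos_nonneg)
qed (use assms in \<open>simp add: binom_coeff_Suc\<close>)

text \<open>Summing coefficients is division by 1 - k, which lowers the exponent by one.\<close>

lemma binom_coeff_sum: "(\<Sum>i\<le>n. binom_coeff a i) = binom_coeff (a - 1) n"
  using gbinomial_sum_lower_neg[of a n] by (simp add: binom_coeff_def mult.commute)

text \<open>After the zeroth coefficient all have the same sign, so the absolute values add up to 1
  minus a partial sum, and that partial sum is a coefficient of (1 - k)^(a - 1), hence nonnegative.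
  This gives absolute convergence up to and including norm 1.\<close>

lemma binom_coeff_abs_sum:
  assumes "0 < a" "a < 1" shows "(\<Sum>i<n. \<bar>binom_coeff a (Suc i)\<bar>) \<le> 1"
proof -
  have "(\<Sum>i<n. \<bar>binom_coeff a (Suc i)\<bar>) = - (\<Sum>i<n. binom_coeff a (Suc i))"
    unfolding sum_negf[symmetric]
    by (rule sum.cong[OF refl]) (rule abs_of_nonpos, rule binom_coeff_nonpos[OF assms])
  also have "\<dots> = 1 - (\<Sum>i\<le>n. binom_coeff a i)"
    by (subst sum.atMost_shift) simp
  also have "\<dots> \<le> 1"
    using binom_coeff_neg_exponent[of "a - 1" n] assms by (simp add: binom_coeff_sum)
  finally show ?thesis .
qed

lemma binom_coeff_summable:
  assumes "0 < a" "a < 1"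
  shows "summable (\<lambda>n. \<bar>binom_coeff a n\<bar>)" "suminf (\<lambda>n. \<bar>binom_coeff a (Suc n)\<bar>) \<le> 1"
proof -
  have s: "summable (\<lambda>n. \<bar>binom_coeff a (Suc n)\<bar>)"
    by (rule summableI_nonneg_bounded[where x=1]) (use binom_coeff_abs_sum[OF assms] in auto)
  then show "summable (\<lambda>n. \<bar>binom_coeff a n\<bar>)" by (subst (asm) summable_Suc_iff)
  show "suminf (\<lambda>n. \<bar>binom_coeff a (Suc n)\<bar>) \<le> 1"
    by (rule suminf_le_const[OF s]) (use binom_coeff_abs_sum[OF assms] in auto)
qed

text \<open>Serves the series of (1 - k)^(-1/4), which does not converge absolutely at norm 1. The
  ratio of consecutive coefficients is 1 - (3/4)/(n + 1), which is at most exp(-(3/4)/(n + 1)), and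
  the logarithm inequality compares this with ((n + 2)/(n + 1))^(-3/4).\<close>

lemma binom_coeff_bound: "binom_coeff (- 1/4) n \<le> (real n + 1) powr (- 3/4)"
proof (induction n)
  case (Suc n)
  let ?x = "real n + 1"
  have "ln ((?x + 1) / ?x) \<le> 1 / ?x"
    using ln_add_one_self_le_self[of "1 / ?x"] by (simp add: field_simps)
  then have "- 3/4 * (1 / ?x) \<le> - 3/4 * ln ((?x + 1) / ?x)" by (rule mult_left_mono_neg) simp
  then have "exp (- 3/4 * (1 / ?x)) \<le> ((?x + 1) / ?x) powr (- 3/4)"
    by (simp add: powr_def)
  moreover have "(real n + 1/4) / ?x \<le> exp (- 3/4 * (1 / ?x))"
    using exp_ge_add_one_self[of "- 3/4 * (1 / ?x)"] by (simp add: field_simps)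
  ultimately have *: "(real n + 1/4) / ?x \<le> ((?x + 1) / ?x) powr (- 3/4)" by linarith
  have "binom_coeff (- 1/4) (Suc n) = binom_coeff (- 1/4) n * ((real n + 1/4) / ?x)"
    by (simp add: binom_coeff_Suc)
  also have "\<dots> \<le> ?x powr (- 3/4) * ((?x + 1) / ?x) powr (- 3/4)"
    by (rule mult_mono[OF Suc *]) simp_all
  also have "\<dots> = (real (Suc n) + 1) powr (- 3/4)"
    by (simp flip: powr_mult add: add.commute)
  finally show ?case .
qed simp

text \<open>The power (1 - k)^a, meaningful for 0 < a < 1 and \<open>norm k \<le> 1\<close>.\<close>

definition binom_series :: "real \<Rightarrow> 'a::cstar_alg_1 \<Rightarrow> 'a"
  where "binom_series a k = suminf (\<lambda>n. binom_coeff a n *\<^sub>R k ^ n)"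

lemma norm_power_le_1: "norm (k::'a::real_normed_algebra_1) \<le> 1 \<Longrightarrow> norm (k ^ n) \<le> 1"
  by (meson norm_power_ineq order_trans power_le_one norm_ge_zero)

lemma binom_series_summable:
  fixes k :: "'a::cstar_alg_1"
  assumes "0 < a" "a < 1" "norm k \<le> 1"
  shows "summable (\<lambda>n. norm (binom_coeff a n *\<^sub>R k ^ n))"
  by (rule summable_comparison_test'[OF binom_coeff_summable(1)[OF assms(1,2)], of 0])
    (simp add: mult_left_le norm_power_le_1[OF assms(3)])

text \<open>Cauchy product. The conclusion is a \<open>sums\<close> statement because a + b may be
  1, where the product is the polynomial 1 - k.\<close>

lemma binom_series_mult:
  fixes k :: "'a::cstar_alg_1"
  assumes "0 < a" "a < 1" "0 < b" "b < 1" "norm k \<le> 1"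
  shows "(\<lambda>n. binom_coeff (a + b) n *\<^sub>R k ^ n) sums (binom_series a k * binom_series b k)"
proof -
  have "(\<Sum>i\<le>n. binom_coeff a i *\<^sub>R k ^ i * binom_coeff b (n - i) *\<^sub>R k ^ (n - i))
      = binom_coeff (a + b) n *\<^sub>R k ^ n" for n
  proof -
    have "(\<Sum>i\<le>n. binom_coeff a i *\<^sub>R k ^ i * binom_coeff b (n - i) *\<^sub>R k ^ (n - i))
       = (\<Sum>i\<le>n. (binom_coeff a i * binom_coeff b (n - i)) *\<^sub>R k ^ n)"
      by (rule sum.cong) (simp_all flip: power_add)
    then show ?thesis by (simp flip: scaleR_left.sum add: binom_coeff_convolution)
  qed
  then show ?thesis
    using Cauchy_product_sums[OF binom_series_summable[OF assms(1,2,5)] binom_series_summable[OF assms(3,4,5)]]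
    by (simp add: binom_series_def)
qed

lemma binom_series_sqrt:
  fixes k :: "'a::cstar_alg_1"
  assumes "norm k \<le> 1" shows "binom_series (1/2) k * binom_series (1/2) k = 1 - k"
proof -
  have "(\<lambda>n. binom_coeff 1 n *\<^sub>R k ^ n) sums (\<Sum>n\<in>{0,1}. binom_coeff 1 n *\<^sub>R k ^ n)"
    by (rule sums_finite) (auto simp: binom_coeff_one)
  then have "(\<lambda>n. binom_coeff 1 n *\<^sub>R k ^ n) sums (1 - k)" by (simp add: binom_coeff_one)
  then show ?thesis using binom_series_mult[of "1/2" "1/2" k] assms sums_unique2 by force
qed

lemma binom_series_commute:
  fixes k :: "'a::cstar_alg_1"
  assumes "0 < a" "a < 1" "norm k \<le> 1" "y * k = k * y"
  shows "y * binom_series a k = binom_series a k * y"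
proof -
  have s: "summable (\<lambda>n. binom_coeff a n *\<^sub>R k ^ n)"
    using binom_series_summable[OF assms(1-3)] by (rule summable_norm_cancel)
  have p: "y * k ^ n = k ^ n * y" for n
    using assms(4) by (induction n) (simp_all add: mult.assoc, metis mult.assoc)
  show ?thesis unfolding binom_series_def
    by (simp add: suminf_mult[OF s, symmetric] suminf_mult2[OF s] p)
qed

lemma binom_series_adj:
  fixes k :: "'a::cstar_alg_1"
  assumes "0 < a" "a < 1" "norm k \<le> 1" "adj k = k"
  shows "adj (binom_series a k) = binom_series a k"
proof -
  have s: "summable (\<lambda>n. binom_coeff a n *\<^sub>R k ^ n)"
    using binom_series_summable[OF assms(1-3)] by (rule summable_norm_cancel)
  show ?thesis unfolding binom_series_def
    by (simp add: bounded_linear.suminf[OF bounded_linear_adj s] adj_scaleR adj_power assms(4))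
qed

text \<open>Removing the constant term 1 leaves coefficients whose absolute values sum to at most
  1.\<close>

lemma binom_series_norm:
  fixes k :: "'a::cstar_alg_1"
  assumes "0 < a" "a < 1" "norm k \<le> 1"
  shows "norm (1 - binom_series a k) \<le> 1"
proof -
  have s: "summable (\<lambda>n. norm (binom_coeff a n *\<^sub>R k ^ n))"
    by (rule binom_series_summable[OF assms])
  then have s': "summable (\<lambda>n. norm (binom_coeff a (Suc n) *\<^sub>R k ^ Suc n))"
    by (subst summable_Suc_iff)
  have "1 - binom_series a k = - suminf (\<lambda>n. binom_coeff a (Suc n) *\<^sub>R k ^ Suc n)"
    unfolding binom_series_def
    using suminf_split_head[OF summable_norm_cancel[OF s]] by simp
  then have "norm (1 - binom_series a k) \<le> suminf (\<lambda>n. norm (binom_coeff a (Suc n) *\<^sub>R k ^ Suc n))"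
    using summable_norm[OF s'] by simp
  also have "\<dots> \<le> suminf (\<lambda>n. \<bar>binom_coeff a (Suc n)\<bar>)"
  proof (rule suminf_le[OF _ s'])
    show "summable (\<lambda>n. \<bar>binom_coeff a (Suc n)\<bar>)"
      using binom_coeff_summable(1)[OF assms(1,2)] by (subst summable_Suc_iff)
    show "norm (binom_coeff a (Suc n) *\<^sub>R k ^ Suc n) \<le> \<bar>binom_coeff a (Suc n)\<bar>" for n
      using norm_power_le_1[OF assms(3), of "Suc n"] by (simp add: mult_left_le del: power_Suc)
  qed
  also have "\<dots> \<le> 1" by (rule binom_coeff_summable(2)[OF assms(1,2)])
  finally show ?thesis .
qed

text \<open>In a unital algebra the positive elements are first taken to be the squares of self-adjoint
  elements; that every \<open>adj x * x\<close> is such a square is only shown in \<open>square_adj_mult\<close>.\<close>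

definition is_square :: "'a::cstar_alg_1 \<Rightarrow> bool"
  where "is_square h \<longleftrightarrow> (\<exists>g. adj g = g \<and> h = g * g)"

text \<open>With h = t (1 - k) the ball condition says \<open>norm k \<le> 1\<close>, so sqrt t
  times (1 - k)^(1/2) is a root. It is a limit of polynomials in h, hence commutes with whatever
  commutes with h. The last property puts the root in a ball again, so that a root of the root
  exists.\<close>

lemma square_root_of_ball:
  fixes h :: "'a::cstar_alg_1"
  assumes "adj h = h" "norm (of_real t - h) \<le> t"
  obtains g where "adj g = g" "h = g * g" "\<And>y. y * h = h * y \<Longrightarrow> y * g = g * y"
    "norm (of_real (sqrt t) - g) \<le> sqrt t"
proof (cases "t = 0")
  case True
  then have "h = 0" using assms by simp
  then show ?thesis using that[of 0] True by simp
next
  case False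
  then have t: "t > 0" using assms(2) norm_ge_zero order_trans by (metis less_eq_real_def)
  define k where "k = 1 - (1/t) *\<^sub>R h"
  have "k = (1/t) *\<^sub>R (of_real t - h)" using t by (simp add: k_def scaleR_diff_right of_real_def)
  then have nk: "norm k \<le> 1" using assms(2) t by simp
  have ak: "adj k = k" using assms(1) by (simp add: k_def adj_diff adj_scaleR)
  define g where "g = sqrt t *\<^sub>R binom_series (1/2) k"
  show ?thesis
  proof
    show "adj g = g" using binom_series_adj[of "1/2" k] nk ak by (simp add: g_def adj_scaleR)
    have "g * g = t *\<^sub>R (1 - k)" using binom_series_sqrt[OF nk] t by (simp add: g_def)
    then show "h = g * g" using t by (simp add: k_def)
    show "y * g = g * y" if "y * h = h * y" for y
      using binom_series_commute[of "1/2" k y] nk that by (simp add: g_def k_def algebra_simps)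
    have "of_real (sqrt t) - g = sqrt t *\<^sub>R (1 - binom_series (1/2) k)"
      by (simp add: g_def scaleR_diff_right of_real_def)
    then show "norm (of_real (sqrt t) - g) \<le> sqrt t"
      using binom_series_norm[of "1/2" k] nk t by (simp add: mult_left_le)
  qed
qed

text \<open>The two elements are the real and imaginary parts of the normal element v = g + i s, for
  which \<open>adj v * v\<close> is the sum of their squares; a real part is never longer than the
  element.\<close>

lemma norm_re_part_le:
  assumes "adj (g::'a::cstar_alg) = g" "adj s = s" "g * s = s * g"
  shows "(norm g)\<^sup>2 \<le> norm (g * g + s * s)"
proof -
  define v where "v = g + imul s"
  have av: "adj v = g - imul s" using assms by (simp add: v_def adj_add adj_imul)
  have "adj v * v = g * g + s * s"
    unfolding av by (simp add: v_def algebra_simps imul_mult_left imul_mult_right assms(3) imul_minus imul_diff)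
  then have nv: "(norm v)\<^sup>2 = norm (g * g + s * s)" by (metis cstar_norm)
  have "2 *\<^sub>R g = v + adj v" unfolding av by (simp add: v_def scaleR_2)
  then have "2 * norm g \<le> norm v + norm v" 
    by (metis norm_adj norm_scaleR norm_triangle_ineq abs_numeral)
  then have "norm g \<le> norm v" by simp
  then show ?thesis using nv by (metis norm_ge_zero power_mono)
qed

text \<open>The distance of t - g^2 from t is \<open>norm (g * g)\<close>, so t - g^2 has a root s
  by \<open>square_root_of_ball\<close>, and s commutes with g. Then g^2 + s^2 = t, and
  \<open>norm_re_part_le\<close>, with s as the real part, bounds \<open>norm (s * s)\<close> by
  t.\<close>

lemma square_in_ball:
  fixes g :: "'a::cstar_alg_1"
  assumes g: "adj g = g" and t: "(norm g)\<^sup>2 \<le> t"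
  shows "norm (of_real t - g * g) \<le> t"
proof -
  have n: "norm (of_real t - (of_real t - g * g)) \<le> t" using g t by (simp add: norm_square_selfadjoint)
  have a: "adj (of_real t - g * g) = of_real t - g * g" by (simp add: adj_diff adj_mult g)
  obtain s where s: "adj s = s" "of_real t - g * g = s * s"
    "\<And>y. y * (of_real t - g * g) = (of_real t - g * g) * y \<Longrightarrow> y * s = s * y"
    using square_root_of_ball[OF a n] by metis
  have "g * s = s * g"
    by (rule s(3)) (simp add: right_diff_distrib left_diff_distrib mult.assoc of_real_def)
  then have "(norm s)\<^sup>2 \<le> norm (s * s + g * g)" using norm_re_part_le[OF s(1) g] by simp
  also have "s * s + g * g = of_real t" by (simp flip: s(2))
  finally have "(norm s)\<^sup>2 \<le> t" using t zero_le_power2[of "norm g"] by simp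
  then show ?thesis by (simp add: s(2) norm_square_selfadjoint s(1))
qed

text \<open>The right-hand side mentions no root and is, for fixed t, a closed convex condition on
  h; this is what makes sums and limits of squares tractable.\<close>

lemma is_square_iff:
  fixes h :: "'a::cstar_alg_1"
  assumes "norm h \<le> t"
  shows "is_square h \<longleftrightarrow> adj h = h \<and> norm (of_real t - h) \<le> t"
proof
  assume "is_square h"
  then obtain g where g: "adj g = g" "h = g * g" by (auto simp: is_square_def)
  moreover have "(norm g)\<^sup>2 \<le> t" using assms g by (simp add: norm_square_selfadjoint)
  ultimately show "adj h = h \<and> norm (of_real t - h) \<le> t" by (simp add: adj_mult square_in_ball)
next
  assume "adj h = h \<and> norm (of_real t - h) \<le> t"
  then show "is_square h" using square_root_of_ball[of h t] by (metis is_square_def)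
qed

lemma is_square_ball: "adj h = h \<Longrightarrow> norm (of_real t - h) \<le> t \<Longrightarrow> is_square (h::'a::cstar_alg_1)"
  using square_root_of_ball[of h t] by (metis is_square_def)

lemma is_square_selfadjoint: "is_square h \<Longrightarrow> adj h = h"
  by (auto simp: is_square_def adj_mult)

lemma is_square_add:
  assumes "is_square h" "is_square k" shows "is_square (h + k :: 'a::cstar_alg_1)"
proof (rule is_square_ball)
  have "norm (of_real (norm h) - h) \<le> norm h" "norm (of_real (norm k) - k) \<le> norm k"
    using is_square_iff[of h "norm h"] is_square_iff[of k "norm k"] assms by auto
  moreover have "of_real (norm h + norm k) - (h + k) = (of_real (norm h) - h) + (of_real (norm k) - k)"
    by (simp add: algebra_simps)
  ultimately show "norm (of_real (norm h + norm k) - (h + k)) \<le> norm h + norm k"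
    by (metis add_mono norm_triangle_le)
qed (simp add: adj_add assms is_square_selfadjoint)

lemma is_square_0 [simp]: "is_square 0"
  unfolding is_square_def by (rule exI[of _ 0]) simp

lemma is_square_1 [simp]: "is_square 1"
  unfolding is_square_def by (rule exI[of _ 1]) simp

lemma is_square_scale:
  assumes "is_square h" "0 \<le> r" shows "is_square (r *\<^sub>R h)"
proof -
  obtain g where "adj g = g" "h = g * g" using assms(1) by (auto simp: is_square_def)
  then have "adj (sqrt r *\<^sub>R g) = sqrt r *\<^sub>R g" "r *\<^sub>R h = (sqrt r *\<^sub>R g) * (sqrt r *\<^sub>R g)"
    using assms(2) by (simp_all add: adj_scaleR)
  then show ?thesis unfolding is_square_def by blast
qed

lemma is_square_sum: "(\<And>i. i \<in> I \<Longrightarrow> is_square (f i)) \<Longrightarrow> is_square (\<Sum>i\<in>I. f i)"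
  by (induction I rule: infinite_finite_induct) (simp_all add: is_square_add)

lemma is_square_limit:
  assumes "\<And>n. is_square (f n)" "f \<longlonglongrightarrow> (h::'a::cstar_alg_1)" shows "is_square h"
proof -
  have "(\<lambda>n. adj (f n)) \<longlonglongrightarrow> adj h" by (rule tendsto_adj[OF assms(2)])
  then have "f \<longlonglongrightarrow> adj h" by (simp only: is_square_selfadjoint[OF assms(1)])
  then have a: "adj h = h" using assms(2) by (rule LIMSEQ_unique)
  have "norm (of_real (norm h) - h) \<le> norm h"
  proof (rule LIMSEQ_le[of "\<lambda>n. norm (of_real (norm (f n)) - f n)" _ "\<lambda>n. norm (f n)"])
    show "(\<lambda>n. norm (of_real (norm (f n)) - f n)) \<longlonglongrightarrow> norm (of_real (norm h) - h)"
      by (intro tendsto_intros assms)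
    show "(\<lambda>n. norm (f n)) \<longlonglongrightarrow> norm h" by (intro tendsto_intros assms)
    show "\<exists>N. \<forall>n\<ge>N. norm (of_real (norm (f n)) - f n) \<le> norm (f n)"
      using is_square_iff[OF order_refl, THEN iffD1, OF assms(1)] by simp
  qed
  then show ?thesis using a is_square_ball by blast
qed

text \<open>A root from \<open>square_root_of_ball\<close> commutes with everything that commutes
  with its square, so the roots g and s of p and q commute, and p q = (g s)^2.\<close>

lemma is_square_mult_commute:
  assumes "is_square p" "is_square q" "p * q = q * (p::'a::cstar_alg_1)"
  shows "is_square (p * q)"
proof -
  have p: "adj p = p" "norm (of_real (norm p) - p) \<le> norm p"
    using assms(1) is_square_iff[of p "norm p"] by auto
  have q: "adj q = q" "norm (of_real (norm q) - q) \<le> norm q"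
    using assms(2) is_square_iff[of q "norm q"] by auto
  obtain g where g: "adj g = g" "p = g * g" "\<And>y. y * p = p * y \<Longrightarrow> y * g = g * y"
    using square_root_of_ball[OF p] by metis
  obtain s where s: "adj s = s" "q = s * s" "\<And>y. y * q = q * y \<Longrightarrow> y * s = s * y"
    using square_root_of_ball[OF q] by metis
  have "g * q = q * g" using g(3)[of q] assms(3) by simp
  then have gs: "g * s = s * g" using s(3) by simp
  have "p * q = (g * s) * (g * s)" unfolding g(2) s(2) by (metis gs mult.assoc)
  moreover have "adj (g * s) = g * s" by (simp add: adj_mult g(1) s(1) gs)
  ultimately show ?thesis unfolding is_square_def by blast
qed

lemma is_square_power: "is_square k \<Longrightarrow> is_square (k ^ n)"
  by (induction n) (simp_all add: is_square_mult_commute power_commutes)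

lemma is_square_norm_minus:
  assumes "adj h = h" "norm h \<le> t" shows "is_square (of_real t - h :: 'a::cstar_alg_1)"
  by (rule is_square_ball[of _ t]) (simp_all add: assms adj_diff)

text \<open>p and t - p have commuting roots whose squares add up to t, so
  \<open>norm_re_part_le\<close> applies.\<close>

lemma is_square_norm_le:
  assumes "is_square p" "is_square (of_real t - p)" "0 \<le> t"
  shows "norm (p::'a::cstar_alg_1) \<le> t"
proof -
  define q where "q = of_real t - p"
  have p: "adj p = p" "norm (of_real (norm p) - p) \<le> norm p"
    using assms(1) is_square_iff[of p "norm p"] by auto
  have q: "adj q = q" "norm (of_real (norm q) - q) \<le> norm q"
    using is_square_iff[of q "norm q"] assms(2)[folded q_def] by simp_all
  obtain g where g: "adj g = g" "p = g * g" "\<And>y. y * p = p * y \<Longrightarrow> y * g = g * y"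
    using square_root_of_ball[OF p] by metis
  obtain s where s: "adj s = s" "q = s * s" "\<And>y. y * q = q * y \<Longrightarrow> y * s = s * y"
    using square_root_of_ball[OF q] by metis
  have "q * g = g * q" by (rule g(3)) (simp add: q_def right_diff_distrib left_diff_distrib of_real_def)
  then have "g * s = s * g" using s(3) by simp
  then have "(norm g)\<^sup>2 \<le> norm (g * g + s * s)" by (rule norm_re_part_le[OF g(1) s(1)])
  also have "g * g + s * s = of_real t" unfolding g(2)[symmetric] s(2)[symmetric] by (simp add: q_def)
  finally show ?thesis using assms(3) by (simp add: g(2) norm_square_selfadjoint[OF g(1)])
qed

lemma is_square_norm_mono:
  assumes "is_square p" "is_square q" shows "norm (p::'a::cstar_alg_1) \<le> norm (p + q)"
proof (rule is_square_norm_le[OF assms(1)])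
  have "is_square (of_real (norm (p + q)) - (p + q))"
    by (rule is_square_norm_minus) (simp_all add: adj_add is_square_selfadjoint assms)
  from is_square_add[OF this assms(2)] show "is_square (of_real (norm (p + q)) - p)" by simp
qed simp


text \<open>In terms of the real and imaginary parts of y the mixed terms of the two products
  cancel.\<close>

lemma selfadjoint_decomposition:
  fixes y :: "'a::cstar_alg"
  obtains a b where "adj a = a" "adj b = b" "adj y * y + y * adj y = 2 *\<^sub>R (a * a + b * b)"
proof -
  define a where "a = (1/2) *\<^sub>R (y + adj y)"
  define b where "b = (1/2) *\<^sub>R imul (adj y - y)"
  have y: "y = a + imul b"
    by (simp add: a_def b_def imul_scaleR imul_add imul_minus imul_diff scaleR_add_right scaleR_diff_right
        flip: scaleR_left_distrib)
  have a: "adj a = a" by (simp add: a_def adj_scaleR adj_add add.commute)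
  have b: "adj b = b" by (simp add: b_def adj_scaleR adj_diff adj_imul flip: imul_minus)
  have "adj y = a - imul b" unfolding y by (simp add: adj_add a b adj_imul)
  then have "adj y * y + y * adj y = (a - imul b) * (a + imul b) + (a + imul b) * (a - imul b)"
    using y by simp
  also have "\<dots> = 2 *\<^sub>R (a * a + b * b)"
    by (simp add: algebra_simps imul_mult_left imul_mult_right imul_minus imul_diff imul_add scaleR_2)
  finally show ?thesis using that a b by blast
qed

text \<open>Bernoulli's inequality (1 + l)^n \<ge> 1 + n l, multiplied by l. The remainder satisfies
  X(n + 1) = (1 + l) X(n) + n l^3, so it stays a square by induction.\<close>

lemma is_square_binomial_bound:
  fixes l :: "'a::cstar_alg_1"
  assumes "is_square l"
  shows "is_square ((1 + l) ^ n * l - l - real n *\<^sub>R (l * l))"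
proof -
  define X where "X n = (1 + l) ^ n * l - l - real n *\<^sub>R (l * l)" for n
  have comm: "(1 + l) ^ n * l = l * (1 + l) ^ n" for n
    by (rule power_commuting_commutes) (simp add: algebra_simps)
  have "is_square (X n)"
  proof (induction n)
    case (Suc n)
    have X: "X (Suc n) = (1 + l) * X n + real n *\<^sub>R (l * l * l)"
      by (simp add: X_def algebra_simps)
    have "l * X n = X n * l"
      by (simp add: X_def right_diff_distrib left_diff_distrib comm mult.assoc)
    then have cX: "(1 + l) * X n = X n * (1 + l)" by (simp add: algebra_simps)
    have "is_square ((1 + l) * X n)"
      by (rule is_square_mult_commute[OF _ Suc cX]) (rule is_square_add[OF is_square_1 assms])
    moreover have "is_square (real n *\<^sub>R (l * l * l))"
      by (intro is_square_scale is_square_mult_commute assms) (simp_all add: mult.assoc)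
    ultimately show ?case unfolding X by (rule is_square_add)
  qed (simp add: X_def)
  then show ?thesis by (simp add: X_def)
qed

text \<open>The classical fact that \<open>adj y * y\<close> is negative only for y = 0, usually
  obtained by comparing the spectra of \<open>adj y * y\<close> and \<open>y * adj y\<close>. Here,
  after scaling y to a contraction z with \<open>adj z * z\<close> = -k, the element l =
  \<open>z * adj z\<close> is a square, because the two products add up to a sum of squares.
  Intertwining gives (1 + l)^n l = z (1 - k)^n \<open>adj z\<close>, of norm at most 1 for all n,
  whereas it dominates n l^2.\<close>

lemma anti_square_eq_0:
  fixes y :: "'a::cstar_alg_1"
  assumes "adj y * y = - (v * v)" "adj v = v"
  shows "y = 0"
proof -
  define c where "c = 1 / (1 + norm y)"
  have "1 + norm y > 0" by (simp add: add_pos_nonneg)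
  then have c: "c > 0" "c \<noteq> 0" "c * norm y \<le> 1" by (simp_all add: c_def)
  define z where "z = c *\<^sub>R y"
  define k where "k = (c *\<^sub>R v) * (c *\<^sub>R v)"
  have zz: "adj z * z = - k" by (simp add: z_def k_def adj_scaleR assms(1))
  have sk: "is_square k" unfolding k_def is_square_def using assms(2) by (metis adj_scaleR)
  have nz: "norm z \<le> 1" using c by (simp add: z_def)
  then have "norm k \<le> 1" using cstar_norm[of z] zz by (simp add: power_le_one)
  then have nk: "norm (1 - k) \<le> 1" using is_square_iff[of k 1] sk by simp
  obtain a b where ab: "adj a = a" "adj b = b" "adj z * z + z * adj z = 2 *\<^sub>R (a * a + b * b)"
    by (rule selfadjoint_decomposition)
  define l where "l = z * adj z"
  have "l = 2 *\<^sub>R (a * a + b * b) + k" using ab(3) zz unfolding l_def by (simp add: algebra_simps)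
  moreover have "is_square (2 *\<^sub>R (a * a + b * b) + k)"
    by (intro is_square_add is_square_scale sk) (use ab in \<open>auto simp: is_square_def\<close>)
  ultimately have sl: "is_square l" by simp
  have intertwine: "z * (1 - k) ^ n = (1 + l) ^ n * z" for n
  proof (induction n)
    case (Suc n)
    have "z * (1 - k) = z * (1 + adj z * z)" using zz by simp
    also have "\<dots> = (1 + l) * z" unfolding l_def by (simp add: algebra_simps)
    finally have "z * (1 - k) ^ Suc n = (1 + l) * (z * (1 - k) ^ n)"
      by (simp add: mult.assoc[symmetric])
    then show ?case by (simp only: Suc power_Suc mult.assoc)
  qed simp
  have bound: "real n * norm (l * l) \<le> 1" for n
  proof -
    have "(1 + l) ^ n * l = z * (1 - k) ^ n * adj z"
      by (simp add: intertwine l_def mult.assoc)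
    then have "norm ((1 + l) ^ n * l) \<le> norm z * norm ((1 - k) ^ n) * norm (adj z)"
      by (simp add: order_trans[OF norm_mult_ineq] mult_right_mono norm_mult_ineq)
    also have "\<dots> \<le> 1 * 1 * 1"
      by (intro mult_mono) (use nz norm_power_le_1[OF nk] in auto)
    finally have 1: "norm ((1 + l) ^ n * l) \<le> 1" by simp
    have "is_square ((1 + l) ^ n * l - l - real n *\<^sub>R (l * l) + l)"
      by (intro is_square_add is_square_binomial_bound sl)
    then have 2: "is_square ((1 + l) ^ n * l - real n *\<^sub>R (l * l))" by simp
    have 3: "is_square (real n *\<^sub>R (l * l))"
      by (intro is_square_scale is_square_mult_commute sl) simp_all
    have "norm (real n *\<^sub>R (l * l)) \<le> norm ((1 + l) ^ n * l)"
      using is_square_norm_mono[OF 3 2] by simp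
    then show ?thesis using 1 by simp
  qed
  have "norm (l * l) = 0"
  proof (rule ccontr)
    assume "norm (l * l) \<noteq> 0"
    then obtain n where "1 < real n * norm (l * l)"
      using reals_Archimedean3[of "norm (l * l)"] by auto
    then show False using bound[of n] by simp
  qed
  then have "norm l = 0" using norm_square_selfadjoint[of l] is_square_selfadjoint[OF sl] by simp
  then have "norm (adj z) = 0" using cstar_norm[of "adj z"] by (simp add: l_def)
  then show ?thesis using c by (simp add: z_def)
qed

text \<open>Let q be twice the negative part of h = \<open>adj x * x\<close>. Then
  \<open>adj (x * q) * (x * q)\<close> = q h q is minus a square, so x q = 0 by
  \<open>anti_square_eq_0\<close>, whence h q = 0 and q = 0.\<close>

lemma is_square_adj_mult: "is_square (adj x * (x::'a::cstar_alg_1))"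
proof -
  define h where "h = adj x * x"
  have h: "adj h = h" by (simp add: h_def adj_mult)
  have n1: "norm (of_real ((norm h)\<^sup>2) - h * h) \<le> (norm h)\<^sup>2" by (rule square_in_ball[OF h order_refl])
  have ahh: "adj (h * h) = h * h" by (simp add: adj_mult h)
  \<comment> \<open>r is the absolute value of h. Its ball property allows one more root w, which
    exhibits q r q as the square of w q.\<close>
  obtain r where r: "adj r = r" "h * h = r * r" "\<And>y. y * (h * h) = h * h * y \<Longrightarrow> y * r = r * y"
    "norm (of_real (sqrt ((norm h)\<^sup>2)) - r) \<le> sqrt ((norm h)\<^sup>2)"
    using square_root_of_ball[OF ahh n1] by metis
  obtain w where w: "adj w = w" "r = w * w" "\<And>y. y * r = r * y \<Longrightarrow> y * w = w * y"
    using square_root_of_ball[OF r(1) r(4)] by metis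
  have hr: "h * r = r * h" by (rule r(3)) (simp add: mult.assoc)
  have hw: "h * w = w * h" by (rule w(3)) (rule hr)
  have rw: "r * w = w * r" by (rule w(3)) (rule refl)
  define q where "q = r - h"
  have q: "adj q = q" by (simp add: q_def adj_diff r(1) h)
  have qw: "q * w = w * q" by (simp add: q_def algebra_simps hw rw)
  have hq: "h * q = - (r * q)" by (simp add: q_def algebra_simps hr r(2))
  have av: "adj (w * q) = w * q" by (simp add: adj_mult q w(1) qw)
  have rqq: "q * r * q = (w * q) * (w * q)" unfolding w(2) by (metis qw mult.assoc)
  have "adj (x * q) * (x * q) = q * (h * q)" by (simp add: adj_mult q h_def mult.assoc)
  also have "\<dots> = - ((w * q) * (w * q))" using rqq by (simp add: hq mult.assoc)
  finally have "x * q = 0" by (rule anti_square_eq_0) (rule av)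
  then have hq0: "h * q = 0" by (simp add: h_def mult.assoc)
  then have "q * q = 0" using hq by (simp add: q_def left_diff_distrib)
  then have "norm q = 0" using norm_square_selfadjoint[OF q] by simp
  then have "h = w * w" using w(2) by (simp add: q_def)
  then show ?thesis using w(1) unfolding h_def is_square_def by blast
qed

text \<open>The elements (1 - k) k^j decrease in j, so m + 1 copies of the last one are dominated by
  the sum over j \<le> m, which telescopes to 1 - k^(m + 1).\<close>

lemma norm_decay:
  fixes k :: "'a::cstar_alg_1"
  assumes k: "is_square k" "is_square (1 - k)"
  shows "(real m + 1) * norm ((1 - k) * k ^ m) \<le> 1"
proof -
  have comm: "(1 - k) * k ^ j = k ^ j * (1 - k)" for j
    by (simp add: algebra_simps power_commutes)
  have tele: "(\<Sum>j<n. (1 - k) * k ^ j) = 1 - k ^ n" for n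
    by (induction n) (simp_all add: algebra_simps)
  have sq: "is_square ((1 - k) * k ^ j)" for j
    by (rule is_square_mult_commute[OF k(2) is_square_power[OF k(1)] comm])
  have sq1: "is_square (1 - k ^ n)" for n
    unfolding tele[symmetric] by (rule is_square_sum) (rule sq)
  have "is_square (\<Sum>j<Suc m. (1 - k) * k ^ j - (1 - k) * k ^ m)"
  proof (rule is_square_sum)
    fix j assume "j \<in> {..<Suc m}"
    then have j: "k ^ m = k ^ j * k ^ (m - j)" by (simp flip: power_add)
    have "(1 - k) * k ^ j - (1 - k) * k ^ m = ((1 - k) * k ^ j) * (1 - k ^ (m - j))"
      unfolding j by (simp add: algebra_simps)
    moreover have "is_square (((1 - k) * k ^ j) * (1 - k ^ (m - j)))"
    proof (rule is_square_mult_commute[OF sq sq1])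
      have "k ^ i * ((1 - k) * k ^ j) = (1 - k) * k ^ j * k ^ i" for i
        by (metis comm mult.assoc power_add add.commute)
      then show "(1 - k) * k ^ j * (1 - k ^ (m - j)) = (1 - k ^ (m - j)) * ((1 - k) * k ^ j)"
        by (simp add: right_diff_distrib[of "(1 - k) * k ^ j"] left_diff_distrib[of 1 "k ^ (m - j)"])
    qed
    ultimately show "is_square ((1 - k) * k ^ j - (1 - k) * k ^ m)" by simp
  qed
  also have "(\<Sum>j<Suc m. (1 - k) * k ^ j - (1 - k) * k ^ m)
      = 1 - k ^ Suc m - (real m + 1) *\<^sub>R ((1 - k) * k ^ m)"
    by (simp only: sum_subtractf tele sum_constant_scaleR) (simp add: add.commute)
  finally have "is_square (1 - k ^ Suc m - (real m + 1) *\<^sub>R ((1 - k) * k ^ m) + k ^ Suc m)"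
    by (rule is_square_add) (rule is_square_power[OF k(1)])
  then have "is_square (of_real 1 - (real m + 1) *\<^sub>R ((1 - k) * k ^ m))" by simp
  then have "norm ((real m + 1) *\<^sub>R ((1 - k) * k ^ m)) \<le> 1"
    by (intro is_square_norm_le is_square_scale sq) simp_all
  then show ?thesis by simp
qed


section \<open>Multipliers: a unital algebra containing a given one as an ideal\<close>

lemma mult_left_cancel_all:
  fixes x y :: "'a::cstar_alg"
  assumes "\<And>z. adj z * x = adj z * y" shows "x = y"
proof -
  have "adj (x - y) * (x - y) = 0" using assms[of "x - y"] by (simp add: right_diff_distrib)
  then show ?thesis using cstar_norm[of "x - y"] by simp
qed

text \<open>Adjointness for the inner product \<open>adj x * y\<close> of the algebra regarded as a
  Hilbert module over itself.\<close>

definition adjoint_blinfuns :: "('a::cstar_alg \<Rightarrow>\<^sub>L 'a) \<Rightarrow> ('a \<Rightarrow>\<^sub>L 'a) \<Rightarrow> bool"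
  where "adjoint_blinfuns T S \<longleftrightarrow> (\<forall>x y. adj (blinfun_apply T x) * y = adj x * blinfun_apply S y)"

lemma adjoint_blinfuns_sym: "adjoint_blinfuns T S \<Longrightarrow> adjoint_blinfuns S T"
  unfolding adjoint_blinfuns_def by (metis adj_adj adj_mult)

lemma adjoint_blinfuns_norm:
  assumes "adjoint_blinfuns T S" shows "norm (S o\<^sub>L T) = (norm T)\<^sup>2" "norm S = norm T"
proof -
  have le: "(norm T)\<^sup>2 \<le> norm (S o\<^sub>L T)" if "adjoint_blinfuns T S" for T S :: "'a \<Rightarrow>\<^sub>L 'a"
  proof -
    have "norm (blinfun_apply T x) \<le> sqrt (norm (S o\<^sub>L T)) * norm x" for x
    proof -
      have "(norm (blinfun_apply T x))\<^sup>2 = norm (adj x * blinfun_apply (S o\<^sub>L T) x)"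
        using that by (simp add: adjoint_blinfuns_def flip: cstar_norm)
      also have "\<dots> \<le> norm x * (norm (S o\<^sub>L T) * norm x)"
        using norm_mult_ineq[of "adj x"] norm_blinfun[of "S o\<^sub>L T" x]
        by (smt (verit) norm_adj mult_left_mono norm_ge_zero)
      also have "\<dots> = (sqrt (norm (S o\<^sub>L T)) * norm x)\<^sup>2" by (simp add: power_mult_distrib power2_eq_square)
      finally show ?thesis by (rule power2_le_imp_le) simp
    qed
    then have "norm T \<le> sqrt (norm (S o\<^sub>L T))" by (intro norm_blinfun_bound) simp_all
    then have "(norm T)\<^sup>2 \<le> (sqrt (norm (S o\<^sub>L T)))\<^sup>2" by (intro power_mono) simp_all
    then show ?thesis by simp
  qed
  have "norm T \<le> norm S" if "adjoint_blinfuns T S" for T S :: "'a \<Rightarrow>\<^sub>L 'a"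
  proof -
    have "norm T * norm T \<le> norm S * norm T"
      using order_trans[OF le[OF that] norm_blinfun_compose] by (simp add: power2_eq_square)
    then show ?thesis by (cases "norm T = 0") (simp_all add: mult_le_cancel_right)
  qed
  then show eq: "norm S = norm T" using assms adjoint_blinfuns_sym by (metis order_antisym)
  show "norm (S o\<^sub>L T) = (norm T)\<^sup>2" using eq le[OF assms] norm_blinfun_compose[of S T] by (simp add: power2_eq_square)
qed

text \<open>Moving T to the other side of the inner product shows that it commutes with right
  multiplication and, though only real-linear by its type, with \<open>imul\<close>.\<close>

lemma adjoint_blinfuns_module:
  assumes "adjoint_blinfuns T S"
  shows "blinfun_apply T (x * y) = blinfun_apply T x * y" "blinfun_apply T (imul x) = imul (blinfun_apply T x)"
proof -
  have *: "adj z * blinfun_apply T x = adj (blinfun_apply S z) * x" for z x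
    using adjoint_blinfuns_sym[OF assms] by (simp add: adjoint_blinfuns_def)
  show "blinfun_apply T (x * y) = blinfun_apply T x * y"
    by (rule mult_left_cancel_all) (simp only: * mult.assoc[symmetric])
  show "blinfun_apply T (imul x) = imul (blinfun_apply T x)"
    by (rule mult_left_cancel_all) (simp only: * imul_mult_right)
qed

lift_definition imul_blinfun :: "'a::cstar_alg \<Rightarrow>\<^sub>L 'a" is imul by (rule bounded_linear_imul)

lift_definition mult_blinfun :: "'a::real_normed_algebra \<Rightarrow> 'a \<Rightarrow>\<^sub>L 'a" is "(*)"
  by (rule bounded_linear_mult_right)

declare imul_blinfun.rep_eq [simp] mult_blinfun.rep_eq [simp]

text \<open>A unital algebra containing the given one as an ideal: adjointable operators together with
  their adjoints.  The extra scalar component keeps \<open>1 \<noteq> 0\<close> when the given algebra is zero.\<close>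

typedef (overloaded) 'a multiplier =
  "{(z :: complex, T :: 'a::cstar_alg \<Rightarrow>\<^sub>L 'a, S :: 'a \<Rightarrow>\<^sub>L 'a). adjoint_blinfuns T S}"
  morphisms multiplier_rep Abs_multiplier
  by (rule exI[of _ "(0, 0, 0)"]) (simp add: adjoint_blinfuns_def)

setup_lifting type_definition_multiplier

instantiation multiplier :: (cstar_alg) real_normed_algebra_1
begin

lift_definition zero_multiplier :: "'a multiplier" is "(0, 0, 0)" by (simp add: adjoint_blinfuns_def)
lift_definition one_multiplier :: "'a multiplier" is "(1, id_blinfun, id_blinfun)"
  by (simp add: adjoint_blinfuns_def)
lift_definition plus_multiplier :: "'a multiplier \<Rightarrow> 'a multiplier \<Rightarrow> 'a multiplier"
  is "\<lambda>(z, T, S) (z', T', S'). (z + z', T + T', S + S')"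
  by (auto simp: adjoint_blinfuns_def blinfun.add_left adj_add algebra_simps)
lift_definition minus_multiplier :: "'a multiplier \<Rightarrow> 'a multiplier \<Rightarrow> 'a multiplier"
  is "\<lambda>(z, T, S) (z', T', S'). (z - z', T - T', S - S')"
  by (auto simp: adjoint_blinfuns_def blinfun.diff_left adj_diff algebra_simps)
lift_definition uminus_multiplier :: "'a multiplier \<Rightarrow> 'a multiplier"
  is "\<lambda>(z, T, S). (- z, - T, - S)"
  by (auto simp: adjoint_blinfuns_def blinfun.minus_left adj_minus)
lift_definition times_multiplier :: "'a multiplier \<Rightarrow> 'a multiplier \<Rightarrow> 'a multiplier"
  is "\<lambda>(z, T, S) (z', T', S'). (z * z', T o\<^sub>L T', S' o\<^sub>L S)"
  by (auto simp: adjoint_blinfuns_def)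
lift_definition scaleR_multiplier :: "real \<Rightarrow> 'a multiplier \<Rightarrow> 'a multiplier"
  is "\<lambda>r (z, T, S). (r *\<^sub>R z, r *\<^sub>R T, r *\<^sub>R S)"
  by (auto simp: adjoint_blinfuns_def blinfun.scaleR_left adj_scaleR)
text \<open>One operator norm serves for both \<open>T\<close> and \<open>S\<close>, as they agree
  by \<open>adjoint_blinfuns_norm\<close>.\<close>

lift_definition norm_multiplier :: "'a multiplier \<Rightarrow> real" is "\<lambda>(z, T, S). max (norm z) (norm T)" .
definition dist_multiplier :: "'a multiplier \<Rightarrow> 'a multiplier \<Rightarrow> real"
  where "dist_multiplier x y = norm (x - y)"
definition sgn_multiplier :: "'a multiplier \<Rightarrow> 'a multiplier" where "sgn_multiplier x = scaleR (inverse (norm x)) x"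
definition uniformity_multiplier :: "('a multiplier \<times> 'a multiplier) filter"
  where "uniformity_multiplier = (INF e\<in>{0 <..}. principal {(x, y). dist x y < e})"
definition open_multiplier :: "'a multiplier set \<Rightarrow> bool"
  where "open_multiplier U \<longleftrightarrow> (\<forall>x\<in>U. eventually (\<lambda>(x', y). x' = x \<longrightarrow> y \<in> U) uniformity)"

lemmas multiplier_rep_eqs = zero_multiplier.rep_eq one_multiplier.rep_eq plus_multiplier.rep_eq
  minus_multiplier.rep_eq uminus_multiplier.rep_eq times_multiplier.rep_eq scaleR_multiplier.rep_eq
  norm_multiplier.rep_eq split_def

lemma multiplier_rep_adjoint: "adjoint_blinfuns (fst (snd (multiplier_rep x))) (snd (snd (multiplier_rep x)))"
  using multiplier_rep[of x] by (auto simp: split_def)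

lemma multiplier_eqI:
  assumes "fst (multiplier_rep x) = fst (multiplier_rep y)"
    "\<And>v. blinfun_apply (fst (snd (multiplier_rep x))) v = blinfun_apply (fst (snd (multiplier_rep y))) v"
    "\<And>v. blinfun_apply (snd (snd (multiplier_rep x))) v = blinfun_apply (snd (snd (multiplier_rep y))) v"
  shows "x = y"
  unfolding multiplier_rep_inject[symmetric]
  by (intro prod_eqI assms(1)) (simp_all add: blinfun_eqI[OF assms(2)] blinfun_eqI[OF assms(3)])

instance
proof
  fix x y z :: "'a multiplier" and r s :: real and U :: "'a multiplier set"
  show "x + y + z = x + (y + z)" by (rule multiplier_eqI) (simp_all add: multiplier_rep_eqs algebra_simps)
  show "x + y = y + x" by (rule multiplier_eqI) (simp_all add: multiplier_rep_eqs algebra_simps)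
  show "0 + x = x" by (rule multiplier_eqI) (simp_all add: multiplier_rep_eqs)
  show "- x + x = 0" by (rule multiplier_eqI) (simp_all add: multiplier_rep_eqs)
  show "x - y = x + - y" by (rule multiplier_eqI) (simp_all add: multiplier_rep_eqs)
  show "1 * x = x" by (rule multiplier_eqI) (simp_all add: multiplier_rep_eqs)
  show "x * 1 = x" by (rule multiplier_eqI) (simp_all add: multiplier_rep_eqs)
  show "(0 :: 'a multiplier) \<noteq> 1" by (simp add: multiplier_rep_inject[symmetric] multiplier_rep_eqs)
  show "r *\<^sub>R s *\<^sub>R x = (r * s) *\<^sub>R x" by (rule multiplier_eqI) (simp_all add: multiplier_rep_eqs)
  show "1 *\<^sub>R x = x" by (rule multiplier_eqI) (simp_all add: multiplier_rep_eqs)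
  show "x * y * z = x * (y * z)" by (rule multiplier_eqI) (simp_all add: multiplier_rep_eqs)
  show "(x + y) * z = x * z + y * z"
    by (rule multiplier_eqI) (simp_all add: multiplier_rep_eqs blinfun.bilinear_simps algebra_simps)
  show "x * (y + z) = x * y + x * z"
    by (rule multiplier_eqI) (simp_all add: multiplier_rep_eqs blinfun.bilinear_simps algebra_simps)
  show "r *\<^sub>R (x + y) = r *\<^sub>R x + r *\<^sub>R y"
    by (rule multiplier_eqI) (simp_all add: multiplier_rep_eqs blinfun.bilinear_simps algebra_simps)
  show "(r + s) *\<^sub>R x = r *\<^sub>R x + s *\<^sub>R x"
    by (rule multiplier_eqI) (simp_all add: multiplier_rep_eqs blinfun.bilinear_simps algebra_simps)
  show "r *\<^sub>R x * y = r *\<^sub>R (x * y)"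
    by (rule multiplier_eqI) (simp_all add: multiplier_rep_eqs blinfun.bilinear_simps)
  show "x * r *\<^sub>R y = r *\<^sub>R (x * y)"
    by (rule multiplier_eqI) (simp_all add: multiplier_rep_eqs blinfun.bilinear_simps)
  show "dist x y = norm (x - y)" by (rule dist_multiplier_def)
  show "sgn x = scaleR (inverse (norm x)) x" by (rule sgn_multiplier_def)
  show "uniformity = (INF e\<in>{0 <..}. principal {(x :: 'a multiplier, y). dist x y < e})"
    by (rule uniformity_multiplier_def)
  show "open U \<longleftrightarrow> (\<forall>x\<in>U. \<forall>\<^sub>F (x', y) in uniformity. x' = x \<longrightarrow> y \<in> U)"
    by (rule open_multiplier_def)
  show "norm (x + y) \<le> norm x + norm y"
    by (simp add: multiplier_rep_eqs)
      (auto intro: order_trans[OF norm_triangle_ineq] add_mono max.cobounded1 max.cobounded2)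
  show "norm (r *\<^sub>R x) = \<bar>r\<bar> * norm x" by (simp add: multiplier_rep_eqs max_mult_distrib_left)
  show "norm (1 :: 'a multiplier) = 1"
    by (simp add: multiplier_rep_eqs) (intro max_absorb1 norm_blinfun_bound, simp_all)
  show "norm (x * y) \<le> norm x * norm y"
    by (simp add: multiplier_rep_eqs norm_mult)
      (intro conjI order_trans[OF norm_blinfun_compose] mult_mono, simp_all add: le_max_iff_disj)
  show "norm x = 0 \<longleftrightarrow> x = 0"
  proof
    assume "norm x = 0"
    then have z: "fst (multiplier_rep x) = 0" "fst (snd (multiplier_rep x)) = 0"
      by (simp_all add: multiplier_rep_eqs max_def split: if_splits)
    have "blinfun_apply (snd (snd (multiplier_rep x))) v = 0" for v
      by (rule mult_left_cancel_all) (use multiplier_rep_adjoint[of x] z in \<open>simp add: adjoint_blinfuns_def\<close>)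
    then show "x = 0" by (intro multiplier_eqI) (simp_all add: multiplier_rep_eqs z)
  qed (simp add: multiplier_rep_eqs)
qed

end

instance multiplier :: (cstar_alg) banach
proof
  fix X :: "nat \<Rightarrow> 'a multiplier" assume X: "Cauchy X"
  define z where "z n = fst (multiplier_rep (X n))" for n
  define T where "T n = fst (snd (multiplier_rep (X n)))" for n
  define S where "S n = snd (snd (multiplier_rep (X n)))" for n
  have rep: "multiplier_rep (X n) = (z n, T n, S n)" for n by (simp add: z_def T_def S_def)
  have adj: "adjoint_blinfuns (T n) (S n)" for n unfolding T_def S_def by (rule multiplier_rep_adjoint)
  have dn: "dist (X m) (X n) = max (cmod (z m - z n)) (norm (T m - T n))" for m n
    by (simp add: dist_multiplier_def multiplier_rep_eqs rep)
  have "adjoint_blinfuns (T m - T n) (S m - S n)" for m n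
    using adj[of m] adj[of n]
    by (simp add: adjoint_blinfuns_def blinfun.diff_left adj_diff left_diff_distrib right_diff_distrib)
  then have ST: "norm (S m - S n) = norm (T m - T n)" for m n by (rule adjoint_blinfuns_norm)
  have le: "dist (z m) (z n) \<le> dist (X m) (X n)" "dist (T m) (T n) \<le> dist (X m) (X n)"
      "dist (S m) (S n) \<le> dist (X m) (X n)" for m n
    unfolding dn by (simp_all add: dist_norm ST)
  have "Cauchy z" "Cauchy T" "Cauchy S"
    using X le unfolding Cauchy_def by (meson le_less_trans)+
  then obtain z' T' S' where lim: "z \<longlonglongrightarrow> z'" "T \<longlonglongrightarrow> T'" "S \<longlonglongrightarrow> S'"
    by (metis Cauchy_convergent_iff convergent_def)
  have "adjoint_blinfuns T' S'" unfolding adjoint_blinfuns_def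
  proof (intro allI)
    fix x y
    have "(\<lambda>n. adj (blinfun_apply (T n) x) * y) \<longlonglongrightarrow> adj (blinfun_apply T' x) * y"
      by (intro tendsto_intros lim)
    moreover have "(\<lambda>n. adj x * blinfun_apply (S n) y) \<longlonglongrightarrow> adj x * blinfun_apply S' y"
      by (intro tendsto_intros lim)
    moreover have "adj (blinfun_apply (T n) x) * y = adj x * blinfun_apply (S n) y" for n
      using adj[of n] by (simp add: adjoint_blinfuns_def)
    ultimately show "adj (blinfun_apply T' x) * y = adj x * blinfun_apply S' y"
      by (simp add: LIMSEQ_unique[of "\<lambda>n. adj x * blinfun_apply (S n) y"])
  qed
  then have rep': "multiplier_rep (Abs_multiplier (z', T', S')) = (z', T', S')"
    by (simp add: Abs_multiplier_inverse)
  have "(\<lambda>n. max (cmod (z n - z')) (norm (T n - T'))) \<longlonglongrightarrow> max (cmod (z' - z')) (norm (T' - T'))"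
    by (intro tendsto_intros lim)
  then have "(\<lambda>n. dist (X n) (Abs_multiplier (z', T', S'))) \<longlonglongrightarrow> 0"
    by (simp add: dist_multiplier_def multiplier_rep_eqs rep rep')
  then show "convergent X" unfolding convergent_def using tendsto_dist_iff by blast
qed

instantiation multiplier :: (cstar_alg) cstar_alg_1
begin

lift_definition adj_multiplier :: "'a multiplier \<Rightarrow> 'a multiplier"
  is "\<lambda>(z, T, S). (cnj z, S, T)"
  by (auto dest: adjoint_blinfuns_sym)
lift_definition imul_multiplier :: "'a multiplier \<Rightarrow> 'a multiplier"
  is "\<lambda>(z, T, S). (\<i> * z, imul_blinfun o\<^sub>L T, - (imul_blinfun o\<^sub>L S))"
  by (auto simp: adjoint_blinfuns_def blinfun.minus_left adj_imul imul_mult_left imul_mult_right)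

lemmas multiplier_adj_eqs = adj_multiplier.rep_eq imul_multiplier.rep_eq multiplier_rep_eqs

instance
proof
  fix x y z :: "'a multiplier" and r :: real
  show "adj (x + y) = adj x + adj y" by (rule multiplier_eqI) (simp_all add: multiplier_adj_eqs)
  show "adj (r *\<^sub>R x) = r *\<^sub>R adj x" by (rule multiplier_eqI) (simp_all add: multiplier_adj_eqs)
  show "adj (adj x) = x" by (rule multiplier_eqI) (simp_all add: multiplier_adj_eqs)
  show "adj (x * y) = adj y * adj x" by (rule multiplier_eqI) (simp_all add: multiplier_adj_eqs)
  show "norm (adj x * x) = (norm x)\<^sup>2"
    by (simp add: multiplier_adj_eqs adjoint_blinfuns_norm[OF multiplier_rep_adjoint] norm_mult)
      (auto simp: max_def power2_eq_square abs_le_square_iff[symmetric] mult_mono intro: antisym mult_mono)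
  show "imul (x + y) = imul x + imul y"
    by (rule multiplier_eqI) (simp_all add: multiplier_adj_eqs blinfun.bilinear_simps imul_add algebra_simps)
  show "imul (r *\<^sub>R x) = r *\<^sub>R imul x"
    by (rule multiplier_eqI) (simp_all add: multiplier_adj_eqs blinfun.bilinear_simps imul_scaleR)
  show "imul (imul x) = - x"
    by (rule multiplier_eqI) (simp_all add: multiplier_adj_eqs blinfun.bilinear_simps imul_minus)
  note mod = adjoint_blinfuns_module(2)[OF multiplier_rep_adjoint]
    adjoint_blinfuns_module(2)[OF adjoint_blinfuns_sym[OF multiplier_rep_adjoint]]
  show "imul x * y = imul (x * y)"
    by (rule multiplier_eqI) (simp_all add: multiplier_adj_eqs blinfun.bilinear_simps mod)
  show "x * imul y = imul (x * y)"
    by (rule multiplier_eqI) (simp_all add: multiplier_adj_eqs blinfun.bilinear_simps mod)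
  show "adj (imul x) = - imul (adj x)"
    by (rule multiplier_eqI) (simp_all add: multiplier_adj_eqs blinfun.bilinear_simps mod)
qed

end

lift_definition multiplier_of :: "'a::cstar_alg \<Rightarrow> 'a multiplier"
  is "\<lambda>x. (0, mult_blinfun x, mult_blinfun (adj x))"
  by (auto simp: adjoint_blinfuns_def adj_mult mult.assoc)

definition multiplier_apply :: "'a::cstar_alg multiplier \<Rightarrow> 'a \<Rightarrow> 'a"
  where "multiplier_apply m = blinfun_apply (fst (snd (multiplier_rep m)))"

lemma multiplier_of_norm [simp]: "norm (multiplier_of x) = norm x"
proof -
  have 1: "norm (mult_blinfun x) \<le> norm x"
    by (rule norm_blinfun_bound) (simp_all add: norm_mult_ineq)
  have "norm x * norm x = norm (blinfun_apply (mult_blinfun x) (adj x))"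
    using cstar_norm[of "adj x"] by (simp add: power2_eq_square)
  also have "\<dots> \<le> norm (mult_blinfun x) * norm x" by (rule order_trans[OF norm_blinfun]) simp
  finally have "norm x \<le> norm (mult_blinfun x)"
    by (cases "norm x = 0") (simp_all add: mult_le_cancel_right)
  then show ?thesis using 1 by (simp add: norm_multiplier.rep_eq multiplier_of.rep_eq)
qed

lemma multiplier_of_add: "multiplier_of (x + y) = multiplier_of x + multiplier_of y"
  by (rule multiplier_eqI) (simp_all add: multiplier_rep_eqs multiplier_of.rep_eq blinfun.bilinear_simps adj_add algebra_simps)

lemma multiplier_of_scaleR: "multiplier_of (r *\<^sub>R x) = r *\<^sub>R multiplier_of x"
  by (rule multiplier_eqI) (simp_all add: multiplier_rep_eqs multiplier_of.rep_eq blinfun.bilinear_simps adj_scaleR)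

lemma multiplier_of_mult: "multiplier_of (x * y) = multiplier_of x * multiplier_of y"
  by (rule multiplier_eqI) (simp_all add: multiplier_rep_eqs multiplier_of.rep_eq adj_mult mult.assoc)

lemma multiplier_of_adj: "multiplier_of (adj x) = adj (multiplier_of x)"
  by (rule multiplier_eqI) (simp_all add: multiplier_adj_eqs multiplier_of.rep_eq)

text \<open>The image of the algebra is a left ideal: the scalar component of m is annihilated by
  the component 0 of \<open>multiplier_of x\<close>, and right-linearity of the operator part turns
  the composition into left multiplication by one element.\<close>

lemma multiplier_mult_of: "m * multiplier_of x = multiplier_of (multiplier_apply m x)"
proof -
  let ?T = "blinfun_apply (fst (snd (multiplier_rep m)))" and ?S = "blinfun_apply (snd (snd (multiplier_rep m)))"
  note adj = multiplier_rep_adjoint[of m]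
  have "adj x * ?S v = adj (?T x) * v" for v
    using adj by (simp add: adjoint_blinfuns_def)
  then show ?thesis
    by (intro multiplier_eqI)
      (simp_all add: multiplier_rep_eqs multiplier_of.rep_eq multiplier_apply_def adjoint_blinfuns_module(1)[OF adj])
qed

lemma bounded_linear_multiplier_of: "bounded_linear multiplier_of"
  by (rule bounded_linear_intro[of _ 1]) (simp_all add: multiplier_of_add multiplier_of_scaleR)

lemmas multiplier_of_0 [simp] = linear_0[OF bounded_linear.linear[OF bounded_linear_multiplier_of]]
  and multiplier_of_diff = linear_diff[OF bounded_linear.linear[OF bounded_linear_multiplier_of]]
  and multiplier_of_sum = linear_sum[OF bounded_linear.linear[OF bounded_linear_multiplier_of]]
  and tendsto_multiplier_of = bounded_linear.tendsto[OF bounded_linear_multiplier_of]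

lemma multiplier_of_eq_iff [simp]: "multiplier_of x = multiplier_of y \<longleftrightarrow> x = y"
  using multiplier_of_norm[of "x - y"] by (auto simp: multiplier_of_diff simp del: multiplier_of_norm)

lemma range_multiplier_of_limit:
  assumes "\<And>n. f n \<in> range multiplier_of" "f \<longlonglongrightarrow> m" shows "m \<in> range multiplier_of"
proof -
  have "\<forall>n. \<exists>x. f n = multiplier_of x" using assms(1) by auto
  then obtain g where "\<forall>n. f n = multiplier_of (g n)" by (auto dest!: choice)
  then have g: "f = (\<lambda>n. multiplier_of (g n))" by auto
  have d: "dist (f i) (f j) = dist (g i) (g j)" for i j
    by (simp add: g dist_norm flip: multiplier_of_diff)
  have "Cauchy g" using LIMSEQ_imp_Cauchy[OF assms(2)] by (simp add: Cauchy_def d)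
  then obtain x where "g \<longlonglongrightarrow> x" by (metis Cauchy_convergent_iff convergent_def)
  then have "f \<longlonglongrightarrow> multiplier_of x" unfolding g by (rule tendsto_multiplier_of)
  then show ?thesis using assms(2) LIMSEQ_unique by blast
qed


section \<open>Square roots and factorization inside the ideal\<close>

lemma multiplier_of_power_diff:
  assumes "1 - k \<in> range (multiplier_of :: 'a::cstar_alg \<Rightarrow> _)"
  shows "1 - k ^ n \<in> range multiplier_of"
proof (induction n)
  case 0
  have "1 - k ^ 0 = multiplier_of (0::'a)" by simp
  then show ?case by (rule range_eqI)
next
  case (Suc n)
  from assms Suc obtain x y where x: "1 - k = multiplier_of x" and y: "1 - k ^ n = multiplier_of y"
    by auto
  have "1 - k ^ Suc n = (1 - k ^ n) + k ^ n * (1 - k)" by (simp add: algebra_simps power_commutes)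
  also have "\<dots> = multiplier_of (y + multiplier_apply (k ^ n) x)"
    by (simp only: x y multiplier_mult_of multiplier_of_add)
  finally show ?case by (rule range_eqI)
qed

text \<open>s (1 - k^n) lies in the ideal and converges to s. Series such as (1 - k)^(1/2) are
  formed with the unit; this is the test by which their sum is recognised as an element of the
  original algebra.\<close>

lemma range_multiplier_of_decay:
  assumes "1 - k \<in> range (multiplier_of :: 'a::cstar_alg \<Rightarrow> _)" "(\<lambda>n. norm (s * k ^ n)) \<longlonglongrightarrow> 0"
  shows "s \<in> range multiplier_of"
proof (rule range_multiplier_of_limit)
  show "s * (1 - k ^ n) \<in> range multiplier_of" for n
    using multiplier_of_power_diff[OF assms(1), of n] multiplier_mult_of by (metis imageE rangeI)
  have "(\<lambda>n. s - s * k ^ n) \<longlonglongrightarrow> s - 0"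
    by (intro tendsto_intros) (rule tendsto_norm_zero_cancel[OF assms(2)])
  then show "(\<lambda>n. s * (1 - k ^ n)) \<longlonglongrightarrow> s" by (simp add: right_diff_distrib)
qed

lemma norm_selfadjoint_mult_power:
  fixes s k :: "'a::cstar_alg_1"
  assumes "adj s = s" "adj k = k" "s * k = k * s"
  shows "(norm (s * k ^ n))\<^sup>2 = norm (s * s * k ^ (2 * n))"
proof -
  have c: "s * k ^ n = k ^ n * s" by (metis assms(3) power_commuting_commutes)
  have "adj (s * k ^ n) * (s * k ^ n) = k ^ n * s * (s * k ^ n)"
    by (simp add: adj_mult adj_power assms)
  also have "\<dots> = s * s * (k ^ n * k ^ n)" by (metis c mult.assoc)
  finally show ?thesis by (metis cstar_norm mult_2 power_add)
qed

text \<open>The square of the norm of (1 - k)^(1/2) k^n is the norm of (1 - k) k^(2n), which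
  \<open>norm_decay\<close> controls; in the same way the fourth root is reduced to the square
  root.\<close>

lemma root_decay:
  fixes k :: "'a::cstar_alg_1"
  assumes k: "is_square k" "is_square (1 - k)" and n: "norm k \<le> 1"
  shows "(\<lambda>n. norm (binom_series (1/2) k * k ^ n)) \<longlonglongrightarrow> 0"
    "(\<lambda>n. norm (binom_series (1/4) k * k ^ n)) \<longlonglongrightarrow> 0"
proof -
  let ?s = "binom_series (1/2) k" and ?r = "binom_series (1/4) k"
  have ak: "adj k = k" by (rule is_square_selfadjoint[OF k(1)])
  have lim0: "(\<lambda>n. f n) \<longlonglongrightarrow> 0" if "\<And>n. (f n)\<^sup>2 \<le> g n" "g \<longlonglongrightarrow> 0" for f g :: "nat \<Rightarrow> real"
  proof -
    have "(\<lambda>n. (f n)\<^sup>2) \<longlonglongrightarrow> 0"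
      by (rule tendsto_sandwich[of "\<lambda>_. 0" _ _ g]) (use that in auto)
    then have "(\<lambda>n. sqrt ((f n)\<^sup>2)) \<longlonglongrightarrow> sqrt 0" by (rule tendsto_real_sqrt)
    then show ?thesis by (simp add: tendsto_rabs_zero_iff)
  qed
  show *: "(\<lambda>n. norm (?s * k ^ n)) \<longlonglongrightarrow> 0"
  proof (rule lim0)
    fix n
    have "(norm (?s * k ^ n))\<^sup>2 = norm ((1 - k) * k ^ (2 * n))"
      using norm_selfadjoint_mult_power[of ?s k n] binom_series_adj[of "1/2" k]
        binom_series_commute[of "1/2" k k] binom_series_sqrt[of k] n ak by simp
    also have "\<dots> \<le> 1 / (real n + 1)"
    proof -
      have "(real n + 1) * norm ((1 - k) * k ^ (2 * n)) \<le> (real (2 * n) + 1) * norm ((1 - k) * k ^ (2 * n))"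
        by (rule mult_right_mono) simp_all
      also have "\<dots> \<le> 1" by (rule norm_decay[OF k])
      finally show ?thesis by (simp add: field_simps)
    qed
    finally show "(norm (?s * k ^ n))\<^sup>2 \<le> 1 / (real n + 1)" .
  next
    show "(\<lambda>n. 1 / (real n + 1)) \<longlonglongrightarrow> 0"
      using LIMSEQ_inverse_real_of_nat by (simp add: inverse_eq_divide add.commute)
  qed
  have rr: "?r * ?r = ?s"
  proof -
    have "(\<lambda>n. binom_coeff (1/2) n *\<^sub>R k ^ n) sums (?r * ?r)"
      using binom_series_mult[of "1/4" "1/4" k] n by simp
    then show ?thesis by (simp add: sums_unique binom_series_def)
  qed
  show "(\<lambda>n. norm (?r * k ^ n)) \<longlonglongrightarrow> 0"
  proof (rule lim0)
    fix n
    show "(norm (?r * k ^ n))\<^sup>2 \<le> norm (?s * k ^ (2 * n))"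
      using norm_selfadjoint_mult_power[of ?r k n] binom_series_adj[of "1/4" k]
        binom_series_commute[of "1/4" k k] rr n ak by simp
  next
    have "strict_mono (\<lambda>n::nat. 2 * n)" by (simp add: strict_mono_def)
    from LIMSEQ_subseq_LIMSEQ[OF * this] show "(\<lambda>n. norm (?s * k ^ (2 * n))) \<longlonglongrightarrow> 0" by (simp add: o_def)
  qed
qed

definition pos :: "'a::cstar_alg \<Rightarrow> bool"
  where "pos h \<longleftrightarrow> (\<exists>x. h = adj x * x)"

lemma pos_adj_mult [simp, intro]: "pos (adj x * x)"
  unfolding pos_def by blast

lemma is_square_normalized:
  assumes "is_square (h::'a::cstar_alg_1)" "norm h \<le> 1"
  shows "is_square (1 - h)" "norm (1 - h) \<le> 1"
  using is_square_norm_minus[of h 1] is_square_iff[of h 1] is_square_selfadjoint[of h] assms by auto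

text \<open>From left to right this is \<open>is_square_adj_mult\<close> among the multipliers.
  Conversely h is scaled to g with 1 - k = g, and the root (1 - k)^(1/2) belongs to the algebra
  itself because its products with k^n tend to 0.\<close>

lemma pos_iff: "pos h \<longleftrightarrow> is_square (multiplier_of h)"
proof
  assume "pos h"
  then obtain x where "h = adj x * x" by (auto simp: pos_def)
  then show "is_square (multiplier_of h)"
    by (simp add: multiplier_of_mult multiplier_of_adj is_square_adj_mult)
next
  assume h: "is_square (multiplier_of h)"
  define t where "t = norm h + 1"
  have t: "t > 0" "norm h \<le> t" by (simp_all add: t_def add_nonneg_pos)
  define g where "g = (1/t) *\<^sub>R h"
  have g: "is_square (multiplier_of g)" "norm (multiplier_of g) \<le> 1"
    using t h by (simp_all add: g_def multiplier_of_scaleR is_square_scale)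
  define k where "k = 1 - multiplier_of g"
  note k = is_square_normalized[OF g, folded k_def]
  have kg: "1 - k = multiplier_of g" by (simp add: k_def)
  have "binom_series (1/2) k \<in> range (multiplier_of :: 'a \<Rightarrow> _)"
  proof (rule range_multiplier_of_decay)
    show "1 - k \<in> range (multiplier_of :: 'a \<Rightarrow> _)" unfolding kg by (rule rangeI)
    show "(\<lambda>n. norm (binom_series (1/2) k * k ^ n)) \<longlonglongrightarrow> 0"
      using root_decay(1)[OF k(1) _ k(2)] g(1) kg by simp
  qed
  then obtain s where s: "binom_series (1/2) k = multiplier_of s" by auto
  have "adj (binom_series (1/2) k) = binom_series (1/2) k"
    using binom_series_adj[of "1/2" k] k is_square_selfadjoint[OF k(1)] by simp
  then have as: "adj s = s" unfolding s by (simp flip: multiplier_of_adj)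
  have "multiplier_of (s * s) = multiplier_of g"
    using binom_series_sqrt[OF k(2)] unfolding s kg by (simp add: multiplier_of_mult)
  then have "h = adj (sqrt t *\<^sub>R s) * (sqrt t *\<^sub>R s)"
    using t as by (simp add: g_def adj_scaleR)
  then show "pos h" unfolding pos_def by blast
qed

lemma pos_add: "pos x \<Longrightarrow> pos y \<Longrightarrow> pos (x + y)"
  by (simp add: pos_iff multiplier_of_add is_square_add)

lemma pos_0 [simp]: "pos 0" by (simp add: pos_iff)

lemma pos_scale: "pos x \<Longrightarrow> 0 \<le> r \<Longrightarrow> pos (r *\<^sub>R x)"
  by (simp add: pos_iff multiplier_of_scaleR is_square_scale)

lemma pos_sum: "(\<And>i. i \<in> I \<Longrightarrow> pos (f i)) \<Longrightarrow> pos (\<Sum>i\<in>I. f i)"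
  by (simp add: pos_iff multiplier_of_sum is_square_sum)

lemma pos_limit: "(\<And>n. pos (f n)) \<Longrightarrow> f \<longlonglongrightarrow> h \<Longrightarrow> pos h"
  unfolding pos_iff by (rule is_square_limit) (auto intro: tendsto_multiplier_of)

lemma pos_norm_mono: "pos p \<Longrightarrow> pos (q - p) \<Longrightarrow> norm p \<le> norm q"
  using is_square_norm_mono[of "multiplier_of p" "multiplier_of (q - p)"]
  by (simp add: pos_iff flip: multiplier_of_add)

lemma pos_selfadjoint: "pos p \<Longrightarrow> adj p = p"
  by (auto simp: pos_def adj_mult)

lemma pos_conjugate: "pos h \<Longrightarrow> pos (adj x * h * x)"
  by (auto simp: pos_def) (metis adj_mult mult.assoc)

text \<open>\<open>norm h\<close> - h is a square g^2 among the multipliers, and conjugating it by x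
  gives \<open>adj (g * x) * (g * x)\<close>.\<close>

lemma pos_norm_bound_conjugate:
  assumes "pos h" shows "pos (norm h *\<^sub>R (adj x * x) - adj x * h * x)"
proof -
  have "is_square (of_real (norm h) - multiplier_of h)"
    using is_square_norm_minus[of "multiplier_of h" "norm h"] pos_selfadjoint[OF assms]
    by (simp flip: multiplier_of_adj)
  then obtain g where g: "adj g = g" "of_real (norm h) - multiplier_of h = g * g" by (auto simp: is_square_def)
  have "multiplier_of (norm h *\<^sub>R (adj x * x) - adj x * h * x)
      = adj (multiplier_of x) * (of_real (norm h) - multiplier_of h) * multiplier_of x"
    by (simp add: multiplier_of_diff multiplier_of_scaleR multiplier_of_mult multiplier_of_adj of_real_def algebra_simps)
  also have "\<dots> = adj (g * multiplier_of x) * (g * multiplier_of x)"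
    unfolding g(2) by (simp add: adj_mult g(1) mult.assoc)
  finally show ?thesis by (simp add: pos_iff is_square_adj_mult)
qed

text \<open>The abstract Cauchy-Schwarz inequality: for an algebra-valued semi-inner product with p
  = <x,x>, q = <y,y> and z = <x,y>, the hypothesis says that <x a - y, x a - y> is positive for
  every a. Taking a = t z yields (2 t - t^2 \<open>norm p\<close>) \<open>adj z * z\<close> \<le>
  q.\<close>

lemma pos_cauchy_schwarz:
  fixes p q z :: "'a::cstar_alg"
  assumes p: "pos p" and all: "\<And>a. pos (adj a * p * a - adj a * z - adj z * a + q)"
  shows "(norm z)\<^sup>2 \<le> norm p * norm q"
proof -
  have *: "(2 * t - t\<^sup>2 * norm p) * (norm z)\<^sup>2 \<le> norm q" if t: "0 \<le> 2 * t - t\<^sup>2 * norm p" for t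
  proof -
    have "pos (t\<^sup>2 *\<^sub>R (norm p *\<^sub>R (adj z * z) - adj z * p * z)
        + (adj (t *\<^sub>R z) * p * (t *\<^sub>R z) - adj (t *\<^sub>R z) * z - adj z * (t *\<^sub>R z) + q))"
      by (intro pos_add pos_scale pos_norm_bound_conjugate p all) simp
    also have "t\<^sup>2 *\<^sub>R (norm p *\<^sub>R (adj z * z) - adj z * p * z)
        + (adj (t *\<^sub>R z) * p * (t *\<^sub>R z) - adj (t *\<^sub>R z) * z - adj z * (t *\<^sub>R z) + q)
        = q - (2 * t - t\<^sup>2 * norm p) *\<^sub>R (adj z * z)"
    proof -
      have e: "adj (t *\<^sub>R z) * p * (t *\<^sub>R z) = t\<^sup>2 *\<^sub>R (adj z * p * z)"
        "adj (t *\<^sub>R z) * z = t *\<^sub>R (adj z * z)" "adj z * (t *\<^sub>R z) = t *\<^sub>R (adj z * z)"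
        by (simp_all add: adj_scaleR power2_eq_square)
      have "(2 * t - c) *\<^sub>R w = t *\<^sub>R w + t *\<^sub>R w - c *\<^sub>R w" for c and w :: 'a
        by (simp add: scaleR_left_diff_distrib flip: scaleR_left_distrib)
      then show ?thesis unfolding e by (simp add: scaleR_diff_right)
    qed
    finally have "norm ((2 * t - t\<^sup>2 * norm p) *\<^sub>R (adj z * z)) \<le> norm q"
      by (intro pos_norm_mono pos_scale t) simp
    then show ?thesis using t by (simp add: cstar_norm)
  qed
  show ?thesis
  proof (cases "norm p = 0")
    case True
    have "(norm z)\<^sup>2 = 0"
    proof (rule ccontr)
      assume nz: "(norm z)\<^sup>2 \<noteq> 0"
      \<comment> \<open>With \<open>norm p\<close> = 0 the inequality is linear in t; this t makes
        its left side \<open>norm q + 1\<close>.\<close>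
      define t where "t = (norm q + 1) / (2 * (norm z)\<^sup>2)"
      have "0 \<le> t" by (simp add: t_def)
      then have "2 * t * (norm z)\<^sup>2 \<le> norm q" using *[of t] True by simp
      then show False using nz by (simp add: t_def)
    qed
    then show ?thesis by simp
  next
    case False
    \<comment> \<open>t = 1 / \<open>norm p\<close> maximises 2 t - t^2
      \<open>norm p\<close>.\<close>
    then have e: "2 * (1 / norm p) - (1 / norm p)\<^sup>2 * norm p = 1 / norm p"
      by (simp add: power2_eq_square)
    have "(1 / norm p) * (norm z)\<^sup>2 \<le> norm q" using *[of "1 / norm p"] unfolding e by simp
    then show ?thesis using False by (simp add: divide_le_eq mult.commute)
  qed
qed

text \<open>The coefficients of (1 - k)^(-1/4) are bounded by (n + 1)^(-3/4), and the factor (n +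
  1)^(-1/2), supplied by c k^n in \<open>factorization\<close>, brings the exponent to -5/4.\<close>

lemma summable_root_coeff: "summable (\<lambda>n. binom_coeff (- 1/4) n * sqrt (1 / (real n + 1)))"
proof (rule summable_comparison_test'[where N=0])
  have "summable (\<lambda>n. real (Suc n) powr (- 5/4))"
    by (subst summable_Suc_iff) (simp add: summable_real_powr_iff)
  then show "summable (\<lambda>n. (real n + 1) powr (- 5/4))" by (simp add: add.commute)
  fix n
  have "sqrt (1 / (real n + 1)) = (real n + 1) powr (- 1/2)"
    by (simp add: real_sqrt_divide powr_minus_divide powr_half_sqrt flip: powr_minus)
  moreover have "0 \<le> binom_coeff (- 1/4) n" by (rule binom_coeff_neg_exponent) simp
  moreover have "(real n + 1) powr (- 5/4) = (real n + 1) powr (- 3/4) * (real n + 1) powr (- 1/2)"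
    by (simp flip: powr_add)
  ultimately show "norm (binom_coeff (- 1/4) n * sqrt (1 / (real n + 1))) \<le> (real n + 1) powr (- 5/4)"
    using binom_coeff_bound[of n] by (simp add: mult_right_mono)
qed

text \<open>With 1 - k = \<open>adj c * c\<close> for a contraction c, put s = (1 - k)^(1/4) and u =
  c (1 - k)^(-1/4), so that u s = c. The series for u is summed with c inside it, because the
  squared norm of c k^n is that of (1 - k) k^(2n) and brings the missing decay.\<close>

lemma factorization:
  fixes c :: "'a::cstar_alg"
  obtains u s where "c = u * s"
proof -
  have ex: "\<exists>u s. c = u * s" if c: "norm c \<le> 1" for c :: 'a
  proof -
    define k where "k = 1 - multiplier_of (adj c * c)"
    have sq: "is_square (multiplier_of (adj c * c))" by (simp flip: pos_iff)
    have "norm (multiplier_of (adj c * c)) \<le> 1" using c by (simp add: cstar_norm power_le_one)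
    note k = is_square_normalized[OF sq this, folded k_def]
    have kc: "1 - k = multiplier_of (adj c * c)" by (simp add: k_def)
    have ak: "adj k = k" by (rule is_square_selfadjoint[OF k(1)])
    let ?s = "binom_series (1/4) k"
    have "?s \<in> range (multiplier_of :: 'a \<Rightarrow> _)"
    proof (rule range_multiplier_of_decay)
      show "1 - k \<in> range (multiplier_of :: 'a \<Rightarrow> _)" unfolding kc by (rule rangeI)
      show "(\<lambda>n. norm (?s * k ^ n)) \<longlonglongrightarrow> 0"
        using root_decay(2)[OF k(1) _ k(2)] sq kc by simp
    qed
    then obtain s where s: "?s = multiplier_of s" by auto
    define a where "a n = binom_coeff (- 1/4) n *\<^sub>R (multiplier_of c * k ^ n)" for n
    have a0: "0 \<le> binom_coeff (- 1/4) n" for n by (rule binom_coeff_neg_exponent) simp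
    have nck: "norm (multiplier_of c * k ^ n) \<le> sqrt (1 / (real n + 1))" for n
    proof (rule real_le_rsqrt)
      have "adj (multiplier_of c * k ^ n) * (multiplier_of c * k ^ n) = k ^ n * (1 - k) * k ^ n"
        by (simp add: adj_mult adj_power ak kc multiplier_of_mult multiplier_of_adj mult.assoc)
      also have "\<dots> = (1 - k) * k ^ (2 * n)"
      proof -
        have "k ^ n * (1 - k) = (1 - k) * k ^ n" by (simp add: algebra_simps power_commutes)
        then show ?thesis by (simp add: mult.assoc mult_2 power_add)
      qed
      finally have "(norm (multiplier_of c * k ^ n))\<^sup>2 = norm ((1 - k) * k ^ (2 * n))"
        by (simp only: cstar_norm[symmetric])
      also have "\<dots> \<le> 1 / (real n + 1)"
      proof -
        have "(real n + 1) * norm ((1 - k) * k ^ (2 * n)) \<le> (real (2 * n) + 1) * norm ((1 - k) * k ^ (2 * n))"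
          by (rule mult_right_mono) simp_all
        also have "\<dots> \<le> 1" by (rule norm_decay) (use k sq kc in auto)
        finally show ?thesis by (simp add: field_simps)
      qed
      finally show "(norm (multiplier_of c * k ^ n))\<^sup>2 \<le> 1 / (real n + 1)" .
    qed
    have sa: "summable (\<lambda>n. norm (a n))"
      by (rule summable_comparison_test'[OF summable_root_coeff, of 0])
        (use a0 nck in \<open>simp add: a_def mult_left_mono\<close>)
    have sb: "summable (\<lambda>n. norm (binom_coeff (1/4) n *\<^sub>R k ^ n))"
      by (rule binom_series_summable) (use k in auto)
    have conv: "(\<Sum>i\<le>n. a i * binom_coeff (1/4) (n - i) *\<^sub>R k ^ (n - i))
        = (if n = 0 then multiplier_of c else 0)" for n
    proof -
      have "(\<Sum>i\<le>n. a i * binom_coeff (1/4) (n - i) *\<^sub>R k ^ (n - i))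
          = (\<Sum>i\<le>n. (binom_coeff (- 1/4) i * binom_coeff (1/4) (n - i)) *\<^sub>R (multiplier_of c * k ^ n))"
        by (rule sum.cong) (simp_all add: a_def mult.assoc flip: power_add)
      also have "\<dots> = binom_coeff 0 n *\<^sub>R (multiplier_of c * k ^ n)"
        using binom_coeff_convolution[of "- 1/4" "1/4" n] by (simp flip: scaleR_left.sum)
      finally show ?thesis by (simp add: binom_coeff_zero)
    qed
    have "(\<lambda>n. if n = 0 then multiplier_of c else 0) sums (suminf a * ?s)"
      using Cauchy_product_sums[OF sa sb] unfolding conv binom_series_def .
    moreover have "(\<lambda>n. if n = 0 then multiplier_of c else 0) sums multiplier_of c"
      using sums_single[of 0 "\<lambda>_. multiplier_of c"] by simp
    ultimately have cu: "multiplier_of c = suminf a * multiplier_of s"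
      unfolding s by (rule sums_unique2[symmetric])
    \<comment> \<open>c k^n = c - c (1 - k^n) is in the ideal although k itself is not.\<close>
    have "suminf a \<in> range (multiplier_of :: 'a \<Rightarrow> _)"
    proof (rule range_multiplier_of_limit)
      have "multiplier_of c * k ^ n \<in> range multiplier_of" for n
      proof -
        obtain y where y: "1 - k ^ n = multiplier_of y"
          using multiplier_of_power_diff[of k n] unfolding kc by auto
        have "multiplier_of c * k ^ n = multiplier_of c - multiplier_of c * (1 - k ^ n)"
          by (simp add: algebra_simps)
        also have "\<dots> = multiplier_of (c - c * y)"
          unfolding y by (simp only: multiplier_of_diff multiplier_of_mult)
        finally show ?thesis by (rule range_eqI)
      qed
      then have "\<forall>n. \<exists>x. multiplier_of c * k ^ n = multiplier_of x" by (simp add: image_iff)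
      then have "\<forall>n. \<exists>x. a n = multiplier_of x" unfolding a_def by (metis multiplier_of_scaleR)
      then obtain g where "\<forall>n. a n = multiplier_of (g n)" by (auto dest!: choice)
      then show "(\<Sum>i<n. a i) \<in> range multiplier_of" for n by (simp flip: multiplier_of_sum)
      show "(\<lambda>n. \<Sum>i<n. a i) \<longlonglongrightarrow> suminf a"
        using summable_LIMSEQ[OF summable_norm_cancel[OF sa]] .
    qed
    then obtain u where "suminf a = multiplier_of u" by auto
    then have "c = u * s" using cu by (simp flip: multiplier_of_mult)
    then show ?thesis by blast
  qed
  define t where "t = norm c + 1"
  have t: "t > 0" by (simp add: t_def add_nonneg_pos)
  have "norm ((1/t) *\<^sub>R c) \<le> 1" using t by (simp add: t_def)
  then obtain u s where "(1/t) *\<^sub>R c = u * s" using ex by blast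
  then have "c = (t *\<^sub>R u) * s" using t by (simp flip: \<open>(1/t) *\<^sub>R c = u * s\<close>)
  then show ?thesis using that by blast
qed


section \<open>Adjointable maps and linear functionals\<close>

text \<open>Hellinger-Toeplitz by Baire category. For fixed y the numbers
  \<open>norm (adj (T x) * y)\<close> with \<open>norm x \<le> 1\<close> are bounded by
  \<open>norm (S y)\<close>, so the closed sets \<open>E n\<close> cover the space and one of them
  contains a ball. This gives content to the operator norm of adjointable operators, which are by
  definition arbitrary functions with an adjoint.\<close>

lemma adjointable_bounded:
  fixes T S :: "'a::cstar_alg \<Rightarrow> 'a"
  assumes TS: "\<And>x y. adj (T x) * y = adj x * S y"
  obtains K where "\<And>x. norm (T x) \<le> K * norm x"
proof -
  have ST: "adj z * T x = adj (S z) * x" for x z by (metis TS adj_adj adj_mult)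
  have T_scale: "T (r *\<^sub>R x) = r *\<^sub>R T x" for r x
    by (rule mult_left_cancel_all) (simp add: ST)
  define E where "E n = {y. \<forall>x. norm x \<le> 1 \<longrightarrow> norm (adj (T x) * y) \<le> real n}" for n :: nat
  have clE: "closed (E n)" for n
  proof -
    have "E n = (\<Inter>x\<in>{x. norm x \<le> 1}. {y. norm (adj (T x) * y) \<le> real n})" by (auto simp: E_def)
    also have "closed \<dots>"
      by (intro closed_INT ballI closed_Collect_le continuous_intros)
    finally show ?thesis .
  qed
  have "\<exists>n. interior (E n) \<noteq> {}"
  proof (rule ccontr)
    assume none: "\<not> (\<exists>n. interior (E n) \<noteq> {})"
    have "Met_TC.mtopology interior_of \<Union>(range E) = {}"
    proof (rule Met_TC.metric_Baire_category_alt)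
      show "Met_TC.mcomplete TYPE('a)" by (simp add: complete_UNIV)
      show "closedin Met_TC.mtopology U \<and> Met_TC.mtopology interior_of U = {}" if "U \<in> range E" for U
        using none that clE by auto
    qed auto
    moreover have "\<Union>(range E) = UNIV"
    proof -
      have "y \<in> E (nat \<lceil>norm (S y)\<rceil>)" for y
      proof -
        have "norm (adj x * S y) \<le> norm (S y)" if "norm x \<le> 1" for x
          using order_trans[OF norm_mult_ineq[of "adj x" "S y"]] that by (simp add: mult_left_le_one_le)
        then have "norm (adj (T x) * y) \<le> real (nat \<lceil>norm (S y)\<rceil>)" if "norm x \<le> 1" for x
          unfolding TS using that real_nat_ceiling_ge[of "norm (S y)"] by (meson order_trans)
        then show ?thesis by (simp add: E_def)
      qed
      then show ?thesis by auto
    qed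
    ultimately show False by simp
  qed
  then obtain n y r where r: "r > 0" "ball y r \<subseteq> E n"
    by (metis all_not_in_conv mem_interior)
  have small: "norm (T x) \<le> 4 * real n / r" if x: "norm x \<le> 1" for x
  proof (cases "T x = 0")
    case False
    \<comment> \<open>The test vector is parallel to T x and half the radius long, so the
      C*-identity turns the bound 2 n on \<open>adj (T x) * v\<close> into
      \<open>norm (T x) \<le> 4 * n / r\<close>.\<close>
    define v where "v = (r / (2 * norm (T x))) *\<^sub>R T x"
    have v: "norm v < r" using False r(1) by (simp add: v_def)
    have "y \<in> E n" "y + v \<in> E n" using r v by (auto simp: subset_iff dist_norm)
    then have "norm (adj (T x) * (y + v)) \<le> n" "norm (adj (T x) * y) \<le> n" using x by (auto simp: E_def)
    moreover have "adj (T x) * v = adj (T x) * (y + v) - adj (T x) * y" by (simp add: distrib_left)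
    ultimately have "norm (adj (T x) * v) \<le> 2 * n"
      using norm_triangle_ineq4[of "adj (T x) * (y + v)" "adj (T x) * y"] by simp
    moreover have "norm (adj (T x) * v) = r / 2 * norm (T x)"
      using False r(1) by (simp add: v_def cstar_norm power2_eq_square)
    ultimately show ?thesis using r(1) by (simp add: field_simps)
  qed (use r(1) in simp)
  have "norm (T x) \<le> 4 * real n / r * norm x" for x
  proof (cases "x = 0")
    case False
    have "norm (T ((1 / norm x) *\<^sub>R x)) \<le> 4 * real n / r" by (rule small) (use False in simp)
    then show ?thesis using False unfolding T_scale by (simp add: divide_le_eq mult.commute)
  next
    case True
    then show ?thesis using T_scale[of 0 0] by simp
  qed
  then show ?thesis using that by blast
qed

text \<open>Zorn's lemma is applied to graphs, i.e. to subspaces of \<open>'a \<times> real\<close> dominated by the norm.\<close>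

lemma hahn_banach_norm:
  fixes x :: "'a::real_normed_vector"
  obtains f :: "'a \<Rightarrow> real" where "linear f" "\<And>v. \<bar>f v\<bar> \<le> norm v" "f x = norm x"
proof -
  define D where "D G \<longleftrightarrow> subspace G \<and> (\<forall>v r. (v, r) \<in> G \<longrightarrow> r \<le> norm v)" for G :: "('a \<times> real) set"
  define G0 where "G0 = span {(x, norm x)}"
  have G0_eq: "G0 = range (\<lambda>t. (t *\<^sub>R x, t * norm x))" by (simp add: G0_def span_singleton)
  have "t * norm x \<le> \<bar>t\<bar> * norm x" for t by (rule mult_right_mono) simp_all
  moreover have "subspace G0" unfolding G0_def by (rule subspace_span)
  ultimately have G0: "D G0" unfolding D_def by (auto simp: G0_eq)
  have "\<exists>M\<in>{G. D G \<and> G0 \<subseteq> G}. \<forall>X\<in>{G. D G \<and> G0 \<subseteq> G}. M \<subseteq> X \<longrightarrow> X = M"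
  proof (rule subset_Zorn_nonempty)
    show "{G. D G \<and> G0 \<subseteq> G} \<noteq> {}" using G0 by auto
    fix \<C> assume ne: "\<C> \<noteq> {}" and ch: "subset.chain {G. D G \<and> G0 \<subseteq> G} \<C>"
    then have C: "\<And>G. G \<in> \<C> \<Longrightarrow> D G \<and> G0 \<subseteq> G" "\<And>G H. G \<in> \<C> \<Longrightarrow> H \<in> \<C> \<Longrightarrow> G \<subseteq> H \<or> H \<subseteq> G"
      unfolding subset_chain_def by blast+
    have "subspace (\<Union>\<C>)"
    proof (rule subspaceI)
      show "0 \<in> \<Union>\<C>" using ne C(1) by (auto simp: D_def subspace_def)
      show "a + b \<in> \<Union>\<C>" if ab: "a \<in> \<Union>\<C>" "b \<in> \<Union>\<C>" for a b
      proof -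
        obtain G H where "G \<in> \<C>" "a \<in> G" "H \<in> \<C>" "b \<in> H" using ab by auto
        then obtain K where "K \<in> \<C>" "a \<in> K" "b \<in> K" using C(2) by blast
        then show ?thesis using C(1)[of K] by (auto simp: D_def subspace_def)
      qed
      show "c *\<^sub>R a \<in> \<Union>\<C>" if a: "a \<in> \<Union>\<C>" for a c
      proof -
        obtain G where G: "G \<in> \<C>" "a \<in> G" using a by auto
        then have "c *\<^sub>R a \<in> G" using C(1)[of G] by (intro subspace_scale) (simp_all add: D_def)
        then show ?thesis using G(1) by (rule UnionI[rotated])
      qed
    qed
    then show "\<Union>\<C> \<in> {G. D G \<and> G0 \<subseteq> G}"
      using C(1) ne unfolding D_def by blast
  qed
  then obtain G where G: "D G" "G0 \<subseteq> G" "\<And>X. D X \<Longrightarrow> G0 \<subseteq> X \<Longrightarrow> G \<subseteq> X \<Longrightarrow> X = G" by auto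
  have sub: "subspace G" and dom: "\<And>v r. (v, r) \<in> G \<Longrightarrow> r \<le> norm v" using G(1) by (auto simp: D_def)
  have total: "\<exists>r. (v, r) \<in> G" for v
  proof (rule ccontr)
    assume nv: "\<not> (\<exists>r. (v, r) \<in> G)"
    define lo where "lo = (\<lambda>(u, r). r - norm (u - v)) ` G"
    have cross: "r - norm (u - v) \<le> norm (u' + v) - r'" if "(u, r) \<in> G" "(u', r') \<in> G" for u r u' r'
    proof -
      have "(u + u', r + r') \<in> G" using subspace_add[OF sub that] by simp
      then have "r + r' \<le> norm ((u - v) + (u' + v))" using dom by simp
      also have "\<dots> \<le> norm (u - v) + norm (u' + v)" by (rule norm_triangle_ineq)
      finally show ?thesis by simp
    qed
    have 0: "(0, 0) \<in> G" using subspace_0[OF sub] by (simp add: zero_prod_def)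
    \<comment> \<open>\<alpha> is the value to be assigned to v. By \<open>cross\<close> every lower
      bound \<open>r - norm (u - v)\<close> lies below every upper bound
      \<open>norm (u' + v) - r'\<close>, so the supremum of the lower ones respects both.\<close>
    define \<alpha> where "\<alpha> = Sup lo"
    have lo: "lo \<noteq> {}" "bdd_above lo"
      using 0 cross[OF _ 0] by (auto simp: lo_def intro!: bdd_aboveI)
    have lower: "r - norm (u - v) \<le> \<alpha>" if "(u, r) \<in> G" for u r
      unfolding \<alpha>_def using that by (intro cSup_upper lo) (auto simp: lo_def)
    have upper: "\<alpha> \<le> norm (u + v) - r" if "(u, r) \<in> G" for u r
      unfolding \<alpha>_def using that cross by (intro cSup_least lo) (auto simp: lo_def)
    define X where "X = {g + t *\<^sub>R (v, \<alpha>) | g t. g \<in> G}"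
    have GX: "G \<subseteq> X"
    proof
      fix g assume "g \<in> G"
      moreover have "g = g + 0 *\<^sub>R (v, \<alpha>)" by (simp only: scaleR_zero_left add_0_right)
      ultimately show "g \<in> X" unfolding X_def by blast
    qed
    have "subspace X"
    proof (rule subspaceI)
      show "0 \<in> X" using subspace_0[OF sub] GX by blast
      show "a + b \<in> X" if ab: "a \<in> X" "b \<in> X" for a b
      proof -
        obtain g t h s where gh: "g \<in> G" "h \<in> G" "a = g + t *\<^sub>R (v, \<alpha>)" "b = h + s *\<^sub>R (v, \<alpha>)"
          using ab unfolding X_def by blast
        have "a + b = (g + h) + (t + s) *\<^sub>R (v, \<alpha>)" unfolding gh by (simp only: scaleR_left_distrib ac_simps)
        then show ?thesis unfolding X_def using subspace_add[OF sub gh(1,2)] by blast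
      qed
      show "c *\<^sub>R a \<in> X" if aX: "a \<in> X" for a c
      proof -
        obtain g t where a: "g \<in> G" "a = g + t *\<^sub>R (v, \<alpha>)" using aX unfolding X_def by blast
        have "c *\<^sub>R a = c *\<^sub>R g + (c * t) *\<^sub>R (v, \<alpha>)" unfolding a by (simp only: scaleR_right_distrib scaleR_scaleR)
        then show ?thesis unfolding X_def using subspace_scale[OF sub a(1)] by blast
      qed
    qed
    moreover have "s \<le> norm w" if ws: "(w, s) \<in> X" for w s
    proof -
      obtain u r t where ur: "(u, r) \<in> G" "w = u + t *\<^sub>R v" "s = r + t * \<alpha>"
        using ws unfolding X_def by auto
      consider "t = 0" | "t > 0" | "t < 0" by linarith
      then show ?thesis
      proof cases
        case 1 then show ?thesis using dom ur by simp
      next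
        case 2
        have "((1/t) *\<^sub>R u, r / t) \<in> G" using subspace_scale[OF sub ur(1), of "1/t"] by simp
        from upper[OF this] have "t * \<alpha> \<le> t * (norm ((1/t) *\<^sub>R u + v) - r / t)" using 2 by simp
        also have "\<dots> = norm (t *\<^sub>R ((1/t) *\<^sub>R u + v)) - r" using 2 by (simp add: right_diff_distrib)
        also have "t *\<^sub>R ((1/t) *\<^sub>R u + v) = w" using 2 ur(2) by (simp add: scaleR_right_distrib)
        finally show ?thesis using ur(3) by simp
      next
        case 3
        define q where "q = - t"
        have q: "q > 0" "t = - q" using 3 by (simp_all add: q_def)
        have "((1/q) *\<^sub>R u, r / q) \<in> G" using subspace_scale[OF sub ur(1), of "1/q"] by simp
        from lower[OF this] have "q * (r / q - norm ((1/q) *\<^sub>R u - v)) \<le> q * \<alpha>" using q(1) by simp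
        moreover have "q * (r / q - norm ((1/q) *\<^sub>R u - v)) = r - norm (q *\<^sub>R ((1/q) *\<^sub>R u - v))"
          using q(1) by (simp add: right_diff_distrib)
        moreover have "q *\<^sub>R ((1/q) *\<^sub>R u - v) = w" using q ur(2) by (simp add: scaleR_diff_right)
        ultimately show ?thesis using ur(3) q(2) by simp
      qed
    qed
    ultimately have "D X" by (simp add: D_def)
    then have "X = G" using G GX by blast
    moreover have "(v, \<alpha>) \<in> X"
    proof -
      have "(v, \<alpha>) = (0, 0) + 1 *\<^sub>R (v, \<alpha>)" by simp
      then show ?thesis unfolding X_def using 0 by blast
    qed
    ultimately show False using nv by blast
  qed
  have uniq: "r = s" if "(v, r) \<in> G" "(v, s) \<in> G" for v r s
    using dom[of 0 "r - s"] dom[of 0 "s - r"] subspace_diff[OF sub that] subspace_diff[OF sub that(2,1)] by simp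
  define f where "f v = (THE r. (v, r) \<in> G)" for v
  have f: "(v, f v) \<in> G" for v
    unfolding f_def using total[of v] uniq by (metis (no_types, lifting) theI)
  have f_eq: "f v = r" if "(v, r) \<in> G" for v r using uniq[OF f that] .
  show ?thesis
  proof
    show "linear f"
    proof (rule linearI)
      show "f (a + b) = f a + f b" for a b using subspace_add[OF sub f[of a] f[of b]] by (intro f_eq) simp
      show "f (c *\<^sub>R a) = c *\<^sub>R f a" for a c using subspace_scale[OF sub f[of a], of c] by (intro f_eq) simp
    qed
    then have "f (- v) = - f v" for v by (rule linear_neg)
    then show "\<bar>f v\<bar> \<le> norm v" for v using dom[OF f[of v]] dom[OF f[of "- v"]] by simp
    have "(x, norm x) \<in> G0" unfolding G0_def by (rule span_base) simp
    then show "f x = norm x" using G(2) by (intro f_eq) auto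
  qed
qed


section \<open>Matrices and positive bimodule maps\<close>

text \<open>Unit-free form of 1 - \<open>adj a * a\<close> = (1 - g)^2. Here 1 - g is the root (1 -
  h)^(1/2); its constant term is 1, so g is a limit of polynomials in h without constant term and
  lies in the algebra.\<close>

lemma contraction_root:
  fixes a :: "'a::cstar_alg"
  assumes "norm a \<le> 1"
  obtains g where "adj g = g" "adj a * a = g + g - g * g"
proof -
  define h where "h = multiplier_of (adj a * a)"
  have n: "norm h \<le> 1" using assms by (simp add: h_def cstar_norm power_le_one)
  have ah: "adj h = h" unfolding h_def by (simp only: multiplier_of_adj[symmetric] adj_mult adj_adj)
  let ?s = "binom_series (1/2) h"
  have sm: "summable (\<lambda>n. binom_coeff (1/2) n *\<^sub>R h ^ n)"
    by (rule summable_norm_cancel, rule binom_series_summable) (use n in auto)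
  have hn: "h ^ Suc n \<in> range multiplier_of" for n
  proof -
    have "h ^ Suc n = multiplier_of (multiplier_apply (h ^ n) (adj a * a))"
      by (simp only: power_Suc2 multiplier_mult_of[symmetric] h_def)
    then show ?thesis by (rule range_eqI)
  qed
  have "1 - ?s \<in> range (multiplier_of :: 'a \<Rightarrow> _)"
  proof (rule range_multiplier_of_limit)
    have "\<forall>n. \<exists>x. h ^ Suc n = multiplier_of x" using hn by (auto simp: image_iff)
    then obtain x where x: "\<And>n. h ^ Suc n = multiplier_of (x n)" by (auto dest!: choice)
    show "1 - (\<Sum>i<Suc n. binom_coeff (1/2) i *\<^sub>R h ^ i) \<in> range multiplier_of" for n
    proof -
      have "1 - (\<Sum>i<Suc n. binom_coeff (1/2) i *\<^sub>R h ^ i)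
          = multiplier_of (- (\<Sum>i<n. binom_coeff (1/2) (Suc i) *\<^sub>R x i))"
        by (simp only: sum.lessThan_Suc_shift x multiplier_of_sum multiplier_of_scaleR
            linear_neg[OF bounded_linear.linear[OF bounded_linear_multiplier_of]]) simp
      then show ?thesis by (rule range_eqI)
    qed
    have "(\<lambda>n. \<Sum>i<Suc n. binom_coeff (1/2) i *\<^sub>R h ^ i) \<longlonglongrightarrow> ?s"
      using LIMSEQ_Suc[OF summable_LIMSEQ[OF sm]] by (simp only: binom_series_def)
    then show "(\<lambda>n. 1 - (\<Sum>i<Suc n. binom_coeff (1/2) i *\<^sub>R h ^ i)) \<longlonglongrightarrow> 1 - ?s"
      by (intro tendsto_diff tendsto_const)
  qed
  then obtain g where g: "1 - ?s = multiplier_of g" by auto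
  have "adj (1 - ?s) = 1 - ?s" using binom_series_adj[of "1/2" h] n ah by (simp add: adj_diff)
  then have ag: "adj g = g" unfolding g by (simp flip: multiplier_of_adj)
  have "multiplier_of (adj a * a) = 1 - ?s * ?s" using binom_series_sqrt[OF n] by (simp add: h_def)
  also have "?s = 1 - multiplier_of g" using g by (simp add: algebra_simps)
  also have "1 - (1 - multiplier_of g) * (1 - multiplier_of g) = multiplier_of (g + g - g * g)"
    by (simp add: multiplier_of_add multiplier_of_diff multiplier_of_mult algebra_simps)
  finally show ?thesis using that ag by simp
qed

text \<open>Take c = h: the fourth power of \<open>norm h\<close> is the norm of h^4, and h^3 is a
  conjugate of h. In an algebra without unit this replaces conjugation by 1.\<close>

lemma norm_le_by_conjugates:
  fixes h :: "'a::cstar_alg"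
  assumes h: "adj h = h" and r0: "0 \<le> r" and r: "\<And>c. norm (adj c * h * c) \<le> r * (norm c)\<^sup>2"
  shows "norm h \<le> r"
proof (cases "h = 0")
  case True
  then show ?thesis using r0 by simp
next
  case False
  have "(norm h) ^ 4 = norm ((h * h) * (h * h))"
    using norm_square_selfadjoint[of "h * h"] norm_square_selfadjoint[OF h] by (simp add: adj_mult h)
  also have "\<dots> \<le> norm (h * h * h) * norm h" by (simp only: mult.assoc[symmetric] norm_mult_ineq)
  also have "\<dots> \<le> r * (norm h)\<^sup>2 * norm h" using r[of h] h by (intro mult_right_mono) simp_all
  finally have "norm h * (norm h) ^ 3 \<le> r * (norm h) ^ 3"
    by (simp add: power2_eq_square power3_eq_cube power4_eq_xxxx mult.assoc)
  then show ?thesis using False by (simp add: mult_le_cancel_right)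
qed

section \<open>Columns and matrices as operators between Hilbert modules\<close>

definition col_sq :: "'i set \<Rightarrow> ('i \<Rightarrow> 'a::cstar_alg) \<Rightarrow> real"
  where "col_sq I x = norm (\<Sum>i\<in>I. adj (x i) * x i)"

text \<open>\<open>t\<close> bounds the square of the operator norm of \<open>M\<close>, since
  \<open>col_sq\<close> is already a squared norm; this accounts for the squares and fourth powers
  below.\<close>

definition mat_bound :: "'i set \<Rightarrow> 'j set \<Rightarrow> ('i \<Rightarrow> 'j \<Rightarrow> 'a::cstar_alg) \<Rightarrow> real \<Rightarrow> bool"
  where "mat_bound I J M t \<longleftrightarrow> (\<forall>v. col_sq I (\<lambda>i. \<Sum>j\<in>J. M i j * v j) \<le> t * col_sq J v)"

lemma col_sq_nonneg [simp]: "0 \<le> col_sq I x" by (simp add: col_sq_def)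

lemma pos_col_sq: "pos (\<Sum>i\<in>I. adj (x i) * x i)"
  by (rule pos_sum) (rule pos_adj_mult)

lemma col_sq_entry: "finite I \<Longrightarrow> i \<in> I \<Longrightarrow> (norm (x i))\<^sup>2 \<le> col_sq I x"
  unfolding cstar_norm[symmetric] col_sq_def
proof (rule pos_norm_mono)
  assume "finite I" "i \<in> I"
  then have "(\<Sum>i\<in>I. adj (x i) * x i) - adj (x i) * x i = (\<Sum>i\<in>I - {i}. adj (x i) * x i)"
    by (simp add: sum_diff1)
  then show "pos ((\<Sum>i\<in>I. adj (x i) * x i) - adj (x i) * x i)" by (simp add: pos_col_sq)
qed simp

lemma col_sq_le_sum: "col_sq I x \<le> (\<Sum>i\<in>I. (norm (x i))\<^sup>2)"
  unfolding col_sq_def by (rule order_trans[OF norm_sum]) (simp add: cstar_norm)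

lemma col_sq_cauchy_schwarz: "(norm (\<Sum>i\<in>I. adj (x i) * y i))\<^sup>2 \<le> col_sq I x * col_sq I y"
  unfolding col_sq_def
proof (rule pos_cauchy_schwarz[OF pos_col_sq])
  fix a
  have "adj a * (\<Sum>i\<in>I. adj (x i) * x i) * a - adj a * (\<Sum>i\<in>I. adj (x i) * y i)
      - adj (\<Sum>i\<in>I. adj (x i) * y i) * a + (\<Sum>i\<in>I. adj (y i) * y i)
    = (\<Sum>i\<in>I. adj (x i * a - y i) * (x i * a - y i))"
    by (simp add: adj_sum sum_distrib_left sum_distrib_right adj_mult adj_diff algebra_simps
        sum.distrib sum_subtractf mult.assoc)
  then show "pos (adj a * (\<Sum>i\<in>I. adj (x i) * x i) * a - adj a * (\<Sum>i\<in>I. adj (x i) * y i)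
      - adj (\<Sum>i\<in>I. adj (x i) * y i) * a + (\<Sum>i\<in>I. adj (y i) * y i))"
    by (simp add: pos_col_sq)
qed

text \<open>A row x has squared operator norm at most \<open>norm H\<close>, and here it acts on
  several columns at once. If b is the result, \<open>adj (b i) * b i\<close> pairs the entries
  \<open>adj (x k) * b i\<close> with w, and these entries have squared column norm at most
  \<open>norm H\<close> times \<open>col_sq I b\<close>; Cauchy-Schwarz then leaves one factor
  \<open>col_sq I b\<close> to cancel.\<close>

lemma row_times_columns:
  "col_sq I (\<lambda>i. \<Sum>k\<in>P. x k * w k i) \<le> norm (\<Sum>k\<in>P. x k * adj (x k)) * col_sq (P \<times> I) (\<lambda>(k, i). w k i)"
proof -
  define b where "b i = (\<Sum>k\<in>P. x k * w k i)" for i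
  define H where "H = (\<Sum>k\<in>P. x k * adj (x k))"
  have pH: "pos H" unfolding H_def
    by (rule pos_sum) (metis adj_adj pos_adj_mult)
  have "adj (b i) * b i = (\<Sum>k\<in>P. adj (adj (x k) * b i) * w k i)" for i
  proof -
    have "adj (b i) * b i = (\<Sum>k\<in>P. adj (b i) * (x k * w k i))"
      by (subst (2) b_def) (rule sum_distrib_left)
    then show ?thesis by (simp add: adj_mult mult.assoc)
  qed
  then have "(\<Sum>i\<in>I. adj (b i) * b i) = (\<Sum>i\<in>I. \<Sum>k\<in>P. adj (adj (x k) * b i) * w k i)" by simp
  also have "\<dots> = (\<Sum>(k, i)\<in>P \<times> I. adj (adj (x k) * b i) * w k i)"
    by (subst sum.swap) (simp add: sum.cartesian_product)
  finally have e: "(\<Sum>i\<in>I. adj (b i) * b i) = (\<Sum>p\<in>P \<times> I. adj (adj (x (fst p)) * b (snd p)) * w (fst p) (snd p))"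
    by (simp add: split_def)
  have "col_sq (P \<times> I) (\<lambda>p. adj (x (fst p)) * b (snd p)) = norm (\<Sum>(k, i)\<in>P \<times> I. adj (b i) * (x k * adj (x k)) * b i)"
    by (simp add: col_sq_def split_def adj_mult mult.assoc)
  also have "(\<Sum>(k, i)\<in>P \<times> I. adj (b i) * (x k * adj (x k)) * b i) = (\<Sum>i\<in>I. adj (b i) * H * b i)"
    unfolding H_def sum.cartesian_product[symmetric]
    by (subst sum.swap) (simp only: sum_distrib_left sum_distrib_right)
  also have "norm \<dots> \<le> norm (norm H *\<^sub>R (\<Sum>i\<in>I. adj (b i) * b i))"
  proof (rule pos_norm_mono)
    show "pos (\<Sum>i\<in>I. adj (b i) * H * b i)" by (intro pos_sum pos_conjugate pH)
    have "pos (\<Sum>i\<in>I. norm H *\<^sub>R (adj (b i) * b i) - adj (b i) * H * b i)"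
      by (intro pos_sum pos_norm_bound_conjugate pH)
    then show "pos (norm H *\<^sub>R (\<Sum>i\<in>I. adj (b i) * b i) - (\<Sum>i\<in>I. adj (b i) * H * b i))"
      by (simp only: sum_subtractf scaleR_right.sum)
  qed
  finally have le: "col_sq (P \<times> I) (\<lambda>p. adj (x (fst p)) * b (snd p)) \<le> norm H * col_sq I b"
    by (simp add: col_sq_def)
  have "(col_sq I b)\<^sup>2 \<le> col_sq (P \<times> I) (\<lambda>p. adj (x (fst p)) * b (snd p)) * col_sq (P \<times> I) (\<lambda>p. w (fst p) (snd p))"
    unfolding col_sq_def[of I b] e by (rule col_sq_cauchy_schwarz)
  also have "\<dots> \<le> norm H * col_sq I b * col_sq (P \<times> I) (\<lambda>p. w (fst p) (snd p))"
    by (rule mult_right_mono[OF le]) simp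
  finally have "(col_sq I b)\<^sup>2 \<le> norm H * col_sq I b * col_sq (P \<times> I) (\<lambda>p. w (fst p) (snd p))" .
  then have "col_sq I b * col_sq I b \<le> (norm H * col_sq (P \<times> I) (\<lambda>p. w (fst p) (snd p))) * col_sq I b"
    by (simp add: power2_eq_square ac_simps)
  then have "col_sq I b \<le> norm H * col_sq (P \<times> I) (\<lambda>p. w (fst p) (snd p))"
    by (cases "col_sq I b = 0") (simp_all add: mult_le_cancel_right less_le)
  then show ?thesis by (simp add: b_def[abs_def] H_def split_def)
qed

text \<open>If f 0 = q r V with q > 1, the step inequality forces f m \<ge> q^(2^m) r^(2^m) V, which
  outgrows any constant C. Thus C, whatever its size, leaves no trace in the conclusion.\<close>

lemma power_iteration_bound:
  fixes f :: "nat \<Rightarrow> real"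
  assumes f0: "\<And>m. 0 \<le> f m" and V: "0 \<le> V" and r: "0 \<le> r"
    and step: "\<And>m. (f m)\<^sup>2 \<le> V * f (Suc m)" and bd: "\<And>m. f m \<le> C * r ^ (2 ^ m) * V"
  shows "f 0 \<le> r * V"
proof (rule ccontr)
  assume "\<not> f 0 \<le> r * V"
  then have gt: "r * V < f 0" by simp
  have Vp: "V > 0"
  proof (rule ccontr)
    assume "\<not> V > 0"
    then have "V = 0" using V by simp
    then show False using step[of 0] gt by simp
  qed
  have rp: "r > 0"
  proof (rule ccontr)
    assume "\<not> r > 0"
    then have "r = 0" using r by simp
    then show False using bd[of 0] gt by simp
  qed
  define q where "q = f 0 / (r * V)"
  have q: "q > 1" using gt Vp rp by (simp add: q_def)
  have lower: "q ^ (2 ^ m) * r ^ (2 ^ m) * V \<le> f m" for m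
  proof (induction m)
    case 0
    then show ?case using Vp rp by (simp add: q_def)
  next
    case (Suc m)
    have "V * (q ^ (2 ^ Suc m) * r ^ (2 ^ Suc m) * V) = (q ^ (2 ^ m) * r ^ (2 ^ m) * V)\<^sup>2"
      by (simp add: mult_2 power_add power2_eq_square)
    also have "\<dots> \<le> (f m)\<^sup>2" using Suc q Vp rp by (intro power_mono) simp_all
    also have "\<dots> \<le> V * f (Suc m)" by (rule step)
    finally show ?case using Vp by simp
  qed
  have "q ^ (2 ^ m) \<le> C" for m
  proof -
    have "q ^ (2 ^ m) * (r ^ (2 ^ m) * V) \<le> C * (r ^ (2 ^ m) * V)"
      using order_trans[OF lower bd] by (simp add: mult.assoc)
    then show ?thesis using Vp rp by (simp add: mult_le_cancel_right)
  qed
  moreover obtain n where "C < q ^ n" using real_arch_pow[OF q] by auto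
  moreover have "q ^ n \<le> q ^ (2 ^ n)" using q by (intro power_increasing) (simp_all add: less_imp_le)
  ultimately show False by (meson leD less_le_trans)
qed


lemma square_le_cancel:
  fixes x :: real
  assumes "x\<^sup>2 \<le> a * x" "0 \<le> x" "0 \<le> a" shows "x \<le> a"
  using assms by (cases "x = 0") (simp_all add: power2_eq_square mult_le_cancel_right)

lemma sum_rotate: "(\<Sum>j\<in>J. \<Sum>l\<in>K. \<Sum>i\<in>I. f j l i) = (\<Sum>i\<in>I. \<Sum>j\<in>J. \<Sum>l\<in>K. f j l i)"
proof -
  have "(\<Sum>j\<in>J. \<Sum>l\<in>K. \<Sum>i\<in>I. f j l i) = (\<Sum>j\<in>J. \<Sum>i\<in>I. \<Sum>l\<in>K. f j l i)"
    by (intro sum.cong refl sum.swap)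
  also have "\<dots> = (\<Sum>i\<in>I. \<Sum>j\<in>J. \<Sum>l\<in>K. f j l i)" by (rule sum.swap)
  finally show ?thesis .
qed

text \<open>One half of the C*-identity for matrices; t bounds the squared norm of \<open>M\<close>,
  that is the norm of the Gram matrix, whose squared norm is then bounded by t^2.\<close>

lemma mat_bound_gram:
  assumes M: "mat_bound I J M t" and t: "0 \<le> t"
  shows "mat_bound J J (\<lambda>j l. \<Sum>i\<in>I. adj (M i j) * M i l) (t\<^sup>2)"
  unfolding mat_bound_def
proof
  fix v :: "'b \<Rightarrow> 'c"
  define b where "b j = (\<Sum>l\<in>J. (\<Sum>i\<in>I. adj (M i j) * M i l) * v l)" for j
  have e: "(\<Sum>j\<in>J. adj (b j) * b j) = (\<Sum>i\<in>I. adj (\<Sum>j\<in>J. M i j * b j) * (\<Sum>l\<in>J. M i l * v l))"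
  proof -
    have "(\<Sum>j\<in>J. adj (b j) * b j) = (\<Sum>j\<in>J. adj (b j) * (\<Sum>l\<in>J. (\<Sum>i\<in>I. adj (M i j) * M i l) * v l))"
      by (simp only: b_def[symmetric])
    also have "\<dots> = (\<Sum>j\<in>J. \<Sum>l\<in>J. \<Sum>i\<in>I. adj (b j) * (adj (M i j) * (M i l * v l)))"
      by (simp only: sum_distrib_left sum_distrib_right mult.assoc)
    also have "\<dots> = (\<Sum>i\<in>I. \<Sum>j\<in>J. \<Sum>l\<in>J. adj (b j) * (adj (M i j) * (M i l * v l)))"
      by (rule sum_rotate)
    also have "\<dots> = (\<Sum>i\<in>I. adj (\<Sum>j\<in>J. M i j * b j) * (\<Sum>l\<in>J. M i l * v l))"
      by (simp only: adj_sum adj_mult sum_product mult.assoc)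
    finally show ?thesis .
  qed
  have "(col_sq J b)\<^sup>2 \<le> col_sq I (\<lambda>i. \<Sum>j\<in>J. M i j * b j) * col_sq I (\<lambda>i. \<Sum>l\<in>J. M i l * v l)"
    unfolding col_sq_def[of J b] e by (rule col_sq_cauchy_schwarz)
  also have "\<dots> \<le> (t * col_sq J b) * (t * col_sq J v)"
    using M t by (intro mult_mono) (auto simp: mat_bound_def)
  finally have "(col_sq J b)\<^sup>2 \<le> (t\<^sup>2 * col_sq J v) * col_sq J b"
    by (simp add: power2_eq_square ac_simps)
  then show "col_sq J b \<le> t\<^sup>2 * col_sq J v" by (rule square_le_cancel) simp_all
qed

text \<open>Tested on the column with \<open>adj (M i j)\<close> in position j and 0 elsewhere;
  coordinate i of the image is \<open>M i j * adj (M i j)\<close>.\<close>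

lemma mat_bound_entry:
  assumes M: "mat_bound I J M (t\<^sup>2)" and t: "0 \<le> t" and IJ: "finite I" "finite J" "i \<in> I" "j \<in> J"
  shows "norm (M i j) \<le> t"
proof -
  define v where "v l = (if l = j then adj (M i j) else 0)" for l
  have s: "(\<Sum>l\<in>J. M k l * v l) = M k j * adj (M i j)" for k
    using IJ by (simp add: v_def if_distrib[of "\<lambda>x. _ * x"] sum.delta' cong: if_cong)
  have "(norm (M i j * adj (M i j)))\<^sup>2 \<le> col_sq I (\<lambda>i. \<Sum>l\<in>J. M i l * v l)"
    using col_sq_entry[of I i "\<lambda>i. \<Sum>l\<in>J. M i l * v l"] IJ by (simp add: s)
  also have "\<dots> \<le> t\<^sup>2 * col_sq J v" using M by (simp add: mat_bound_def)
  also have "col_sq J v \<le> (norm (M i j))\<^sup>2"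
    using order_trans[OF col_sq_le_sum[of J v]] IJ
    by (simp add: v_def if_distrib[of "\<lambda>x. (norm x)\<^sup>2"] sum.delta' cong: if_cong)
  finally have "(norm (M i j * adj (M i j)))\<^sup>2 \<le> t\<^sup>2 * (norm (M i j))\<^sup>2"
    by (simp add: mult_left_mono)
  moreover have "norm (M i j * adj (M i j)) = (norm (M i j))\<^sup>2"
    using cstar_norm[of "adj (M i j)"] by simp
  ultimately have "(norm (M i j) * norm (M i j))\<^sup>2 \<le> (t * norm (M i j))\<^sup>2"
    by (simp add: power2_eq_square ac_simps)
  then have "norm (M i j) * norm (M i j) \<le> t * norm (M i j)"
    by (rule power2_le_imp_le) (simp add: t)
  then show ?thesis using t by (cases "M i j = 0") (simp_all add: mult_le_cancel_right)
qed

section \<open>Actions by adjointable operators and their extension to matrices\<close>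

locale star_action =
  fixes L :: "'a::cstar_alg \<Rightarrow> 'c::cstar_alg \<Rightarrow> 'c"
  assumes L_add_left: "L (a + b) c = L a c + L b c"
    and L_add_right: "L a (c + d) = L a c + L a d"
    and L_scaleR_left: "L (r *\<^sub>R a) c = r *\<^sub>R L a c"
    and L_scaleR_right: "L a (r *\<^sub>R c) = r *\<^sub>R L a c"
    and L_mult: "L (a * b) c = L a (L b c)"
    and L_adj: "adj (L a c) * d = adj c * L (adj a) d"
begin

lemma linear_L_left: "linear (\<lambda>a. L a c)"
  by (rule linearI) (simp_all add: L_add_left L_scaleR_left)

lemma linear_L_right: "linear (L a)"
  by (rule linearI) (simp_all add: L_add_right L_scaleR_right)

lemmas L_diff_left = linear_diff[OF linear_L_left]
  and L_sum_left = linear_sum[OF linear_L_left]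
  and L_0_left [simp] = linear_0[OF linear_L_left]
  and L_0_right [simp] = linear_0[OF linear_L_right]

lemma L_assoc: "L a (c * d) = L a c * d"
proof (rule mult_left_cancel_all)
  fix z
  have "adj z * L a (c * d) = adj (L (adj a) z) * (c * d)" using L_adj[of "adj a" z "c * d"] by simp
  also have "\<dots> = adj z * L a c * d" using L_adj[of "adj a" z c] by (simp flip: mult.assoc)
  finally show "adj z * L a (c * d) = adj z * (L a c * d)" by (simp only: mult.assoc)
qed

text \<open>For a contraction b write \<open>adj b * b\<close> = g + g - g^2 by
  \<open>contraction_root\<close>. Then \<open>adj c * c\<close> exceeds
  \<open>adj (L b c) * L b c\<close> by \<open>adj d * d\<close> with d = \<open>c - L g c\<close>,
  so the bound comes from positivity; continuity of the action is a consequence.\<close>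

lemma L_norm: "norm (L a c) \<le> norm a * norm c"
proof -
  have *: "norm (L b c) \<le> norm c" if b: "norm b \<le> 1" for b
  proof -
    obtain g where g: "adj g = g" "adj b * b = g + g - g * g" using contraction_root[OF b] by metis
    have e: "adj c * L (adj b * b) c = adj (L b c) * L b c" by (simp add: L_mult L_adj)
    have "adj c * c - adj c * L (adj b * b) c = adj (c - L g c) * (c - L g c)"
      unfolding g(2)
      by (simp add: L_diff_left L_add_left L_mult adj_diff left_diff_distrib right_diff_distrib
          distrib_left L_adj g(1))
    then have "norm (adj (L b c) * L b c) \<le> norm (adj c * c)"
      unfolding e by (intro pos_norm_mono) simp_all
    then show ?thesis by (simp add: cstar_norm power2_le_iff_abs_le)
  qed
  show ?thesis
  proof (cases "a = 0")
    case False
    have "norm (L ((1 / norm a) *\<^sub>R a) c) \<le> norm c" by (rule *) (use False in simp)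
    then show ?thesis using False by (simp add: L_scaleR_left divide_le_eq mult.commute)
  qed simp
qed

lemma col_sq_L: "col_sq J (\<lambda>j. L (a j) c) \<le> col_sq J a * (norm c)\<^sup>2"
proof -
  have "(\<Sum>j\<in>J. adj (L (a j) c) * L (a j) c) = adj c * L (\<Sum>j\<in>J. adj (a j) * a j) c"
    by (simp add: L_sum_left sum_distrib_left L_mult L_adj)
  then have "col_sq J (\<lambda>j. L (a j) c) \<le> norm c * norm (L (\<Sum>j\<in>J. adj (a j) * a j) c)"
    unfolding col_sq_def using norm_mult_ineq[of "adj c"] by simp
  also have "\<dots> \<le> norm c * (col_sq J a * norm c)"
    unfolding col_sq_def by (intro mult_left_mono L_norm) simp
  finally show ?thesis by (simp add: power2_eq_square ac_simps)
qed

definition L_bound :: "'i set \<Rightarrow> 'j set \<Rightarrow> ('i \<Rightarrow> 'j \<Rightarrow> 'a) \<Rightarrow> real \<Rightarrow> bool"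
  where "L_bound I J M t \<longleftrightarrow> (\<forall>v. col_sq I (\<lambda>i. \<Sum>j\<in>J. L (M i j) (v j)) \<le> t * col_sq J v)"

lemma L_gram:
  "(\<Sum>i\<in>I. adj (\<Sum>j\<in>J. L (M i j) (u j)) * (\<Sum>l\<in>J. L (M i l) (v l)))
    = (\<Sum>j\<in>J. adj (u j) * (\<Sum>l\<in>J. L (\<Sum>i\<in>I. adj (M i j) * M i l) (v l)))"
proof -
  have "(\<Sum>i\<in>I. adj (\<Sum>j\<in>J. L (M i j) (u j)) * (\<Sum>l\<in>J. L (M i l) (v l)))
      = (\<Sum>i\<in>I. \<Sum>j\<in>J. \<Sum>l\<in>J. adj (u j) * L (adj (M i j) * M i l) (v l))"
    by (simp only: adj_sum sum_product L_adj L_mult)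
  also have "\<dots> = (\<Sum>j\<in>J. \<Sum>l\<in>J. \<Sum>i\<in>I. adj (u j) * L (adj (M i j) * M i l) (v l))"
    by (rule sum_rotate[symmetric])
  also have "\<dots> = (\<Sum>j\<in>J. adj (u j) * (\<Sum>l\<in>J. L (\<Sum>i\<in>I. adj (M i j) * M i l) (v l)))"
    by (simp only: sum_distrib_left L_sum_left)
  finally show ?thesis .
qed

text \<open>The induced map on matrices is contractive: squaring a self-adjoint matrix squares its
  norm, so any bound that depends only on the size of the matrix improves to the constant 1.\<close>

lemma L_bound_selfadjoint:
  assumes J: "finite J" and r: "0 \<le> r"
    and H: "\<And>j l. j \<in> J \<Longrightarrow> l \<in> J \<Longrightarrow> adj (H j l) = H l j" "mat_bound J J H (r\<^sup>2)"
  shows "L_bound J J H (r\<^sup>2)"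
proof -
  \<comment> \<open>\<open>S m\<close> is the matrix power H^(2^m); its operator norm is at most
    \<open>r ^ (2 ^ m)\<close>.\<close>
  define S where "S = rec_nat H (\<lambda>_ G j l. \<Sum>k\<in>J. G j k * G k l)"
  have S0: "S 0 = H" and SS: "S (Suc m) = (\<lambda>j l. \<Sum>k\<in>J. S m j k * S m k l)" for m
    by (simp_all add: S_def)
  have sa: "adj (S m j l) = S m l j" if "j \<in> J" "l \<in> J" for m j l
    using that by (induction m arbitrary: j l) (simp_all add: S0 H SS adj_sum adj_mult)
  have SS': "S (Suc m) j l = (\<Sum>k\<in>J. adj (S m k j) * S m k l)" if "j \<in> J" for m j l
    unfolding SS by (rule sum.cong) (simp_all add: sa that)
  define \<rho> where "\<rho> m = r ^ (2 ^ m)" for m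
  have \<rho>0: "0 \<le> \<rho> m" for m using r by (simp add: \<rho>_def)
  have \<rho>S: "(\<rho> m)\<^sup>2 = \<rho> (Suc m)" for m by (simp add: \<rho>_def mult_2 power_add power2_eq_square)
  have bd: "mat_bound J J (S m) ((\<rho> m)\<^sup>2)" for m
  proof (induction m)
    case 0 then show ?case by (simp add: S0 H \<rho>_def)
  next
    case (Suc m)
    have "mat_bound J J (\<lambda>j l. \<Sum>i\<in>J. adj (S m i j) * S m i l) (((\<rho> m)\<^sup>2)\<^sup>2)"
      by (rule mat_bound_gram[OF Suc]) simp
    then have "mat_bound J J (\<lambda>j l. \<Sum>i\<in>J. adj (S m i j) * S m i l) ((\<rho> (Suc m))\<^sup>2)"
      by (simp only: \<rho>S)
    then show ?case unfolding mat_bound_def col_sq_def by (simp add: SS' cong: sum.cong)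
  qed
  have ent: "norm (S m j l) \<le> \<rho> m" if "j \<in> J" "l \<in> J" for m j l
    by (rule mat_bound_entry[OF bd \<rho>0 J J that])
  show ?thesis unfolding L_bound_def
  proof
    fix v :: "'b \<Rightarrow> 'c"
    define f where "f m = col_sq J (\<lambda>j. \<Sum>l\<in>J. L (S m j l) (v l))" for m
    \<comment> \<open>The constant for \<open>power_iteration_bound\<close> comes from the entries
      alone: a coordinate is a sum of \<open>card J\<close> terms, which gets squared, and there are
      \<open>card J\<close> coordinates.\<close>
    have "f 0 \<le> r\<^sup>2 * col_sq J v"
    proof (rule power_iteration_bound[where C="real (card J) ^ 3"])
      fix m
      have "f m = norm (\<Sum>j\<in>J. adj (v j) * (\<Sum>l\<in>J. L (\<Sum>i\<in>J. adj (S m i j) * S m i l) (v l)))"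
        unfolding f_def col_sq_def L_gram ..
      also have "\<dots> = norm (\<Sum>j\<in>J. adj (v j) * (\<Sum>l\<in>J. L (S (Suc m) j l) (v l)))"
        by (simp add: SS' cong: sum.cong)
      finally show "(f m)\<^sup>2 \<le> col_sq J v * f (Suc m)"
        unfolding f_def[of "Suc m"] using col_sq_cauchy_schwarz by metis
      have vj: "norm (v l) \<le> sqrt (col_sq J v)" if "l \<in> J" for l
        using col_sq_entry[OF J that, of v] by (simp add: real_le_rsqrt)
      have "norm (\<Sum>l\<in>J. L (S m j l) (v l)) \<le> real (card J) * (\<rho> m * sqrt (col_sq J v))" if j: "j \<in> J" for j
      proof (rule order_trans[OF norm_sum], rule sum_bounded_above)
        fix l assume l: "l \<in> J"
        show "norm (L (S m j l) (v l)) \<le> \<rho> m * sqrt (col_sq J v)"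
          by (rule order_trans[OF L_norm mult_mono]) (use ent j l vj \<rho>0 in auto)
      qed
      then have "(norm (\<Sum>l\<in>J. L (S m j l) (v l)))\<^sup>2 \<le> (real (card J) * (\<rho> m * sqrt (col_sq J v)))\<^sup>2" if "j \<in> J" for j
        using that by (intro power_mono) simp_all
      then have "f m \<le> real (card J) * (real (card J) * (\<rho> m * sqrt (col_sq J v)))\<^sup>2"
        unfolding f_def by (intro order_trans[OF col_sq_le_sum] sum_bounded_above)
      also have "\<dots> = real (card J) ^ 3 * (r\<^sup>2) ^ (2 ^ m) * col_sq J v"
        by (simp add: power_mult_distrib \<rho>_def power2_eq_square power3_eq_cube)
      finally show "f m \<le> real (card J) ^ 3 * (r\<^sup>2) ^ (2 ^ m) * col_sq J v" .
    qed (simp_all add: f_def)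
    then show "col_sq J (\<lambda>i. \<Sum>j\<in>J. L (H i j) (v j)) \<le> r\<^sup>2 * col_sq J v" by (simp add: f_def S0)
  qed
qed

text \<open>The general matrix is reduced to its Gram matrix H, which is self-adjoint: pairing v
  with H v gives the squared norm of M v, and Cauchy-Schwarz applies to this pairing.\<close>

lemma L_bound_of_mat_bound:
  assumes J: "finite J" and r: "0 \<le> r" and M: "mat_bound I J M r"
  shows "L_bound I J M r"
  unfolding L_bound_def
proof
  fix v :: "'b \<Rightarrow> 'c"
  let ?H = "\<lambda>j l. \<Sum>i\<in>I. adj (M i j) * M i l"
  have H: "L_bound J J ?H (r\<^sup>2)"
    by (rule L_bound_selfadjoint[OF J r]) (simp_all add: adj_sum adj_mult mat_bound_gram[OF M r])
  let ?f = "col_sq I (\<lambda>i. \<Sum>j\<in>J. L (M i j) (v j))"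
  have "?f\<^sup>2 \<le> col_sq J v * col_sq J (\<lambda>j. \<Sum>l\<in>J. L (?H j l) (v l))"
    unfolding col_sq_def[of I] L_gram by (rule col_sq_cauchy_schwarz)
  also have "\<dots> \<le> col_sq J v * (r\<^sup>2 * col_sq J v)"
    using H by (intro mult_left_mono) (simp_all add: L_bound_def)
  also have "\<dots> = (r * col_sq J v)\<^sup>2" by (simp add: power2_eq_square)
  finally show "?f \<le> r * col_sq J v" by (rule power2_le_imp_le) (simp add: r)
qed

end


section \<open>Positive bimodule maps and the norm they induce\<close>

lemma conjugate_sum:
  fixes c :: "'a::cstar_alg"
  shows "adj c * (\<Sum>i\<in>I. adj (z i) * z i) * c = (\<Sum>i\<in>I. adj (z i * c) * (z i * c))"
  by (simp add: sum_distrib_left sum_distrib_right adj_mult mult.assoc)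

text \<open>The data of a Frobenius algebra, with \<eta> as the left action \<open>L\<close>, the
  right action \<open>R\<close> obtained from it by adjoints, and \<epsilon> as \<open>e\<close>.
  Complex linearity of \<epsilon> appears as \<open>e_imul\<close>.\<close>

locale positive_action = star_action L
  for L :: "'a::cstar_alg \<Rightarrow> 'c::cstar_alg \<Rightarrow> 'c" +
  fixes R :: "'c \<Rightarrow> 'a \<Rightarrow> 'c" and e :: "'c \<Rightarrow> 'a"
  assumes R_def: "R c a = adj (L (adj a) (adj c))"
    and e_add: "e (c + d) = e c + e d"
    and e_scaleR: "e (r *\<^sub>R c) = r *\<^sub>R e c"
    and e_imul: "e (imul c) = imul (e c)"
    and e_pos: "pos c \<Longrightarrow> pos (e c)"
    and e_L: "e (L a c) = a * e c"
    and e_R: "e (R c a) = e c * a"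
begin

lemma linear_e: "linear e"
  by (rule linearI) (simp_all add: e_add e_scaleR)

lemmas e_diff = linear_diff[OF linear_e]
  and e_neg = linear_neg[OF linear_e]
  and e_sum = linear_sum[OF linear_e]
  and e_0 [simp] = linear_0[OF linear_e]

lemma R_mult: "R c a * d = c * L a d"
  by (simp add: R_def L_adj)

lemma R_assoc: "R (c * d) a = c * R d a"
  by (simp add: R_def adj_mult L_assoc)

lemma adj_R: "adj (R c a) = L (adj a) (adj c)"
  by (simp add: R_def)

lemma e_gram: "e (adj (R x b) * R y a) = adj b * e (adj x * y) * a"
  by (simp only: adj_R L_assoc[symmetric] R_assoc[symmetric] e_L e_R mult.assoc)

text \<open>Polarisation: \<open>e (adj z * z)\<close> is self-adjoint for z = x + y and for z = x +
  \<open>imul y\<close>, and the two resulting relations add up to the claim.\<close>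

lemma e_adj: "adj (e (adj x * y)) = e (adj y * x)"
proof -
  have s: "adj (e (adj z * z)) = e (adj z * z)" for z
    by (intro pos_selfadjoint e_pos pos_adj_mult)
  have 1: "adj (e (adj x * y)) + adj (e (adj y * x)) = e (adj x * y) + e (adj y * x)" for x y
    using s[of "x + y"] s[of x] s[of y] by (simp add: adj_add distrib_left distrib_right e_add add_ac)
  have "imul (adj (e (adj y * x))) - imul (adj (e (adj x * y))) = imul (e (adj x * y)) - imul (e (adj y * x))"
    using 1[of x "imul y"]
    by (simp add: adj_imul imul_mult_left imul_mult_right e_imul e_neg adj_minus imul_diff)
  then have "imul (e (adj y * x) - e (adj x * y)) = imul (adj (e (adj x * y)) - adj (e (adj y * x)))"
    unfolding imul_diff by (metis minus_diff_eq)
  then have "imul (imul (e (adj y * x) - e (adj x * y)))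
      = imul (imul (adj (e (adj x * y)) - adj (e (adj y * x))))" by simp
  then have 2: "e (adj y * x) - e (adj x * y) = adj (e (adj x * y)) - adj (e (adj y * x))"
    by (simp only: imul_imul neg_equal_iff_equal)
  have "2 *\<^sub>R adj (e (adj x * y)) = (adj (e (adj x * y)) + adj (e (adj y * x)))
      + (adj (e (adj x * y)) - adj (e (adj y * x)))" by (simp add: scaleR_2)
  also have "\<dots> = (e (adj x * y) + e (adj y * x)) + (e (adj y * x) - e (adj x * y))"
    by (simp only: 1[of x y] 2)
  also have "\<dots> = 2 *\<^sub>R e (adj y * x)" by (simp add: scaleR_2)
  finally have "2 *\<^sub>R adj (e (adj x * y)) = 2 *\<^sub>R e (adj y * x)" .
  then show ?thesis by simp
qed

text \<open>\<open>pos_cauchy_schwarz\<close> for the semi-inner product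
  \<open>e (adj x * y)\<close> summed over columns; the vector x a - y is formed with the right
  action \<open>R\<close>, which e turns into multiplication by a.\<close>

lemma e_cauchy_schwarz:
  "(norm (\<Sum>i\<in>I. e (adj (x i) * y i)))\<^sup>2
    \<le> norm (\<Sum>i\<in>I. e (adj (x i) * x i)) * norm (\<Sum>i\<in>I. e (adj (y i) * y i))"
proof (rule pos_cauchy_schwarz)
  show "pos (\<Sum>i\<in>I. e (adj (x i) * x i))" by (intro pos_sum e_pos pos_adj_mult)
  fix a
  have "e (adj (R (x i) a - y i) * (R (x i) a - y i))
      = adj a * e (adj (x i) * x i) * a - adj a * e (adj (x i) * y i) - adj (e (adj (x i) * y i)) * a
        + e (adj (y i) * y i)" for i
    by (simp add: adj_diff left_diff_distrib right_diff_distrib e_diff e_gram e_adj R_assoc[symmetric] e_R)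
      (simp add: adj_R L_assoc[symmetric] e_L)
  then have "adj a * (\<Sum>i\<in>I. e (adj (x i) * x i)) * a - adj a * (\<Sum>i\<in>I. e (adj (x i) * y i))
      - adj (\<Sum>i\<in>I. e (adj (x i) * y i)) * a + (\<Sum>i\<in>I. e (adj (y i) * y i))
      = (\<Sum>i\<in>I. e (adj (R (x i) a - y i) * (R (x i) a - y i)))"
    by (simp add: sum_distrib_left sum_distrib_right adj_sum sum.distrib sum_subtractf)
  then show "pos (adj a * (\<Sum>i\<in>I. e (adj (x i) * x i)) * a - adj a * (\<Sum>i\<in>I. e (adj (x i) * y i))
      - adj (\<Sum>i\<in>I. e (adj (x i) * y i)) * a + (\<Sum>i\<in>I. e (adj (y i) * y i)))"
    by (simp add: pos_sum e_pos)
qed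

text \<open>For an unbounded map, a suitable infinite sum of positive elements would have an image of
  infinite norm.\<close>

lemma e_bounded:
  obtains \<kappa> where "0 \<le> \<kappa>" "\<And>h. pos h \<Longrightarrow> norm (e h) \<le> \<kappa> * norm h"
proof (rule ccontr)
  assume unb: "\<not> thesis"
  have ex: "\<exists>h. pos h \<and> 4 ^ n * norm h < norm (e h)" for n :: nat
  proof (rule ccontr)
    assume "\<not> (\<exists>h. pos h \<and> 4 ^ n * norm h < norm (e h))"
    then have "norm (e h) \<le> 4 ^ n * norm h" if "pos h" for h using that by force
    then show False using unb that[of "4 ^ n"] by simp
  qed
  have "\<exists>h. pos h \<and> norm h \<le> 1 \<and> 4 ^ n < norm (e h)" for n :: nat
  proof -
    obtain h where h: "pos h" "4 ^ n * norm h < norm (e h)" using ex[of n] by blast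
    then have nz: "norm h > 0" by (metis e_0 less_irrefl mult_zero_right norm_zero zero_less_norm_iff)
    show ?thesis
      using h nz by (intro exI[of _ "(1 / norm h) *\<^sub>R h"])
        (simp add: pos_scale e_scaleR less_divide_eq)
  qed
  from choice[OF allI[OF this]] obtain h
    where "\<forall>n. pos (h n) \<and> norm (h n) \<le> 1 \<and> 4 ^ n < norm (e (h n))" by (rule exE)
  then have h: "pos (h n)" "norm (h n) \<le> 1" "4 ^ n < norm (e (h n))" for n by simp_all
  \<comment> \<open>The weights 2^(-n) make the sum converge while \<open>e (g n)\<close> still has
    norm above 2^n, thanks to the factor 4^n.\<close>
  define g where "g n = (1/2) ^ n *\<^sub>R h n" for n :: nat
  have pg: "pos (g n)" for n unfolding g_def by (intro pos_scale h) simp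
  have le: "norm (norm (g n)) \<le> (1/2) ^ n" for n
  proof -
    have "norm (norm (g n)) = (1/2) ^ n * norm (h n)" by (simp add: g_def)
    also have "\<dots> \<le> (1/2) ^ n * 1" by (rule mult_left_mono[OF h(2)]) simp
    finally show ?thesis by simp
  qed
  have sg: "summable (\<lambda>n. (1/2::real) ^ n)" by (rule summable_geometric) simp
  have "summable (\<lambda>n. norm (g n))"
    by (rule summable_comparison_test'[OF sg, of 0 "\<lambda>n. norm (g n)"]) (rule le)
  then have "summable g" by (rule summable_norm_cancel)
  then have lim: "(\<lambda>n. \<Sum>i<n. g i) \<longlonglongrightarrow> suminf g" by (rule summable_LIMSEQ)
  have "2 ^ n < norm (e (suminf g))" for n
  proof -
    have "(\<lambda>m. (\<Sum>i<m + Suc n. g i) - g n) \<longlonglongrightarrow> suminf g - g n"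
      by (rule tendsto_diff[OF LIMSEQ_ignore_initial_segment[OF lim] tendsto_const])
    moreover have "pos ((\<Sum>i<m + Suc n. g i) - g n)" for m
    proof -
      have "(\<Sum>i<m + Suc n. g i) - g n = (\<Sum>i\<in>{..<m + Suc n} - {n}. g i)"
        by (simp add: sum_diff1)
      then show ?thesis by (simp add: pos_sum pg)
    qed
    ultimately have "pos (suminf g - g n)" by (rule pos_limit[rotated])
    then have "pos (e (suminf g) - e (g n))" by (simp add: e_pos flip: e_diff)
    then have "norm (e (g n)) \<le> norm (e (suminf g))" by (intro pos_norm_mono e_pos pg)
    moreover have "norm (e (g n)) = (1/2) ^ n * norm (e (h n))" by (simp add: g_def e_scaleR)
    moreover have "(1/2) ^ n * 4 ^ n < (1/2) ^ n * norm (e (h n))" using h(3)[of n] by simp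
    moreover have "(1/2) ^ n * 4 ^ n = (2::real) ^ n" by (simp flip: power_mult_distrib)
    ultimately show ?thesis by simp
  qed
  moreover obtain n where "norm (e (suminf g)) < 2 ^ n" using real_arch_pow[of 2] by auto
  ultimately show False by (metis less_asym)
qed

text \<open>The Gram matrix of the columns of \<open>M\<close> under \<epsilon>; its norm is the
  square of the norm of \<open>M\<close> as a matrix over \<open>E\<close>.\<close>

definition gram :: "'i set \<Rightarrow> ('i \<Rightarrow> 'j \<Rightarrow> 'c) \<Rightarrow> 'j \<Rightarrow> 'j \<Rightarrow> 'a"
  where "gram I M j l = (\<Sum>i\<in>I. e (adj (M i j) * M i l))"

lemma gram_form:
  "(\<Sum>j\<in>J. adj (b j) * (\<Sum>l\<in>J. gram I M j l * a l))
    = (\<Sum>i\<in>I. e (adj (\<Sum>j\<in>J. R (M i j) (b j)) * (\<Sum>l\<in>J. R (M i l) (a l))))"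
proof -
  have "(\<Sum>j\<in>J. adj (b j) * (\<Sum>l\<in>J. gram I M j l * a l))
      = (\<Sum>j\<in>J. \<Sum>l\<in>J. \<Sum>i\<in>I. adj (b j) * e (adj (M i j) * M i l) * a l)"
    by (simp only: gram_def sum_distrib_left sum_distrib_right mult.assoc)
  also have "\<dots> = (\<Sum>i\<in>I. \<Sum>j\<in>J. \<Sum>l\<in>J. adj (b j) * e (adj (M i j) * M i l) * a l)"
    by (rule sum_rotate)
  also have "\<dots> = (\<Sum>i\<in>I. e (adj (\<Sum>j\<in>J. R (M i j) (b j)) * (\<Sum>l\<in>J. R (M i l) (a l))))"
    by (simp only: adj_sum sum_product e_sum e_gram)
  finally show ?thesis .
qed

text \<open>Multiplying by c turns the right action into a left one,
  \<open>R (M i j) (a j) * c = M i j * L (a j) c\<close>, so the bound on \<open>M\<close> applies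
  to the column of the \<open>L (a j) c\<close>, which \<open>col_sq_L\<close> controls.\<close>

lemma mat_bound_R:
  assumes M: "mat_bound I J M t" and t: "0 \<le> t"
  shows "col_sq I (\<lambda>i. \<Sum>j\<in>J. R (M i j) (a j)) \<le> t * col_sq J a"
  unfolding col_sq_def[of I]
proof (rule norm_le_by_conjugates)
  let ?z = "\<lambda>i. \<Sum>j\<in>J. R (M i j) (a j)"
  show "adj (\<Sum>i\<in>I. adj (?z i) * ?z i) = (\<Sum>i\<in>I. adj (?z i) * ?z i)"
    by (rule pos_selfadjoint[OF pos_col_sq])
  show "0 \<le> t * col_sq J a" using t by simp
  fix c
  have "adj c * (\<Sum>i\<in>I. adj (?z i) * ?z i) * c = (\<Sum>i\<in>I. adj (?z i * c) * (?z i * c))"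
    by (rule conjugate_sum)
  then have "norm (adj c * (\<Sum>i\<in>I. adj (?z i) * ?z i) * c) = col_sq I (\<lambda>i. \<Sum>j\<in>J. M i j * L (a j) c)"
    by (simp only: col_sq_def sum_distrib_right R_mult)
  also have "\<dots> \<le> t * col_sq J (\<lambda>j. L (a j) c)" using M by (simp add: mat_bound_def)
  also have "\<dots> \<le> t * (col_sq J a * (norm c)\<^sup>2)" by (intro mult_left_mono col_sq_L t)
  finally show "norm (adj c * (\<Sum>i\<in>I. adj (?z i) * ?z i) * c) \<le> t * col_sq J a * (norm c)\<^sup>2"
    by (simp only: mult.assoc)
qed

text \<open>With b = G a for the Gram matrix G, the squared norm of b is at most that of an
  \<epsilon>-inner product of M b and M a. Both factors of Cauchy-Schwarz are bounded through
  \<kappa> and the bound on \<open>M\<close>, and one norm of b cancels. The constants do not see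
  the index sets, which is the point of complete boundedness.\<close>

lemma gram_bound:
  assumes \<kappa>: "0 \<le> \<kappa>" "\<And>h. pos h \<Longrightarrow> norm (e h) \<le> \<kappa> * norm h"
    and M: "mat_bound I J M t" and t: "0 \<le> t"
  shows "mat_bound J J (gram I M) ((\<kappa> * t)\<^sup>2)"
  unfolding mat_bound_def
proof
  fix a :: "'d \<Rightarrow> 'a"
  define b where "b j = (\<Sum>l\<in>J. gram I M j l * a l)" for j
  let ?z = "\<lambda>a i. \<Sum>j\<in>J. R (M i j) (a j)"
  have ez: "norm (\<Sum>i\<in>I. e (adj (?z a i) * ?z a i)) \<le> \<kappa> * (t * col_sq J a)" for a
  proof -
    have "norm (\<Sum>i\<in>I. e (adj (?z a i) * ?z a i)) \<le> \<kappa> * col_sq I (?z a)"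
      unfolding e_sum[symmetric] col_sq_def by (rule \<kappa>(2)) (rule pos_col_sq)
    then show ?thesis using mat_bound_R[OF M t, of a] \<kappa>(1) by (meson mult_left_mono order_trans)
  qed
  have "(col_sq J b)\<^sup>2 = (norm (\<Sum>i\<in>I. e (adj (?z b i) * ?z a i)))\<^sup>2"
    unfolding gram_form[symmetric] b_def[symmetric] col_sq_def ..
  also have "\<dots> \<le> norm (\<Sum>i\<in>I. e (adj (?z b i) * ?z b i)) * norm (\<Sum>i\<in>I. e (adj (?z a i) * ?z a i))"
    by (rule e_cauchy_schwarz)
  also have "\<dots> \<le> (\<kappa> * (t * col_sq J b)) * (\<kappa> * (t * col_sq J a))"
    by (intro mult_mono ez) (use \<kappa>(1) t in auto)
  finally have "(col_sq J b)\<^sup>2 \<le> ((\<kappa> * t)\<^sup>2 * col_sq J a) * col_sq J b"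
    by (simp add: power2_eq_square ac_simps)
  then show "col_sq J b \<le> (\<kappa> * t)\<^sup>2 * col_sq J a" by (rule square_le_cancel) simp_all
qed

text \<open>The coefficients e(y_k M_ij) form a matrix Z over the first algebra with rows (k, i).
  Its bound there is \<kappa> Y s, by pairing Z a with itself under e;
  \<open>L_bound_of_mat_bound\<close> carries the bound over to the action, and the row x costs its
  own squared norm. The number s bounds the norm of the Gram matrix, i.e. the squared norm of
  \<open>M\<close> over \<open>E\<close>, and so enters linearly.\<close>

lemma approximant_bound:
  fixes M :: "'i \<Rightarrow> 'j \<Rightarrow> 'c"
  assumes \<kappa>: "0 \<le> \<kappa>" "\<And>h. pos h \<Longrightarrow> norm (e h) \<le> \<kappa> * norm h"
    and J: "finite J" and s: "0 \<le> s" and G: "mat_bound J J (gram I M) (s\<^sup>2)"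
  shows "col_sq I (\<lambda>i. \<Sum>k\<in>P. x k * (\<Sum>j\<in>J. L (e (y k * M i j)) (v j)))
    \<le> norm (\<Sum>k\<in>P. x k * adj (x k)) * (\<kappa> * norm (\<Sum>k\<in>P. adj (y k) * y k) * s * col_sq J v)"
proof -
  define Y where "Y = norm (\<Sum>k\<in>P. adj (y k) * y k)"
  have Y: "0 \<le> Y" by (simp add: Y_def)
  define Z where "Z p j = e (y (fst p) * M (snd p) j)" for p j
  have "mat_bound (P \<times> I) J Z (\<kappa> * Y * s)"
    unfolding mat_bound_def
  proof
    fix a :: "'j \<Rightarrow> 'a"
    define z where "z i = (\<Sum>j\<in>J. R (M i j) (a j))" for i
    define \<beta> where "\<beta> p = e (y (fst p) * z (snd p))" for p
    have Z\<beta>: "(\<Sum>j\<in>J. Z p j * a j) = \<beta> p" for p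
      by (simp add: Z_def \<beta>_def z_def sum_distrib_left e_sum e_R flip: R_assoc)
    define g where "g i = (\<Sum>k\<in>P. R (adj (y k)) (\<beta> (k, i)))" for i
    \<comment> \<open>Moving \<beta> and y_k to the other side of the inner product turns the sum
      over (k, i) into a sum over i alone, to which \<open>e_cauchy_schwarz\<close> applies.\<close>
    have eq: "(\<Sum>p\<in>P \<times> I. adj (\<beta> p) * \<beta> p) = (\<Sum>i\<in>I. e (adj (g i) * z i))"
    proof -
      have "adj (\<beta> p) * \<beta> p = e (adj (R (adj (y (fst p))) (\<beta> p)) * z (snd p))" for p
        by (simp add: adj_R e_L L_assoc[symmetric]) (simp add: \<beta>_def)
      then have "(\<Sum>p\<in>P \<times> I. adj (\<beta> p) * \<beta> p) = (\<Sum>k\<in>P. \<Sum>i\<in>I. e (adj (R (adj (y k)) (\<beta> (k, i))) * z i))"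
        by (simp add: sum.cartesian_product split_def)
      also have "\<dots> = (\<Sum>i\<in>I. \<Sum>k\<in>P. e (adj (R (adj (y k)) (\<beta> (k, i))) * z i))" by (rule sum.swap)
      also have "\<dots> = (\<Sum>i\<in>I. e (adj (g i) * z i))"
        by (simp add: g_def adj_sum sum_distrib_right e_sum)
      finally show ?thesis .
    qed
    have cg: "col_sq I g \<le> Y * col_sq (P \<times> I) \<beta>"
      unfolding col_sq_def[of I]
    proof (rule norm_le_by_conjugates)
      show "adj (\<Sum>i\<in>I. adj (g i) * g i) = (\<Sum>i\<in>I. adj (g i) * g i)"
        by (rule pos_selfadjoint[OF pos_col_sq])
      show "0 \<le> Y * col_sq (P \<times> I) \<beta>" using Y by simp
      fix c
      have "adj c * (\<Sum>i\<in>I. adj (g i) * g i) * c = (\<Sum>i\<in>I. adj (g i * c) * (g i * c))"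
        by (rule conjugate_sum)
      then have "norm (adj c * (\<Sum>i\<in>I. adj (g i) * g i) * c)
          = col_sq I (\<lambda>i. \<Sum>k\<in>P. adj (y k) * L (\<beta> (k, i)) c)"
        by (simp only: col_sq_def g_def sum_distrib_right R_mult)
      also have "\<dots> \<le> norm (\<Sum>k\<in>P. adj (y k) * adj (adj (y k))) * col_sq (P \<times> I) (\<lambda>(k, i). L (\<beta> (k, i)) c)"
        by (rule row_times_columns)
      also have "\<dots> \<le> Y * (col_sq (P \<times> I) \<beta> * (norm c)\<^sup>2)"
        using col_sq_L[of "P \<times> I" \<beta> c] by (simp add: Y_def split_def mult_left_mono)
      finally show "norm (adj c * (\<Sum>i\<in>I. adj (g i) * g i) * c) \<le> Y * col_sq (P \<times> I) \<beta> * (norm c)\<^sup>2"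
        by (simp only: mult.assoc)
    qed
    have "(norm (\<Sum>i\<in>I. e (adj (z i) * z i)))\<^sup>2 \<le> col_sq J a * col_sq J (\<lambda>j. \<Sum>l\<in>J. gram I M j l * a l)"
      unfolding z_def gram_form[symmetric] by (rule col_sq_cauchy_schwarz)
    also have "\<dots> \<le> col_sq J a * (s\<^sup>2 * col_sq J a)"
      using G by (intro mult_left_mono) (simp_all add: mat_bound_def)
    also have "\<dots> = (s * col_sq J a)\<^sup>2" by (simp add: power2_eq_square)
    finally have ez: "norm (\<Sum>i\<in>I. e (adj (z i) * z i)) \<le> s * col_sq J a"
      by (rule power2_le_imp_le) (simp add: s)
    have "(col_sq (P \<times> I) \<beta>)\<^sup>2 \<le> norm (\<Sum>i\<in>I. e (adj (g i) * g i)) * norm (\<Sum>i\<in>I. e (adj (z i) * z i))"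
      unfolding col_sq_def eq by (rule e_cauchy_schwarz)
    also have "\<dots> \<le> (\<kappa> * (Y * col_sq (P \<times> I) \<beta>)) * (s * col_sq J a)"
    proof (intro mult_mono ez)
      have "norm (\<Sum>i\<in>I. e (adj (g i) * g i)) \<le> \<kappa> * col_sq I g"
        unfolding e_sum[symmetric] col_sq_def by (rule \<kappa>(2)) (rule pos_col_sq)
      then show "norm (\<Sum>i\<in>I. e (adj (g i) * g i)) \<le> \<kappa> * (Y * col_sq (P \<times> I) \<beta>)"
        using cg \<kappa>(1) by (meson mult_left_mono order_trans)
    qed (use \<kappa>(1) Y in auto)
    finally have "(col_sq (P \<times> I) \<beta>)\<^sup>2 \<le> (\<kappa> * Y * s * col_sq J a) * col_sq (P \<times> I) \<beta>"
      by (simp add: ac_simps)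
    then show "col_sq (P \<times> I) (\<lambda>p. \<Sum>j\<in>J. Z p j * a j) \<le> \<kappa> * Y * s * col_sq J a"
      unfolding Z\<beta> by (rule square_le_cancel) (use \<kappa>(1) Y s in auto)
  qed
  then have "L_bound (P \<times> I) J Z (\<kappa> * Y * s)"
    by (rule L_bound_of_mat_bound[OF J, rotated]) (use \<kappa>(1) Y s in auto)
  then have Lb: "col_sq (P \<times> I) (\<lambda>p. \<Sum>j\<in>J. L (Z p j) (v j)) \<le> \<kappa> * Y * s * col_sq J v"
    by (simp add: L_bound_def)
  have "col_sq I (\<lambda>i. \<Sum>k\<in>P. x k * (\<Sum>j\<in>J. L (e (y k * M i j)) (v j)))
      \<le> norm (\<Sum>k\<in>P. x k * adj (x k)) * col_sq (P \<times> I) (\<lambda>p. \<Sum>j\<in>J. L (Z p j) (v j))"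
    using row_times_columns[of I x "\<lambda>k i. \<Sum>j\<in>J. L (e (y k * M i j)) (v j)" P]
    by (simp add: Z_def split_def)
  also have "\<dots> \<le> norm (\<Sum>k\<in>P. x k * adj (x k)) * (\<kappa> * Y * s * col_sq J v)"
    by (intro mult_left_mono Lb) simp
  finally show ?thesis by (simp add: Y_def)
qed

text \<open>What the estimates retain of the bounded approximate identity: finitely many products c
  v are reproduced by sums of x_k e(y_k c) v, and K bounds the squared row norm of x times the
  squared column norm of y. \<open>S\<close> is later the embedded carrier, while v ranges over the
  whole type.\<close>

definition approximate_unit :: "'c set \<Rightarrow> real \<Rightarrow> bool"
  where "approximate_unit S K \<longleftrightarrow> 0 \<le> K \<and> (\<forall>Q \<delta>. finite Q \<longrightarrow> fst ` Q \<subseteq> S \<longrightarrow> 0 < \<delta> \<longrightarrow>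
    (\<exists>(P :: nat set) x y. norm (\<Sum>k\<in>P. x k * adj (x k)) * norm (\<Sum>k\<in>P. adj (y k) * y k) \<le> K \<and>
      (\<forall>(c, v)\<in>Q. norm ((\<Sum>k\<in>P. x k * L (e (y k * c)) v) - c * v) \<le> \<delta>)))"

text \<open>Each approximant satisfies \<open>approximant_bound\<close> with a constant free of n
  and converges to M v in every coordinate, so the bound survives the limit. This is the estimate
  behind the inverse of \<phi>, again independent of the index sets.\<close>

theorem bound_of_gram_bound:
  fixes M :: "'i \<Rightarrow> 'j \<Rightarrow> 'c"
  assumes \<kappa>: "0 \<le> \<kappa>" "\<And>h. pos h \<Longrightarrow> norm (e h) \<le> \<kappa> * norm h"
    and K: "approximate_unit S K" and M: "\<And>i j. i \<in> I \<Longrightarrow> j \<in> J \<Longrightarrow> M i j \<in> S"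
    and IJ: "finite I" "finite J" and s: "0 \<le> s" and G: "mat_bound J J (gram I M) (s\<^sup>2)"
  shows "mat_bound I J M (K * \<kappa> * s)"
  unfolding mat_bound_def
proof
  fix v :: "'j \<Rightarrow> 'c"
  \<comment> \<open>Only finitely many pairs of an entry and a coordinate occur in M v, so one
    choice of x and y serves them all.\<close>
  define Q where "Q = (\<lambda>(i, j). (M i j, v j)) ` (I \<times> J)"
  have Q: "finite Q" "fst ` Q \<subseteq> S" unfolding Q_def using IJ M by auto
  define A where "A n P x y \<longleftrightarrow> norm (\<Sum>k\<in>P. x k * adj (x k)) * norm (\<Sum>k\<in>P. adj (y k) * y k) \<le> K \<and>
      (\<forall>(c, v)\<in>Q. norm ((\<Sum>k\<in>P. x k * L (e (y k * c)) v) - c * v) \<le> 1 / (real n + 1))"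
    for n :: nat and P :: "nat set" and x y
  have "\<exists>P x y. A n P x y" for n
    using K Q unfolding approximate_unit_def A_def by simp
  then obtain P x y where A: "\<And>n. A n (P n) (x n) (y n)" by metis
  define b where "b n i = (\<Sum>k\<in>P n. x n k * (\<Sum>j\<in>J. L (e (y n k * M i j)) (v j)))" for n i
  have b_alt: "b n i = (\<Sum>j\<in>J. \<Sum>k\<in>P n. x n k * L (e (y n k * M i j)) (v j))" for n i
    unfolding b_def sum_distrib_left by (rule sum.swap)
  have lim0: "(\<lambda>n. 1 / (real n + 1)) \<longlonglongrightarrow> 0"
    using LIMSEQ_inverse_real_of_nat by (simp add: inverse_eq_divide add.commute)
  have lim: "(\<lambda>n. b n i) \<longlonglongrightarrow> (\<Sum>j\<in>J. M i j * v j)" if i: "i \<in> I" for i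
    unfolding b_alt
  proof (rule tendsto_sum)
    fix j assume j: "j \<in> J"
    have "(M i j, v j) \<in> Q" unfolding Q_def using i j by force
    then have "norm ((\<Sum>k\<in>P n. x n k * L (e (y n k * M i j)) (v j)) - M i j * v j) \<le> 1 / (real n + 1)" for n
      using A[of n] unfolding A_def by blast
    then have "(\<lambda>n. (\<Sum>k\<in>P n. x n k * L (e (y n k * M i j)) (v j)) - M i j * v j) \<longlonglongrightarrow> 0"
      by (intro Lim_null_comparison[OF _ lim0] always_eventually) simp
    then show "(\<lambda>n. \<Sum>k\<in>P n. x n k * L (e (y n k * M i j)) (v j)) \<longlonglongrightarrow> M i j * v j"
      by (rule LIM_zero_cancel)
  qed
  have "col_sq I (b n) \<le> K * \<kappa> * s * col_sq J v" for n
  proof -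
    have "col_sq I (b n) \<le> norm (\<Sum>k\<in>P n. x n k * adj (x n k)) *
        (\<kappa> * norm (\<Sum>k\<in>P n. adj (y n k) * y n k) * s * col_sq J v)"
      unfolding b_def by (rule approximant_bound[OF \<kappa> IJ(2) s G])
    also have "\<dots> = (norm (\<Sum>k\<in>P n. x n k * adj (x n k)) * norm (\<Sum>k\<in>P n. adj (y n k) * y n k)) * (\<kappa> * s * col_sq J v)"
      by (simp only: ac_simps)
    also have "\<dots> \<le> K * (\<kappa> * s * col_sq J v)"
      using A[of n] \<kappa>(1) s by (intro mult_right_mono) (simp_all add: A_def)
    finally show ?thesis by (simp only: mult.assoc)
  qed
  moreover have "(\<lambda>n. col_sq I (b n)) \<longlonglongrightarrow> col_sq I (\<lambda>i. \<Sum>j\<in>J. M i j * v j)"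
    unfolding col_sq_def by (intro tendsto_intros lim)
  ultimately show "col_sq I (\<lambda>i. \<Sum>j\<in>J. M i j * v j) \<le> K * \<kappa> * s * col_sq J v"
    by (meson LIMSEQ_le_const2)
qed

end


section \<open>Normed spaces and C*-algebras on carriers\<close>

lemma carrier_complex_ring [simp]: "carrier complex_ring = UNIV"
  and complex_ring_simps [simp]: "\<one>\<^bsub>complex_ring\<^esub> = 1" "\<zero>\<^bsub>complex_ring\<^esub> = 0"
    "a \<oplus>\<^bsub>complex_ring\<^esub> b = a + b" "a \<otimes>\<^bsub>complex_ring\<^esub> b = a * b"
  by (simp_all add: complex_ring_def)

lemma cring_complex_ring: "cring complex_ring"
proof (intro cringI abelian_groupI comm_monoidI)
  show "\<exists>y\<in>carrier complex_ring. y \<oplus>\<^bsub>complex_ring\<^esub> x = \<zero>\<^bsub>complex_ring\<^esub>" for x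
    by (rule bexI[of _ "- x"]) simp_all
qed (simp_all add: algebra_simps)

lemma uminus_complex_ring [simp]: "\<ominus>\<^bsub>complex_ring\<^esub> c = - c"
proof -
  interpret cring complex_ring by (rule cring_complex_ring)
  have "\<ominus>\<^bsub>complex_ring\<^esub> c \<oplus>\<^bsub>complex_ring\<^esub> c = \<zero>\<^bsub>complex_ring\<^esub>" by (rule l_neg) simp
  then show ?thesis by (simp add: add_eq_0_iff2)
qed

text \<open>The seminorm is a parameter rather than the field \<open>nrm\<close>, so that the norm
  \<open>hnorm\<close> of a Hilbert module is covered as well.\<close>

locale seminormed_module = Module.module complex_ring V
  for V :: "(complex, 'v, 'm) module_scheme" (structure) +
  fixes n :: "'v \<Rightarrow> real"
  assumes n_nonneg: "x \<in> carrier V \<Longrightarrow> 0 \<le> n x"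
    and n_triangle: "\<lbrakk>x \<in> carrier V; y \<in> carrier V\<rbrakk> \<Longrightarrow> n (x \<oplus> y) \<le> n x + n y"
    and n_smult: "x \<in> carrier V \<Longrightarrow> n (c \<odot> x) = cmod c * n x"
begin

lemma smult_closed' [simp, intro]: "x \<in> carrier V \<Longrightarrow> c \<odot> x \<in> carrier V"
  by (rule smult_closed) simp_all

lemma smult_zero_left [simp]: "x \<in> carrier V \<Longrightarrow> 0 \<odot> x = \<zero>"
  using smult_l_null[of x] by simp

lemma minus_eq_smult: "x \<in> carrier V \<Longrightarrow> \<ominus> x = (- 1) \<odot> x"
  using smult_l_minus[of 1 x] smult_one[of x] by simp

lemma n_zero [simp]: "n \<zero> = 0"
  using n_smult[of \<zero> 0] smult_l_null[of \<zero>] by simp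

lemma n_uminus: "x \<in> carrier V \<Longrightarrow> n (\<ominus> x) = n x"
  by (simp add: minus_eq_smult n_smult)

lemma n_minus_commute: "\<lbrakk>x \<in> carrier V; y \<in> carrier V\<rbrakk> \<Longrightarrow> n (x \<ominus> y) = n (y \<ominus> x)"
proof -
  assume "x \<in> carrier V" "y \<in> carrier V"
  moreover from this have "\<ominus> (x \<ominus> y) = y \<ominus> x" by (simp add: a_minus_def minus_add a_comm)
  ultimately show ?thesis by (metis minus_closed n_uminus)
qed

lemma minus_chain: "\<lbrakk>x \<in> carrier V; y \<in> carrier V; z \<in> carrier V\<rbrakk> \<Longrightarrow> x \<ominus> z = (x \<ominus> y) \<oplus> (y \<ominus> z)"
  by (simp add: a_minus_def a_assoc r_neg1 r_neg2)

lemma n_minus_triangle: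
  "\<lbrakk>x \<in> carrier V; y \<in> carrier V; z \<in> carrier V\<rbrakk> \<Longrightarrow> n (x \<ominus> z) \<le> n (x \<ominus> y) + n (y \<ominus> z)"
  by (subst minus_chain[of x y z]) (simp_all add: n_triangle)

lemma minus_plus_cancel: "\<lbrakk>x \<in> carrier V; y \<in> carrier V\<rbrakk> \<Longrightarrow> (x \<ominus> y) \<oplus> y = x"
  by (simp add: a_minus_def a_assoc l_neg)

lemma n_diff_bound: "\<lbrakk>x \<in> carrier V; y \<in> carrier V\<rbrakk> \<Longrightarrow> \<bar>n x - n y\<bar> \<le> n (x \<ominus> y)"
  using n_triangle[of "x \<ominus> y" y] n_triangle[of "y \<ominus> x" x] n_minus_commute[of x y]
  by (simp add: minus_plus_cancel abs_le_iff)

lemma minus_eq_zero_iff: "\<lbrakk>x \<in> carrier V; y \<in> carrier V\<rbrakk> \<Longrightarrow> x \<ominus> y = \<zero> \<longleftrightarrow> x = y"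
proof
  assume xy: "x \<in> carrier V" "y \<in> carrier V" "x \<ominus> y = \<zero>"
  then show "x = y" using minus_plus_cancel[of x y] by (simp only: l_zero)
qed (simp add: a_minus_def r_neg)

lemma add_minus_add: "\<lbrakk>x \<in> carrier V; y \<in> carrier V; x' \<in> carrier V; y' \<in> carrier V\<rbrakk>
  \<Longrightarrow> (x \<oplus> y) \<ominus> (x' \<oplus> y') = (x \<ominus> x') \<oplus> (y \<ominus> y')"
  by (simp add: a_minus_def minus_add a_ac)

lemma smult_minus: "\<lbrakk>x \<in> carrier V; y \<in> carrier V\<rbrakk> \<Longrightarrow> c \<odot> (x \<ominus> y) = c \<odot> x \<ominus> c \<odot> y"
  by (simp add: a_minus_def smult_r_distr smult_r_minus)

end

locale normed_module = seminormed_module +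
  assumes n_definite: "\<lbrakk>x \<in> carrier V; n x = 0\<rbrakk> \<Longrightarrow> x = \<zero>"

sublocale normed_module \<subseteq> metric: Metric_space "carrier V" "norm_dist V n"
proof
  fix x y z
  show "0 \<le> norm_dist V n x y" by (simp add: norm_dist_def n_nonneg)
  show "norm_dist V n x y = norm_dist V n y x" by (simp add: norm_dist_def n_minus_commute)
  assume xy: "x \<in> carrier V" "y \<in> carrier V"
  show "norm_dist V n x y = 0 \<longleftrightarrow> x = y"
  proof
    assume "norm_dist V n x y = 0"
    then have "n (x \<ominus> y) = 0" using xy by (simp add: norm_dist_def)
    then have "x \<ominus> y = \<zero>" using xy by (intro n_definite) simp_all
    then show "x = y" using xy minus_eq_zero_iff by blast
  qed (use xy in \<open>simp add: norm_dist_def a_minus_def r_neg\<close>)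
  assume "z \<in> carrier V"
  then show "norm_dist V n x z \<le> norm_dist V n x y + norm_dist V n y z"
    using xy by (simp add: norm_dist_def n_minus_triangle)
qed

context normed_module
begin

lemma MCauchy_iff: "metric.MCauchy s \<longleftrightarrow>
  (\<forall>k. s k \<in> carrier V) \<and> (\<forall>\<epsilon>>0. \<exists>N. \<forall>i\<ge>N. \<forall>j\<ge>N. n (s i \<ominus> s j) < \<epsilon>)"
proof -
  have "(\<forall>k. s k \<in> carrier V) \<Longrightarrow> norm_dist V n (s i) (s j) = n (s i \<ominus> s j)" for i j
    by (simp add: norm_dist_def)
  then show ?thesis unfolding metric.MCauchy_def by (auto simp: image_subset_iff) 
qed

lemma limitin_iff: "limitin metric.mtopology s x sequentially \<longleftrightarrow>
  x \<in> carrier V \<and> (\<forall>\<epsilon>>0. \<exists>N. \<forall>k\<ge>N. s k \<in> carrier V \<and> n (s k \<ominus> x) < \<epsilon>)"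
proof -
  have "s k \<in> carrier V \<and> norm_dist V n (s k) x < \<epsilon> \<longleftrightarrow> s k \<in> carrier V \<and> n (s k \<ominus> x) < \<epsilon>"
    if "x \<in> carrier V" for k \<epsilon>
    using that by (auto simp: norm_dist_def)
  then show ?thesis unfolding metric.limitin_metric eventually_sequentially by auto
qed

lemma norm_complete_iff: "norm_complete V n \<longleftrightarrow> (\<forall>s. (\<forall>k::nat. s k \<in> carrier V) \<and>
    (\<forall>\<epsilon>>0. \<exists>N. \<forall>i\<ge>N. \<forall>j\<ge>N. n (s i \<ominus> s j) < \<epsilon>) \<longrightarrow>
  (\<exists>x\<in>carrier V. \<forall>\<epsilon>>0. \<exists>N. \<forall>k\<ge>N. n (s k \<ominus> x) < \<epsilon>))"
proof -
  have *: "(\<exists>x. limitin metric.mtopology s x sequentially) \<longleftrightarrow>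
      (\<exists>x\<in>carrier V. \<forall>\<epsilon>>0. \<exists>N. \<forall>k\<ge>N. n (s k \<ominus> x) < \<epsilon>)" if "\<forall>k. s k \<in> carrier V" for s
    using that by (simp add: limitin_iff Bex_def)
  show ?thesis
    unfolding norm_complete_def metric.mcomplete_def MCauchy_iff
    by (simp add: * cong: imp_cong)
qed

lemma closure_iff: "x \<in> metric.mtopology closure_of S \<longleftrightarrow>
  x \<in> carrier V \<and> (\<forall>\<epsilon>>0. \<exists>y\<in>S. y \<in> carrier V \<and> n (x \<ominus> y) < \<epsilon>)"
  unfolding metric.metric_closure_of by (auto simp: norm_dist_def)

end

sublocale banach_space \<subseteq> normed_module V "nrm V"
  by unfold_locales (simp_all add: nrm_nonneg nrm_triangle nrm_smult nrm_eq_0_iff)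

lemma (in banach_space) Cauchy_limit:
  assumes "\<And>k::nat. s k \<in> carrier V" "\<And>\<epsilon>. \<epsilon> > 0 \<Longrightarrow> \<exists>N. \<forall>i\<ge>N. \<forall>j\<ge>N. nrm V (s i \<ominus> s j) < \<epsilon>"
  shows "\<exists>x\<in>carrier V. \<forall>\<epsilon>>0. \<exists>N. \<forall>k\<ge>N. nrm V (s k \<ominus> x) < \<epsilon>"
  by (rule complete[unfolded norm_complete_iff, THEN spec, THEN mp]) (use assms in simp)

context cstar_algebra
begin

lemma star_closed [simp, intro]: "x \<in> carrier A \<Longrightarrow> star A x \<in> carrier A"
  and star_add: "\<lbrakk>x \<in> carrier A; y \<in> carrier A\<rbrakk> \<Longrightarrow> star A (x \<oplus> y) = star A x \<oplus> star A y"
  and star_smult: "x \<in> carrier A \<Longrightarrow> star A (c \<odot> x) = cnj c \<odot> star A x"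
  using star_conj_linear by (auto simp: conj_linear_map_def)

lemmas [simp, intro] = mult_closed

lemma star_zero [simp]: "star A \<zero> = \<zero>"
  using star_smult[of \<zero> 0] by simp

lemma mult_zero_left [simp]: "x \<in> carrier A \<Longrightarrow> \<zero> \<otimes> x = \<zero>"
  using smult_mult_left[of \<zero> x 0] by simp

lemma mult_zero_right [simp]: "x \<in> carrier A \<Longrightarrow> x \<otimes> \<zero> = \<zero>"
  using smult_mult_right[of x \<zero> 0] by simp

end

text \<open>The product of all C*-algebra structures on a type: a type-class C*-algebra in which every
  C*-algebra with elements in that type is a direct factor.\<close>

typedef 'a universal = "{f :: 'a cstar \<Rightarrow> 'a.
    (\<forall>A. if cstar_algebra A then f A \<in> carrier A else f A = undefined) \<and>
    (\<exists>K. \<forall>A. cstar_algebra A \<longrightarrow> nrm A (f A) \<le> K)}"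
  morphisms universal_rep Abs_universal
proof (rule exI[of _ "\<lambda>A. if cstar_algebra A then \<zero>\<^bsub>A\<^esub> else undefined"], clarsimp, intro conjI allI impI)
  fix A :: "'a cstar" assume "cstar_algebra A"
  then interpret cstar_algebra A .
  show "\<zero>\<^bsub>A\<^esub> \<in> carrier A" by simp
next
  have "nrm A \<zero>\<^bsub>A\<^esub> \<le> 0" if "cstar_algebra A" for A :: "'a cstar"
  proof -
    interpret cstar_algebra A by (rule that)
    show ?thesis by simp
  qed
  then show "\<exists>K. \<forall>A :: 'a cstar. cstar_algebra A \<longrightarrow> nrm A \<zero>\<^bsub>A\<^esub> \<le> K" by blast
qed

definition component :: "'a cstar \<Rightarrow> 'a universal \<Rightarrow> 'a"
  where "component A x = universal_rep x A"

definition make_universal :: "('a cstar \<Rightarrow> 'a) \<Rightarrow> 'a universal"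
  where "make_universal f = Abs_universal (\<lambda>A. if cstar_algebra A then f A else undefined)"

lemma component_closed [simp, intro]: "cstar_algebra A \<Longrightarrow> component A x \<in> carrier A"
  using universal_rep[of x] by (auto simp: component_def)

lemma component_make:
  assumes "cstar_algebra A" "\<And>A. cstar_algebra A \<Longrightarrow> f A \<in> carrier A"
    "\<And>A. cstar_algebra A \<Longrightarrow> nrm A (f A) \<le> K"
  shows "component A (make_universal f) = f A"
proof -
  have "\<exists>K. \<forall>A. cstar_algebra A \<longrightarrow> nrm A (f A) \<le> K" using assms(3) by blast
  then show ?thesis using assms(1,2)
    by (simp add: component_def make_universal_def Abs_universal_inverse)
qed

lemma universal_eqI: "(\<And>A. cstar_algebra A \<Longrightarrow> component A x = component A y) \<Longrightarrow> x = y"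
proof -
  assume *: "\<And>A. cstar_algebra A \<Longrightarrow> component A x = component A y"
  have "universal_rep x A = universal_rep y A" for A
    using universal_rep[of x] universal_rep[of y] *[of A]
    by (cases "cstar_algebra A") (auto simp: component_def split: if_splits)
  then show ?thesis by (simp add: universal_rep_inject[symmetric] fun_eq_iff)
qed

text \<open>Set to 0 on records that are not C*-algebras, so that the supremum may range over all
  records of the type.\<close>

definition component_norm :: "'a universal \<Rightarrow> 'a cstar \<Rightarrow> real"
  where "component_norm x A = (if cstar_algebra A then nrm A (component A x) else 0)"

lemma component_norm_bdd: "bdd_above (range (component_norm x))"
proof -
  obtain K where "\<forall>A. cstar_algebra A \<longrightarrow> nrm A (component A x) \<le> K"
    using universal_rep[of x] by (auto simp: component_def)
  then have "component_norm x A \<le> max K 0" for A by (simp add: component_norm_def le_max_iff_disj)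
  then show ?thesis by (intro bdd_aboveI) auto
qed

definition universal_norm :: "'a universal \<Rightarrow> real"
  where "universal_norm x = (SUP A. component_norm x A)"

lemma component_norm_le_universal: "component_norm x A \<le> universal_norm x"
  unfolding universal_norm_def by (rule cSUP_upper[OF UNIV_I component_norm_bdd])

lemma component_norm_le: "cstar_algebra A \<Longrightarrow> nrm A (component A x) \<le> universal_norm x"
  using component_norm_le_universal[of x A] by (simp add: component_norm_def)

lemma universal_norm_le:
  "0 \<le> K \<Longrightarrow> (\<And>A. cstar_algebra A \<Longrightarrow> nrm A (component A x) \<le> K) \<Longrightarrow> universal_norm x \<le> K"
  unfolding universal_norm_def by (rule cSUP_least) (simp_all add: component_norm_def)

lemma universal_norm_nonneg: "0 \<le> universal_norm x"
proof (rule order_trans[OF _ component_norm_le_universal])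
  show "0 \<le> component_norm x undefined"
    by (simp add: component_norm_def banach_space.nrm_nonneg cstar_algebra.axioms(1))
qed


lemma component_make_bounded:
  assumes "cstar_algebra A" "\<And>A. cstar_algebra A \<Longrightarrow> f A \<in> carrier A \<and> nrm A (f A) \<le> K"
  shows "component A (make_universal f) = f A"
  by (rule component_make[OF assms(1), where K=K]) (use assms(2) in auto)

instantiation universal :: (type) real_normed_algebra
begin

definition "0 = make_universal (\<lambda>A. \<zero>\<^bsub>A\<^esub>)"
definition "x + y = make_universal (\<lambda>A. component A x \<oplus>\<^bsub>A\<^esub> component A y)"
definition "- x = make_universal (\<lambda>A. \<ominus>\<^bsub>A\<^esub> component A x)"
definition "x - y = x + (- y :: 'a universal)"
definition "x * y = make_universal (\<lambda>A. component A x \<otimes>\<^bsub>A\<^esub> component A y)"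
definition "r *\<^sub>R x = make_universal (\<lambda>A. complex_of_real r \<odot>\<^bsub>A\<^esub> component A x)"
definition "norm x = universal_norm x"
definition dist_universal :: "'a universal \<Rightarrow> 'a universal \<Rightarrow> real"
  where "dist_universal x y = norm (x - y)"
definition sgn_universal :: "'a universal \<Rightarrow> 'a universal"
  where "sgn_universal x = scaleR (inverse (norm x)) x"
definition uniformity_universal :: "('a universal \<times> 'a universal) filter"
  where "uniformity_universal = (INF e\<in>{0 <..}. principal {(x, y). dist x y < e})"
definition open_universal :: "'a universal set \<Rightarrow> bool"
  where "open_universal U \<longleftrightarrow> (\<forall>x\<in>U. eventually (\<lambda>(x', y). x' = x \<longrightarrow> y \<in> U) uniformity)"

lemma component_0: "cstar_algebra A \<Longrightarrow> component A 0 = \<zero>\<^bsub>A\<^esub>"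
  unfolding zero_universal_def
proof (rule component_make_bounded[where K=0])
  fix A :: "'a cstar" assume "cstar_algebra A"
  then interpret cstar_algebra A .
  show "\<zero>\<^bsub>A\<^esub> \<in> carrier A \<and> nrm A \<zero>\<^bsub>A\<^esub> \<le> 0" by simp
qed

lemma component_add: "cstar_algebra A \<Longrightarrow> component A (x + y) = component A x \<oplus>\<^bsub>A\<^esub> component A y"
  unfolding plus_universal_def
proof (rule component_make_bounded[where K="universal_norm x + universal_norm y"])
  fix A :: "'a cstar" assume A: "cstar_algebra A"
  then interpret cstar_algebra A .
  show "component A x \<oplus>\<^bsub>A\<^esub> component A y \<in> carrier A \<and>
      nrm A (component A x \<oplus>\<^bsub>A\<^esub> component A y) \<le> universal_norm x + universal_norm y"
    using nrm_triangle[of "component A x" "component A y"] component_norm_le[OF A, of x]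
      component_norm_le[OF A, of y] A by simp
qed

lemma component_uminus: "cstar_algebra A \<Longrightarrow> component A (- x) = \<ominus>\<^bsub>A\<^esub> component A x"
  unfolding uminus_universal_def
proof (rule component_make_bounded[where K="universal_norm x"])
  fix A :: "'a cstar" assume A: "cstar_algebra A"
  then interpret cstar_algebra A .
  show "\<ominus>\<^bsub>A\<^esub> component A x \<in> carrier A \<and> nrm A (\<ominus>\<^bsub>A\<^esub> component A x) \<le> universal_norm x"
    using component_norm_le[OF A, of x] A by (simp add: n_uminus)
qed

lemma component_mult: "cstar_algebra A \<Longrightarrow> component A (x * y) = component A x \<otimes>\<^bsub>A\<^esub> component A y"
  unfolding times_universal_def
proof (rule component_make_bounded[where K="universal_norm x * universal_norm y"])
  fix A :: "'a cstar" assume A: "cstar_algebra A"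
  then interpret cstar_algebra A .
  have "nrm A (component A x \<otimes>\<^bsub>A\<^esub> component A y) \<le> nrm A (component A x) * nrm A (component A y)"
    using A by (simp add: nrm_mult)
  also have "\<dots> \<le> universal_norm x * universal_norm y"
    using A by (intro mult_mono component_norm_le nrm_nonneg universal_norm_nonneg) simp_all
  finally show "component A x \<otimes>\<^bsub>A\<^esub> component A y \<in> carrier A \<and>
      nrm A (component A x \<otimes>\<^bsub>A\<^esub> component A y) \<le> universal_norm x * universal_norm y"
    using A by simp
qed

lemma component_scaleR: "cstar_algebra A \<Longrightarrow> component A (r *\<^sub>R x) = complex_of_real r \<odot>\<^bsub>A\<^esub> component A x"
  unfolding scaleR_universal_def
proof (rule component_make_bounded[where K="\<bar>r\<bar> * universal_norm x"])
  fix A :: "'a cstar" assume A: "cstar_algebra A"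
  then interpret cstar_algebra A .
  show "complex_of_real r \<odot>\<^bsub>A\<^esub> component A x \<in> carrier A \<and>
      nrm A (complex_of_real r \<odot>\<^bsub>A\<^esub> component A x) \<le> \<bar>r\<bar> * universal_norm x"
    using component_norm_le[OF A, of x] A by (simp add: nrm_smult mult_left_mono)
qed

lemmas component_simps = component_0 component_add component_uminus component_mult component_scaleR

lemma norm_component_le: "cstar_algebra A \<Longrightarrow> nrm A (component A x) \<le> norm x"
  unfolding norm_universal_def by (rule component_norm_le)

lemma norm_universal_leI:
  "0 \<le> K \<Longrightarrow> (\<And>A. cstar_algebra A \<Longrightarrow> nrm A (component A x) \<le> K) \<Longrightarrow> norm x \<le> K"
  unfolding norm_universal_def by (rule universal_norm_le)

lemma norm_universal_nonneg: "0 \<le> norm (x :: 'a universal)"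
  unfolding norm_universal_def by (rule universal_norm_nonneg)

lemma norm_universal_scaleR_le: "norm (r *\<^sub>R x) \<le> \<bar>r\<bar> * norm (x :: 'a universal)"
proof (rule norm_universal_leI)
  show "0 \<le> \<bar>r\<bar> * norm x" by (simp add: norm_universal_nonneg)
  fix A :: "'a cstar" assume A: "cstar_algebra A"
  then interpret cstar_algebra A .
  show "nrm A (component A (r *\<^sub>R x)) \<le> \<bar>r\<bar> * norm x"
    using A norm_component_le[OF A, of x] by (simp add: component_scaleR nrm_smult mult_left_mono)
qed

instance
proof
  fix x y z :: "'a universal" and r s :: real and U :: "'a universal set"
  show "x + y + z = x + (y + z)"
  proof (rule universal_eqI)
    fix A :: "'a cstar" assume A: "cstar_algebra A"
    then interpret cstar_algebra A .
    show "component A (x + y + z) = component A (x + (y + z))"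
      using A by (simp add: component_simps a_assoc)
  qed
  show "x + y = y + x"
  proof (rule universal_eqI)
    fix A :: "'a cstar" assume A: "cstar_algebra A"
    then interpret cstar_algebra A .
    show "component A (x + y) = component A (y + x)" using A by (simp add: component_simps a_comm)
  qed
  show "0 + x = x"
  proof (rule universal_eqI)
    fix A :: "'a cstar" assume A: "cstar_algebra A"
    then interpret cstar_algebra A .
    show "component A (0 + x) = component A x" using A by (simp add: component_simps)
  qed
  show "- x + x = 0"
  proof (rule universal_eqI)
    fix A :: "'a cstar" assume A: "cstar_algebra A"
    then interpret cstar_algebra A .
    show "component A (- x + x) = component A 0" using A by (simp add: component_simps l_neg)
  qed
  show "x - y = x + - y" by (rule minus_universal_def)
  show "x * y * z = x * (y * z)"
  proof (rule universal_eqI)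
    fix A :: "'a cstar" assume A: "cstar_algebra A"
    then interpret cstar_algebra A .
    show "component A (x * y * z) = component A (x * (y * z))" using A by (simp add: component_simps mult_assoc)
  qed
  show "(x + y) * z = x * z + y * z"
  proof (rule universal_eqI)
    fix A :: "'a cstar" assume A: "cstar_algebra A"
    then interpret cstar_algebra A .
    show "component A ((x + y) * z) = component A (x * z + y * z)" using A by (simp add: component_simps mult_add_left)
  qed
  show "x * (y + z) = x * y + x * z"
  proof (rule universal_eqI)
    fix A :: "'a cstar" assume A: "cstar_algebra A"
    then interpret cstar_algebra A .
    show "component A (x * (y + z)) = component A (x * y + x * z)" using A by (simp add: component_simps mult_add_right)
  qed
  show "r *\<^sub>R (x + y) = r *\<^sub>R x + r *\<^sub>R y"
  proof (rule universal_eqI)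
    fix A :: "'a cstar" assume A: "cstar_algebra A"
    then interpret cstar_algebra A .
    show "component A (r *\<^sub>R (x + y)) = component A (r *\<^sub>R x + r *\<^sub>R y)" using A by (simp add: component_simps smult_r_distr)
  qed
  show "(r + s) *\<^sub>R x = r *\<^sub>R x + s *\<^sub>R x"
  proof (rule universal_eqI)
    fix A :: "'a cstar" assume A: "cstar_algebra A"
    then interpret cstar_algebra A .
    show "component A ((r + s) *\<^sub>R x) = component A (r *\<^sub>R x + s *\<^sub>R x)"
      using A smult_l_distr[of "complex_of_real r" "complex_of_real s" "component A x"] by (simp add: component_simps)
  qed
  show "r *\<^sub>R s *\<^sub>R x = (r * s) *\<^sub>R x"
  proof (rule universal_eqI)
    fix A :: "'a cstar" assume A: "cstar_algebra A"
    then interpret cstar_algebra A .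
    show "component A (r *\<^sub>R s *\<^sub>R x) = component A ((r * s) *\<^sub>R x)"
      using A smult_assoc1[of "complex_of_real r" "complex_of_real s" "component A x"] by (simp add: component_simps)
  qed
  show "1 *\<^sub>R x = x"
  proof (rule universal_eqI)
    fix A :: "'a cstar" assume A: "cstar_algebra A"
    then interpret cstar_algebra A .
    show "component A (1 *\<^sub>R x) = component A x" using A smult_one[of "component A x"] by (simp add: component_simps)
  qed
  show "r *\<^sub>R x * y = r *\<^sub>R (x * y)"
  proof (rule universal_eqI)
    fix A :: "'a cstar" assume A: "cstar_algebra A"
    then interpret cstar_algebra A .
    show "component A (r *\<^sub>R x * y) = component A (r *\<^sub>R (x * y))" using A by (simp add: component_simps smult_mult_left)
  qed
  show "x * r *\<^sub>R y = r *\<^sub>R (x * y)"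
  proof (rule universal_eqI)
    fix A :: "'a cstar" assume A: "cstar_algebra A"
    then interpret cstar_algebra A .
    show "component A (x * r *\<^sub>R y) = component A (r *\<^sub>R (x * y))" using A by (simp add: component_simps smult_mult_right)
  qed
  show "dist x y = norm (x - y)" by (rule dist_universal_def)
  show "sgn x = scaleR (inverse (norm x)) x" by (rule sgn_universal_def)
  show "uniformity = (INF e\<in>{0 <..}. principal {(x :: 'a universal, y). dist x y < e})"
    by (rule uniformity_universal_def)
  show "open U \<longleftrightarrow> (\<forall>x\<in>U. \<forall>\<^sub>F (x', y) in uniformity. x' = x \<longrightarrow> y \<in> U)"
    by (rule open_universal_def)
  show "norm x = 0 \<longleftrightarrow> x = 0"
  proof
    assume 0: "norm x = 0"
    show "x = 0"
    proof (rule universal_eqI)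
      fix A :: "'a cstar" assume A: "cstar_algebra A"
      then interpret cstar_algebra A .
      have "nrm A (component A x) \<le> 0" using norm_component_le[OF A, of x] 0 by simp
      then have "nrm A (component A x) = 0" using nrm_nonneg[of "component A x"] A by simp
      then show "component A x = component A 0" using A by (simp add: nrm_eq_0_iff component_0)
    qed
  next
    assume 0: "x = 0"
    have "norm x \<le> 0"
    proof (rule norm_universal_leI)
      fix A :: "'a cstar" assume A: "cstar_algebra A"
      then interpret cstar_algebra A .
      show "nrm A (component A x) \<le> 0" using A by (simp add: 0 component_0)
    qed simp
    then show "norm x = 0" using norm_universal_nonneg[of x] by simp
  qed
  show "norm (x + y) \<le> norm x + norm y"
  proof (rule norm_universal_leI)
    show "0 \<le> norm x + norm y" by (intro add_nonneg_nonneg norm_universal_nonneg)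
    fix A :: "'a cstar" assume A: "cstar_algebra A"
    then interpret cstar_algebra A .
    have "nrm A (component A (x + y)) \<le> nrm A (component A x) + nrm A (component A y)"
      using A by (simp add: component_add nrm_triangle)
    also have "\<dots> \<le> norm x + norm y" by (intro add_mono norm_component_le A)
    finally show "nrm A (component A (x + y)) \<le> norm x + norm y" .
  qed
  have smult: "r *\<^sub>R s *\<^sub>R x = (r * s) *\<^sub>R x" "1 *\<^sub>R x = x" for r s and x :: "'a universal"
  proof -
    show "r *\<^sub>R s *\<^sub>R x = (r * s) *\<^sub>R x"
    proof (rule universal_eqI)
      fix A :: "'a cstar" assume A: "cstar_algebra A"
      then interpret cstar_algebra A .
      show "component A (r *\<^sub>R s *\<^sub>R x) = component A ((r * s) *\<^sub>R x)"
        using A smult_assoc1[of "complex_of_real r" "complex_of_real s" "component A x"] by (simp add: component_simps)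
    qed
    show "1 *\<^sub>R x = x"
    proof (rule universal_eqI)
      fix A :: "'a cstar" assume A: "cstar_algebra A"
      then interpret cstar_algebra A .
      show "component A (1 *\<^sub>R x) = component A x" using A smult_one[of "component A x"] by (simp add: component_simps)
    qed
  qed
  show "norm (r *\<^sub>R x) = \<bar>r\<bar> * norm x"
  proof (cases "r = 0")
    case True
    then show ?thesis using norm_universal_scaleR_le[of 0 x] norm_universal_nonneg[of "0 *\<^sub>R x"] by simp
  next
    case False
    have "norm ((1/r) *\<^sub>R r *\<^sub>R x) \<le> \<bar>1/r\<bar> * norm (r *\<^sub>R x)" by (rule norm_universal_scaleR_le)
    moreover have "(1/r) *\<^sub>R r *\<^sub>R x = x" unfolding smult(1) using False smult(2) by simp
    ultimately have "\<bar>r\<bar> * norm x \<le> norm (r *\<^sub>R x)" using False by (simp add: field_simps)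
    then show ?thesis using norm_universal_scaleR_le[of r x] by simp
  qed
  show "norm (x * y) \<le> norm x * norm y"
  proof (rule norm_universal_leI)
    show "0 \<le> norm x * norm y" by (intro mult_nonneg_nonneg norm_universal_nonneg)
    fix A :: "'a cstar" assume A: "cstar_algebra A"
    then interpret cstar_algebra A .
    have "nrm A (component A (x * y)) \<le> nrm A (component A x) * nrm A (component A y)"
      using A by (simp add: component_mult nrm_mult)
    also have "\<dots> \<le> norm x * norm y"
      using A by (intro mult_mono norm_component_le norm_universal_nonneg nrm_nonneg) simp_all
    finally show "nrm A (component A (x * y)) \<le> norm x * norm y" .
  qed
qed

end


lemma component_minus: "cstar_algebra A \<Longrightarrow> component A (x - y) = component A x \<ominus>\<^bsub>A\<^esub> component A y"
  by (simp only: minus_universal_def component_add component_uminus a_minus_def)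

instance universal :: (type) banach
proof
  fix X :: "nat \<Rightarrow> 'a universal" assume X: "Cauchy X"
  have cauchy: "\<exists>N. \<forall>i\<ge>N. \<forall>j\<ge>N. norm (X i - X j) < \<epsilon>" if "\<epsilon> > 0" for \<epsilon>
    using X that unfolding Cauchy_iff by simp
  define lim where "lim A l \<longleftrightarrow> l \<in> carrier A \<and>
    (\<forall>\<epsilon>>0. \<exists>N. \<forall>k\<ge>N. nrm A (component A (X k) \<ominus>\<^bsub>A\<^esub> l) < \<epsilon>)" for A and l :: 'a
  have "\<exists>l. lim A l" if A: "cstar_algebra A" for A
  proof -
    interpret cstar_algebra A by (rule A)
    have c: "\<exists>N. \<forall>i\<ge>N. \<forall>j\<ge>N. nrm A (component A (X i) \<ominus>\<^bsub>A\<^esub> component A (X j)) < \<epsilon>" if e: "\<epsilon> > 0" for \<epsilon>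
    proof -
      obtain N where N: "\<forall>i\<ge>N. \<forall>j\<ge>N. norm (X i - X j) < \<epsilon>" using cauchy[OF e] by auto
      have "nrm A (component A (X i) \<ominus>\<^bsub>A\<^esub> component A (X j)) < \<epsilon>" if "i \<ge> N" "j \<ge> N" for i j
        unfolding component_minus[OF A, symmetric]
        by (rule le_less_trans[OF norm_component_le[OF A]]) (use N that in simp)
      then show ?thesis by blast
    qed
    show ?thesis
      using Cauchy_limit[of "\<lambda>k. component A (X k)", OF component_closed[OF A] c]
      unfolding lim_def Bex_def .
  qed
  then have "\<forall>A. \<exists>l. cstar_algebra A \<longrightarrow> lim A l" by blast
  from choice[OF this] obtain L where "\<forall>A. cstar_algebra A \<longrightarrow> lim A (L A)" by (rule exE)
  then have L: "lim A (L A)" if "cstar_algebra A" for A using that by simp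
  \<comment> \<open>The componentwise limits must be approached uniformly in the algebra, since the
    norm is a supremum over all of them; the Cauchy condition in the supremum norm provides
    this.\<close>
  have unif: "nrm A (component A (X k) \<ominus>\<^bsub>A\<^esub> L A) \<le> \<epsilon>"
    if A: "cstar_algebra A" and N: "\<forall>i\<ge>N. \<forall>j\<ge>N. norm (X i - X j) < \<epsilon>" and k: "k \<ge> N" for A k N \<epsilon>
  proof (rule field_le_epsilon)
    fix \<delta> :: real assume "\<delta> > 0"
    interpret cstar_algebra A by (rule A)
    obtain M where M: "\<forall>k\<ge>M. nrm A (component A (X k) \<ominus>\<^bsub>A\<^esub> L A) < \<delta>"
      using L[OF A] \<open>\<delta> > 0\<close> unfolding lim_def by blast
    have Lc: "L A \<in> carrier A" using L[OF A] by (simp add: lim_def)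
    define m where "m = max M N"
    have "nrm A (component A (X k) \<ominus>\<^bsub>A\<^esub> L A)
      \<le> nrm A (component A (X k) \<ominus>\<^bsub>A\<^esub> component A (X m)) + nrm A (component A (X m) \<ominus>\<^bsub>A\<^esub> L A)"
      by (rule n_minus_triangle) (use A Lc in auto)
    moreover have "nrm A (component A (X k) \<ominus>\<^bsub>A\<^esub> component A (X m)) \<le> norm (X k - X m)"
      unfolding component_minus[OF A, symmetric] by (rule norm_component_le[OF A])
    moreover have "norm (X k - X m) < \<epsilon>" using N k by (simp add: m_def)
    moreover have "nrm A (component A (X m) \<ominus>\<^bsub>A\<^esub> L A) < \<delta>" using M by (simp add: m_def)
    ultimately show "nrm A (component A (X k) \<ominus>\<^bsub>A\<^esub> L A) \<le> \<epsilon> + \<delta>" by linarith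
  qed
  obtain N1 where N1: "\<forall>i\<ge>N1. \<forall>j\<ge>N1. norm (X i - X j) < 1" using cauchy[of 1] by auto
  have comp: "component A (make_universal L) = L A" if "cstar_algebra A" for A
  proof (rule component_make_bounded[OF that, where K="norm (X N1) + 1"])
    fix A :: "'a cstar" assume A: "cstar_algebra A"
    then interpret cstar_algebra A .
    have Lc: "L A \<in> carrier A" using L[OF A] by (simp add: lim_def)
    have "\<bar>nrm A (component A (X N1)) - nrm A (L A)\<bar> \<le> nrm A (component A (X N1) \<ominus>\<^bsub>A\<^esub> L A)"
      by (rule n_diff_bound) (use A Lc in auto)
    moreover have "nrm A (component A (X N1) \<ominus>\<^bsub>A\<^esub> L A) \<le> 1" by (rule unif[OF A N1]) simp
    ultimately have "nrm A (L A) \<le> norm (X N1) + 1"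
      using norm_component_le[OF A, of "X N1"] by linarith
    then show "L A \<in> carrier A \<and> nrm A (L A) \<le> norm (X N1) + 1" using Lc by simp
  qed
  have "X \<longlonglongrightarrow> make_universal L"
  proof (rule LIMSEQ_I)
    fix r :: real assume r: "0 < r"
    obtain N where N: "\<forall>i\<ge>N. \<forall>j\<ge>N. norm (X i - X j) < r / 2" using cauchy[of "r / 2"] r by auto
    have "norm (X k - make_universal L) \<le> r / 2" if k: "k \<ge> N" for k
    proof (rule norm_universal_leI)
      fix A :: "'a cstar" assume A: "cstar_algebra A"
      show "nrm A (component A (X k - make_universal L)) \<le> r / 2"
        unfolding component_minus[OF A] comp[OF A] by (rule unif[OF A N k])
    qed (use r in simp)
    then show "\<exists>no. \<forall>n\<ge>no. norm (X n - make_universal L) < r" using r by fastforce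
  qed
  then show "convergent X" by (rule convergentI)
qed

context cstar_algebra
begin

lemma nrm_star [simp]: "x \<in> carrier A \<Longrightarrow> nrm A (star A x) = nrm A x"
proof -
  have le: "nrm A y \<le> nrm A (star A y)" if y: "y \<in> carrier A" for y
  proof (cases "nrm A y = 0")
    case False
    have "nrm A y * nrm A y \<le> nrm A (star A y) * nrm A y"
      using nrm_mult[of "star A y" y] cstar_identity[OF y] y by (simp add: power2_eq_square)
    then show ?thesis using False nrm_nonneg[OF y] by (simp add: mult_le_cancel_right)
  qed (use y in \<open>simp add: nrm_nonneg\<close>)
  assume "x \<in> carrier A"
  then show ?thesis using le[of x] le[of "star A x"] by (simp add: star_star)
qed

end

instantiation universal :: (type) cstar_alg
begin

definition "adj x = make_universal (\<lambda>A. star A (component A x))"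
definition "imul x = make_universal (\<lambda>A. \<i> \<odot>\<^bsub>A\<^esub> component A x)"

lemma component_adj: "cstar_algebra A \<Longrightarrow> component A (adj x) = star A (component A x)"
  unfolding adj_universal_def
proof (rule component_make_bounded[where K="norm x"])
  fix A :: "'a cstar" assume A: "cstar_algebra A"
  then interpret cstar_algebra A .
  show "star A (component A x) \<in> carrier A \<and> nrm A (star A (component A x)) \<le> norm x"
    using norm_component_le[OF A, of x] A by simp
qed

lemma component_imul: "cstar_algebra A \<Longrightarrow> component A (imul x) = \<i> \<odot>\<^bsub>A\<^esub> component A x"
  unfolding imul_universal_def
proof (rule component_make_bounded[where K="norm x"])
  fix A :: "'a cstar" assume A: "cstar_algebra A"
  then interpret cstar_algebra A .
  show "\<i> \<odot>\<^bsub>A\<^esub> component A x \<in> carrier A \<and> nrm A (\<i> \<odot>\<^bsub>A\<^esub> component A x) \<le> norm x"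
    using norm_component_le[OF A, of x] A by (simp add: nrm_smult)
qed

instance
proof
  fix x y z :: "'a universal" and r :: real
  show "adj (x + y) = adj x + adj y"
  proof (rule universal_eqI)
    fix A :: "'a cstar" assume A: "cstar_algebra A"
    then interpret cstar_algebra A .
    show "component A (adj (x + y)) = component A (adj x + adj y)"
      using A by (simp add: component_adj component_add star_add)
  qed
  show "adj (r *\<^sub>R x) = r *\<^sub>R adj x"
  proof (rule universal_eqI)
    fix A :: "'a cstar" assume A: "cstar_algebra A"
    then interpret cstar_algebra A .
    show "component A (adj (r *\<^sub>R x)) = component A (r *\<^sub>R adj x)"
      using A by (simp add: component_adj component_scaleR star_smult)
  qed
  show "adj (adj x) = x"
  proof (rule universal_eqI)
    fix A :: "'a cstar" assume A: "cstar_algebra A"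
    then interpret cstar_algebra A .
    show "component A (adj (adj x)) = component A x" using A by (simp add: component_adj star_star)
  qed
  show "adj (x * y) = adj y * adj x"
  proof (rule universal_eqI)
    fix A :: "'a cstar" assume A: "cstar_algebra A"
    then interpret cstar_algebra A .
    show "component A (adj (x * y)) = component A (adj y * adj x)"
      using A by (simp add: component_adj component_mult star_mult)
  qed
  show "norm (adj x * x) = (norm x)\<^sup>2"
  proof (rule antisym)
    show "norm (adj x * x) \<le> (norm x)\<^sup>2"
    proof (rule norm_universal_leI)
      fix A :: "'a cstar" assume A: "cstar_algebra A"
      then interpret cstar_algebra A .
      show "nrm A (component A (adj x * x)) \<le> (norm x)\<^sup>2"
        using A by (simp add: component_mult component_adj cstar_identity power_mono norm_component_le nrm_nonneg)
    qed simp
    have "norm x \<le> sqrt (norm (adj x * x))"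
    proof (rule norm_universal_leI)
      fix A :: "'a cstar" assume A: "cstar_algebra A"
      then interpret cstar_algebra A .
      have "(nrm A (component A x))\<^sup>2 = nrm A (component A (adj x * x))"
        using A by (simp add: component_mult component_adj cstar_identity)
      also have "\<dots> \<le> norm (adj x * x)" by (rule norm_component_le[OF A])
      finally show "nrm A (component A x) \<le> sqrt (norm (adj x * x))" by (rule real_le_rsqrt)
    qed simp
    then have "(norm x)\<^sup>2 \<le> (sqrt (norm (adj x * x)))\<^sup>2" by (rule power_mono) simp
    then show "(norm x)\<^sup>2 \<le> norm (adj x * x)" by simp
  qed
  show "imul (x + y) = imul x + imul y"
  proof (rule universal_eqI)
    fix A :: "'a cstar" assume A: "cstar_algebra A"
    then interpret cstar_algebra A .
    show "component A (imul (x + y)) = component A (imul x + imul y)"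
      using A by (simp add: component_imul component_add smult_r_distr)
  qed
  show "imul (r *\<^sub>R x) = r *\<^sub>R imul x"
  proof (rule universal_eqI)
    fix A :: "'a cstar" assume A: "cstar_algebra A"
    then interpret cstar_algebra A .
    show "component A (imul (r *\<^sub>R x)) = component A (r *\<^sub>R imul x)"
      using A smult_assoc1[of \<i> "complex_of_real r" "component A x"]
        smult_assoc1[of "complex_of_real r" \<i> "component A x"]
      by (simp add: component_imul component_scaleR mult.commute)
  qed
  show "imul (imul x) = - x"
  proof (rule universal_eqI)
    fix A :: "'a cstar" assume A: "cstar_algebra A"
    then interpret cstar_algebra A .
    show "component A (imul (imul x)) = component A (- x)"
      using A smult_assoc1[of \<i> \<i> "component A x"]
      by (simp add: component_imul component_uminus minus_eq_smult)
  qed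
  show "imul x * y = imul (x * y)"
  proof (rule universal_eqI)
    fix A :: "'a cstar" assume A: "cstar_algebra A"
    then interpret cstar_algebra A .
    show "component A (imul x * y) = component A (imul (x * y))"
      using A by (simp add: component_imul component_mult smult_mult_left)
  qed
  show "x * imul y = imul (x * y)"
  proof (rule universal_eqI)
    fix A :: "'a cstar" assume A: "cstar_algebra A"
    then interpret cstar_algebra A .
    show "component A (x * imul y) = component A (imul (x * y))"
      using A by (simp add: component_imul component_mult smult_mult_right)
  qed
  show "adj (imul x) = - imul (adj x)"
  proof (rule universal_eqI)
    fix A :: "'a cstar" assume A: "cstar_algebra A"
    then interpret cstar_algebra A .
    show "component A (adj (imul x)) = component A (- imul (adj x))"
      using A smult_assoc1[of "- 1" \<i> "star A (component A x)"]
      by (simp add: component_imul component_adj component_uminus star_smult minus_eq_smult)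
  qed
qed

end

lemmas component_eqs = component_0 component_add component_uminus component_minus component_mult
  component_scaleR component_adj component_imul

definition incl :: "'a cstar \<Rightarrow> 'a \<Rightarrow> 'a universal"
  where "incl A x = make_universal (\<lambda>A'. if A' = A then x else \<zero>\<^bsub>A'\<^esub>)"

context
  fixes A :: "'a cstar"
  assumes A: "cstar_algebra A"
begin

interpretation cstar_algebra A by (rule A)

lemma component_incl':
  assumes "x \<in> carrier A" "cstar_algebra A'"
  shows "component A' (incl A x) = (if A' = A then x else \<zero>\<^bsub>A'\<^esub>)"
  unfolding incl_def
proof (rule component_make_bounded[OF assms(2), where K="nrm A x"])
  fix A' :: "'a cstar" assume A': "cstar_algebra A'"
  then interpret A': cstar_algebra A' .
  show "(if A' = A then x else \<zero>\<^bsub>A'\<^esub>) \<in> carrier A' \<and> nrm A' (if A' = A then x else \<zero>\<^bsub>A'\<^esub>) \<le> nrm A x"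
    using assms(1) by (simp add: nrm_nonneg)
qed

lemma component_incl [simp]: "x \<in> carrier A \<Longrightarrow> component A (incl A x) = x"
  using component_incl'[of x A] A by simp

lemma incl_eqI:
  assumes "x \<in> carrier A" "component A u = x"
    "\<And>A'. cstar_algebra A' \<Longrightarrow> A' \<noteq> A \<Longrightarrow> component A' u = \<zero>\<^bsub>A'\<^esub>"
  shows "incl A x = u"
  by (rule universal_eqI) (use assms in \<open>auto simp: component_incl'\<close>)

lemma incl_add: "x \<in> carrier A \<Longrightarrow> y \<in> carrier A \<Longrightarrow> incl A (x \<oplus>\<^bsub>A\<^esub> y) = incl A x + incl A y"
proof (rule incl_eqI)
  fix A' :: "'a cstar" assume *: "x \<in> carrier A" "y \<in> carrier A" "cstar_algebra A'" "A' \<noteq> A"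
  then interpret A': cstar_algebra A' by simp
  show "component A' (incl A x + incl A y) = \<zero>\<^bsub>A'\<^esub>"
    using * by (simp add: component_eqs component_incl')
qed (use A in \<open>simp_all add: component_eqs\<close>)

lemma incl_smult: "x \<in> carrier A \<Longrightarrow> incl A (c \<odot>\<^bsub>A\<^esub> x) = Re c *\<^sub>R incl A x + Im c *\<^sub>R imul (incl A x)"
proof (rule incl_eqI)
  fix A' :: "'a cstar" assume *: "x \<in> carrier A" "cstar_algebra A'" "A' \<noteq> A"
  then interpret A': cstar_algebra A' by simp
  show "component A' (Re c *\<^sub>R incl A x + Im c *\<^sub>R imul (incl A x)) = \<zero>\<^bsub>A'\<^esub>"
    using * by (simp add: component_eqs component_incl')
next
  assume x: "x \<in> carrier A"
  have "c \<odot>\<^bsub>A\<^esub> x = (complex_of_real (Re c) \<oplus>\<^bsub>complex_ring\<^esub> complex_of_real (Im c) * \<i>) \<odot>\<^bsub>A\<^esub> x"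
    by (simp add: complex_eq[symmetric] mult.commute[of _ \<i>])
  also have "\<dots> = complex_of_real (Re c) \<odot>\<^bsub>A\<^esub> x \<oplus>\<^bsub>A\<^esub> complex_of_real (Im c) \<odot>\<^bsub>A\<^esub> (\<i> \<odot>\<^bsub>A\<^esub> x)"
    using x smult_assoc1[of "complex_of_real (Im c)" \<i> x] by (subst smult_l_distr) simp_all
  finally show "component A (Re c *\<^sub>R incl A x + Im c *\<^sub>R imul (incl A x)) = c \<odot>\<^bsub>A\<^esub> x"
    using A x by (simp add: component_eqs)
qed simp

text \<open>The embedded algebra is an ideal: a product with an arbitrary element sees only the
  component in \<open>A\<close>, because \<open>incl A x\<close> vanishes in all others.\<close>

lemma incl_mult_component: "x \<in> carrier A \<Longrightarrow> incl A x * u = incl A (x \<otimes>\<^bsub>A\<^esub> component A u)"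
proof (rule incl_eqI[symmetric])
  fix A' :: "'a cstar" assume *: "x \<in> carrier A" "cstar_algebra A'" "A' \<noteq> A"
  then interpret A': cstar_algebra A' by simp
  show "component A' (incl A x * u) = \<zero>\<^bsub>A'\<^esub>"
    using * by (simp add: component_eqs component_incl')
qed (use A in \<open>simp_all add: component_eqs\<close>)

lemma incl_mult: "x \<in> carrier A \<Longrightarrow> y \<in> carrier A \<Longrightarrow> incl A (x \<otimes>\<^bsub>A\<^esub> y) = incl A x * incl A y"
  by (simp add: incl_mult_component)

lemma incl_star: "x \<in> carrier A \<Longrightarrow> incl A (star A x) = adj (incl A x)"
proof (rule incl_eqI)
  fix A' :: "'a cstar" assume *: "x \<in> carrier A" "cstar_algebra A'" "A' \<noteq> A"
  then interpret A': cstar_algebra A' by simp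
  show "component A' (adj (incl A x)) = \<zero>\<^bsub>A'\<^esub>"
    using * by (simp add: component_eqs component_incl')
qed (use A in \<open>simp_all add: component_eqs\<close>)

lemma norm_incl [simp]: "x \<in> carrier A \<Longrightarrow> norm (incl A x) = nrm A x"
proof (rule antisym)
  assume x: "x \<in> carrier A"
  show "norm (incl A x) \<le> nrm A x"
  proof (rule norm_universal_leI)
    fix A' :: "'a cstar" assume A': "cstar_algebra A'"
    then interpret A': cstar_algebra A' .
    show "nrm A' (component A' (incl A x)) \<le> nrm A x"
      using A' x by (simp add: component_incl' nrm_nonneg)
  qed (use x in \<open>simp add: nrm_nonneg\<close>)
  show "nrm A x \<le> norm (incl A x)" using norm_component_le[OF A, of "incl A x"] x by simp
qed

lemma incl_zero [simp]: "incl A \<zero>\<^bsub>A\<^esub> = 0"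
  by (rule incl_eqI) (use A in \<open>simp_all add: component_eqs\<close>)

lemma incl_inj: "x \<in> carrier A \<Longrightarrow> y \<in> carrier A \<Longrightarrow> incl A x = incl A y \<longleftrightarrow> x = y"
  by (metis component_incl)

lemma incl_minus: "x \<in> carrier A \<Longrightarrow> y \<in> carrier A \<Longrightarrow> incl A (x \<ominus>\<^bsub>A\<^esub> y) = incl A x - incl A y"
  using incl_add[of "x \<ominus>\<^bsub>A\<^esub> y" y] by (simp add: minus_plus_cancel)

lemma incl_finsum:
  "finite I \<Longrightarrow> (\<And>i. i \<in> I \<Longrightarrow> f i \<in> carrier A) \<Longrightarrow> incl A (finsum A f I) = (\<Sum>i\<in>I. incl A (f i))"
  by (induction I rule: finite_induct) (simp_all add: incl_add Pi_def)

text \<open>The element whose square is \<open>incl A x\<close> may lie outside the image of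
  \<open>incl A\<close>, but its component in \<open>A\<close> serves.\<close>

lemma positive_cone_iff: "x \<in> carrier A \<Longrightarrow> x \<in> positive_cone A \<longleftrightarrow> pos (incl A x)"
proof
  assume x: "x \<in> carrier A"
  show "pos (incl A x)" if xp: "x \<in> positive_cone A"
  proof -
    obtain y where "y \<in> carrier A" "x = star A y \<otimes>\<^bsub>A\<^esub> y" using xp by (auto simp: positive_cone_def)
    then have "incl A x = adj (incl A y) * incl A y" by (simp add: incl_mult incl_star)
    then show ?thesis by simp
  qed
  show "x \<in> positive_cone A" if xp: "pos (incl A x)"
  proof -
    obtain u where "incl A x = adj u * u" using xp by (auto simp: pos_def)
    then have "component A (incl A x) = star A (component A u) \<otimes>\<^bsub>A\<^esub> component A u"
      using A by (simp add: component_eqs)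
    then show ?thesis using x A by (auto simp: positive_cone_def)
  qed
qed

lemma pos_component: "pos u \<Longrightarrow> component A u \<in> positive_cone A"
  using A by (auto simp: pos_def positive_cone_def component_eqs)

lemma carrier_factorization:
  assumes "c \<in> carrier A"
  obtains u s where "u \<in> carrier A" "s \<in> carrier A" "c = u \<otimes>\<^bsub>A\<^esub> s"
proof -
  obtain u s where "incl A c = u * s" by (rule factorization)
  then have "component A (incl A c) = component A u \<otimes>\<^bsub>A\<^esub> component A s"
    using A by (simp add: component_eqs)
  then show ?thesis using that[of "component A u" "component A s"] assms A by simp
qed

end


section \<open>Operator norms of matrices over a carrier\<close>

lemma mat_bound_adj:
  fixes M :: "'i \<Rightarrow> 'j \<Rightarrow> 'c::cstar_alg"
  assumes M: "mat_bound I J M t" and t: "0 \<le> t"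
  shows "mat_bound J I (\<lambda>j i. adj (M i j)) t"
  unfolding mat_bound_def
proof
  fix w :: "'i \<Rightarrow> 'c"
  define v where "v j = (\<Sum>i\<in>I. adj (M i j) * w i)" for j
  have e: "(\<Sum>j\<in>J. adj (v j) * v j) = (\<Sum>i\<in>I. adj (\<Sum>j\<in>J. M i j * v j) * w i)"
  proof -
    have "(\<Sum>j\<in>J. adj (v j) * v j) = (\<Sum>j\<in>J. adj (v j) * (\<Sum>i\<in>I. adj (M i j) * w i))"
      by (simp only: v_def[symmetric])
    also have "\<dots> = (\<Sum>i\<in>I. \<Sum>j\<in>J. adj (v j) * (adj (M i j) * w i))"
      unfolding sum_distrib_left by (rule sum.swap)
    also have "\<dots> = (\<Sum>i\<in>I. adj (\<Sum>j\<in>J. M i j * v j) * w i)"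
      by (simp only: adj_sum adj_mult sum_distrib_right mult.assoc)
    finally show ?thesis .
  qed
  have "(col_sq J v)\<^sup>2 \<le> col_sq I (\<lambda>i. \<Sum>j\<in>J. M i j * v j) * col_sq I w"
    unfolding col_sq_def[of J] e by (rule col_sq_cauchy_schwarz)
  also have "\<dots> \<le> t * col_sq J v * col_sq I w"
    using M by (intro mult_right_mono) (simp_all add: mat_bound_def)
  finally have "(col_sq J v)\<^sup>2 \<le> (t * col_sq I w) * col_sq J v" by (simp only: ac_simps)
  then have "col_sq J v \<le> t * col_sq I w" by (rule square_le_cancel) (simp_all add: t)
  then show "col_sq J (\<lambda>j. \<Sum>i\<in>I. adj (M i j) * w i) \<le> t * col_sq I w" by (simp add: v_def[abs_def])
qed

text \<open>Converse of \<open>mat_bound_gram\<close>: the squared norm of M v is the pairing of v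
  with the Gram matrix applied to v.\<close>

lemma mat_bound_of_gram:
  fixes M :: "'i \<Rightarrow> 'j \<Rightarrow> 'c::cstar_alg"
  assumes G: "mat_bound J J (\<lambda>j l. \<Sum>i\<in>I. adj (M i j) * M i l) (t\<^sup>2)" and t: "0 \<le> t"
  shows "mat_bound I J M t"
  unfolding mat_bound_def
proof
  fix v :: "'j \<Rightarrow> 'c"
  define w where "w i = (\<Sum>j\<in>J. M i j * v j)" for i
  have e: "(\<Sum>i\<in>I. adj (w i) * w i) = (\<Sum>j\<in>J. adj (v j) * (\<Sum>l\<in>J. (\<Sum>i\<in>I. adj (M i j) * M i l) * v l))"
  proof -
    have "(\<Sum>j\<in>J. adj (v j) * (\<Sum>l\<in>J. (\<Sum>i\<in>I. adj (M i j) * M i l) * v l))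
        = (\<Sum>j\<in>J. \<Sum>l\<in>J. \<Sum>i\<in>I. adj (v j) * (adj (M i j) * (M i l * v l)))"
      by (simp only: sum_distrib_left sum_distrib_right mult.assoc)
    also have "\<dots> = (\<Sum>i\<in>I. \<Sum>j\<in>J. \<Sum>l\<in>J. adj (v j) * (adj (M i j) * (M i l * v l)))"
      by (rule sum_rotate)
    also have "\<dots> = (\<Sum>i\<in>I. adj (w i) * w i)"
      by (simp only: w_def adj_sum adj_mult sum_product mult.assoc)
    finally show ?thesis by (rule sym)
  qed
  have "(col_sq I w)\<^sup>2 \<le> col_sq J v * col_sq J (\<lambda>j. \<Sum>l\<in>J. (\<Sum>i\<in>I. adj (M i j) * M i l) * v l)"
    unfolding col_sq_def[of I] e by (rule col_sq_cauchy_schwarz)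
  also have "\<dots> \<le> col_sq J v * (t\<^sup>2 * col_sq J v)"
    using G by (intro mult_left_mono) (simp_all add: mat_bound_def)
  also have "\<dots> = (t * col_sq J v)\<^sup>2" by (simp add: power2_eq_square)
  finally have "col_sq I w \<le> t * col_sq J v" by (rule power2_le_imp_le) (simp add: t)
  then show "col_sq I (\<lambda>i. \<Sum>j\<in>J. M i j * v j) \<le> t * col_sq J v" by (simp add: w_def[abs_def])
qed

text \<open>A crude bound growing with the index sets. It shows that the supremum in
  \<open>matrix_norm\<close> is finite.\<close>

lemma mat_bound_exists:
  fixes M :: "'i \<Rightarrow> 'j \<Rightarrow> 'a::cstar_alg"
  assumes "finite J"
  obtains t where "0 \<le> t" "mat_bound I J M (t\<^sup>2)"
proof -
  define s where "s = (\<Sum>i\<in>I. (\<Sum>j\<in>J. norm (M i j))\<^sup>2)"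
  have s: "0 \<le> s" unfolding s_def by (intro sum_nonneg) simp
  have "col_sq I (\<lambda>i. \<Sum>j\<in>J. M i j * v j) \<le> s * col_sq J v" for v :: "'j \<Rightarrow> 'a"
  proof -
    have vj: "norm (v j) \<le> sqrt (col_sq J v)" if "j \<in> J" for j
      using col_sq_entry[OF assms that, of v] by (rule real_le_rsqrt)
    have "norm (\<Sum>j\<in>J. M i j * v j) \<le> (\<Sum>j\<in>J. norm (M i j)) * sqrt (col_sq J v)" for i
      unfolding sum_distrib_right
      by (rule order_trans[OF norm_sum], rule sum_mono, rule order_trans[OF norm_mult_ineq])
        (simp add: mult_left_mono vj)
    then have "(norm (\<Sum>j\<in>J. M i j * v j))\<^sup>2 \<le> ((\<Sum>j\<in>J. norm (M i j)) * sqrt (col_sq J v))\<^sup>2" for i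
      by (intro power_mono) simp_all
    then have "(\<Sum>i\<in>I. (norm (\<Sum>j\<in>J. M i j * v j))\<^sup>2) \<le> (\<Sum>i\<in>I. (\<Sum>j\<in>J. norm (M i j))\<^sup>2 * col_sq J v)"
      by (intro sum_mono) (simp add: power_mult_distrib)
    then show ?thesis
      using col_sq_le_sum[of I "\<lambda>i. \<Sum>j\<in>J. M i j * v j"] by (simp add: s_def sum_distrib_right)
  qed
  then show ?thesis using that[of "sqrt s"] s by (simp add: mat_bound_def)
qed

lemma mat_bound_single:
  assumes "mat_bound {i} {j} M t" "0 \<le> t" shows "(norm (M i j))\<^sup>2 \<le> t"
proof -
  have "mat_bound {i} {j} M ((sqrt t)\<^sup>2)" using assms by simp
  then have "norm (M i j) \<le> sqrt t" by (rule mat_bound_entry) (use assms in auto)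
  then have "(norm (M i j))\<^sup>2 \<le> (sqrt t)\<^sup>2" by (rule power_mono) simp
  then show ?thesis using assms by simp
qed

lemma (in positive_action) norm_le_e:
  assumes \<kappa>: "0 \<le> \<kappa>" "\<And>h. pos h \<Longrightarrow> norm (e h) \<le> \<kappa> * norm h" and K: "approximate_unit S K" and c: "c \<in> S"
  shows "(norm c)\<^sup>2 \<le> K * \<kappa> * norm (e (adj c * c))"
proof -
  define g where "g = e (adj c * c)"
  have "mat_bound {()} {()} (gram {()} (\<lambda>_ _. c)) ((norm g)\<^sup>2)"
    unfolding mat_bound_def gram_def g_def[symmetric]
    by (simp add: col_sq_def cstar_norm flip: g_def)
      (simp add: norm_mult_ineq power_mono flip: power_mult_distrib)
  then have "mat_bound {()} {()} (\<lambda>_ _. c) (K * \<kappa> * norm g)"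
    by (intro bound_of_gram_bound[OF \<kappa> K]) (simp_all add: c)
  then show ?thesis unfolding g_def
    by (rule mat_bound_single) (use K \<kappa>(1) in \<open>simp add: approximate_unit_def\<close>)
qed

context
  fixes B :: "'b cstar"
  assumes B: "cstar_algebra B"
begin

interpretation cstar_algebra B by (rule B)

lemma incl_mult_component_left:
  assumes x: "x \<in> carrier B" shows "u * incl B x = incl B (component B u \<otimes>\<^bsub>B\<^esub> x)"
proof -
  have "u * incl B x = adj (incl B (star B x) * adj u)"
    using x by (simp add: adj_mult incl_star[OF B])
  also have "\<dots> = incl B (component B u \<otimes>\<^bsub>B\<^esub> x)"
    using x B by (simp add: incl_mult_component component_adj star_mult star_star flip: incl_star[OF B])
  finally show ?thesis .
qed

lemma col_sq_incl:
  assumes "\<And>i. i < s \<Longrightarrow> v i \<in> carrier B"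
  shows "column_norm B (vec s v) = sqrt (col_sq {..<s} (\<lambda>i. incl B (v i)))"
proof -
  have "(\<Oplus>\<^bsub>B\<^esub>i\<in>{..<s}. star B (vec s v $ i) \<otimes>\<^bsub>B\<^esub> (vec s v $ i)) = (\<Oplus>\<^bsub>B\<^esub>i\<in>{..<s}. star B (v i) \<otimes>\<^bsub>B\<^esub> v i)"
    by (rule finsum_cong') (use assms in auto)
  moreover have "incl B (\<Oplus>\<^bsub>B\<^esub>i\<in>{..<s}. star B (v i) \<otimes>\<^bsub>B\<^esub> v i) = (\<Sum>i<s. adj (incl B (v i)) * incl B (v i))"
    using assms by (subst incl_finsum[OF B]) (simp_all add: incl_mult[OF B] incl_star[OF B])
  moreover have "(\<Oplus>\<^bsub>B\<^esub>i\<in>{..<s}. star B (v i) \<otimes>\<^bsub>B\<^esub> v i) \<in> carrier B"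
    by (rule finsum_closed) (use assms in auto)
  ultimately show ?thesis
    unfolding column_norm_def col_sq_def by (metis dim_vec norm_incl[OF B])
qed

lemma mat_apply_vec:
  assumes "\<And>i j. i < r \<Longrightarrow> j < s \<Longrightarrow> M i j \<in> carrier B" "\<And>j. j < s \<Longrightarrow> v j \<in> carrier B"
  shows "mat_apply B (mat r s (\<lambda>(i, j). M i j)) (vec s v) = vec r (\<lambda>i. \<Oplus>\<^bsub>B\<^esub>j\<in>{..<s}. M i j \<otimes>\<^bsub>B\<^esub> v j)"
  unfolding mat_apply_def
  by (intro eq_vecI) (use assms in \<open>auto intro!: finsum_cong'\<close>)

lemma incl_mat_apply:
  fixes r s :: nat
  assumes "\<And>i j. i < r \<Longrightarrow> j < s \<Longrightarrow> M i j \<in> carrier B" "\<And>j. j < s \<Longrightarrow> v j \<in> carrier B" "i < r"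
  shows "incl B (\<Oplus>\<^bsub>B\<^esub>j\<in>{..<s}. M i j \<otimes>\<^bsub>B\<^esub> v j) = (\<Sum>j<s. incl B (M i j) * incl B (v j))"
  using assms by (subst incl_finsum[OF B]) (simp_all add: incl_mult[OF B])

lemma column_norm_mat_apply:
  assumes "\<And>i j. i < r \<Longrightarrow> j < s \<Longrightarrow> M i j \<in> carrier B" "\<And>j. j < s \<Longrightarrow> v j \<in> carrier B"
  shows "column_norm B (mat_apply B (mat r s (\<lambda>(i, j). M i j)) (vec s v))
    = sqrt (col_sq {..<r} (\<lambda>i. \<Sum>j<s. incl B (M i j) * incl B (v j)))"
proof -
  have e: "mat_apply B (mat r s (\<lambda>(i, j). M i j)) (vec s v) = vec r (\<lambda>i. \<Oplus>\<^bsub>B\<^esub>j\<in>{..<s}. M i j \<otimes>\<^bsub>B\<^esub> v j)"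
    by (rule mat_apply_vec) (use assms in auto)
  have "column_norm B (mat_apply B (mat r s (\<lambda>(i, j). M i j)) (vec s v))
      = sqrt (col_sq {..<r} (\<lambda>i. incl B (\<Oplus>\<^bsub>B\<^esub>j\<in>{..<s}. M i j \<otimes>\<^bsub>B\<^esub> v j)))"
    unfolding e by (rule col_sq_incl, rule finsum_closed) (use assms in auto)
  moreover have "incl B (\<Oplus>\<^bsub>B\<^esub>j\<in>{..<s}. M i j \<otimes>\<^bsub>B\<^esub> v j) = (\<Sum>j<s. incl B (M i j) * incl B (v j))" if "i < r" for i
    by (rule incl_mat_apply[where r=r]) (use assms that in auto)
  ultimately show ?thesis by (simp add: col_sq_def)
qed

text \<open>Identifies \<open>matrix_norm\<close>, a supremum over unit columns with entries in the
  carrier, with the least operator bound over all columns of the product algebra. Passing to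
  components in \<open>B\<close> changes no product with \<open>M\<close> and does not increase the
  column norm.\<close>

lemma matrix_norm_bounds:
  assumes M: "\<And>i j. i < r \<Longrightarrow> j < s \<Longrightarrow> M i j \<in> carrier B"
  defines "N \<equiv> matrix_norm B (mat r s (\<lambda>(i, j). M i j))" and "M' \<equiv> (\<lambda>i j. incl B (M i j))"
  shows "0 \<le> N" "mat_bound {..<r} {..<s} M' (N\<^sup>2)"
    "\<And>t. 0 \<le> t \<Longrightarrow> mat_bound {..<r} {..<s} M' (t\<^sup>2) \<Longrightarrow> N \<le> t"
proof -
  define X where "X = {v \<in> carrier_vec s. \<forall>j<s. v $ j \<in> carrier B}"
  have N: "N = (SUP x\<in>{x \<in> X. column_norm B x \<le> 1}. column_norm B (mat_apply B (mat r s (\<lambda>(i, j). M i j)) x))"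
    unfolding N_def matrix_norm_def op_norm_def X_def by simp
  have Xv: "x \<in> X \<longleftrightarrow> (\<exists>v. (\<forall>j<s. v j \<in> carrier B) \<and> x = vec s v)" for x
    unfolding X_def by (auto intro!: exI[of _ "\<lambda>j. x $ j"])
  have le: "column_norm B (mat_apply B (mat r s (\<lambda>(i, j). M i j)) x) \<le> t"
    if t: "0 \<le> t" "mat_bound {..<r} {..<s} M' (t\<^sup>2)" and x: "x \<in> {x \<in> X. column_norm B x \<le> 1}" for t x
  proof -
    obtain v where v: "\<forall>j<s. v j \<in> carrier B" "x = vec s v" using x Xv by auto
    have "sqrt (col_sq {..<s} (\<lambda>i. incl B (v i))) \<le> 1" using x v col_sq_incl[of s v] by simp
    then have "col_sq {..<s} (\<lambda>i. incl B (v i)) \<le> 1" by simp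
    moreover have "col_sq {..<r} (\<lambda>i. \<Sum>j<s. M' i j * incl B (v j)) \<le> t\<^sup>2 * col_sq {..<s} (\<lambda>i. incl B (v i))"
      using t(2) by (simp add: mat_bound_def)
    ultimately have "col_sq {..<r} (\<lambda>i. \<Sum>j<s. M' i j * incl B (v j)) \<le> t\<^sup>2 * 1"
      by (meson mult_left_mono order_trans zero_le_power2)
    then have "sqrt (col_sq {..<r} (\<lambda>i. \<Sum>j<s. M' i j * incl B (v j))) \<le> t"
      using t(1) by (simp add: real_le_lsqrt)
    then show ?thesis
      unfolding v(2) M'_def using column_norm_mat_apply[where r=r and s=s and M=M and v=v, OF M] v(1) by simp
  qed
  obtain t0 where t0: "0 \<le> t0" "mat_bound {..<r} {..<s} M' (t0\<^sup>2)"
    by (rule mat_bound_exists[of "{..<s}" "{..<r}" M']) simp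
  have bdd: "bdd_above ((\<lambda>x. column_norm B (mat_apply B (mat r s (\<lambda>(i, j). M i j)) x)) ` {x \<in> X. column_norm B x \<le> 1})"
    by (rule bdd_aboveI2[where M=t0]) (rule le[OF t0])
  have zero: "vec s (\<lambda>_. \<zero>\<^bsub>B\<^esub>) \<in> {x \<in> X. column_norm B x \<le> 1}"
    using col_sq_incl[of s "\<lambda>_. \<zero>\<^bsub>B\<^esub>"] B by (simp add: X_def col_sq_def)
  show "N \<le> t" if "0 \<le> t" "mat_bound {..<r} {..<s} M' (t\<^sup>2)" for t
    unfolding N by (rule cSUP_least) (use zero le[OF that] in auto)
  have upper: "sqrt (col_sq {..<r} (\<lambda>i. \<Sum>j<s. M' i j * incl B (v j))) \<le> N"
    if v: "\<forall>j<s. v j \<in> carrier B" "col_sq {..<s} (\<lambda>i. incl B (v i)) \<le> 1" for v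
  proof -
    have "vec s v \<in> {x \<in> X. column_norm B x \<le> 1}" using v col_sq_incl[of s v] by (auto simp: Xv)
    then have "column_norm B (mat_apply B (mat r s (\<lambda>(i, j). M i j)) (vec s v)) \<le> N"
      unfolding N by (rule cSUP_upper[OF _ bdd])
    then show ?thesis unfolding M'_def using column_norm_mat_apply[where r=r and s=s and M=M and v=v, OF M] v(1) by simp
  qed
  show N0: "0 \<le> N" using upper[of "\<lambda>_. \<zero>\<^bsub>B\<^esub>"] B by (simp add: col_sq_def)
  have carr: "col_sq {..<r} (\<lambda>i. \<Sum>j<s. M' i j * incl B (v j)) \<le> N\<^sup>2 * col_sq {..<s} (\<lambda>i. incl B (v i))"
    if v: "\<forall>j<s. v j \<in> carrier B" for v
  proof (cases "col_sq {..<s} (\<lambda>i. incl B (v i)) = 0")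
    case True
    \<comment> \<open>A column of norm 0 cannot be normalised; the crude bound shows that its image
      has norm 0 too.\<close>
    then show ?thesis using t0(2)[unfolded mat_bound_def, rule_format, of "\<lambda>j. incl B (v j)"] by simp
  next
    case False
    define c where "c = sqrt (col_sq {..<s} (\<lambda>i. incl B (v i)))"
    have c: "c > 0" "c\<^sup>2 = col_sq {..<s} (\<lambda>i. incl B (v i))"
      using False by (simp_all add: c_def less_le)
    define k where "k = complex_of_real (1 / c)"
    have sc: "incl B (k \<odot>\<^bsub>B\<^esub> v i) = (1 / c) *\<^sub>R incl B (v i)" if "i < s" for i
      using v that by (simp add: k_def incl_smult[OF B])
    have sq: "col_sq I (\<lambda>i. (1 / c) *\<^sub>R f i) = col_sq I f / c\<^sup>2" for I and f :: "nat \<Rightarrow> 'b universal"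
      using c(1) by (simp add: col_sq_def adj_scaleR power2_eq_square flip: scaleR_right.sum)
    have "col_sq {..<s} (\<lambda>i. incl B (k \<odot>\<^bsub>B\<^esub> v i)) = col_sq {..<s} (\<lambda>i. (1 / c) *\<^sub>R incl B (v i))"
      by (simp add: col_sq_def sc)
    also have "\<dots> = 1" using c False by (simp add: sq)
    finally have 1: "sqrt (col_sq {..<r} (\<lambda>i. \<Sum>j<s. M' i j * incl B (k \<odot>\<^bsub>B\<^esub> v j))) \<le> N"
      using v by (intro upper) simp_all
    have 2: "(\<Sum>j<s. M' i j * incl B (k \<odot>\<^bsub>B\<^esub> v j)) = (1 / c) *\<^sub>R (\<Sum>j<s. M' i j * incl B (v j))" for i
      by (simp add: sc scaleR_right.sum)
    from 1 have "sqrt (col_sq {..<r} (\<lambda>i. \<Sum>j<s. M' i j * incl B (v j)) / c\<^sup>2) \<le> N"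
      unfolding 2 sq .
    then have "col_sq {..<r} (\<lambda>i. \<Sum>j<s. M' i j * incl B (v j)) / c\<^sup>2 \<le> N\<^sup>2" by (rule sqrt_le_D)
    then have "col_sq {..<r} (\<lambda>i. \<Sum>j<s. M' i j * incl B (v j)) \<le> N\<^sup>2 * c\<^sup>2"
      using c(1) by (simp add: divide_le_eq)
    then show ?thesis unfolding c(2) .
  qed
  show "mat_bound {..<r} {..<s} M' (N\<^sup>2)"
    unfolding mat_bound_def
  proof
    fix v :: "nat \<Rightarrow> 'b universal"
    have "col_sq {..<r} (\<lambda>i. \<Sum>j<s. M' i j * v j) = col_sq {..<r} (\<lambda>i. \<Sum>j<s. M' i j * incl B (component B (v j)))"
      using M B by (simp add: col_sq_def M'_def incl_mult_component)
    also have "\<dots> \<le> N\<^sup>2 * col_sq {..<s} (\<lambda>i. incl B (component B (v i)))" using B by (intro carr) simp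
    also have "col_sq {..<s} (\<lambda>i. incl B (component B (v i))) \<le> col_sq {..<s} v"
    proof -
      have "(\<Sum>i<s. adj (incl B (component B (v i))) * incl B (component B (v i)))
          = incl B (component B (\<Sum>i<s. adj (v i) * v i))"
      proof (induction s)
        case 0 show ?case using B by (simp add: component_0)
      next
        case (Suc s)
        then show ?case using B
          by (simp add: component_add component_mult component_adj incl_add incl_mult incl_star)
      qed
      then show ?thesis using norm_component_le[OF B] B by (simp add: col_sq_def)
    qed
    finally show "col_sq {..<r} (\<lambda>i. \<Sum>j<s. M' i j * v j) \<le> N\<^sup>2 * col_sq {..<s} v"
      by (simp add: mult_left_mono)
  qed
qed

end


section \<open>Quotients and completions\<close>

lemma complex_moduleI:
  fixes V :: "(complex, 'v, 'm) module_scheme" (structure)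
  assumes "\<And>x y. \<lbrakk>x \<in> carrier V; y \<in> carrier V\<rbrakk> \<Longrightarrow> x \<oplus> y \<in> carrier V"
    and "\<zero> \<in> carrier V"
    and "\<And>x y z. \<lbrakk>x \<in> carrier V; y \<in> carrier V; z \<in> carrier V\<rbrakk> \<Longrightarrow> (x \<oplus> y) \<oplus> z = x \<oplus> (y \<oplus> z)"
    and "\<And>x y. \<lbrakk>x \<in> carrier V; y \<in> carrier V\<rbrakk> \<Longrightarrow> x \<oplus> y = y \<oplus> x"
    and "\<And>x. x \<in> carrier V \<Longrightarrow> \<zero> \<oplus> x = x"
    and "\<And>x. x \<in> carrier V \<Longrightarrow> \<exists>y\<in>carrier V. y \<oplus> x = \<zero>"
    and "\<And>c x. x \<in> carrier V \<Longrightarrow> c \<odot> x \<in> carrier V"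
    and "\<And>c d x. x \<in> carrier V \<Longrightarrow> (c + d) \<odot> x = c \<odot> x \<oplus> d \<odot> x"
    and "\<And>c x y. \<lbrakk>x \<in> carrier V; y \<in> carrier V\<rbrakk> \<Longrightarrow> c \<odot> (x \<oplus> y) = c \<odot> x \<oplus> c \<odot> y"
    and "\<And>c d x. x \<in> carrier V \<Longrightarrow> (c * d) \<odot> x = c \<odot> (d \<odot> x)"
    and "\<And>x. x \<in> carrier V \<Longrightarrow> 1 \<odot> x = x"
  shows "Module.module complex_ring V"
  by (intro Module.module.intro cring_complex_ring abelian_groupI module_axioms.intro)
    (simp_all add: assms(1-3) assms(5-11) | rule assms(4), assumption+)+

locale complex_module = Module.module complex_ring V
  for V :: "(complex, 'v, 'm) module_scheme" (structure)
begin

lemma smult_in [simp, intro]: "x \<in> carrier V \<Longrightarrow> c \<odot> x \<in> carrier V"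
  by (rule smult_closed) simp_all

lemma submodule_lin_span:
  assumes "S \<subseteq> carrier V" shows "submodule (lin_span V S) complex_ring V" "S \<subseteq> lin_span V S"
proof -
  show "S \<subseteq> lin_span V S" by (auto simp: lin_span_def)
  have c: "lin_span V S \<subseteq> carrier V"
    using carrier_is_submodule assms by (auto simp: lin_span_def)
  show "submodule (lin_span V S) complex_ring V"
  proof (rule submoduleI[OF c])
    show "\<zero> \<in> lin_span V S"
      unfolding lin_span_def using subgroup.one_closed submodule.axioms(1) by fastforce
    show "\<ominus> a \<in> lin_span V S" if "a \<in> lin_span V S" for a
      using that submoduleE(3) unfolding lin_span_def by blast
    show "a \<oplus> b \<in> lin_span V S" if "a \<in> lin_span V S" "b \<in> lin_span V S" for a b
      using that submoduleE(5) unfolding lin_span_def by blast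
    show "c \<odot> a \<in> lin_span V S" if "a \<in> lin_span V S" for c a
      using that submoduleE(4) unfolding lin_span_def by (auto simp: )
  qed
qed

lemma lin_span_least: "submodule H complex_ring V \<Longrightarrow> S \<subseteq> H \<Longrightarrow> lin_span V S \<subseteq> H"
  by (auto simp: lin_span_def)

end

text \<open>\<open>Q\<close> is described by equations for its module operations only, so that the
  locale covers both \<open>quotient_space\<close> and the algebraic Haagerup tensor product, whose
  norm is not a quotient norm.\<close>

locale module_quotient = complex_module V
  for V :: "(complex, 'v, 'm) module_scheme" (structure) +
  fixes N :: "'v set" and Q :: "(complex, 'v set, 'q) module_scheme"
  assumes N: "submodule N complex_ring V"
    and Q: "carrier Q = a_rcosets N" "\<zero>\<^bsub>Q\<^esub> = N" "\<And>X Y. X \<oplus>\<^bsub>Q\<^esub> Y = X <+> Y"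
      "\<And>c X. c \<odot>\<^bsub>Q\<^esub> X = N <+> ((\<lambda>x. c \<odot> x) ` X)"
begin

lemma N_subset: "N \<subseteq> carrier V" and N_zero [simp, intro]: "\<zero> \<in> N"
  and N_add [intro]: "\<lbrakk>x \<in> N; y \<in> N\<rbrakk> \<Longrightarrow> x \<oplus> y \<in> N" and N_minus [intro]: "x \<in> N \<Longrightarrow> \<ominus> x \<in> N"
  and N_smult [intro]: "x \<in> N \<Longrightarrow> c \<odot> x \<in> N"
  using submoduleE[OF N] subgroup.one_closed[OF submodule.axioms(1)[OF N]] by auto

lemma subgroup_N: "subgroup N (add_monoid V)"
  by (rule submodule.axioms(1)[OF N])

sublocale sub: abelian_subgroup N V
  by (rule abelian_subgroupI3) (auto intro!: additive_subgroup.intro subgroup_N abelian_group_axioms)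

abbreviation cls :: "'v \<Rightarrow> 'v set" where "cls x \<equiv> N +> x"

lemma mem_cls: "y \<in> cls x \<longleftrightarrow> (\<exists>h\<in>N. y = h \<oplus> x)"
  by (auto simp: a_r_coset_def')

lemma carrier_Q: "carrier Q = cls ` carrier V"
  unfolding Q(1) A_RCOSETS_def' by auto

lemma cls_carrier [simp, intro]: "x \<in> carrier V \<Longrightarrow> cls x \<in> carrier Q"
  by (simp add: carrier_Q)

lemma cls_add: "\<lbrakk>x \<in> carrier V; y \<in> carrier V\<rbrakk> \<Longrightarrow> cls x \<oplus>\<^bsub>Q\<^esub> cls y = cls (x \<oplus> y)"
  by (simp add: Q sub.a_rcos_sum)

lemma cls_zero: "cls \<zero> = \<zero>\<^bsub>Q\<^esub>"
  unfolding Q(2) by (rule a_coset_join2[OF _ subgroup_N]) auto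

lemma cls_smult: assumes x: "x \<in> carrier V" shows "c \<odot>\<^bsub>Q\<^esub> cls x = cls (c \<odot> x)"
proof
  show "c \<odot>\<^bsub>Q\<^esub> cls x \<subseteq> cls (c \<odot> x)"
  proof
    fix y assume "y \<in> c \<odot>\<^bsub>Q\<^esub> cls x"
    then obtain h k where hk: "h \<in> N" "k \<in> N" "y = h \<oplus> c \<odot> (k \<oplus> x)"
      by (auto simp: Q set_add_def' mem_cls)
    then have "y = (h \<oplus> c \<odot> k) \<oplus> c \<odot> x"
      using x N_subset by (subst hk(3), subst smult_r_distr) (auto simp: a_assoc subset_iff)
    moreover have "h \<oplus> c \<odot> k \<in> N" using hk by auto
    ultimately show "y \<in> cls (c \<odot> x)" unfolding mem_cls by blast
  qed
  show "cls (c \<odot> x) \<subseteq> c \<odot>\<^bsub>Q\<^esub> cls x"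
  proof
    fix y assume "y \<in> cls (c \<odot> x)"
    then obtain h where h: "h \<in> N" "y = h \<oplus> c \<odot> x" by (auto simp: mem_cls)
    have "x \<in> cls x" using x by (rule sub.a_rcos_self)
    then show "y \<in> c \<odot>\<^bsub>Q\<^esub> cls x" using h by (auto simp: Q set_add_def')
  qed
qed

lemma module_Q: "Module.module complex_ring Q"
proof (rule complex_moduleI)
  show "\<exists>Y\<in>carrier Q. Y \<oplus>\<^bsub>Q\<^esub> X = \<zero>\<^bsub>Q\<^esub>" if "X \<in> carrier Q" for X
  proof -
    obtain x where x: "x \<in> carrier V" "X = cls x" using \<open>X \<in> carrier Q\<close> by (auto simp: carrier_Q)
    then show ?thesis by (intro bexI[of _ "cls (\<ominus> x)"]) (simp_all add: cls_add l_neg cls_zero)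
  qed
qed (use smult_l_distr smult_r_distr smult_assoc1 smult_one in
    \<open>auto simp: carrier_Q cls_add cls_smult cls_zero[symmetric] a_ac\<close>)

lemma cls_eq_iff: "\<lbrakk>x \<in> carrier V; y \<in> carrier V\<rbrakk> \<Longrightarrow> cls x = cls y \<longleftrightarrow> x \<ominus> y \<in> N"
proof
  assume xy: "x \<in> carrier V" "y \<in> carrier V"
  show "x \<ominus> y \<in> N" if "cls x = cls y"
  proof -
    have "x \<in> cls y" using sub.a_rcos_self[OF xy(1)] that by simp
    then obtain h where h: "h \<in> N" "x = h \<oplus> y" by (auto simp: mem_cls)
    then have "x \<ominus> y = h" using xy N_subset by (auto simp: a_minus_def a_assoc r_neg)
    then show ?thesis using h by simp
  qed
  show "cls x = cls y" if "x \<ominus> y \<in> N"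
  proof (rule a_repr_independence[OF _ _ subgroup_N, symmetric])
    have "x = (x \<ominus> y) \<oplus> y" using xy by (simp add: a_minus_def a_assoc l_neg)
    then show "x \<in> cls y" unfolding mem_cls using that by blast
  qed (rule xy)
qed

lemma cls_uminus: "x \<in> carrier V \<Longrightarrow> \<ominus>\<^bsub>Q\<^esub> cls x = cls (\<ominus> x)"
proof -
  interpret Q: Module.module complex_ring Q by (rule module_Q)
  assume x: "x \<in> carrier V"
  then have "cls (\<ominus> x) \<oplus>\<^bsub>Q\<^esub> cls x = \<zero>\<^bsub>Q\<^esub>" by (simp add: cls_add l_neg cls_zero)
  then show ?thesis using x by (metis Q.minus_equality a_inv_closed cls_carrier)
qed

lemma cls_minus: "\<lbrakk>x \<in> carrier V; y \<in> carrier V\<rbrakk> \<Longrightarrow> cls x \<ominus>\<^bsub>Q\<^esub> cls y = cls (x \<ominus> y)"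
  by (simp add: a_minus_def cls_uminus cls_add)

end

locale seminorm_quotient = module_quotient V N Q + seminormed_module V "nrm V"
  for V :: "('v, 'm) nspace_scheme" (structure) and N and Q :: "('v set, 'q) nspace_scheme" +
  assumes Q_nrm: "nrm Q = (\<lambda>X. INF x\<in>X. nrm V x)"
begin

lemma cls_sub_carrier: "x \<in> carrier V \<Longrightarrow> y \<in> cls x \<Longrightarrow> y \<in> carrier V"
  using N_subset by (auto simp: mem_cls)

lemma nrm_bdd: "x \<in> carrier V \<Longrightarrow> bdd_below (nrm V ` cls x)"
  by (rule bdd_belowI[where m=0]) (auto simp: n_nonneg cls_sub_carrier)

lemma nrm_cls_le: "x \<in> carrier V \<Longrightarrow> y \<in> cls x \<Longrightarrow> nrm Q (cls x) \<le> nrm V y"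
  unfolding Q_nrm by (rule cINF_lower[OF nrm_bdd])

lemma nrm_cls_self: "x \<in> carrier V \<Longrightarrow> nrm Q (cls x) \<le> nrm V x"
  by (rule nrm_cls_le) (auto intro: sub.a_rcos_self)

lemma nrm_cls_approx:
  assumes x: "x \<in> carrier V" and "nrm Q (cls x) < t"
  obtains y where "y \<in> cls x" "y \<in> carrier V" "nrm V y < t"
proof -
  have "cls x \<noteq> {}" using sub.a_rcos_self[OF x] by auto
  then obtain y where "y \<in> cls x" "nrm V y < t"
    using assms(2) nrm_bdd[OF x] unfolding Q_nrm by (auto simp: cINF_less_iff)
  then show ?thesis using that cls_sub_carrier[OF x] by blast
qed

lemma nrm_cls_ge: "x \<in> carrier V \<Longrightarrow> (\<And>y. y \<in> cls x \<Longrightarrow> t \<le> nrm V y) \<Longrightarrow> t \<le> nrm Q (cls x)"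
  unfolding Q_nrm by (rule cINF_greatest) (use sub.a_rcos_self in auto)

lemma cls_of_mem: "x \<in> carrier V \<Longrightarrow> y \<in> cls x \<Longrightarrow> cls y = cls x"
  by (rule a_repr_independence[OF _ _ subgroup_N, symmetric])

lemma nrm_cls_smult_le: assumes x: "x \<in> carrier V" shows "nrm Q (cls (c \<odot> x)) \<le> cmod c * nrm Q (cls x)"
proof (cases "c = 0")
  case True
  then have e: "c \<odot> x = \<zero>" using x by simp
  have "nrm Q (cls \<zero>) \<le> nrm V \<zero>" by (rule nrm_cls_self) (rule zero_closed)
  then show ?thesis unfolding e using True by simp
next
  case False
  have "nrm Q (cls (c \<odot> x)) / cmod c \<le> nrm Q (cls x)"
  proof (rule nrm_cls_ge[OF x])
    fix y assume y: "y \<in> cls x"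
    have yc: "y \<in> carrier V" "cls y = cls x" by (rule cls_sub_carrier[OF x y], rule cls_of_mem[OF x y])
    have "cls (c \<odot> x) = cls (c \<odot> y)"
      unfolding cls_smult[OF x, symmetric] cls_smult[OF yc(1), symmetric] yc(2) ..
    then have "nrm Q (cls (c \<odot> x)) \<le> cmod c * nrm V y"
      using nrm_cls_self[of "c \<odot> y"] yc by (simp add: n_smult)
    then show "nrm Q (cls (c \<odot> x)) / cmod c \<le> nrm V y" using False by (simp add: divide_le_eq mult.commute)
  qed
  then show ?thesis using False by (simp add: divide_le_eq mult.commute)
qed

lemma seminormed_Q: "seminormed_module Q (nrm Q)"
proof (intro seminormed_module.intro module_Q seminormed_module_axioms.intro)
  fix X Y assume X: "X \<in> carrier Q"
  then obtain x where x: "x \<in> carrier V" "X = cls x" by (auto simp: carrier_Q)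
  show "0 \<le> nrm Q X" unfolding x(2)
    by (rule nrm_cls_ge[OF x(1)]) (rule n_nonneg[OF cls_sub_carrier[OF x(1)]])
  show "nrm Q (c \<odot>\<^bsub>Q\<^esub> X) = cmod c * nrm Q X" for c
  proof (rule antisym)
    show "nrm Q (c \<odot>\<^bsub>Q\<^esub> X) \<le> cmod c * nrm Q X" unfolding x(2) cls_smult[OF x(1)]
      by (rule nrm_cls_smult_le[OF x(1)])
    show "cmod c * nrm Q X \<le> nrm Q (c \<odot>\<^bsub>Q\<^esub> X)"
    proof (cases "c = 0")
      case True
      then show ?thesis unfolding x(2) cls_smult[OF x(1)]
        using nrm_cls_ge[of "c \<odot> x" 0] n_nonneg[OF cls_sub_carrier[of "c \<odot> x"]] x(1) by simp
    next
      case False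
      have "nrm Q (cls ((1 / c) \<odot> (c \<odot> x))) \<le> cmod (1 / c) * nrm Q (cls (c \<odot> x))"
        using x by (intro nrm_cls_smult_le) simp
      moreover have "(1 / c) \<odot> (c \<odot> x) = x" using x False smult_assoc1[of "1 / c" c x] smult_one by simp
      ultimately show ?thesis unfolding x(2) cls_smult[OF x(1)] using False
        by (simp add: norm_divide divide_simps mult.commute)
    qed
  qed
  assume "Y \<in> carrier Q"
  then obtain y where y: "y \<in> carrier V" "Y = cls y" by (auto simp: carrier_Q)
  show "nrm Q (X \<oplus>\<^bsub>Q\<^esub> Y) \<le> nrm Q X + nrm Q Y"
  proof (rule field_le_epsilon)
    fix \<epsilon> :: real assume e: "\<epsilon> > 0"
    have "nrm Q (cls x) < nrm Q X + \<epsilon> / 2" "nrm Q (cls y) < nrm Q Y + \<epsilon> / 2" using x y e by simp_all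
    note approx = nrm_cls_approx[OF x(1) this(1)] nrm_cls_approx[OF y(1) this(2)]
    obtain x' where x': "x' \<in> cls x" "x' \<in> carrier V" "nrm V x' < nrm Q X + \<epsilon> / 2"
      by (rule approx(1))
    obtain y' where y': "y' \<in> cls y" "y' \<in> carrier V" "nrm V y' < nrm Q Y + \<epsilon> / 2"
      by (rule approx(2))
    have "X \<oplus>\<^bsub>Q\<^esub> Y = cls (x' \<oplus> y')"
      unfolding cls_add[OF x'(2) y'(2), symmetric] cls_of_mem[OF x(1) x'(1)] cls_of_mem[OF y(1) y'(1)] x(2) y(2) ..
    then have "nrm Q (X \<oplus>\<^bsub>Q\<^esub> Y) \<le> nrm V (x' \<oplus> y')" using nrm_cls_self x' y' by simp
    also have "\<dots> \<le> nrm V x' + nrm V y'" using x' y' by (simp add: n_triangle)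
    finally show "nrm Q (X \<oplus>\<^bsub>Q\<^esub> Y) \<le> nrm Q X + nrm Q Y + \<epsilon>" using x' y' by simp
  qed
qed

end


text \<open>Equality in homogeneity follows by applying the inequality also to 1/c.\<close>

lemma seminormed_moduleI:
  fixes V :: "(complex, 'v, 'm) module_scheme" (structure)
  assumes V: "Module.module complex_ring V"
    and nonneg: "\<And>x. x \<in> carrier V \<Longrightarrow> 0 \<le> n x"
    and tri: "\<And>x y. \<lbrakk>x \<in> carrier V; y \<in> carrier V\<rbrakk> \<Longrightarrow> n (x \<oplus> y) \<le> n x + n y"
    and smult: "\<And>c x. x \<in> carrier V \<Longrightarrow> n (c \<odot> x) \<le> cmod c * n x"
  shows "seminormed_module V n"
proof (intro seminormed_module.intro V seminormed_module_axioms.intro nonneg tri)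
  interpret complex_module V by (rule complex_module.intro[OF V])
  fix c x assume x: "x \<in> carrier V"
  show "n (c \<odot> x) = cmod c * n x"
  proof (cases "c = 0")
    case True
    then show ?thesis using smult[OF x, of 0] nonneg[of "0 \<odot> x"] x by simp
  next
    case False
    have "n ((1 / c) \<odot> (c \<odot> x)) \<le> cmod (1 / c) * n (c \<odot> x)" using x by (intro smult) simp
    moreover have "(1 / c) \<odot> (c \<odot> x) = x" using x False smult_assoc1[of "1 / c" c x] smult_one by simp
    ultimately have "cmod c * n x \<le> n (c \<odot> x)"
      using False by (simp add: norm_divide divide_simps mult.commute)
    then show ?thesis using smult[OF x, of c] by simp
  qed
qed

locale normed_completion = normed_module V "nrm V" for V :: "('v, 'm) nspace_scheme" (structure)
begin

abbreviation "CS \<equiv> cauchy_space V"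

lemma CS_carrier: "s \<in> carrier CS \<longleftrightarrow>
    (\<forall>k. s k \<in> carrier V) \<and> (\<forall>\<epsilon>>0. \<exists>N. \<forall>i\<ge>N. \<forall>j\<ge>N. nrm V (s i \<ominus> s j) < \<epsilon>)"
  by (simp add: cauchy_space_def MCauchy_iff)

lemma CS_simps [simp]: "s \<oplus>\<^bsub>CS\<^esub> t = (\<lambda>n. s n \<oplus> t n)" "c \<odot>\<^bsub>CS\<^esub> s = (\<lambda>n. c \<odot> s n)" "\<zero>\<^bsub>CS\<^esub> = (\<lambda>_. \<zero>)"
    "nrm CS s = lim (\<lambda>n. nrm V (s n))"
  by (simp_all add: cauchy_space_def)

lemma CS_closed [simp]: "s \<in> carrier CS \<Longrightarrow> s k \<in> carrier V"
  by (simp add: CS_carrier)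

lemma CS_const [simp, intro]: "v \<in> carrier V \<Longrightarrow> (\<lambda>_. v) \<in> carrier CS"
  by (simp add: CS_carrier a_minus_def r_neg)

lemma CS_add: assumes s: "s \<in> carrier CS" and t: "t \<in> carrier CS" shows "(\<lambda>n. s n \<oplus> t n) \<in> carrier CS"
  unfolding CS_carrier
proof (intro conjI allI impI)
  show "s k \<oplus> t k \<in> carrier V" for k using s t by simp
  fix \<epsilon> :: real assume "\<epsilon> > 0"
  then have e: "\<epsilon> / 2 > 0" by simp
  obtain M where M: "\<forall>i\<ge>M. \<forall>j\<ge>M. nrm V (s i \<ominus> s j) < \<epsilon> / 2" using s e unfolding CS_carrier by blast
  obtain N where N: "\<forall>i\<ge>N. \<forall>j\<ge>N. nrm V (t i \<ominus> t j) < \<epsilon> / 2" using t e unfolding CS_carrier by blast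
  have "nrm V ((s i \<oplus> t i) \<ominus> (s j \<oplus> t j)) < \<epsilon>" if ij: "i \<ge> max M N" "j \<ge> max M N" for i j
  proof -
    have "nrm V ((s i \<oplus> t i) \<ominus> (s j \<oplus> t j)) \<le> nrm V (s i \<ominus> s j) + nrm V (t i \<ominus> t j)"
      using s t by (subst add_minus_add) (simp_all add: n_triangle)
    moreover have "nrm V (s i \<ominus> s j) < \<epsilon> / 2" "nrm V (t i \<ominus> t j) < \<epsilon> / 2" using M N ij by simp_all
    ultimately show ?thesis by simp
  qed
  then show "\<exists>N. \<forall>i\<ge>N. \<forall>j\<ge>N. nrm V ((s i \<oplus> t i) \<ominus> (s j \<oplus> t j)) < \<epsilon>" by blast
qed

lemma CS_smult: assumes s: "s \<in> carrier CS" shows "(\<lambda>n. c \<odot> s n) \<in> carrier CS"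
  unfolding CS_carrier
proof (intro conjI allI impI)
  show "c \<odot> s k \<in> carrier V" for k using s by simp
  fix \<epsilon> :: real assume e: "\<epsilon> > 0"
  have "cmod c + 1 > 0" by (simp add: add_nonneg_pos)
  then have "\<epsilon> / (cmod c + 1) > 0" using e by simp
  then obtain M where M: "\<forall>i\<ge>M. \<forall>j\<ge>M. nrm V (s i \<ominus> s j) < \<epsilon> / (cmod c + 1)"
    using s unfolding CS_carrier by blast
  have "nrm V (c \<odot> s i \<ominus> c \<odot> s j) < \<epsilon>" if ij: "i \<ge> M" "j \<ge> M" for i j
  proof -
    have "nrm V (c \<odot> s i \<ominus> c \<odot> s j) = cmod c * nrm V (s i \<ominus> s j)"
      using s by (simp add: n_smult flip: smult_minus)
    also have "\<dots> \<le> (cmod c + 1) * nrm V (s i \<ominus> s j)" using s by (intro mult_right_mono n_nonneg) simp_all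
    also have "\<dots> < (cmod c + 1) * (\<epsilon> / (cmod c + 1))"
      using M ij \<open>cmod c + 1 > 0\<close> by (intro mult_strict_left_mono) simp_all
    also have "\<dots> = \<epsilon>" using \<open>cmod c + 1 > 0\<close> by simp
    finally show ?thesis .
  qed
  then show "\<exists>N. \<forall>i\<ge>N. \<forall>j\<ge>N. nrm V (c \<odot> s i \<ominus> c \<odot> s j) < \<epsilon>" by blast
qed

lemma CS_nrm_convergent: assumes s: "s \<in> carrier CS" shows "(\<lambda>n. nrm V (s n)) \<longlonglongrightarrow> nrm CS s"
proof -
  have "Cauchy (\<lambda>n. nrm V (s n))"
    unfolding Cauchy_iff
  proof (intro allI impI)
    fix \<epsilon> :: real assume "\<epsilon> > 0"
    then obtain N where N: "\<forall>i\<ge>N. \<forall>j\<ge>N. nrm V (s i \<ominus> s j) < \<epsilon>" using s unfolding CS_carrier by blast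
    have "norm (nrm V (s i) - nrm V (s j)) < \<epsilon>" if "i \<ge> N" "j \<ge> N" for i j
      using n_diff_bound[of "s i" "s j"] N that s by (force intro: le_less_trans)
    then show "\<exists>M. \<forall>m\<ge>M. \<forall>n\<ge>M. norm (nrm V (s m) - nrm V (s n)) < \<epsilon>" by blast
  qed
  then show ?thesis by (simp add: Cauchy_convergent_iff convergent_LIMSEQ_iff)
qed

lemma module_CS: "Module.module complex_ring CS"
proof (rule complex_moduleI)
  show "\<exists>t\<in>carrier CS. t \<oplus>\<^bsub>CS\<^esub> s = \<zero>\<^bsub>CS\<^esub>" if s: "s \<in> carrier CS" for s
  proof (rule bexI[of _ "\<lambda>n. (- 1) \<odot> s n"])
    show "(\<lambda>n. (- 1) \<odot> s n) \<oplus>\<^bsub>CS\<^esub> s = \<zero>\<^bsub>CS\<^esub>"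
      using s by (simp add: fun_eq_iff l_neg flip: minus_eq_smult)
  qed (rule CS_smult[OF s])
qed (use smult_l_distr smult_r_distr smult_assoc1 smult_one in
    \<open>simp_all add: CS_add CS_smult fun_eq_iff a_ac\<close>)

lemma seminormed_CS: "seminormed_module CS (nrm CS)"
proof (rule seminormed_moduleI[OF module_CS])
  fix s assume s: "s \<in> carrier CS"
  show "0 \<le> nrm CS s"
    by (rule LIMSEQ_le_const[OF CS_nrm_convergent[OF s]]) (use s in \<open>simp add: n_nonneg\<close>)
  show "nrm CS (c \<odot>\<^bsub>CS\<^esub> s) \<le> cmod c * nrm CS s" for c
  proof -
    have "(\<lambda>n. cmod c * nrm V (s n)) \<longlonglongrightarrow> cmod c * nrm CS s"
      by (intro tendsto_mult_left CS_nrm_convergent s)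
    then have "(\<lambda>n. nrm V (c \<odot> s n)) \<longlonglongrightarrow> cmod c * nrm CS s" using s by (simp add: n_smult)
    then show ?thesis by (simp add: limI)
  qed
  fix t assume t: "t \<in> carrier CS"
  show "nrm CS (s \<oplus>\<^bsub>CS\<^esub> t) \<le> nrm CS s + nrm CS t"
  proof (rule LIMSEQ_le[OF CS_nrm_convergent tendsto_add[OF CS_nrm_convergent[OF s] CS_nrm_convergent[OF t]]])
    show "s \<oplus>\<^bsub>CS\<^esub> t \<in> carrier CS" using CS_add[OF s t] by simp
    show "\<exists>N. \<forall>n\<ge>N. nrm V ((s \<oplus>\<^bsub>CS\<^esub> t) n) \<le> nrm V (s n) + nrm V (t n)"
      using s t by (simp add: n_triangle)
  qed
qed

lemma submodule_null: "submodule (null_sequences V) complex_ring CS"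
proof -
  interpret CS: seminormed_module CS "nrm CS" by (rule seminormed_CS)
  have sm: "(\<lambda>n. c \<odot> s n) \<in> null_sequences V" if s: "s \<in> null_sequences V" for c s
  proof -
    have "s \<in> carrier CS" "(\<lambda>n. nrm V (s n)) \<longlonglongrightarrow> 0" using s by (auto simp: null_sequences_def)
    moreover from this have "(\<lambda>n. cmod c * nrm V (s n)) \<longlonglongrightarrow> cmod c * 0" by (intro tendsto_mult_left)
    ultimately show ?thesis by (simp add: null_sequences_def CS_smult n_smult)
  qed
  show ?thesis
  proof (rule CS.submoduleI)
    show "null_sequences V \<subseteq> carrier CS" by (auto simp: null_sequences_def)
    show "\<zero>\<^bsub>CS\<^esub> \<in> null_sequences V" by (simp add: null_sequences_def)
    show "c \<odot>\<^bsub>CS\<^esub> s \<in> null_sequences V" if "s \<in> null_sequences V" for c s using sm[OF that] by simp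
    show "\<ominus>\<^bsub>CS\<^esub> s \<in> null_sequences V" if s: "s \<in> null_sequences V" for s
    proof -
      have "s \<in> carrier CS" using s by (simp add: null_sequences_def)
      then have "\<ominus>\<^bsub>CS\<^esub> s = (\<lambda>n. (- 1) \<odot> s n)" by (simp add: CS.minus_eq_smult)
      then show ?thesis using sm[OF s] by simp
    qed
    fix s t assume "s \<in> null_sequences V" "t \<in> null_sequences V"
    then have st: "s \<in> carrier CS" "t \<in> carrier CS" "(\<lambda>n. nrm V (s n)) \<longlonglongrightarrow> 0" "(\<lambda>n. nrm V (t n)) \<longlonglongrightarrow> 0"
      by (auto simp: null_sequences_def)
    have lim: "(\<lambda>n. nrm V (s n) + nrm V (t n)) \<longlonglongrightarrow> 0 + 0" by (intro tendsto_add st)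
    have "(\<lambda>n. nrm V (s n \<oplus> t n)) \<longlonglongrightarrow> 0"
    proof (rule Lim_null_comparison[OF always_eventually], rule allI)
      show "norm (nrm V (s n \<oplus> t n)) \<le> nrm V (s n) + nrm V (t n)" for n
        using st by (simp add: n_nonneg n_triangle)
    qed (use lim in simp)
    then show "s \<oplus>\<^bsub>CS\<^esub> t \<in> null_sequences V" using st by (simp add: null_sequences_def CS_add)
  qed
qed

sublocale comp: seminorm_quotient CS "null_sequences V" "Defs.completion V"
proof -
  interpret CS: seminormed_module CS "nrm CS" by (rule seminormed_CS)
  show "seminorm_quotient CS (null_sequences V) (Defs.completion V)"
    by (intro seminorm_quotient.intro seminormed_CS module_quotient.intro complex_module.intro module_CS
        module_quotient_axioms.intro seminorm_quotient_axioms.intro submodule_null)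
      (simp_all add: Defs.completion_def quotient_space_def)
qed

text \<open>Adding a null sequence does not change the limit of the norms, so the infimum over the
  coset is taken over a constant.\<close>

lemma nrm_comp_cls: assumes s: "s \<in> carrier CS" shows "nrm (Defs.completion V) (comp.cls s) = nrm CS s"
proof (rule antisym[OF comp.nrm_cls_self[OF s]], rule comp.nrm_cls_ge[OF s])
  fix t assume t: "t \<in> comp.cls s"
  obtain h where h: "h \<in> null_sequences V" "t = h \<oplus>\<^bsub>CS\<^esub> s"
    by (rule bexE[OF t[unfolded comp.mem_cls]])
  have hc: "h \<in> carrier CS" "(\<lambda>n. nrm V (h n)) \<longlonglongrightarrow> 0"
    using h(1) unfolding null_sequences_def by simp_all
  have "(\<lambda>n. nrm V (h n \<oplus> s n) - nrm V (s n)) \<longlonglongrightarrow> 0"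
  proof (rule Lim_null_comparison[OF always_eventually hc(2)], rule allI)
    fix n
    have "(h n \<oplus> s n) \<ominus> s n = h n" using hc s by (simp add: a_minus_def a_assoc r_neg)
    then show "norm (nrm V (h n \<oplus> s n) - nrm V (s n)) \<le> nrm V (h n)"
      using n_diff_bound[of "h n \<oplus> s n" "s n"] hc s by simp
  qed
  then have "(\<lambda>n. nrm V (h n \<oplus> s n) - nrm V (s n) + nrm V (s n)) \<longlonglongrightarrow> 0 + nrm CS s"
    by (intro tendsto_add CS_nrm_convergent s)
  then have "nrm CS t = nrm CS s" unfolding h(2) by (simp add: limI)
  then show "nrm CS s \<le> nrm CS t" by simp
qed

lemma normed_completion: "normed_module (Defs.completion V) (nrm (Defs.completion V))"
proof (intro normed_module.intro comp.seminormed_Q normed_module_axioms.intro)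
  fix X assume X: "X \<in> carrier (Defs.completion V)" "nrm (Defs.completion V) X = 0"
  then obtain s where s: "s \<in> carrier CS" "X = comp.cls s" unfolding comp.carrier_Q by blast
  have "nrm CS s = 0" using X(2) unfolding s(2) nrm_comp_cls[OF s(1)] .
  then have "(\<lambda>n. nrm V (s n)) \<longlonglongrightarrow> 0" using CS_nrm_convergent[OF s(1)] by simp
  then have null: "s \<in> null_sequences V" unfolding null_sequences_def using s(1) by simp
  have "comp.cls s = null_sequences V" by (rule comp.a_coset_join2[OF s(1) comp.subgroup_N null])
  then show "X = \<zero>\<^bsub>Defs.completion V\<^esub>" unfolding s(2) comp.Q(2) .
qed

lemma to_completion_cls: "to_completion V v = comp.cls (\<lambda>_. v)"
  by (simp add: to_completion_def)

lemma to_completion_closed [simp, intro]: "v \<in> carrier V \<Longrightarrow> to_completion V v \<in> carrier (Defs.completion V)"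
  unfolding to_completion_cls by (rule comp.cls_carrier[OF CS_const])

lemma to_completion_add: "\<lbrakk>v \<in> carrier V; w \<in> carrier V\<rbrakk> \<Longrightarrow>
    to_completion V (v \<oplus> w) = to_completion V v \<oplus>\<^bsub>Defs.completion V\<^esub> to_completion V w"
  unfolding to_completion_cls by (subst comp.cls_add) simp_all

lemma to_completion_smult: "v \<in> carrier V \<Longrightarrow>
    to_completion V (c \<odot> v) = c \<odot>\<^bsub>Defs.completion V\<^esub> to_completion V v"
  unfolding to_completion_cls by (subst comp.cls_smult) simp_all

lemma nrm_to_completion: "v \<in> carrier V \<Longrightarrow> nrm (Defs.completion V) (to_completion V v) = nrm V v"
  unfolding to_completion_cls by (subst nrm_comp_cls) (simp_all add: limI)

text \<open>A late term of a representing Cauchy sequence, taken as a constant sequence, is close to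
  the class.\<close>

lemma to_completion_dense:
  assumes X: "X \<in> carrier (Defs.completion V)" and e: "\<epsilon> > 0"
  obtains v where "v \<in> carrier V" "nrm (Defs.completion V) (X \<ominus>\<^bsub>Defs.completion V\<^esub> to_completion V v) < \<epsilon>"
proof -
  obtain s where s: "s \<in> carrier CS" "X = comp.cls s" using X unfolding comp.carrier_Q by blast
  have "\<epsilon> / 2 > 0" using e by simp
  then obtain N where N: "\<forall>i\<ge>N. \<forall>j\<ge>N. nrm V (s i \<ominus> s j) < \<epsilon> / 2" using s unfolding CS_carrier by blast
  have m: "(s \<ominus>\<^bsub>CS\<^esub> (\<lambda>_. s N)) = (\<lambda>n. s n \<ominus> s N)"
    unfolding a_minus_def using s by (simp add: comp.minus_eq_smult[OF CS_const] minus_eq_smult)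
  have mc: "(\<lambda>n. s n \<ominus> s N) \<in> carrier CS"
    unfolding m[symmetric] by (rule comp.minus_closed) (use s in auto)
  have "X \<ominus>\<^bsub>Defs.completion V\<^esub> to_completion V (s N) = comp.cls (\<lambda>n. s n \<ominus> s N)"
    unfolding to_completion_cls s(2) m[symmetric] by (rule comp.cls_minus) (use s in auto)
  then have "nrm (Defs.completion V) (X \<ominus>\<^bsub>Defs.completion V\<^esub> to_completion V (s N)) = nrm CS (\<lambda>n. s n \<ominus> s N)"
    using nrm_comp_cls[OF mc] by simp
  also have "\<dots> \<le> \<epsilon> / 2"
    by (rule LIMSEQ_le_const2[OF CS_nrm_convergent[OF mc]]) (use N in \<open>auto intro!: exI[of _ N] less_imp_le\<close>)
  also have "\<dots> < \<epsilon>" using e by simp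
  finally show ?thesis using that[of "s N"] s by simp
qed

end

context normed_module
begin

lemma submodule_closure:
  assumes S: "submodule S complex_ring V"
  shows "submodule (metric.mtopology closure_of S) complex_ring V"
proof -
  interpret complex_module V by (rule complex_module.intro) unfold_locales
  note SE = submoduleE[OF S]
  have sm: "c \<odot> x \<in> metric.mtopology closure_of S" if x: "x \<in> metric.mtopology closure_of S" for c x
    unfolding closure_iff
  proof (intro conjI allI impI)
    have xc: "x \<in> carrier V" using x by (simp add: closure_iff)
    then show "c \<odot> x \<in> carrier V" by simp
    fix \<epsilon> :: real assume e: "\<epsilon> > 0"
    have p: "cmod c + 1 > 0" by (simp add: add_nonneg_pos)
    then have "\<epsilon> / (cmod c + 1) > 0" using e by simp
    then obtain y where y: "y \<in> S" "y \<in> carrier V" "n (x \<ominus> y) < \<epsilon> / (cmod c + 1)"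
      using x unfolding closure_iff by blast
    have "n (c \<odot> x \<ominus> c \<odot> y) = cmod c * n (x \<ominus> y)" using xc y by (simp add: n_smult flip: smult_minus)
    also have "\<dots> \<le> (cmod c + 1) * n (x \<ominus> y)" using xc y by (intro mult_right_mono n_nonneg) simp_all
    also have "\<dots> < \<epsilon>" using y(3) p by (simp add: pos_less_divide_eq mult.commute)
    finally show "\<exists>y\<in>S. y \<in> carrier V \<and> n (c \<odot> x \<ominus> y) < \<epsilon>"
      using y SE(4) by (intro bexI[of _ "c \<odot> y"]) simp_all
  qed
  show ?thesis
  proof (rule submoduleI)
    show "metric.mtopology closure_of S \<subseteq> carrier V" by (auto simp: closure_iff)
    have "\<zero> \<in> S" by (rule subgroup.one_closed[OF submodule.axioms(1)[OF S], simplified])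
    then show "\<zero> \<in> metric.mtopology closure_of S" by (auto simp: closure_iff a_minus_def n_uminus intro!: bexI[of _ \<zero>])
    show "c \<odot> x \<in> metric.mtopology closure_of S" if "x \<in> metric.mtopology closure_of S" for c x
      by (rule sm[OF that])
    show "\<ominus> x \<in> metric.mtopology closure_of S" if x: "x \<in> metric.mtopology closure_of S" for x
      using sm[OF x, of "- 1"] x by (simp add: minus_eq_smult closure_iff)
    fix x y assume xy: "x \<in> metric.mtopology closure_of S" "y \<in> metric.mtopology closure_of S"
    have xyc: "x \<in> carrier V" "y \<in> carrier V" using xy by (auto simp: closure_iff)
    show "x \<oplus> y \<in> metric.mtopology closure_of S"
      unfolding closure_iff
    proof (intro conjI allI impI)
      show "x \<oplus> y \<in> carrier V" using xyc by simp
      fix \<epsilon> :: real assume "\<epsilon> > 0"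
      then have e: "\<epsilon> / 2 > 0" by simp
      obtain x' where x': "x' \<in> S" "x' \<in> carrier V" "n (x \<ominus> x') < \<epsilon> / 2" using xy(1) e unfolding closure_iff by blast
      obtain y' where y': "y' \<in> S" "y' \<in> carrier V" "n (y \<ominus> y') < \<epsilon> / 2" using xy(2) e unfolding closure_iff by blast
      have "n ((x \<oplus> y) \<ominus> (x' \<oplus> y')) \<le> n (x \<ominus> x') + n (y \<ominus> y')"
        using xyc x' y' by (subst add_minus_add) (simp_all add: n_triangle)
      then show "\<exists>z\<in>S. z \<in> carrier V \<and> n (x \<oplus> y \<ominus> z) < \<epsilon>"
        using x' y' SE(5) by (intro bexI[of _ "x' \<oplus> y'"]) simp_all
    qed
  qed
qed

end


section \<open>The Haagerup tensor product\<close>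

text \<open>Scalars as a C*-algebra, so that complex-valued bilinear forms fall under the same
  linear extension as the multiplication of \<open>C\<close>.\<close>

instantiation complex :: cstar_alg
begin

definition "adj z = cnj z"
definition "imul z = \<i> * z"

instance
  by standard (simp_all add: adj_complex_def imul_complex_def norm_mult power2_eq_square
      scaleR_conv_of_real algebra_simps)

end

section \<open>Complex scalars and separating functionals\<close>

definition csc :: "complex \<Rightarrow> 'd::cstar_alg \<Rightarrow> 'd"
  where "csc z w = Re z *\<^sub>R w + Im z *\<^sub>R imul w"

lemma csc_add_left: "csc (a + b) w = csc a w + csc b w"
  by (simp add: csc_def scaleR_add_left)

lemma linear_csc: "linear (csc a)"
  by (rule linearI) (simp_all add: csc_def imul_add imul_scaleR scaleR_add_right mult.commute)

lemmas csc_sum = linear_sum[OF linear_csc]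
  and csc_0_right [simp] = linear_0[OF linear_csc]

lemma csc_0_left [simp]: "csc 0 w = 0" and csc_1 [simp]: "csc 1 w = w"
  and csc_of_real: "csc (of_real r) w = r *\<^sub>R w"
  by (simp_all add: csc_def)

lemma csc_mult: "csc (a * b) w = csc a (csc b w)"
  by (simp add: csc_def imul_add imul_diff imul_minus imul_scaleR algebra_simps)

lemma csc_times_left: "csc a v * w = csc a (v * w)" and csc_times_right: "v * csc a w = csc a (v * w)"
  by (simp_all add: csc_def distrib_left distrib_right imul_mult_left imul_mult_right)

lemma adj_csc: "adj (csc a w) = csc (cnj a) (adj w)"
  by (simp add: csc_def adj_add adj_scaleR adj_imul)

lemma csc_complex: "csc a (b :: complex) = a * b"
  by (simp add: csc_def imul_complex_def complex_eq_iff)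

lemma adj_csc_mult: "adj (csc a v) * csc a v = (cmod a)\<^sup>2 *\<^sub>R (adj v * v)"
proof -
  have "a * cnj a = of_real ((cmod a)\<^sup>2)" by (simp only: complex_norm_square)
  then show ?thesis
    by (simp only: adj_csc csc_times_left csc_times_right csc_mult[symmetric] csc_of_real)
qed

text \<open>The scalars form a column. If z is the sum, \<open>z * adj z\<close> is the row x
  applied to the column of the \<open>csc (c k) (adj z)\<close>, so \<open>row_times_columns\<close>
  applies and a factor \<open>(norm z)\<^sup>2\<close> cancels.\<close>

lemma norm_csc_sum:
  "(norm (\<Sum>k\<in>P. csc (c k) (x k)))\<^sup>2 \<le> norm (\<Sum>k\<in>P. x k * adj (x k)) * (\<Sum>k\<in>P. (cmod (c k))\<^sup>2)"
proof -
  define z where "z = (\<Sum>k\<in>P. csc (c k) (x k))"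
  have nz: "norm (z * adj z) = (norm z)\<^sup>2" using cstar_norm[of "adj z"] by simp
  have e: "(\<Sum>k\<in>P. x k * csc (c k) (adj z)) = z * adj z"
    by (simp add: z_def sum_distrib_right csc_times_left csc_times_right)
  have "col_sq {()} (\<lambda>i. \<Sum>k\<in>P. x k * csc (c k) (adj z))
      \<le> norm (\<Sum>k\<in>P. x k * adj (x k)) * col_sq (P \<times> {()}) (\<lambda>(k, i). csc (c k) (adj z))"
    by (rule row_times_columns)
  moreover have "col_sq {()} (\<lambda>i. \<Sum>k\<in>P. x k * csc (c k) (adj z)) = ((norm z)\<^sup>2)\<^sup>2"
    unfolding e by (simp add: col_sq_def cstar_norm nz)
  moreover have "col_sq (P \<times> {()}) (\<lambda>(k, i). csc (c k) (adj z)) = (\<Sum>k\<in>P. (cmod (c k))\<^sup>2) * (norm z)\<^sup>2"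
  proof -
    have "(\<Sum>p\<in>P \<times> {()}. adj (case p of (k, i) \<Rightarrow> csc (c k) (adj z)) * (case p of (k, i) \<Rightarrow> csc (c k) (adj z)))
        = (\<Sum>k\<in>P. \<Sum>i\<in>{()}. (cmod (c k))\<^sup>2 *\<^sub>R (z * adj z))"
      unfolding sum.cartesian_product split_def adj_csc_mult adj_adj ..
    then show ?thesis by (simp add: col_sq_def nz sum_nonneg flip: scaleR_left.sum)
  qed
  ultimately have "((norm z)\<^sup>2)\<^sup>2 \<le> (norm (\<Sum>k\<in>P. x k * adj (x k)) * (\<Sum>k\<in>P. (cmod (c k))\<^sup>2)) * (norm z)\<^sup>2"
    by simp
  then have "(norm z)\<^sup>2 \<le> norm (\<Sum>k\<in>P. x k * adj (x k)) * (\<Sum>k\<in>P. (cmod (c k))\<^sup>2)"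
    by (rule square_le_cancel) (simp_all add: sum_nonneg)
  then show ?thesis by (simp add: z_def)
qed

lemma hahn_banach_ex:
  "\<exists>f :: 'd::real_normed_vector \<Rightarrow> real. linear f \<and> (\<forall>v. \<bar>f v\<bar> \<le> norm v) \<and> f x = norm x"
  by (rule hahn_banach_norm[of x]) blast

text \<open>The complex-linear functional with real part \<open>f\<close>.\<close>

definition cfun :: "('d::cstar_alg \<Rightarrow> real) \<Rightarrow> 'd \<Rightarrow> complex"
  where "cfun f w = Complex (f w) (- f (imul w))"

context
  fixes f :: "'d::cstar_alg \<Rightarrow> real"
  assumes f: "linear f" "\<And>v. \<bar>f v\<bar> \<le> norm v"
begin

lemma cfun_add: "cfun f (v + w) = cfun f v + cfun f w"
  by (simp add: cfun_def complex_eq_iff imul_add linear_add[OF f(1)])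

lemma cfun_csc: "cfun f (csc c w) = c * cfun f w"
  by (simp add: cfun_def complex_eq_iff csc_def imul_add imul_scaleR
      linear_add[OF f(1)] linear_diff[OF f(1)] linear_scale[OF f(1)] linear_neg[OF f(1)])

lemma cfun_0: "cfun f 0 = 0"
  using cfun_csc[of 0 0] by simp

lemma cfun_sum: "cfun f (sum g P) = (\<Sum>k\<in>P. cfun f (g k))"
  by (induction P rule: infinite_finite_induct) (simp_all add: cfun_0 cfun_add)

text \<open>Real and imaginary parts are estimated separately; the factor 2 is harmless, since later
  only the vanishing of functionals on tensors of norm 0 is drawn from it.\<close>

lemma cfun_norm: "cmod (cfun f w) \<le> 2 * norm w"
  using cmod_le[of "cfun f w"] f(2)[of w] f(2)[of "imul w"] by (simp add: cfun_def norm_imul)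

text \<open>Duality: with the conjugates of the values as coefficients, the functional applied to
  the combination z returns the sum of squares S, so S \<le> 2 \<open>norm z\<close> and S^2 \<le> 4
  X S.\<close>

lemma cfun_square_sum:
  assumes X: "0 \<le> X" "\<And>c. (norm (\<Sum>k\<in>P. csc (c k) (x k)))\<^sup>2 \<le> X * (\<Sum>k\<in>P. (cmod (c k))\<^sup>2)"
  shows "(\<Sum>k\<in>P. (cmod (cfun f (x k)))\<^sup>2) \<le> 4 * X"
proof -
  define S where "S = (\<Sum>k\<in>P. (cmod (cfun f (x k)))\<^sup>2)"
  have S: "0 \<le> S" by (simp add: S_def sum_nonneg)
  define z where "z = (\<Sum>k\<in>P. csc (cnj (cfun f (x k))) (x k))"
  have "cfun f z = (\<Sum>k\<in>P. of_real ((cmod (cfun f (x k)))\<^sup>2))"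
    unfolding z_def cfun_sum cfun_csc by (intro sum.cong refl) (simp only: complex_norm_square mult.commute)
  then have "cfun f z = of_real S" by (simp add: S_def)
  then have "S \<le> 2 * norm z" using cfun_norm[of z] S by simp
  then have "S\<^sup>2 \<le> (2 * norm z)\<^sup>2" using S by (intro power_mono)
  also have "\<dots> = 4 * (norm z)\<^sup>2" by (simp add: power_mult_distrib)
  also have "\<dots> \<le> 4 * (X * S)"
    using X(2)[of "\<lambda>k. cnj (cfun f (x k))"] unfolding z_def S_def by simp
  finally have "S\<^sup>2 \<le> (4 * X) * S" by simp
  then have "S \<le> 4 * X" by (rule square_le_cancel) (use S X in auto)
  then show ?thesis by (simp add: S_def)
qed

lemma cfun_row: "(\<Sum>k\<in>P. (cmod (cfun f (x k)))\<^sup>2) \<le> 4 * norm (\<Sum>k\<in>P. x k * adj (x k))"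
  by (rule cfun_square_sum) (simp_all add: norm_csc_sum)

lemma cfun_column: "(\<Sum>k\<in>P. (cmod (cfun f (x k)))\<^sup>2) \<le> 4 * norm (\<Sum>k\<in>P. adj (x k) * x k)"
proof (rule cfun_square_sum)
  fix c
  have "norm (\<Sum>k\<in>P. csc (c k) (x k)) = norm (adj (\<Sum>k\<in>P. csc (c k) (x k)))" by simp
  also have "adj (\<Sum>k\<in>P. csc (c k) (x k)) = (\<Sum>k\<in>P. csc (cnj (c k)) (adj (x k)))"
    by (simp only: adj_sum adj_csc)
  finally show "(norm (\<Sum>k\<in>P. csc (c k) (x k)))\<^sup>2 \<le> norm (\<Sum>k\<in>P. adj (x k) * x k) * (\<Sum>k\<in>P. (cmod (c k))\<^sup>2)"
    using norm_csc_sum[of "\<lambda>k. cnj (c k)" "\<lambda>k. adj (x k)" P] by simp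
qed simp

end

lemma incl_csc: "cstar_algebra A \<Longrightarrow> x \<in> carrier A \<Longrightarrow> incl A (c \<odot>\<^bsub>A\<^esub> x) = csc c (incl A x)"
  by (simp add: csc_def incl_smult)

definition lin_extend :: "('x \<Rightarrow> 'y \<Rightarrow> 'd) \<Rightarrow> (('x \<times> 'y) \<Rightarrow>\<^sub>0 complex) \<Rightarrow> 'd::cstar_alg"
  where "lin_extend b u = (\<Sum>k\<in>Poly_Mapping.keys u. csc (Poly_Mapping.lookup u k) (b (fst k) (snd k)))"

lemma lin_extend_superset:
  "finite K \<Longrightarrow> Poly_Mapping.keys u \<subseteq> K \<Longrightarrow>
    lin_extend b u = (\<Sum>k\<in>K. csc (Poly_Mapping.lookup u k) (b (fst k) (snd k)))"
  unfolding lin_extend_def by (rule sum.mono_neutral_left) (auto simp: in_keys_iff)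

lemma lin_extend_add: "lin_extend b (u + v) = lin_extend b u + lin_extend b v"
proof -
  let ?K = "Poly_Mapping.keys u \<union> Poly_Mapping.keys v"
  have k: "Poly_Mapping.keys (u + v) \<subseteq> ?K" by (rule Poly_Mapping.keys_add)
  show ?thesis
    by (simp add: lin_extend_superset[OF _ k] lin_extend_superset[of ?K u] lin_extend_superset[of ?K v]
        lookup_add csc_add_left sum.distrib)
qed

lemma lookup_scale: "Poly_Mapping.lookup (Poly_Mapping.map ((*) c) u) k = c * Poly_Mapping.lookup u (k :: 'k) "
  for c :: complex
  by (simp add: Poly_Mapping.map.rep_eq when_def)

lemma lin_extend_scale: "lin_extend b (Poly_Mapping.map ((*) c) u) = csc c (lin_extend b u)"
proof -
  have k: "Poly_Mapping.keys (Poly_Mapping.map ((*) c) u) \<subseteq> Poly_Mapping.keys u"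
    by (auto simp: in_keys_iff lookup_scale)
  show ?thesis
    unfolding lin_extend_superset[OF finite_keys k] lin_extend_def[of b u] lookup_scale csc_mult csc_sum ..
qed

lemma lin_extend_0 [simp]: "lin_extend b 0 = 0"
  by (simp add: lin_extend_def)

lemma lin_extend_diff: "lin_extend b (u - v) = lin_extend b u - lin_extend b v"
  using lin_extend_add[of b "u - v" v] by simp

lemma lin_extend_sum: "lin_extend b (sum g P) = (\<Sum>k\<in>P. lin_extend b (g k))"
  by (induction P rule: infinite_finite_induct) (simp_all add: lin_extend_add)

lemma lin_extend_pair [simp]: "lin_extend b (pair x y) = b x y"
  by (simp add: lin_extend_def pair_def)

definition cat :: "nat \<Rightarrow> (nat \<Rightarrow> 'z) \<Rightarrow> (nat \<Rightarrow> 'z) \<Rightarrow> nat \<Rightarrow> 'z"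
  where "cat p x x' k = (if k < p then x k else x' (k - p))"

lemma sum_cat:
  "(\<Sum>k<p + q. g (cat p x x' k) (cat p y y' k)) = (\<Sum>k<p. g (x k) (y k)) + (\<Sum>k<q. g (x' k) (y' k))"
  for g :: "'x \<Rightarrow> 'y \<Rightarrow> 'z::comm_monoid_add"
  by (induction q) (auto simp: cat_def add.assoc intro!: sum.cong)

locale haagerup = X: cstar_algebra X + Y: cstar_algebra Y for X :: "'x cstar" and Y :: "'y cstar"
begin

abbreviation "FS \<equiv> free_space X Y"
abbreviation "N0 \<equiv> lin_span FS (bilinear_relations X Y)"
abbreviation "H0 \<equiv> haagerup_algebraic X Y"

lemma FS_carrier: "u \<in> carrier FS \<longleftrightarrow> (\<forall>k. Poly_Mapping.lookup u k \<noteq> 0 \<longrightarrow> k \<in> carrier X \<times> carrier Y)"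
  by (auto simp: free_space_def in_keys_iff subset_iff)

lemma FS_simps [simp]: "\<zero>\<^bsub>FS\<^esub> = 0" "u \<oplus>\<^bsub>FS\<^esub> v = u + v" "c \<odot>\<^bsub>FS\<^esub> u = Poly_Mapping.map ((*) c) u"
  by (simp_all add: free_space_def)

lemma FS_0 [simp]: "0 \<in> carrier FS" by (simp add: FS_carrier)

lemma FS_add [simp, intro]: "\<lbrakk>u \<in> carrier FS; v \<in> carrier FS\<rbrakk> \<Longrightarrow> u + v \<in> carrier FS"
  unfolding free_space_def using Poly_Mapping.keys_add[of u v] by auto

lemma FS_scale [simp, intro]: "u \<in> carrier FS \<Longrightarrow> Poly_Mapping.map ((*) c) u \<in> carrier FS"
  unfolding FS_carrier by (auto simp: lookup_scale)

lemma FS_pair [simp, intro]: "\<lbrakk>x \<in> carrier X; y \<in> carrier Y\<rbrakk> \<Longrightarrow> pair x y \<in> carrier FS"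
  unfolding FS_carrier by (auto simp: pair_def lookup_single when_def split: if_splits)

lemma FS_sum [intro]: "(\<And>k. k \<in> P \<Longrightarrow> g k \<in> carrier FS) \<Longrightarrow> sum g P \<in> carrier FS"
  by (induction P rule: infinite_finite_induct) simp_all

lemma FS_diff [simp, intro]: "\<lbrakk>u \<in> carrier FS; v \<in> carrier FS\<rbrakk> \<Longrightarrow> u - v \<in> carrier FS"
  unfolding free_space_def using Poly_Mapping.keys_diff[of u v] by auto

lemma module_FS: "Module.module complex_ring FS"
proof (rule complex_moduleI)
  show "\<exists>y\<in>carrier FS. y \<oplus>\<^bsub>FS\<^esub> x = \<zero>\<^bsub>FS\<^esub>" if "x \<in> carrier FS" for x
    by (rule bexI[of _ "0 - x"]) (use that FS_diff[OF FS_0] in simp_all)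
qed (auto intro!: poly_mapping_eqI simp: lookup_scale lookup_add algebra_simps)

sublocale complex_module FS by (rule complex_module.intro) (rule module_FS)

lemma FS_minus: "\<lbrakk>u \<in> carrier FS; v \<in> carrier FS\<rbrakk> \<Longrightarrow> u \<ominus>\<^bsub>FS\<^esub> v = u - v"
proof -
  assume uv: "u \<in> carrier FS" "v \<in> carrier FS"
  have "\<ominus>\<^bsub>FS\<^esub> v = 0 - v" by (rule minus_equality) (use uv FS_diff[OF FS_0] in simp_all)
  then show ?thesis by (simp add: a_minus_def)
qed

lemma relations_subset: "bilinear_relations X Y \<subseteq> carrier FS"
  unfolding bilinear_relations_def by (safe; intro FS_diff FS_pair FS_scale; simp)

sublocale tens: module_quotient FS N0 H0
proof (rule module_quotient.intro[OF complex_module_axioms module_quotient_axioms.intro])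
  show "submodule N0 complex_ring FS" by (rule submodule_lin_span(1)[OF relations_subset])
qed (simp_all only: haagerup_algebraic_def quotient_space_def nspace.simps partial_object.simps
    monoid.simps ring.simps module.simps nspace.update_convs)

lemma relation_mem: "u \<in> bilinear_relations X Y \<Longrightarrow> u \<in> N0"
  using submodule_lin_span(2)[OF relations_subset] by blast

lemma cls_plus: "\<lbrakk>u \<in> carrier FS; v \<in> carrier FS\<rbrakk> \<Longrightarrow> tens.cls (u + v) = tens.cls u \<oplus>\<^bsub>H0\<^esub> tens.cls v"
  using tens.cls_add[of u v] by simp

lemma cls_scale: "u \<in> carrier FS \<Longrightarrow> tens.cls (Poly_Mapping.map ((*) c) u) = c \<odot>\<^bsub>H0\<^esub> tens.cls u"
  using tens.cls_smult[of u c] by simp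

lemma cls_eqI: "\<lbrakk>u \<in> carrier FS; v \<in> carrier FS; u - v \<in> N0\<rbrakk> \<Longrightarrow> tens.cls u = tens.cls v"
  using tens.cls_eq_iff[of u v] by (simp add: FS_minus)

lemma cls_pair_add_left: "\<lbrakk>x \<in> carrier X; x' \<in> carrier X; y \<in> carrier Y\<rbrakk> \<Longrightarrow>
    tens.cls (pair (x \<oplus>\<^bsub>X\<^esub> x') y) = tens.cls (pair x y) \<oplus>\<^bsub>H0\<^esub> tens.cls (pair x' y)"
  unfolding cls_plus[OF FS_pair FS_pair, symmetric]
  by (rule cls_eqI; (rule relation_mem)?; simp only: diff_diff_eq[symmetric] FS_pair FS_add X.a_closed Y.a_closed;
      unfold bilinear_relations_def; blast)

lemma cls_pair_add_right: "\<lbrakk>x \<in> carrier X; y \<in> carrier Y; y' \<in> carrier Y\<rbrakk> \<Longrightarrow>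
    tens.cls (pair x (y \<oplus>\<^bsub>Y\<^esub> y')) = tens.cls (pair x y) \<oplus>\<^bsub>H0\<^esub> tens.cls (pair x y')"
  unfolding cls_plus[OF FS_pair FS_pair, symmetric]
  by (rule cls_eqI; (rule relation_mem)?; simp only: diff_diff_eq[symmetric] FS_pair FS_add X.a_closed Y.a_closed;
      unfold bilinear_relations_def; blast)

lemma cls_pair_smult_left: "\<lbrakk>x \<in> carrier X; y \<in> carrier Y\<rbrakk> \<Longrightarrow>
    tens.cls (pair (c \<odot>\<^bsub>X\<^esub> x) y) = c \<odot>\<^bsub>H0\<^esub> tens.cls (pair x y)"
  unfolding cls_scale[OF FS_pair, symmetric]
  by (rule cls_eqI; (rule relation_mem)?; (simp add: X.smult_closed' Y.smult_closed'; fail)?;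
      unfold bilinear_relations_def; blast)

lemma cls_pair_smult_right: "\<lbrakk>x \<in> carrier X; y \<in> carrier Y\<rbrakk> \<Longrightarrow>
    tens.cls (pair x (c \<odot>\<^bsub>Y\<^esub> y)) = c \<odot>\<^bsub>H0\<^esub> tens.cls (pair x y)"
  unfolding cls_scale[OF FS_pair, symmetric]
  by (rule cls_eqI; (rule relation_mem)?; (simp add: X.smult_closed' Y.smult_closed'; fail)?;
      unfold bilinear_relations_def; blast)

sublocale H0: Module.module complex_ring H0 by (rule tens.module_Q)

lemma cls_sum_cong:
  fixes p :: nat
  assumes "\<And>k. k < p \<Longrightarrow> g k \<in> carrier FS" "\<And>k. k < p \<Longrightarrow> h k \<in> carrier FS"
    "\<And>k. k < p \<Longrightarrow> tens.cls (g k) = tens.cls (h k)"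
  shows "tens.cls (\<Sum>k<p. g k) = tens.cls (\<Sum>k<p. h k)"
  using assms
proof (induction p)
  case (Suc p)
  then have "(\<Sum>k<p. g k) \<in> carrier FS" "(\<Sum>k<p. h k) \<in> carrier FS" by (auto intro!: FS_sum)
  then show ?case using Suc by (simp add: cls_plus)
qed simp

definition bilinear :: "('x \<Rightarrow> 'y \<Rightarrow> 'd::cstar_alg) \<Rightarrow> bool"
  where "bilinear b \<longleftrightarrow>
    (\<forall>x\<in>carrier X. \<forall>x'\<in>carrier X. \<forall>y\<in>carrier Y. b (x \<oplus>\<^bsub>X\<^esub> x') y = b x y + b x' y) \<and>
    (\<forall>x\<in>carrier X. \<forall>y\<in>carrier Y. \<forall>y'\<in>carrier Y. b x (y \<oplus>\<^bsub>Y\<^esub> y') = b x y + b x y') \<and>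
    (\<forall>c. \<forall>x\<in>carrier X. \<forall>y\<in>carrier Y. b (c \<odot>\<^bsub>X\<^esub> x) y = csc c (b x y) \<and> b x (c \<odot>\<^bsub>Y\<^esub> y) = csc c (b x y))"

lemma lin_extend_N0:
  assumes b: "bilinear b" and u: "u \<in> N0" shows "lin_extend b u = 0"
proof -
  have "submodule {u \<in> carrier FS. lin_extend b u = 0} complex_ring FS"
  proof (rule submoduleI)
    fix u assume "u \<in> {u \<in> carrier FS. lin_extend b u = 0}"
    moreover from this have "\<ominus>\<^bsub>FS\<^esub> u = 0 - u" using FS_minus[OF FS_0, of u] by (simp add: a_minus_def)
    ultimately show "\<ominus>\<^bsub>FS\<^esub> u \<in> {u \<in> carrier FS. lin_extend b u = 0}"
      using FS_diff[OF FS_0, of u] lin_extend_diff[of b 0 u] by simp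
  qed (auto simp: lin_extend_add lin_extend_scale)
  moreover have "bilinear_relations X Y \<subseteq> {u \<in> carrier FS. lin_extend b u = 0}"
    using relations_subset b
    by (auto simp: bilinear_relations_def bilinear_def lin_extend_diff lin_extend_scale)
  ultimately have "N0 \<subseteq> {u \<in> carrier FS. lin_extend b u = 0}" by (rule lin_span_least)
  then show ?thesis using u by blast
qed

lemma lin_extend_cls_eq:
  assumes b: "bilinear b" and u: "u \<in> carrier FS" "v \<in> carrier FS" "tens.cls u = tens.cls v"
  shows "lin_extend b u = lin_extend b v"
  using lin_extend_N0[OF b, of "u - v"] tens.cls_eq_iff[of u v] u by (simp add: FS_minus lin_extend_diff)

definition row_sq :: "nat \<Rightarrow> (nat \<Rightarrow> 'x) \<Rightarrow> real"
  where "row_sq p x = norm (\<Sum>k<p. incl X (x k) * adj (incl X (x k)))"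

definition column_sq :: "nat \<Rightarrow> (nat \<Rightarrow> 'y) \<Rightarrow> real"
  where "column_sq p y = norm (\<Sum>k<p. adj (incl Y (y k)) * incl Y (y k))"

lemma row_sq_nonneg [simp]: "0 \<le> row_sq p x" and column_sq_nonneg [simp]: "0 \<le> column_sq p y"
  by (simp_all add: row_sq_def column_sq_def)

lemma one_set: "{..<1::nat} = {0}" by auto

text \<open>The upper bound is \<open>row_times_columns\<close>; the lower one comes from testing on
  the column of the adjoints of the entries.\<close>

lemma matrix_norm_row:
  assumes x: "\<And>k. k < p \<Longrightarrow> x k \<in> carrier X"
  shows "matrix_norm X (mat 1 p (\<lambda>(i, j). x j)) = sqrt (row_sq p x)"
proof -
  define N where "N = matrix_norm X (mat 1 p (\<lambda>(i, j). x j))"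
  have mb: "0 \<le> N" "mat_bound {..<1::nat} {..<p} (\<lambda>i j. incl X (x j)) (N\<^sup>2)"
    "\<And>t. 0 \<le> t \<Longrightarrow> mat_bound {..<1::nat} {..<p} (\<lambda>i j. incl X (x j)) (t\<^sup>2) \<Longrightarrow> N \<le> t"
    unfolding N_def
    by (rule matrix_norm_bounds(1)[OF X.cstar_algebra_axioms, where r=1 and s=p and M="\<lambda>i. x"], (assumption | rule x)+,
      rule matrix_norm_bounds(2)[OF X.cstar_algebra_axioms, where r=1 and s=p and M="\<lambda>i. x"], (assumption | rule x)+,
      rule matrix_norm_bounds(3)[OF X.cstar_algebra_axioms, where r=1 and s=p and M="\<lambda>i. x"], (assumption | rule x)+)
  show ?thesis unfolding N_def[symmetric]
  proof (rule antisym)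
    show "N \<le> sqrt (row_sq p x)"
    proof (rule mb(3))
      show "mat_bound {..<1::nat} {..<p} (\<lambda>i j. incl X (x j)) ((sqrt (row_sq p x))\<^sup>2)"
        unfolding mat_bound_def
      proof
        fix v :: "nat \<Rightarrow> 'x universal"
        have "col_sq ({..<p} \<times> {..<1::nat}) (\<lambda>(k, i). v k) = col_sq {..<p} v"
        proof -
          have "(\<Sum>q\<in>{..<p} \<times> {0::nat}. adj (case q of (k, i) \<Rightarrow> v k) * (case q of (k, i) \<Rightarrow> v k))
              = (\<Sum>k<p. \<Sum>i\<in>{0::nat}. adj (v k) * v k)"
            unfolding sum.cartesian_product split_def ..
          then show ?thesis unfolding col_sq_def one_set by simp
        qed
        then show "col_sq {..<1::nat} (\<lambda>i. \<Sum>j<p. incl X (x j) * v j) \<le> (sqrt (row_sq p x))\<^sup>2 * col_sq {..<p} v"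
          using row_times_columns[of "{..<1::nat}" "\<lambda>k. incl X (x k)" "\<lambda>k i. v k" "{..<p}"]
          by (simp add: row_sq_def)
      qed
    qed simp_all
    define h where "h = (\<Sum>k<p. incl X (x k) * adj (incl X (x k)))"
    have ah: "adj h = h" by (simp add: h_def adj_sum adj_mult)
    have "col_sq {..<1::nat} (\<lambda>i. \<Sum>j<p. incl X (x j) * adj (incl X (x j))) \<le> N\<^sup>2 * col_sq {..<p} (\<lambda>k. adj (incl X (x k)))"
      using mb(2)[unfolded mat_bound_def, THEN spec, of "\<lambda>k. adj (incl X (x k))"] by simp
    then have "(norm h)\<^sup>2 \<le> N\<^sup>2 * norm h"
      unfolding one_set by (simp add: col_sq_def cstar_norm flip: h_def)
    then have "norm h \<le> N\<^sup>2" by (rule square_le_cancel) simp_all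
    then show "sqrt (row_sq p x) \<le> N" using mb(1) by (simp add: row_sq_def h_def real_le_lsqrt)
  qed
qed

text \<open>For a column the test vectors are single elements c, and the image has squared norm
  \<open>norm (adj c * h * c)\<close>; without a unit, \<open>norm_le_by_conjugates\<close> recovers
  \<open>norm h\<close>.\<close>

lemma matrix_norm_column:
  assumes y: "\<And>k. k < p \<Longrightarrow> y k \<in> carrier Y"
  shows "matrix_norm Y (mat p 1 (\<lambda>(i, j). y i)) = sqrt (column_sq p y)"
proof -
  define N where "N = matrix_norm Y (mat p 1 (\<lambda>(i, j). y i))"
  have mb: "0 \<le> N" "mat_bound {..<p} {..<1::nat} (\<lambda>i j. incl Y (y i)) (N\<^sup>2)"
    "\<And>t. 0 \<le> t \<Longrightarrow> mat_bound {..<p} {..<1::nat} (\<lambda>i j. incl Y (y i)) (t\<^sup>2) \<Longrightarrow> N \<le> t"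
    unfolding N_def
    by (rule matrix_norm_bounds(1)[OF Y.cstar_algebra_axioms, where r=p and s=1 and M="\<lambda>i j. y i"], (assumption | rule y)+,
      rule matrix_norm_bounds(2)[OF Y.cstar_algebra_axioms, where r=p and s=1 and M="\<lambda>i j. y i"], (assumption | rule y)+,
      rule matrix_norm_bounds(3)[OF Y.cstar_algebra_axioms, where r=p and s=1 and M="\<lambda>i j. y i"], (assumption | rule y)+)
  define h where "h = (\<Sum>k<p. adj (incl Y (y k)) * incl Y (y k))"
  have ah: "adj h = h" by (simp add: h_def adj_sum adj_mult)
  have e: "col_sq {..<p} (\<lambda>k. incl Y (y k) * c) = norm (adj c * h * c)" for c
    unfolding col_sq_def h_def conjugate_sum ..
  show ?thesis unfolding N_def[symmetric]
  proof (rule antisym)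
    show "N \<le> sqrt (column_sq p y)"
    proof (rule mb(3))
      show "mat_bound {..<p} {..<1::nat} (\<lambda>i j. incl Y (y i)) ((sqrt (column_sq p y))\<^sup>2)"
        unfolding mat_bound_def
      proof
        fix v :: "nat \<Rightarrow> 'y universal"
        have "norm (adj (v 0) * h * v 0) \<le> norm (adj (v 0)) * norm h * norm (v 0)"
          by (meson norm_mult_ineq mult_right_mono norm_ge_zero order_trans)
        then show "col_sq {..<p} (\<lambda>i. \<Sum>j<1::nat. incl Y (y i) * v j) \<le> (sqrt (column_sq p y))\<^sup>2 * col_sq {..<1::nat} v"
          unfolding one_set
          by (simp add: e) (simp add: col_sq_def cstar_norm column_sq_def h_def power2_eq_square ac_simps)
      qed
    qed simp_all
    have "norm h \<le> N\<^sup>2"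
    proof (rule norm_le_by_conjugates[OF ah])
      show "norm (adj c * h * c) \<le> N\<^sup>2 * (norm c)\<^sup>2" for c
        using mb(2)[unfolded mat_bound_def, THEN spec, of "\<lambda>_. c"]
        unfolding one_set by (simp add: e) (simp add: col_sq_def cstar_norm)
    qed simp
    then show "sqrt (column_sq p y) \<le> N" using mb(1) by (simp add: column_sq_def h_def real_le_lsqrt)
  qed
qed

definition rep :: "(('x \<times> 'y) \<Rightarrow>\<^sub>0 complex) set \<Rightarrow> nat \<Rightarrow> (nat \<Rightarrow> 'x) \<Rightarrow> (nat \<Rightarrow> 'y) \<Rightarrow> bool"
  where "rep U p x y \<longleftrightarrow> (\<forall>k<p. x k \<in> carrier X) \<and> (\<forall>k<p. y k \<in> carrier Y) \<and>
    tens.cls (\<Sum>k<p. pair (x k) (y k)) = U"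

lemma rep_carrier: "rep U p x y \<Longrightarrow> (\<Sum>k<p. pair (x k) (y k)) \<in> carrier FS"
  by (auto simp: rep_def intro!: FS_sum)

lemma mem_iff_cls: "U \<in> carrier H0 \<Longrightarrow> u \<in> carrier FS \<Longrightarrow> u \<in> U \<longleftrightarrow> tens.cls u = U"
proof
  assume "U \<in> carrier H0" "u \<in> U"
  then obtain v where "v \<in> carrier FS" "U = tens.cls v" unfolding tens.carrier_Q by blast
  then show "tens.cls u = U"
    using \<open>u \<in> U\<close> a_repr_independence[OF _ _ tens.subgroup_N] by blast
qed (use tens.sub.a_rcos_self in blast)

lemma nrm_H0:
  assumes U: "U \<in> carrier H0"
  shows "nrm H0 U = Inf {sqrt (row_sq p x) * sqrt (column_sq p y) | p x y. rep U p x y}"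
proof -
  have "{matrix_norm X x * matrix_norm Y y | x y p.
       x \<in> matrices 1 p (carrier X) \<and> y \<in> matrices p 1 (carrier Y) \<and>
       (\<Sum>k<p. pair (x $$ (0, k)) (y $$ (k, 0))) \<in> U}
     = {sqrt (row_sq p x) * sqrt (column_sq p y) | p x y. rep U p x y}" (is "?L = ?R")
  proof
    show "?L \<subseteq> ?R"
    proof
      fix t assume "t \<in> ?L"
      then obtain x y p where t: "t = matrix_norm X x * matrix_norm Y y"
        and xm: "x \<in> matrices 1 p (carrier X)" and ym: "y \<in> matrices p 1 (carrier Y)"
        and m: "(\<Sum>k<p. pair (x $$ (0, k)) (y $$ (k, 0))) \<in> U" by blast
      have xc: "x $$ (0, k) \<in> carrier X" and yc: "y $$ (k, 0) \<in> carrier Y" if "k < p" for k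
        using xm ym that by (auto simp: matrices_def elements_mat_def UN_subset_iff image_subset_iff)
      have "x = mat 1 p (\<lambda>(i, j). x $$ (0, j))" "y = mat p 1 (\<lambda>(i, j). y $$ (i, 0))"
        using xm ym by (auto simp: matrices_def intro!: eq_matI)
      then have xy: "matrix_norm X x = sqrt (row_sq p (\<lambda>k. x $$ (0, k)))"
        "matrix_norm Y y = sqrt (column_sq p (\<lambda>k. y $$ (k, 0)))"
        using matrix_norm_row[where p=p and x="\<lambda>k. x $$ (0, k)", OF xc]
          matrix_norm_column[where p=p and y="\<lambda>k. y $$ (k, 0)", OF yc] by simp_all
      have "rep U p (\<lambda>k. x $$ (0, k)) (\<lambda>k. y $$ (k, 0))"
        unfolding rep_def using xc yc m by (subst mem_iff_cls[OF U, symmetric]) (auto intro!: FS_sum)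
      moreover have "t = sqrt (row_sq p (\<lambda>k. x $$ (0, k))) * sqrt (column_sq p (\<lambda>k. y $$ (k, 0)))"
        unfolding t xy ..
      ultimately show "t \<in> ?R" by blast
    qed
    show "?R \<subseteq> ?L"
    proof
      fix t assume "t \<in> ?R"
      then obtain p x y where t: "t = sqrt (row_sq p x) * sqrt (column_sq p y)" and r: "rep U p x y" by blast
      have xc: "x k \<in> carrier X" and yc: "y k \<in> carrier Y" if "k < p" for k
        using r that by (auto simp: rep_def)
      have "t = matrix_norm X (mat 1 p (\<lambda>(i, j). x j)) * matrix_norm Y (mat p 1 (\<lambda>(i, j). y i))"
        unfolding t
        using matrix_norm_row[where p=p and x=x, OF xc] matrix_norm_column[where p=p and y=y, OF yc] by simp
      moreover have "mat 1 p (\<lambda>(i, j). x j) \<in> matrices 1 p (carrier X)"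
        "mat p 1 (\<lambda>(i, j). y i) \<in> matrices p 1 (carrier Y)"
        using xc yc by (auto simp: matrices_def elements_mat_def)
      moreover have "(\<Sum>k<p. pair (mat 1 p (\<lambda>(i, j). x j) $$ (0, k)) (mat p 1 (\<lambda>(i, j). y i) $$ (k, 0))) \<in> U"
        using mem_iff_cls[OF U rep_carrier[OF r]] r by (simp add: rep_def)
      ultimately show "t \<in> ?L" by blast
    qed
  qed
  then show ?thesis by (simp add: haagerup_algebraic_def)
qed

lemma rep_add:
  assumes U: "rep U p x y" and V: "rep V q x' y'"
  shows "rep (U \<oplus>\<^bsub>H0\<^esub> V) (p + q) (cat p x x') (cat p y y')"
proof -
  have "tens.cls (\<Sum>k<p + q. pair (cat p x x' k) (cat p y y' k)) = U \<oplus>\<^bsub>H0\<^esub> V"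
    using U V by (simp add: sum_cat cls_plus[OF rep_carrier[OF U] rep_carrier[OF V]] rep_def)
  then show ?thesis using U V unfolding rep_def by (simp add: cat_def)
qed

lemma row_sq_cat: "row_sq (p + q) (cat p x x') \<le> row_sq p x + row_sq q x'"
  unfolding row_sq_def
    sum_cat[where g="\<lambda>a b. incl X a * adj (incl X a)" and x=x and x'=x' and y="x" and y'="x'"]
  by (rule norm_triangle_ineq)

lemma column_sq_cat: "column_sq (p + q) (cat p x x') \<le> column_sq p x + column_sq q x'"
  unfolding column_sq_def
    sum_cat[where g="\<lambda>a b. adj (incl Y a) * incl Y a" and x=x and x'=x' and y="x" and y'="x'"]
  by (rule norm_triangle_ineq)

lemma rep_exists:
  assumes U: "U \<in> carrier H0" obtains p x y where "rep U p x y"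
proof -
  obtain u where u: "u \<in> carrier FS" "U = tens.cls u" using U unfolding tens.carrier_Q by blast
  have uk: "Poly_Mapping.keys u \<subseteq> carrier X \<times> carrier Y" using u(1) by (simp add: free_space_def)
  have ue: "u = (\<Sum>k\<in>Poly_Mapping.keys u. Poly_Mapping.map ((*) (Poly_Mapping.lookup u k)) (pair (fst k) (snd k)))"
    by (rule poly_mapping_eqI)
      (auto simp: lookup_sum lookup_scale pair_def lookup_single when_def if_distrib[of "(*) _"] in_keys_iff sum.delta cong: if_cong)
  have "\<exists>p x y. rep (tens.cls (\<Sum>k\<in>K. Poly_Mapping.map ((*) (c k)) (pair (fst k) (snd k)))) p x y"
    if "finite K" "K \<subseteq> carrier X \<times> carrier Y" for K c
    using that
  proof (induction K rule: finite_induct)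
    case empty
    have "rep (tens.cls 0) 0 x y" for x y by (simp add: rep_def)
    then show ?case by (simp only: sum.empty) blast
  next
    case (insert k K)
    obtain p x y where r: "rep (tens.cls (\<Sum>k\<in>K. Poly_Mapping.map ((*) (c k)) (pair (fst k) (snd k)))) p x y"
      using insert by auto
    have kc: "fst k \<in> carrier X" "snd k \<in> carrier Y" using insert by auto
    have 1: "rep (tens.cls (Poly_Mapping.map ((*) (c k)) (pair (fst k) (snd k)))) 1 (\<lambda>_. c k \<odot>\<^bsub>X\<^esub> fst k) (\<lambda>_. snd k)"
      using kc by (simp add: rep_def cls_pair_smult_left cls_scale X.smult_closed')
    have sc: "(\<Sum>k\<in>K. Poly_Mapping.map ((*) (c k)) (pair (fst k) (snd k))) \<in> carrier FS"
      using insert by (intro FS_sum) auto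
    have "tens.cls (\<Sum>k\<in>insert k K. Poly_Mapping.map ((*) (c k)) (pair (fst k) (snd k)))
        = tens.cls (Poly_Mapping.map ((*) (c k)) (pair (fst k) (snd k))) \<oplus>\<^bsub>H0\<^esub>
          tens.cls (\<Sum>k\<in>K. Poly_Mapping.map ((*) (c k)) (pair (fst k) (snd k)))"
      using insert(1,2) sc kc by (simp add: cls_plus)
    then show ?case using rep_add[OF 1 r] by (simp only:) (intro exI)
  qed
  from this[OF finite_keys uk, of "Poly_Mapping.lookup u"] show ?thesis
    using that unfolding u(2) ue[symmetric] by blast
qed

lemma rep_bdd: "bdd_below {sqrt (row_sq p x) * sqrt (column_sq p y) | p x y. rep U p x y}"
  by (rule bdd_belowI[where m=0]) auto

lemma nrm_H0_le: "U \<in> carrier H0 \<Longrightarrow> rep U p x y \<Longrightarrow> nrm H0 U \<le> sqrt (row_sq p x) * sqrt (column_sq p y)"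
  unfolding nrm_H0 by (rule cInf_lower[OF _ rep_bdd]) blast

lemma nrm_H0_ge:
  assumes U: "U \<in> carrier H0" and "\<And>p x y. rep U p x y \<Longrightarrow> t \<le> sqrt (row_sq p x) * sqrt (column_sq p y)"
  shows "t \<le> nrm H0 U"
proof -
  obtain p x y where "rep U p x y" using rep_exists[OF U] by blast
  then have "{sqrt (row_sq p x) * sqrt (column_sq p y) | p x y. rep U p x y} \<noteq> {}" by blast
  then show ?thesis unfolding nrm_H0[OF U] by (rule cInf_greatest) (use assms(2) in blast)
qed

lemma nrm_H0_nonneg: "U \<in> carrier H0 \<Longrightarrow> 0 \<le> nrm H0 U"
  by (rule nrm_H0_ge) simp_all

lemma row_sq_smult:
  assumes "\<And>k. k < p \<Longrightarrow> x k \<in> carrier X"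
  shows "row_sq p (\<lambda>k. c \<odot>\<^bsub>X\<^esub> x k) = (cmod c)\<^sup>2 * row_sq p x"
proof -
  have "incl X (c \<odot>\<^bsub>X\<^esub> x k) * adj (incl X (c \<odot>\<^bsub>X\<^esub> x k)) = (cmod c)\<^sup>2 *\<^sub>R (incl X (x k) * adj (incl X (x k)))" if "k < p" for k
    using adj_csc_mult[of "cnj c" "adj (incl X (x k))"] assms[OF that]
    by (simp add: incl_csc X.cstar_algebra_axioms adj_csc)
  then show ?thesis by (simp add: row_sq_def flip: scaleR_right.sum)
qed

lemma column_sq_smult:
  assumes "\<And>k. k < p \<Longrightarrow> y k \<in> carrier Y"
  shows "column_sq p (\<lambda>k. c \<odot>\<^bsub>Y\<^esub> y k) = (cmod c)\<^sup>2 * column_sq p y"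
  using assms by (simp add: column_sq_def incl_csc Y.cstar_algebra_axioms adj_csc_mult flip: scaleR_right.sum)

text \<open>Multiplying x by s and y by 1/s leaves the tensor unchanged, so a product of norms below
  t can be balanced into factors whose squared norms are both at most t. In this form
  representations can be concatenated.\<close>

lemma rep_approx:
  assumes U: "U \<in> carrier H0" and t: "nrm H0 U < t"
  obtains p x y where "rep U p x y" "row_sq p x \<le> t" "column_sq p y \<le> t"
proof -
  have t0: "0 < t" using nrm_H0_nonneg[OF U] t by simp
  have "\<exists>p x y. rep U p x y \<and> sqrt (row_sq p x) * sqrt (column_sq p y) < t"
  proof (rule ccontr)
    assume "\<not> ?thesis"
    then have "t \<le> nrm H0 U" by (intro nrm_H0_ge[OF U]) (meson not_less)
    then show False using t by simp
  qed
  then obtain p x y where r: "rep U p x y" and lt: "sqrt (row_sq p x) * sqrt (column_sq p y) < t" by blast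
  define a b where "a = row_sq p x" and "b = column_sq p y"
  have ab: "0 \<le> a" "0 \<le> b" by (simp_all add: a_def b_def)
  have "sqrt (a * b) < t" using lt by (simp add: a_def b_def real_sqrt_mult)
  then have "(sqrt (a * b))\<^sup>2 < t\<^sup>2" by (rule power_strict_mono) (use ab in auto)
  then have abt: "a * b < t\<^sup>2" using ab by simp
  obtain q where q: "0 < q" "q * a \<le> t" "b / q \<le> t"
  proof (cases "a = 0")
    case True
    have "b / t + 1 > 0" using ab t0 by (simp add: add_nonneg_pos)
    moreover have "b / (b / t + 1) \<le> t" using ab t0 calculation by (simp add: pos_divide_le_eq distrib_left)
    ultimately show ?thesis using that[of "b / t + 1"] True t0 by simp
  next
    case False
    then have "a > 0" using ab by simp
    moreover have "b / (t / a) \<le> t" using abt t0 by (simp add: divide_le_eq power2_eq_square mult.commute)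
    ultimately show ?thesis using that[of "t / a"] t0 by simp
  qed
  define s where "s = complex_of_real (sqrt q)"
  have s: "s \<noteq> 0" "(cmod s)\<^sup>2 = q" using q by (simp_all add: s_def)
  have xy: "x k \<in> carrier X" "y k \<in> carrier Y" if "k < p" for k using r that by (simp_all add: rep_def)
  have pe: "tens.cls (pair (s \<odot>\<^bsub>X\<^esub> x k) ((1 / s) \<odot>\<^bsub>Y\<^esub> y k)) = tens.cls (pair (x k) (y k))" if "k < p" for k
    using xy[OF that] s H0.smult_assoc1[of "1 / s" s "tens.cls (pair (x k) (y k))"] H0.smult_one[of "tens.cls (pair (x k) (y k))"]
    by (simp add: cls_pair_smult_left cls_pair_smult_right)
  have "tens.cls (\<Sum>k<p. pair (s \<odot>\<^bsub>X\<^esub> x k) ((1 / s) \<odot>\<^bsub>Y\<^esub> y k)) = tens.cls (\<Sum>k<p. pair (x k) (y k))"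
    by (rule cls_sum_cong) (use xy pe in auto)
  then have "rep U p (\<lambda>k. s \<odot>\<^bsub>X\<^esub> x k) (\<lambda>k. (1 / s) \<odot>\<^bsub>Y\<^esub> y k)" using r by (simp add: rep_def)
  moreover have "row_sq p (\<lambda>k. s \<odot>\<^bsub>X\<^esub> x k) \<le> t"
    using row_sq_smult[of p x s] xy q(2) s by (simp add: a_def)
  moreover have "column_sq p (\<lambda>k. (1 / s) \<odot>\<^bsub>Y\<^esub> y k) \<le> t"
    using column_sq_smult[of p y "1 / s"] xy q(3) s by (simp add: b_def norm_divide power_divide)
  ultimately show ?thesis by (rule that)
qed

text \<open>Triangle inequality: squared row and column norms are subadditive under concatenation,
  so balanced representations at \<open>nrm H0 U + \<epsilon> / 2\<close> and
  \<open>nrm H0 V + \<epsilon> / 2\<close> combine to a balanced one at their sum.\<close>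

lemma seminormed_H0: "seminormed_module H0 (nrm H0)"
proof (rule seminormed_moduleI)
  show "Module.module complex_ring H0" by (rule tens.module_Q)
  fix U assume U: "U \<in> carrier H0"
  show "0 \<le> nrm H0 U" by (rule nrm_H0_nonneg[OF U])
  show "nrm H0 (U \<oplus>\<^bsub>H0\<^esub> V) \<le> nrm H0 U + nrm H0 V" if V: "V \<in> carrier H0" for V
  proof (rule field_le_epsilon)
    fix \<epsilon> :: real assume "\<epsilon> > 0"
    then have lt: "nrm H0 U < nrm H0 U + \<epsilon> / 2" "nrm H0 V < nrm H0 V + \<epsilon> / 2" by simp_all
    obtain p x y where r: "rep U p x y" "row_sq p x \<le> nrm H0 U + \<epsilon> / 2" "column_sq p y \<le> nrm H0 U + \<epsilon> / 2"
      by (rule rep_approx[OF U lt(1)])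
    obtain q x' y' where r': "rep V q x' y'" "row_sq q x' \<le> nrm H0 V + \<epsilon> / 2" "column_sq q y' \<le> nrm H0 V + \<epsilon> / 2"
      by (rule rep_approx[OF V lt(2)])
    let ?t = "nrm H0 U + nrm H0 V + \<epsilon>"
    have le: "row_sq (p + q) (cat p x x') \<le> ?t" "column_sq (p + q) (cat p y y') \<le> ?t"
      using row_sq_cat[of p q x x'] column_sq_cat[of p q y y'] r r' by simp_all
    have t0: "0 \<le> ?t" using nrm_H0_nonneg[OF U] nrm_H0_nonneg[OF V] \<open>\<epsilon> > 0\<close> by simp
    have "nrm H0 (U \<oplus>\<^bsub>H0\<^esub> V) \<le> sqrt (row_sq (p + q) (cat p x x')) * sqrt (column_sq (p + q) (cat p y y'))"
      by (rule nrm_H0_le[OF _ rep_add[OF r(1) r'(1)]]) (use U V in simp)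
    also have "\<dots> \<le> sqrt ?t * sqrt ?t" using le t0 by (intro mult_mono) simp_all
    also have "\<dots> = ?t" using t0 by simp
    finally show "nrm H0 (U \<oplus>\<^bsub>H0\<^esub> V) \<le> nrm H0 U + nrm H0 V + \<epsilon>" .
  qed
  have cU: "c \<odot>\<^bsub>H0\<^esub> U \<in> carrier H0" for c using U H0.smult_closed by simp
  have le: "nrm H0 (c \<odot>\<^bsub>H0\<^esub> U) \<le> cmod c * (sqrt (row_sq p x) * sqrt (column_sq p y))" if r: "rep U p x y" for c p x y
  proof -
    have xy: "x k \<in> carrier X" "y k \<in> carrier Y" if "k < p" for k using r that by (simp_all add: rep_def)
    have "tens.cls (\<Sum>k<p. pair (c \<odot>\<^bsub>X\<^esub> x k) (y k)) = tens.cls (\<Sum>k<p. Poly_Mapping.map ((*) c) (pair (x k) (y k)))"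
      by (rule cls_sum_cong) (use xy in \<open>auto simp: cls_pair_smult_left cls_scale\<close>)
    also have "(\<Sum>k<p. Poly_Mapping.map ((*) c) (pair (x k) (y k))) = Poly_Mapping.map ((*) c) (\<Sum>k<p. pair (x k) (y k))"
      by (rule poly_mapping_eqI) (simp add: lookup_sum lookup_scale sum_distrib_left)
    finally have "rep (c \<odot>\<^bsub>H0\<^esub> U) p (\<lambda>k. c \<odot>\<^bsub>X\<^esub> x k) y"
      using r xy unfolding rep_def by (simp add: cls_scale[OF rep_carrier[OF r]])
    from nrm_H0_le[OF cU this] show ?thesis
      using row_sq_smult[of p x c] xy by (simp add: real_sqrt_mult)
  qed
  show "nrm H0 (c \<odot>\<^bsub>H0\<^esub> U) \<le> cmod c * nrm H0 U" for c
  proof (cases "c = 0")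
    case True
    obtain p x y where r: "rep U p x y" by (rule rep_exists[OF U])
    show ?thesis using le[OF r, of c] True by simp
  next
    case False
    have "nrm H0 (c \<odot>\<^bsub>H0\<^esub> U) / cmod c \<le> nrm H0 U"
      using le False by (intro nrm_H0_ge[OF U]) (simp add: divide_le_eq mult.commute)
    then show ?thesis using False by (simp add: divide_le_eq mult.commute)
  qed
qed

lemma cls_pair_finsum:
  fixes p :: nat
  assumes "\<And>k. k < p \<Longrightarrow> x k \<in> carrier X" and y: "y \<in> carrier Y"
  shows "tens.cls (pair (\<Oplus>\<^bsub>X\<^esub>k\<in>{..<p}. x k) y) = tens.cls (\<Sum>k<p. pair (x k) y)"
  using assms(1)
proof (induction p)
  case 0
  have "tens.cls (pair (0 \<odot>\<^bsub>X\<^esub> \<zero>\<^bsub>X\<^esub>) y) = 0 \<odot>\<^bsub>H0\<^esub> tens.cls (pair \<zero>\<^bsub>X\<^esub> y)"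
    by (rule cls_pair_smult_left) (use y in simp_all)
  also have "\<dots> = tens.cls (Poly_Mapping.map ((*) 0) (pair \<zero>\<^bsub>X\<^esub> y))"
    by (rule cls_scale[symmetric]) (use y in simp)
  also have "Poly_Mapping.map ((*) 0) (pair \<zero>\<^bsub>X\<^esub> y) = 0" by (rule poly_mapping_eqI) (simp add: lookup_scale)
  finally show ?case by simp
next
  case (Suc p)
  have s: "(\<Sum>k<p. pair (x k) y) \<in> carrier FS" using Suc y by (intro FS_sum) auto
  have "(\<Oplus>\<^bsub>X\<^esub>k\<in>{..<Suc p}. x k) = x p \<oplus>\<^bsub>X\<^esub> (\<Oplus>\<^bsub>X\<^esub>k\<in>{..<p}. x k)"
    unfolding lessThan_Suc by (rule X.finsum_insert) (use Suc in auto)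
  moreover have "(\<Oplus>\<^bsub>X\<^esub>k\<in>{..<p}. x k) \<in> carrier X" using Suc by (intro X.finsum_closed) auto
  ultimately show ?case
    using Suc y s by (simp add: cls_pair_add_left cls_plus H0.a_comm)
qed

lemma cls_pair_zero_right: "x \<in> carrier X \<Longrightarrow> tens.cls (pair x \<zero>\<^bsub>Y\<^esub>) = tens.cls 0"
proof -
  assume x: "x \<in> carrier X"
  have "tens.cls (pair x (0 \<odot>\<^bsub>Y\<^esub> \<zero>\<^bsub>Y\<^esub>)) = 0 \<odot>\<^bsub>H0\<^esub> tens.cls (pair x \<zero>\<^bsub>Y\<^esub>)"
    by (rule cls_pair_smult_right) (use x in simp_all)
  also have "\<dots> = tens.cls (Poly_Mapping.map ((*) 0) (pair x \<zero>\<^bsub>Y\<^esub>))"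
    by (rule cls_scale[symmetric]) (use x in simp)
  also have "Poly_Mapping.map ((*) 0) (pair x \<zero>\<^bsub>Y\<^esub>) = 0" by (rule poly_mapping_eqI) (simp add: lookup_scale)
  finally show ?thesis by simp
qed

text \<open>An element of the algebraic tensor product is zero as soon as all product functionals vanish
  on it: if the last right factor is nonzero, separation of points expresses the last left factor
  through the others, and the number of summands drops.\<close>

lemma tensor_separation:
  fixes p :: nat
  assumes "\<And>k. k < p \<Longrightarrow> x k \<in> carrier X" "\<And>k. k < p \<Longrightarrow> y k \<in> carrier Y"
    and "\<And>f g. \<lbrakk>linear f; \<And>v. \<bar>f v\<bar> \<le> norm v; linear g; \<And>v. \<bar>g v\<bar> \<le> norm v\<rbrakk> \<Longrightarrow>
      (\<Sum>k<p. cfun f (incl X (x k)) * cfun g (incl Y (y k))) = 0"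
  shows "tens.cls (\<Sum>k<p. pair (x k) (y k)) = tens.cls 0"
  using assms
proof (induction p arbitrary: y)
  case (Suc p)
  have xc: "k < Suc p \<Longrightarrow> x k \<in> carrier X" and yc: "k < Suc p \<Longrightarrow> y k \<in> carrier Y" for k using Suc.prems by auto
  have sc: "(\<Sum>k<p. pair (x k) (y k)) \<in> carrier FS" using xc yc by (intro FS_sum) auto
  show ?case
  proof (cases "incl Y (y p) = 0")
    case True
    then have y0: "y p = \<zero>\<^bsub>Y\<^esub>"
      using incl_inj[OF Y.cstar_algebra_axioms, of "y p" "\<zero>\<^bsub>Y\<^esub>"] incl_zero[OF Y.cstar_algebra_axioms] yc by simp
    have "tens.cls (\<Sum>k<p. pair (x k) (y k)) = tens.cls 0"
    proof (rule Suc.IH)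
      fix f :: "'x universal \<Rightarrow> real" and g :: "'y universal \<Rightarrow> real"
      assume fg: "linear f" "\<And>v. \<bar>f v\<bar> \<le> norm v" "linear g" "\<And>v. \<bar>g v\<bar> \<le> norm v"
      show "(\<Sum>k<p. cfun f (incl X (x k)) * cfun g (incl Y (y k))) = 0"
        using Suc.prems(3)[OF fg] True cfun_0[OF fg(3,4)] by simp
    qed (use xc yc in auto)
    then have "tens.cls (\<Sum>k<Suc p. pair (x k) (y k)) = tens.cls 0 \<oplus>\<^bsub>H0\<^esub> tens.cls 0"
      using sc xc[of p] y0 cls_pair_zero_right[of "x p"] by (simp add: cls_plus)
    then show ?thesis using cls_plus[OF FS_0 FS_0] by simp
  next
    case False
    \<comment> \<open>g0 does not vanish on the last right factor, so the hypothesis with g0 can be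
      solved for the last left factor.\<close>
    obtain g0 where g0: "linear g0" "\<And>v. \<bar>g0 v\<bar> \<le> norm v" "g0 (incl Y (y p)) = norm (incl Y (y p))"
      using hahn_banach_ex[of "incl Y (y p)"] by blast
    let ?G = "\<lambda>k. cfun g0 (incl Y (y k))"
    have Gp: "?G p \<noteq> 0" using g0(3) False by (auto simp: cfun_def complex_eq_iff)
    define c where "c k = - ?G k / ?G p" for k
    let ?z = "\<Oplus>\<^bsub>X\<^esub>k\<in>{..<p}. c k \<odot>\<^bsub>X\<^esub> x k"
    have zc: "?z \<in> carrier X" using xc by (intro X.finsum_closed) auto
    have iz: "incl X ?z = (\<Sum>k<p. csc (c k) (incl X (x k)))"
      using xc by (subst incl_finsum[OF X.cstar_algebra_axioms]) (auto simp: incl_csc X.cstar_algebra_axioms)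
    have Fp: "cfun f (incl X (x p)) = (\<Sum>k<p. c k * cfun f (incl X (x k)))"
      if f: "linear f" "\<And>v. \<bar>f v\<bar> \<le> norm v" for f
    proof -
      have "(\<Sum>k<p. cfun f (incl X (x k)) * ?G k) + cfun f (incl X (x p)) * ?G p = 0"
        using Suc.prems(3)[OF f g0(1,2)] by simp
      then have "cfun f (incl X (x p)) * ?G p = - (\<Sum>k<p. cfun f (incl X (x k)) * ?G k)"
        by (simp only: eq_neg_iff_add_eq_0 add.commute)
      then have "cfun f (incl X (x p)) = - (\<Sum>k<p. cfun f (incl X (x k)) * ?G k) / ?G p"
        by (rule eq_divide_imp[OF Gp])
      also have "\<dots> = (\<Sum>k<p. - (cfun f (incl X (x k)) * ?G k) / ?G p)"
        by (simp only: sum_divide_distrib[symmetric] sum_negf)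
      also have "\<dots> = (\<Sum>k<p. c k * cfun f (incl X (x k)))"
        by (intro sum.cong refl) (simp add: c_def mult.commute)
      finally show ?thesis .
    qed
    have xz: "x p = ?z"
    proof -
      obtain f where f: "linear f" "\<And>v. \<bar>f v\<bar> \<le> norm v" "f (incl X (x p) - incl X ?z) = norm (incl X (x p) - incl X ?z)"
        using hahn_banach_ex[of "incl X (x p) - incl X ?z"] by blast
      have "cfun f (incl X ?z) = cfun f (incl X (x p))"
        unfolding iz Fp[OF f(1,2)] cfun_sum[OF f(1,2)] cfun_csc[OF f(1,2)] ..
      then have "f (incl X (x p)) = f (incl X ?z)" by (simp add: cfun_def)
      then have "norm (incl X (x p) - incl X ?z) = 0" using f(3) linear_diff[OF f(1)] by simp
      then show ?thesis using incl_inj[OF X.cstar_algebra_axioms] zc xc by simp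
    qed
    \<comment> \<open>With x_p expressed by the other x_k, the last summand is distributed over the
      right factors of the others.\<close>
    define y' where "y' k = y k \<oplus>\<^bsub>Y\<^esub> c k \<odot>\<^bsub>Y\<^esub> y p" for k
    have y'c: "k < p \<Longrightarrow> y' k \<in> carrier Y" for k using yc by (simp add: y'_def)
    have cxc: "(\<Sum>k<p. pair (c k \<odot>\<^bsub>X\<^esub> x k) (y p)) \<in> carrier FS" using xc yc by (intro FS_sum) auto
    have "tens.cls (\<Sum>k<Suc p. pair (x k) (y k))
        = tens.cls (\<Sum>k<p. pair (x k) (y k)) \<oplus>\<^bsub>H0\<^esub> tens.cls (pair ?z (y p))"
      using sc xc yc by (simp add: cls_plus flip: xz)
    also have "tens.cls (pair ?z (y p)) = tens.cls (\<Sum>k<p. pair (c k \<odot>\<^bsub>X\<^esub> x k) (y p))"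
      by (rule cls_pair_finsum) (use xc yc in auto)
    also have "tens.cls (\<Sum>k<p. pair (x k) (y k)) \<oplus>\<^bsub>H0\<^esub> tens.cls (\<Sum>k<p. pair (c k \<odot>\<^bsub>X\<^esub> x k) (y p))
        = tens.cls (\<Sum>k<p. pair (x k) (y k) + pair (c k \<odot>\<^bsub>X\<^esub> x k) (y p))"
      unfolding sum.distrib cls_plus[OF sc cxc] ..
    also have "\<dots> = tens.cls (\<Sum>k<p. pair (x k) (y' k))"
      by (rule cls_sum_cong)
        (use xc yc y'c in \<open>auto simp: cls_plus cls_pair_smult_left cls_pair_add_right cls_pair_smult_right y'_def\<close>)
    also have "\<dots> = tens.cls 0"
    proof (rule Suc.IH)
      fix f :: "'x universal \<Rightarrow> real" and g :: "'y universal \<Rightarrow> real"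
      assume f: "linear f" "\<And>v. \<bar>f v\<bar> \<le> norm v" and g: "linear g" "\<And>v. \<bar>g v\<bar> \<le> norm v"
      have iy: "incl Y (y' k) = incl Y (y k) + csc (c k) (incl Y (y p))" if "k < p" for k
        using yc that by (simp add: y'_def incl_add[OF Y.cstar_algebra_axioms] incl_csc[OF Y.cstar_algebra_axioms])
      have "(\<Sum>k<p. cfun f (incl X (x k)) * cfun g (incl Y (y' k)))
          = (\<Sum>k<p. cfun f (incl X (x k)) * cfun g (incl Y (y k))) +
            (\<Sum>k<p. c k * cfun f (incl X (x k))) * cfun g (incl Y (y p))"
        by (simp add: iy cfun_add[OF g] cfun_csc[OF g] distrib_left sum.distrib sum_distrib_left ac_simps)
      also have "\<dots> = 0" using Suc.prems(3)[OF f g] by (simp add: Fp[OF f])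
      finally show "(\<Sum>k<p. cfun f (incl X (x k)) * cfun g (incl Y (y' k))) = 0" .
    qed (use xc y'c in auto)
    finally show ?thesis .
  qed
qed simp

text \<open>A product of functionals is a bilinear form bounded by 4 times the Haagerup norm:
  Cauchy-Schwarz separates the row from the column, and \<open>cfun_row\<close> and
  \<open>cfun_column\<close> contribute a factor 4 each under the root. A tensor of norm 0 is thus
  killed by all of them and vanishes by \<open>tensor_separation\<close>.\<close>

lemma normed_H0: "normed_module H0 (nrm H0)"
proof (intro normed_module.intro seminormed_H0 normed_module_axioms.intro)
  fix U assume U: "U \<in> carrier H0" and n0: "nrm H0 U = 0"
  obtain p x y where r: "rep U p x y" by (rule rep_exists[OF U])
  have "tens.cls (\<Sum>k<p. pair (x k) (y k)) = tens.cls 0"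
  proof (rule tensor_separation)
    fix f :: "'x universal \<Rightarrow> real" and g :: "'y universal \<Rightarrow> real"
    assume f: "linear f" "\<And>v. \<bar>f v\<bar> \<le> norm v" and g: "linear g" "\<And>v. \<bar>g v\<bar> \<le> norm v"
    define b where "b x y = cfun f (incl X x) * cfun g (incl Y y)" for x y
    have b: "bilinear b"
      unfolding bilinear_def b_def
      by (auto simp: incl_add X.cstar_algebra_axioms Y.cstar_algebra_axioms incl_csc
          cfun_add[OF f] cfun_add[OF g] cfun_csc[OF f] cfun_csc[OF g] csc_complex algebra_simps)
    have bnd: "cmod (lin_extend b (\<Sum>k<q. pair (x' k) (y' k))) / 4 \<le> sqrt (row_sq q x') * sqrt (column_sq q y')" for q x' y'
    proof -
      have "cmod (lin_extend b (\<Sum>k<q. pair (x' k) (y' k))) \<le> (\<Sum>k<q. cmod (cfun f (incl X (x' k))) * cmod (cfun g (incl Y (y' k))))"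
        unfolding lin_extend_sum lin_extend_pair b_def by (rule order_trans[OF norm_sum]) (simp add: norm_mult)
      then have "(cmod (lin_extend b (\<Sum>k<q. pair (x' k) (y' k))))\<^sup>2
          \<le> (\<Sum>k<q. cmod (cfun f (incl X (x' k))) * cmod (cfun g (incl Y (y' k))))\<^sup>2"
        by (rule power_mono) simp
      also have "\<dots> \<le> (\<Sum>k<q. (cmod (cfun f (incl X (x' k))))\<^sup>2) * (\<Sum>k<q. (cmod (cfun g (incl Y (y' k))))\<^sup>2)"
        by (rule Cauchy_Schwarz_ineq_sum)
      also have "\<dots> \<le> (4 * row_sq q x') * (4 * column_sq q y')"
        unfolding row_sq_def column_sq_def
        by (intro mult_mono cfun_row[OF f] cfun_column[OF g]) (simp_all add: sum_nonneg)
      also have "\<dots> = (4 * (sqrt (row_sq q x') * sqrt (column_sq q y')))\<^sup>2"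
        by (simp add: power_mult_distrib)
      finally have "cmod (lin_extend b (\<Sum>k<q. pair (x' k) (y' k))) \<le> 4 * (sqrt (row_sq q x') * sqrt (column_sq q y'))"
        by (rule power2_le_imp_le) simp
      then show ?thesis by simp
    qed
    have "cmod (lin_extend b (\<Sum>k<p. pair (x k) (y k))) / 4 \<le> nrm H0 U"
    proof (rule nrm_H0_ge[OF U])
      fix q x' y' assume r': "rep U q x' y'"
      have e: "lin_extend b (\<Sum>k<p. pair (x k) (y k)) = lin_extend b (\<Sum>k<q. pair (x' k) (y' k))"
        by (rule lin_extend_cls_eq[OF b rep_carrier[OF r] rep_carrier[OF r']]) (use r r' in \<open>simp add: rep_def\<close>)
      show "cmod (lin_extend b (\<Sum>k<p. pair (x k) (y k))) / 4 \<le> sqrt (row_sq q x') * sqrt (column_sq q y')"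
        unfolding e by (rule bnd)
    qed
    then show "(\<Sum>k<p. cfun f (incl X (x k)) * cfun g (incl Y (y k))) = 0"
      using n0 by (simp add: lin_extend_sum b_def)
  qed (use r in \<open>auto simp: rep_def\<close>)
  then show "U = \<zero>\<^bsub>H0\<^esub>" using r tens.cls_zero by (simp add: rep_def)
qed

end

sublocale haagerup \<subseteq> H0: normed_completion "haagerup_algebraic X Y"
  by (rule normed_completion.intro) (rule normed_H0)


section \<open>Frobenius C*-algebras\<close>

lemma (in cstar_algebra) cancel_left:
  assumes "u \<in> carrier A" "v \<in> carrier A" "\<And>x. x \<in> carrier A \<Longrightarrow> x \<otimes> u = x \<otimes> v"
  shows "u = v"
proof -
  have z: "u \<ominus> v \<in> carrier A" using assms by simp
  have "x \<otimes> (u \<ominus> v) = \<zero>" if x: "x \<in> carrier A" for x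
  proof -
    have "x \<otimes> (u \<ominus> v) \<oplus> x \<otimes> v = x \<otimes> u" using assms x by (simp flip: mult_add_right add: minus_plus_cancel)
    moreover have "x \<otimes> (u \<ominus> v) = (x \<otimes> (u \<ominus> v) \<oplus> x \<otimes> v) \<ominus> x \<otimes> v"
      using assms(2) x z by (simp add: a_minus_def a_assoc r_neg)
    ultimately show ?thesis using assms(2) assms(3)[OF x] x by (simp add: a_minus_def r_neg)
  qed
  from this[of "star A (u \<ominus> v)"] have "(nrm A (u \<ominus> v))\<^sup>2 = 0"
    using cstar_identity[OF z] z by simp
  then have "u \<ominus> v = \<zero>" using nrm_eq_0_iff[OF z] by simp
  then show ?thesis using minus_eq_zero_iff assms by simp
qed

locale frobenius_data = frobenius_cstar_algebra A C for A :: "'a cstar" and C :: "('a, 'c) frobenius"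
begin

abbreviation "Q \<equiv> alg C"

lemmas A_cstar = A.cstar_algebra_axioms and Q_cstar = C.cstar_algebra_axioms

lemma eta_mem: "a \<in> carrier A \<Longrightarrow> eta C a \<in> carrier (multiplier_algebra Q)"
  using eta_star_hom by (auto simp: star_hom_def linear_map_def)

lemma left_extensional: "a \<in> carrier A \<Longrightarrow> fst (eta C a) \<in> carrier Q \<rightarrow>\<^sub>E carrier Q"
  and right_extensional: "a \<in> carrier A \<Longrightarrow> snd (eta C a) \<in> carrier Q \<rightarrow>\<^sub>E carrier Q"
  using eta_mem[of a] by (auto simp: multiplier_algebra_def split_beta)

lemma left_closed [simp, intro]: "\<lbrakk>a \<in> carrier A; c \<in> carrier Q\<rbrakk> \<Longrightarrow> left_mult C a c \<in> carrier Q"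
  unfolding left_mult_def by (rule PiE_mem[OF left_extensional])

lemma right_closed [simp, intro]: "\<lbrakk>a \<in> carrier A; c \<in> carrier Q\<rbrakk> \<Longrightarrow> right_mult C c a \<in> carrier Q"
  unfolding right_mult_def by (rule PiE_mem[OF right_extensional])

lemma centraliser: "\<lbrakk>a \<in> carrier A; x \<in> carrier Q; y \<in> carrier Q\<rbrakk> \<Longrightarrow>
    x \<otimes>\<^bsub>Q\<^esub> left_mult C a y = right_mult C x a \<otimes>\<^bsub>Q\<^esub> y"
  using eta_mem[of a] by (auto simp: multiplier_algebra_def left_mult_def right_mult_def split_beta)

lemma eta_add: "\<lbrakk>a \<in> carrier A; b \<in> carrier A\<rbrakk> \<Longrightarrow>
    eta C (a \<oplus>\<^bsub>A\<^esub> b) = eta C a \<oplus>\<^bsub>multiplier_algebra Q\<^esub> eta C b"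
  and eta_smult: "a \<in> carrier A \<Longrightarrow> eta C (z \<odot>\<^bsub>A\<^esub> a) = z \<odot>\<^bsub>multiplier_algebra Q\<^esub> eta C a"
  and eta_mult: "\<lbrakk>a \<in> carrier A; b \<in> carrier A\<rbrakk> \<Longrightarrow>
    eta C (a \<otimes>\<^bsub>A\<^esub> b) = eta C a \<otimes>\<^bsub>multiplier_algebra Q\<^esub> eta C b"
  and eta_star: "a \<in> carrier A \<Longrightarrow> eta C (star A a) = star (multiplier_algebra Q) (eta C a)"
  using eta_star_hom by (auto simp: star_hom_def linear_map_def)

lemma left_add_left: "\<lbrakk>a \<in> carrier A; b \<in> carrier A; c \<in> carrier Q\<rbrakk> \<Longrightarrow>
    left_mult C (a \<oplus>\<^bsub>A\<^esub> b) c = left_mult C a c \<oplus>\<^bsub>Q\<^esub> left_mult C b c"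
  and right_add_right: "\<lbrakk>a \<in> carrier A; b \<in> carrier A; c \<in> carrier Q\<rbrakk> \<Longrightarrow>
    right_mult C c (a \<oplus>\<^bsub>A\<^esub> b) = right_mult C c a \<oplus>\<^bsub>Q\<^esub> right_mult C c b"
  by (simp_all add: left_mult_def right_mult_def eta_add) (simp_all add: multiplier_algebra_def split_beta)

lemma left_smult_left: "\<lbrakk>a \<in> carrier A; c \<in> carrier Q\<rbrakk> \<Longrightarrow>
    left_mult C (z \<odot>\<^bsub>A\<^esub> a) c = z \<odot>\<^bsub>Q\<^esub> left_mult C a c"
  and right_smult_right: "\<lbrakk>a \<in> carrier A; c \<in> carrier Q\<rbrakk> \<Longrightarrow>
    right_mult C c (z \<odot>\<^bsub>A\<^esub> a) = z \<odot>\<^bsub>Q\<^esub> right_mult C c a"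
  by (simp_all add: left_mult_def right_mult_def eta_smult) (simp_all add: multiplier_algebra_def split_beta)

lemma left_mult_left: "\<lbrakk>a \<in> carrier A; b \<in> carrier A; c \<in> carrier Q\<rbrakk> \<Longrightarrow>
    left_mult C (a \<otimes>\<^bsub>A\<^esub> b) c = left_mult C a (left_mult C b c)"
  and right_mult_right: "\<lbrakk>a \<in> carrier A; b \<in> carrier A; c \<in> carrier Q\<rbrakk> \<Longrightarrow>
    right_mult C c (a \<otimes>\<^bsub>A\<^esub> b) = right_mult C (right_mult C c a) b"
  by (simp_all add: left_mult_def right_mult_def eta_mult)
    (simp_all add: multiplier_algebra_def split_beta compose_eq)

lemma left_star: "\<lbrakk>a \<in> carrier A; c \<in> carrier Q\<rbrakk> \<Longrightarrow>
    left_mult C (star A a) c = star Q (right_mult C (star Q c) a)"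
  by (simp add: left_mult_def right_mult_def eta_star) (simp add: multiplier_algebra_def split_beta)

lemma star_left: "\<lbrakk>a \<in> carrier A; c \<in> carrier Q\<rbrakk> \<Longrightarrow>
    star Q (left_mult C a c) = right_mult C (star Q c) (star A a)"
  using left_star[of "star A a" c] by (simp add: A.star_star C.star_star)

text \<open>The definition of double centralisers does not mention linearity. It follows by
  multiplying from the left by x, moving the multiplier onto x with \<open>centraliser\<close>, and
  cancelling x.\<close>

lemma left_add_right: "\<lbrakk>a \<in> carrier A; c \<in> carrier Q; d \<in> carrier Q\<rbrakk> \<Longrightarrow>
    left_mult C a (c \<oplus>\<^bsub>Q\<^esub> d) = left_mult C a c \<oplus>\<^bsub>Q\<^esub> left_mult C a d"
  by (rule C.cancel_left) (simp_all add: centraliser C.mult_add_right)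

lemma left_smult_right: "\<lbrakk>a \<in> carrier A; c \<in> carrier Q\<rbrakk> \<Longrightarrow>
    left_mult C a (z \<odot>\<^bsub>Q\<^esub> c) = z \<odot>\<^bsub>Q\<^esub> left_mult C a c"
  by (rule C.cancel_left) (simp_all add: centraliser C.smult_mult_right)

lemma left_assoc: "\<lbrakk>a \<in> carrier A; c \<in> carrier Q; d \<in> carrier Q\<rbrakk> \<Longrightarrow>
    left_mult C a (c \<otimes>\<^bsub>Q\<^esub> d) = left_mult C a c \<otimes>\<^bsub>Q\<^esub> d"
  by (rule C.cancel_left) (simp_all add: centraliser C.mult_assoc[symmetric])

lemma right_add_left: "\<lbrakk>a \<in> carrier A; c \<in> carrier Q; d \<in> carrier Q\<rbrakk> \<Longrightarrow>
    right_mult C (c \<oplus>\<^bsub>Q\<^esub> d) a = right_mult C c a \<oplus>\<^bsub>Q\<^esub> right_mult C d a"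
  using arg_cong[OF left_add_right[of "star A a" "star Q c" "star Q d"], of "star Q"]
  by (simp add: star_left C.star_add C.star_star A.star_star)

lemma right_smult_left: "\<lbrakk>a \<in> carrier A; c \<in> carrier Q\<rbrakk> \<Longrightarrow>
    right_mult C (z \<odot>\<^bsub>Q\<^esub> c) a = z \<odot>\<^bsub>Q\<^esub> right_mult C c a"
  using arg_cong[OF left_smult_right[of "star A a" "star Q c" "cnj z"], of "star Q"]
  by (simp add: star_left C.star_smult C.star_star A.star_star)

lemma right_assoc: "\<lbrakk>a \<in> carrier A; c \<in> carrier Q; d \<in> carrier Q\<rbrakk> \<Longrightarrow>
    right_mult C (c \<otimes>\<^bsub>Q\<^esub> d) a = c \<otimes>\<^bsub>Q\<^esub> right_mult C d a"
  using arg_cong[OF left_assoc[of "star A a" "star Q d" "star Q c"], of "star Q"]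
  by (simp add: star_left C.star_mult C.star_star A.star_star)

lemma eps_closed [simp, intro]: "c \<in> carrier Q \<Longrightarrow> eps C c \<in> carrier A"
  and eps_add: "\<lbrakk>c \<in> carrier Q; d \<in> carrier Q\<rbrakk> \<Longrightarrow> eps C (c \<oplus>\<^bsub>Q\<^esub> d) = eps C c \<oplus>\<^bsub>A\<^esub> eps C d"
  and eps_smult: "c \<in> carrier Q \<Longrightarrow> eps C (z \<odot>\<^bsub>Q\<^esub> c) = z \<odot>\<^bsub>A\<^esub> eps C c"
  and eps_left: "\<lbrakk>a \<in> carrier A; c \<in> carrier Q\<rbrakk> \<Longrightarrow> eps C (left_mult C a c) = a \<otimes>\<^bsub>A\<^esub> eps C c"
  and eps_right: "\<lbrakk>a \<in> carrier A; c \<in> carrier Q\<rbrakk> \<Longrightarrow> eps C (right_mult C c a) = eps C c \<otimes>\<^bsub>A\<^esub> a"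
  and eps_cone: "c \<in> positive_cone Q \<Longrightarrow> eps C c \<in> positive_cone A"
  using eps_positive by (auto simp: positive_bimodule_map_def linear_map_def left_mult_def right_mult_def)

text \<open>The structure of the Frobenius algebra, extended by zero to the products of all C*-algebra
  structures on the two types.\<close>

definition uleft :: "'a universal \<Rightarrow> 'c universal \<Rightarrow> 'c universal"
  where "uleft a c = incl Q (left_mult C (component A a) (component Q c))"

definition uright :: "'c universal \<Rightarrow> 'a universal \<Rightarrow> 'c universal"
  where "uright c a = incl Q (right_mult C (component Q c) (component A a))"

definition ueps :: "'c universal \<Rightarrow> 'a universal"
  where "ueps c = incl A (eps C (component Q c))"

lemmas [simp] = component_closed[OF A_cstar] component_closed[OF Q_cstar]
  component_incl[OF A_cstar] component_incl[OF Q_cstar]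
lemmas uc = component_eqs[OF A_cstar] component_eqs[OF Q_cstar]
lemmas uA = incl_add[OF A_cstar] incl_csc[OF A_cstar] incl_mult_component_left[OF A_cstar]
  incl_mult_component[OF A_cstar] incl_star[OF A_cstar, symmetric]
lemmas uQ = incl_add[OF Q_cstar] incl_csc[OF Q_cstar] incl_mult_component_left[OF Q_cstar]
  incl_mult_component[OF Q_cstar] incl_star[OF Q_cstar, symmetric]

lemma csc_imaginary_unit: "csc \<i> w = imul w"
  by (simp add: csc_def)

sublocale U: positive_action uleft uright ueps
proof
  fix a b :: "'a universal" and c d :: "'c universal" and r :: real
  show "uleft (a + b) c = uleft a c + uleft b c" by (simp add: uleft_def uc left_add_left uQ)
  show "uleft a (c + d) = uleft a c + uleft a d" by (simp add: uleft_def uc left_add_right uQ)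
  show "uleft (r *\<^sub>R a) c = r *\<^sub>R uleft a c" by (simp add: uleft_def uc left_smult_left uQ csc_of_real)
  show "uleft a (r *\<^sub>R c) = r *\<^sub>R uleft a c" by (simp add: uleft_def uc left_smult_right uQ csc_of_real)
  show "uleft (a * b) c = uleft a (uleft b c)" by (simp add: uleft_def uc left_mult_left)
  show "adj (uleft a c) * d = adj c * uleft (adj a) d"
    by (simp add: uleft_def uc uQ centraliser star_left)
  show "uright c a = adj (uleft (adj a) (adj c))"
    by (simp add: uleft_def uright_def uc uQ star_left A.star_star C.star_star)
  show "ueps (c + d) = ueps c + ueps d" by (simp add: ueps_def uc eps_add uA)
  show "ueps (r *\<^sub>R c) = r *\<^sub>R ueps c" by (simp add: ueps_def uc eps_smult uA csc_of_real)
  show "ueps (imul c) = imul (ueps c)" by (simp add: ueps_def uc eps_smult uA csc_imaginary_unit)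
  show "pos (ueps c)" if "pos c"
  proof -
    have "eps C (component Q c) \<in> positive_cone A" by (rule eps_cone[OF pos_component[OF Q_cstar \<open>pos c\<close>]])
    then show ?thesis unfolding ueps_def by (subst positive_cone_iff[OF A_cstar, symmetric]) simp_all
  qed
  show "ueps (uleft a c) = a * ueps c" by (simp add: ueps_def uleft_def eps_left uA)
  show "ueps (uright c a) = ueps c * a" by (simp add: ueps_def uright_def eps_right uA)
qed

section \<open>The balanced tensor product and the multiplication map\<close>

sublocale hg: haagerup Q Q by unfold_locales

abbreviation "HS \<equiv> haagerup_space Q Q"

definition "relation_set = {haagerup_elem Q Q (right_mult C x a) y \<ominus>\<^bsub>HS\<^esub> haagerup_elem Q Q x (left_mult C a y) | x a y.
       x \<in> carrier Q \<and> a \<in> carrier A \<and> y \<in> carrier Q}"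

abbreviation "BR \<equiv> balanced_relations A Q (right_mult C) Q (left_mult C)"
abbreviation "TS \<equiv> frobenius_tensor A C"

sublocale hs: normed_module HS "nrm HS"
  unfolding haagerup_space_def by (rule hg.H0.normed_completion)

definition "toc u = to_completion hg.H0 (hg.tens.cls u)"

lemma toc_closed [simp, intro]: "u \<in> carrier hg.FS \<Longrightarrow> toc u \<in> carrier HS"
  unfolding toc_def haagerup_space_def by (rule hg.H0.to_completion_closed) (rule hg.tens.cls_carrier)

lemma toc_add: "\<lbrakk>u \<in> carrier hg.FS; v \<in> carrier hg.FS\<rbrakk> \<Longrightarrow> toc (u + v) = toc u \<oplus>\<^bsub>HS\<^esub> toc v"
  unfolding toc_def haagerup_space_def hg.cls_plus
  by (rule hg.H0.to_completion_add) (rule hg.tens.cls_carrier, assumption)+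

lemma toc_scale: "u \<in> carrier hg.FS \<Longrightarrow> toc (Poly_Mapping.map ((*) c) u) = c \<odot>\<^bsub>HS\<^esub> toc u"
  unfolding toc_def haagerup_space_def hg.cls_scale
  by (rule hg.H0.to_completion_smult) (rule hg.tens.cls_carrier)

lemma toc_diff: "\<lbrakk>u \<in> carrier hg.FS; v \<in> carrier hg.FS\<rbrakk> \<Longrightarrow> toc (u - v) = toc u \<ominus>\<^bsub>HS\<^esub> toc v"
proof -
  assume uv: "u \<in> carrier hg.FS" "v \<in> carrier hg.FS"
  have e: "u - v = u + Poly_Mapping.map ((*) (-1)) v"
    by (rule poly_mapping_eqI) (simp add: lookup_minus lookup_add lookup_scale)
  show ?thesis unfolding e a_minus_def using uv
    by (simp only: toc_add hg.FS_scale toc_scale hs.minus_eq_smult toc_closed)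
qed

lemma nrm_toc: "u \<in> carrier hg.FS \<Longrightarrow> nrm HS (toc u) = nrm hg.H0 (hg.tens.cls u)"
  unfolding toc_def haagerup_space_def by (rule hg.H0.nrm_to_completion) (rule hg.tens.cls_carrier)

lemma haagerup_elem_toc: "haagerup_elem Q Q x y = toc (pair x y)"
  by (simp add: haagerup_elem_def toc_def)

lemma relation_set_eq: "relation_set = {toc (pair (right_mult C x a) y - pair x (left_mult C a y)) | x a y.
       x \<in> carrier Q \<and> a \<in> carrier A \<and> y \<in> carrier Q}"
proof -
  have "haagerup_elem Q Q (right_mult C x a) y \<ominus>\<^bsub>HS\<^esub> haagerup_elem Q Q x (left_mult C a y)
      = toc (pair (right_mult C x a) y - pair x (left_mult C a y))"
    if "x \<in> carrier Q" "a \<in> carrier A" "y \<in> carrier Q" for x a y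
    unfolding haagerup_elem_toc by (rule toc_diff[symmetric]) (use that in auto)
  then show ?thesis unfolding relation_set_def by (intro Collect_cong ex_cong1) auto
qed

lemma relation_set_subset: "relation_set \<subseteq> carrier HS"
  unfolding relation_set_eq by auto

lemma BR_closure: "BR = hs.metric.mtopology closure_of (lin_span HS relation_set)"
  by (simp add: balanced_relations_def closed_span_def norm_closure_def relation_set_def)

lemma submodule_span: "submodule (lin_span HS relation_set) complex_ring HS"
proof -
  interpret m: complex_module HS by (rule complex_module.intro) (rule hs.module_axioms)
  show ?thesis by (rule m.submodule_lin_span(1)[OF relation_set_subset])
qed

sublocale bal: seminorm_quotient HS BR TS
proof (intro seminorm_quotient.intro module_quotient.intro complex_module.intro hs.module_axioms
    module_quotient_axioms.intro hs.seminormed_module_axioms seminorm_quotient_axioms.intro)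
  show "submodule BR complex_ring HS" unfolding BR_closure by (rule hs.submodule_closure[OF submodule_span])
qed (simp_all only: frobenius_tensor_def balanced_haagerup_space_def quotient_space_def nspace.simps
    partial_object.simps monoid.simps ring.simps module.simps)

sublocale ts: seminormed_module TS "nrm TS" by (rule bal.seminormed_Q)

abbreviation "FE \<equiv> frobenius_elem A C"

lemma FE_eq: "FE x y = bal.cls (toc (pair x y))"
  by (simp add: frobenius_elem_def balanced_haagerup_elem_def haagerup_elem_toc)

lemma FE_closed [simp, intro]: "\<lbrakk>x \<in> carrier Q; y \<in> carrier Q\<rbrakk> \<Longrightarrow> FE x y \<in> carrier TS"
  unfolding FE_eq by auto

lemma toc_pair_add: "\<lbrakk>x \<in> carrier Q; x' \<in> carrier Q; y \<in> carrier Q\<rbrakk> \<Longrightarrow>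
    toc (pair (x \<oplus>\<^bsub>Q\<^esub> x') y) = toc (pair x y) \<oplus>\<^bsub>HS\<^esub> toc (pair x' y)"
  by (subst toc_add[symmetric]) (auto simp: toc_def hg.cls_pair_add_left hg.cls_plus)

lemma FE_add: "\<lbrakk>x \<in> carrier Q; x' \<in> carrier Q; y \<in> carrier Q\<rbrakk> \<Longrightarrow>
    FE (x \<oplus>\<^bsub>Q\<^esub> x') y = FE x y \<oplus>\<^bsub>TS\<^esub> FE x' y"
  unfolding FE_eq by (subst bal.cls_add) (auto simp: toc_pair_add)

lemma FE_zero: assumes y: "y \<in> carrier Q" shows "FE \<zero>\<^bsub>Q\<^esub> y = \<zero>\<^bsub>TS\<^esub>"
proof -
  have e: "FE \<zero>\<^bsub>Q\<^esub> y = FE \<zero>\<^bsub>Q\<^esub> y \<oplus>\<^bsub>TS\<^esub> FE \<zero>\<^bsub>Q\<^esub> y"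
    using FE_add[of "\<zero>\<^bsub>Q\<^esub>" "\<zero>\<^bsub>Q\<^esub>" y] y by simp
  have c: "FE \<zero>\<^bsub>Q\<^esub> y \<in> carrier TS" using y by simp
  then have "FE \<zero>\<^bsub>Q\<^esub> y = (FE \<zero>\<^bsub>Q\<^esub> y \<oplus>\<^bsub>TS\<^esub> FE \<zero>\<^bsub>Q\<^esub> y) \<ominus>\<^bsub>TS\<^esub> FE \<zero>\<^bsub>Q\<^esub> y"
    by (simp add: a_minus_def ts.a_assoc ts.r_neg)
  also have "\<dots> = \<zero>\<^bsub>TS\<^esub>" unfolding e[symmetric] using c by (simp add: a_minus_def ts.r_neg)
  finally show ?thesis .
qed

definition "product x y = incl Q x * incl Q y"

lemma bilinear_product: "hg.bilinear product"
  unfolding hg.bilinear_def product_def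
  by (auto simp: incl_add[OF Q_cstar] incl_csc[OF Q_cstar] csc_times_left csc_times_right distrib_left distrib_right)

text \<open>A row times a single column is bounded by the product of their norms, for every
  representation of the tensor; the infimum over representations is the Haagerup norm.\<close>

lemma norm_product_extend:
  assumes u: "u \<in> carrier hg.FS" shows "norm (lin_extend product u) \<le> nrm hg.H0 (hg.tens.cls u)"
proof (rule hg.nrm_H0_ge)
  show "hg.tens.cls u \<in> carrier hg.H0" using u by simp
  fix p x y assume r: "hg.rep (hg.tens.cls u) p x y"
  define z where "z = (\<Sum>k<p. incl Q (x k) * incl Q (y k))"
  have e: "lin_extend product u = z"
    using hg.lin_extend_cls_eq[OF bilinear_product hg.rep_carrier[OF r] u] r
    by (simp add: hg.rep_def lin_extend_sum product_def z_def)
  have "col_sq ({..<p} \<times> {()}) (\<lambda>(k, i). incl Q (y k)) = hg.column_sq p y"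
  proof -
    have "(\<Sum>q\<in>{..<p} \<times> {()}. adj (case q of (k, i) \<Rightarrow> incl Q (y k)) * (case q of (k, i) \<Rightarrow> incl Q (y k)))
        = (\<Sum>k<p. \<Sum>i\<in>{()}. adj (incl Q (y k)) * incl Q (y k))"
      unfolding sum.cartesian_product split_def ..
    then show ?thesis by (simp add: col_sq_def hg.column_sq_def)
  qed
  moreover have "col_sq {()} (\<lambda>i. \<Sum>k<p. incl Q (x k) * incl Q (y k)) = (norm z)\<^sup>2"
    by (simp add: col_sq_def cstar_norm flip: z_def)
  ultimately have "(norm z)\<^sup>2 \<le> hg.row_sq p x * hg.column_sq p y"
    using row_times_columns[of "{()}" "\<lambda>k. incl Q (x k)" "\<lambda>k i. incl Q (y k)" "{..<p}"]
    by (simp add: hg.row_sq_def)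
  then have "norm z \<le> sqrt (hg.row_sq p x * hg.column_sq p y)" by (rule real_le_rsqrt)
  then show "norm (lin_extend product u) \<le> sqrt (hg.row_sq p x) * sqrt (hg.column_sq p y)"
    by (simp add: e real_sqrt_mult)
qed

text \<open>The multiplication of \<open>C\<close> annihilates the balancing relations, by
  \<open>centraliser\<close>. Elements of the span are lifted to the free space because the
  multiplication map is defined there and not on the completion.\<close>

lemma span_product_zero:
  assumes h: "h \<in> lin_span HS relation_set"
  obtains v where "v \<in> carrier hg.FS" "h = toc v" "lin_extend product v = 0"
proof -
  let ?G = "{toc v | v. v \<in> carrier hg.FS \<and> lin_extend product v = 0}"
  have sm: "c \<odot>\<^bsub>HS\<^esub> g \<in> ?G" if g: "g \<in> ?G" for c g
  proof -
    obtain v where "v \<in> carrier hg.FS" "lin_extend product v = 0" "g = toc v" using g by blast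
    then have "c \<odot>\<^bsub>HS\<^esub> g = toc (Poly_Mapping.map ((*) c) v)" "Poly_Mapping.map ((*) c) v \<in> carrier hg.FS"
      "lin_extend product (Poly_Mapping.map ((*) c) v) = 0"
      by (simp_all only: toc_scale lin_extend_scale hg.FS_scale csc_0_right)
    then show ?thesis by blast
  qed
  have t0: "toc 0 \<in> ?G" using hg.FS_0 lin_extend_0 by blast
  have sub: "?G \<subseteq> carrier HS" using toc_closed by blast
  have "submodule ?G complex_ring HS"
  proof (rule hs.submoduleI[OF sub])
    have "0 \<odot>\<^bsub>HS\<^esub> toc 0 \<in> ?G" by (rule sm[OF t0])
    then show "\<zero>\<^bsub>HS\<^esub> \<in> ?G" using hs.smult_zero_left[of "toc 0"] by simp
    show "\<ominus>\<^bsub>HS\<^esub> g \<in> ?G" if "g \<in> ?G" for g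
      using sm[OF that, of "- 1"] unfolding hs.minus_eq_smult[OF subsetD[OF sub that], symmetric] .
    show "c \<odot>\<^bsub>HS\<^esub> g \<in> ?G" if "g \<in> ?G" for c g by (rule sm[OF that])
    fix g g' assume "g \<in> ?G" "g' \<in> ?G"
    then obtain v v' where v: "v \<in> carrier hg.FS" "lin_extend product v = 0" "g = toc v"
      "v' \<in> carrier hg.FS" "lin_extend product v' = 0" "g' = toc v'" by blast
    have "g \<oplus>\<^bsub>HS\<^esub> g' = toc (v + v')" unfolding v(3,6) by (rule toc_add[OF v(1,4), symmetric])
    moreover have "lin_extend product (v + v') = 0" by (simp only: lin_extend_add v(2,5) add_0)
    ultimately show "g \<oplus>\<^bsub>HS\<^esub> g' \<in> ?G" using hg.FS_add[OF v(1,4)] by blast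
  qed
  moreover have "relation_set \<subseteq> ?G"
  proof
    fix r assume "r \<in> relation_set"
    then obtain x a y where xay: "x \<in> carrier Q" "a \<in> carrier A" "y \<in> carrier Q"
      and r: "r = toc (pair (right_mult C x a) y - pair x (left_mult C a y))" unfolding relation_set_eq by blast
    have "lin_extend product (pair (right_mult C x a) y - pair x (left_mult C a y)) = 0"
      using xay by (simp add: lin_extend_diff product_def centraliser flip: incl_mult[OF Q_cstar])
    then show "r \<in> ?G" using r xay by blast
  qed
  ultimately have "lin_span HS relation_set \<subseteq> ?G" by (rule bal.lin_span_least)
  then show ?thesis using h that by blast
qed

text \<open>Choose a representative Z = h + x \<otimes> y of almost minimal norm and replace h, a
  limit of combinations of relations, by a nearby combination h'. Multiplication kills h', so it
  sends h' + x \<otimes> y to x y, and it is contractive.\<close>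

lemma norm_product_le:
  assumes x: "x \<in> carrier Q" and y: "y \<in> carrier Q"
  shows "norm (incl Q x * incl Q y) \<le> nrm TS (FE x y)"
proof (rule field_le_epsilon)
  fix \<epsilon> :: real assume e: "\<epsilon> > 0"
  let ?P = "toc (pair x y)"
  have P: "?P \<in> carrier HS" using x y by auto
  have "nrm TS (bal.cls ?P) < nrm TS (FE x y) + \<epsilon> / 2" using e by (simp add: FE_eq)
  then obtain Z where Z: "Z \<in> bal.cls ?P" "Z \<in> carrier HS" "nrm HS Z < nrm TS (FE x y) + \<epsilon> / 2"
    by (rule bal.nrm_cls_approx[OF P])
  obtain h where h: "h \<in> BR" "Z = h \<oplus>\<^bsub>HS\<^esub> ?P" using Z(1) unfolding bal.mem_cls by blast
  have hc: "h \<in> carrier HS" using h(1) bal.N_subset by blast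
  have "\<epsilon> / 2 > 0" using e by simp
  then obtain h' where h': "h' \<in> lin_span HS relation_set" "h' \<in> carrier HS" "nrm HS (h \<ominus>\<^bsub>HS\<^esub> h') < \<epsilon> / 2"
    using h(1) unfolding BR_closure hs.closure_iff by blast
  obtain v where v: "v \<in> carrier hg.FS" "h' = toc v" "lin_extend product v = 0"
    by (rule span_product_zero[OF h'(1)])
  have pc: "pair x y \<in> carrier hg.FS" using x y by auto
  have "toc (v + pair x y) = h' \<oplus>\<^bsub>HS\<^esub> ?P" using v pc by (simp add: toc_add)
  also have "\<dots> = ((h' \<ominus>\<^bsub>HS\<^esub> h) \<oplus>\<^bsub>HS\<^esub> h) \<oplus>\<^bsub>HS\<^esub> ?P" using hs.minus_plus_cancel[of h' h] h'(2) hc by simp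
  also have "\<dots> = (h' \<ominus>\<^bsub>HS\<^esub> h) \<oplus>\<^bsub>HS\<^esub> Z" unfolding h(2) using h'(2) hc P by (intro hs.a_assoc) simp_all
  finally have "nrm HS (toc (v + pair x y)) \<le> nrm HS (h' \<ominus>\<^bsub>HS\<^esub> h) + nrm HS Z"
    using hs.n_triangle[of "h' \<ominus>\<^bsub>HS\<^esub> h" Z] h'(2) hc Z(2) by simp
  moreover have "nrm HS (h' \<ominus>\<^bsub>HS\<^esub> h) = nrm HS (h \<ominus>\<^bsub>HS\<^esub> h')" by (rule hs.n_minus_commute[OF h'(2) hc])
  moreover have "norm (incl Q x * incl Q y) \<le> nrm HS (toc (v + pair x y))"
    using norm_product_extend[of "v + pair x y"] v pc by (simp add: lin_extend_add product_def nrm_toc)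
  ultimately show "norm (incl Q x * incl Q y) \<le> nrm TS (FE x y) + \<epsilon>" using h'(3) Z(3) by simp
qed

text \<open>The right leg v is common to all summands, so the sum of the x_k \<epsilon>(y_k c)
  \<otimes> v is again a single elementary tensor.\<close>

lemma product_elementary:
  fixes p :: nat
  assumes m: "frobenius_product A C m"
    and x: "\<And>k. k < p \<Longrightarrow> x k \<in> carrier Q" and y: "\<And>k. k < p \<Longrightarrow> y k \<in> carrier Q"
    and c: "c \<in> carrier Q" and v: "v \<in> carrier Q"
  obtains w where "w \<in> carrier Q"
    "incl Q w = (\<Sum>k<p. incl Q (right_mult C (x k) (eps C (y k \<otimes>\<^bsub>Q\<^esub> c))))"
    "m (bal.cls (toc (\<Sum>k<p. pair (x k) (y k)))) (FE c v) = FE w v"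
proof -
  have cv: "FE c v \<in> carrier TS" using c v by simp
  have lin: "linear_map TS TS (\<lambda>u. m u (FE c v))"
    using m cv unfolding frobenius_product_def bounded_bilinear_map_def by blast
  have "\<exists>w\<in>carrier Q. incl Q w = (\<Sum>k<p. incl Q (right_mult C (x k) (eps C (y k \<otimes>\<^bsub>Q\<^esub> c)))) \<and>
    m (bal.cls (toc (\<Sum>k<p. pair (x k) (y k)))) (FE c v) = FE w v"
    using x y
  proof (induction p)
    case 0
    have z: "bal.cls (toc 0) \<in> carrier TS" by auto
    have "Poly_Mapping.map ((*) 0) (0 :: ('c \<times> 'c) \<Rightarrow>\<^sub>0 complex) = 0" by (rule poly_mapping_eqI) (simp add: lookup_scale)
    then have "bal.cls (toc 0) = 0 \<odot>\<^bsub>TS\<^esub> bal.cls (toc 0)"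
      using bal.cls_smult[of "toc 0" 0] toc_scale[of 0 0] by simp
    then have "m (bal.cls (toc 0)) (FE c v) = 0 \<odot>\<^bsub>TS\<^esub> m (bal.cls (toc 0)) (FE c v)"
      using lin z unfolding linear_map_def by metis
    also have "\<dots> = \<zero>\<^bsub>TS\<^esub>" using lin z unfolding linear_map_def by (intro ts.smult_zero_left) auto
    finally show ?case using FE_zero[OF v] incl_zero[OF Q_cstar] by (intro bexI[of _ "\<zero>\<^bsub>Q\<^esub>"]) simp_all
  next
    case (Suc p)
    then obtain w where w: "w \<in> carrier Q" "incl Q w = (\<Sum>k<p. incl Q (right_mult C (x k) (eps C (y k \<otimes>\<^bsub>Q\<^esub> c))))"
      "m (bal.cls (toc (\<Sum>k<p. pair (x k) (y k)))) (FE c v) = FE w v" by auto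
    have xp: "x p \<in> carrier Q" "y p \<in> carrier Q" using Suc.prems by simp_all
    have sc: "(\<Sum>k<p. pair (x k) (y k)) \<in> carrier hg.FS" using Suc.prems by (intro hg.FS_sum) auto
    let ?w = "right_mult C (x p) (eps C (y p \<otimes>\<^bsub>Q\<^esub> c))"
    have wc: "?w \<in> carrier Q" using xp c by simp
    have split: "bal.cls (toc (\<Sum>k<Suc p. pair (x k) (y k)))
        = bal.cls (toc (\<Sum>k<p. pair (x k) (y k))) \<oplus>\<^bsub>TS\<^esub> FE (x p) (y p)"
      unfolding FE_eq using sc xp by (subst bal.cls_add) (auto simp: toc_add)
    have "m (bal.cls (toc (\<Sum>k<Suc p. pair (x k) (y k)))) (FE c v)
        = m (bal.cls (toc (\<Sum>k<p. pair (x k) (y k)))) (FE c v) \<oplus>\<^bsub>TS\<^esub> m (FE (x p) (y p)) (FE c v)"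
      unfolding split using lin sc xp unfolding linear_map_def by blast
    also have "m (FE (x p) (y p)) (FE c v) = FE ?w v"
      using m xp c v unfolding frobenius_product_def by blast
    finally have "m (bal.cls (toc (\<Sum>k<Suc p. pair (x k) (y k)))) (FE c v) = FE (w \<oplus>\<^bsub>Q\<^esub> ?w) v"
      using w wc v by (simp add: FE_add)
    then show ?case using w wc by (intro bexI[of _ "w \<oplus>\<^bsub>Q\<^esub> ?w"]) (simp_all add: incl_add[OF Q_cstar])
  qed
  then show ?thesis using that by blast
qed

text \<open>Apply an element u of the bounded approximate identity to tensors c \<otimes> v. After
  replacing u by a nearby finite sum z, the difference between the product z (c \<otimes> v) and c
  \<otimes> v is an elementary tensor (w - c) \<otimes> v, and \<open>norm_product_le\<close> turns
  its small norm into a small norm of (w - c) v.\<close>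

theorem approximate_unit: obtains K where "U.approximate_unit (incl Q ` carrier Q) K"
proof -
  obtain m where m: "frobenius_product A C m" "has_bounded_approximate_identity TS m"
    using approximate_identity by blast
  obtain F :: "('c, 'c) haagerup set filter" and K where F: "F \<noteq> bot"
    and FK: "\<forall>\<^sub>F u in F. u \<in> carrier TS \<and> nrm TS u \<le> K"
    and Flim: "\<And>b. b \<in> carrier TS \<Longrightarrow> ((\<lambda>u. nrm TS (m u b \<ominus>\<^bsub>TS\<^esub> b)) \<longlongrightarrow> 0) F"
    using m(2) unfolding has_bounded_approximate_identity_def by blast
  obtain K' where K': "\<And>u b. \<lbrakk>u \<in> carrier TS; b \<in> carrier TS\<rbrakk> \<Longrightarrow> nrm TS (m u b) \<le> K' * nrm TS u * nrm TS b"
    using m(1) unfolding frobenius_product_def bounded_bilinear_map_def by blast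
  have mlin: "linear_map TS TS (\<lambda>u. m u b)" if "b \<in> carrier TS" for b
    using m(1) that unfolding frobenius_product_def bounded_bilinear_map_def by blast
  \<comment> \<open>One unit of slack for the representative Z of u in the Haagerup space, one for
    the approximation of Z by an algebraic tensor within \<eta> \<le> 1. Row and column squares are
    then both at most t, whence the constant \<open>t * t\<close>.\<close>
  define t where "t = \<bar>K\<bar> + 2"
  have "U.approximate_unit (incl Q ` carrier Q) (t * t)"
    unfolding U.approximate_unit_def
  proof (intro conjI allI impI)
    show "0 \<le> t * t" by simp
    fix S :: "('c universal \<times> 'c universal) set" and \<delta> :: real
    assume S: "finite S" "fst ` S \<subseteq> incl Q ` carrier Q" and \<delta>: "0 < \<delta>"
    define b where "b s = FE (component Q (fst s)) (component Q (snd s))" for s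
    have bc: "b s \<in> carrier TS" for s by (simp add: b_def)
    have "\<forall>\<^sub>F u in F. \<forall>s\<in>S. nrm TS (m u (b s) \<ominus>\<^bsub>TS\<^esub> b s) < \<delta> / 2"
    proof (rule eventually_ball_finite[OF S(1)], rule ballI)
      show "\<forall>\<^sub>F u in F. nrm TS (m u (b s) \<ominus>\<^bsub>TS\<^esub> b s) < \<delta> / 2" for s
        by (rule order_tendstoD(2)[OF Flim[OF bc]]) (use \<delta> in simp)
    qed
    with FK have "\<forall>\<^sub>F u in F. (u \<in> carrier TS \<and> nrm TS u \<le> K) \<and> (\<forall>s\<in>S. nrm TS (m u (b s) \<ominus>\<^bsub>TS\<^esub> b s) < \<delta> / 2)"
      by (rule eventually_conj)
    then obtain u where u: "u \<in> carrier TS" "nrm TS u \<le> K"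
      and us: "\<And>s. s \<in> S \<Longrightarrow> nrm TS (m u (b s) \<ominus>\<^bsub>TS\<^esub> b s) < \<delta> / 2"
      using eventually_happens'[OF F] by blast
    define M where "M = (\<Sum>s\<in>S. nrm TS (b s))"
    have bM: "nrm TS (b s) \<le> M" if "s \<in> S" for s
      unfolding M_def by (rule member_le_sum[OF that _ S(1)]) (rule ts.n_nonneg[OF bc])
    have M0: "0 \<le> M" unfolding M_def by (intro sum_nonneg ts.n_nonneg bc)
    \<comment> \<open>Chosen so that replacing u by z changes \<open>m u (b s)\<close> by at most
      \<open>\<bar>K'\<bar> * \<eta> * M \<le> \<delta> / 2\<close>; the absolute value and the
      added 1 keep the denominator positive for every K' and for M = 0.\<close>
    define \<eta> where "\<eta> = min 1 (\<delta> / (2 * (\<bar>K'\<bar> * M + 1)))"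
    have pos1: "\<bar>K'\<bar> * M + 1 > 0" using M0 by (simp add: add_nonneg_pos)
    have \<eta>: "0 < \<eta>" "\<eta> \<le> 1" "\<eta> * (\<bar>K'\<bar> * M + 1) \<le> \<delta> / 2"
    proof -
      have half: "\<delta> / (2 * q) * q = \<delta> / 2" if "q > 0" for q using that by simp
      show "0 < \<eta>" "\<eta> \<le> 1" using \<delta> pos1 by (simp_all add: \<eta>_def)
      have "\<eta> * (\<bar>K'\<bar> * M + 1) \<le> \<delta> / (2 * (\<bar>K'\<bar> * M + 1)) * (\<bar>K'\<bar> * M + 1)"
        using pos1 by (intro mult_right_mono) (simp_all add: \<eta>_def)
      also have "\<dots> = \<delta> / 2" using half[OF pos1] .
      finally show "\<eta> * (\<bar>K'\<bar> * M + 1) \<le> \<delta> / 2" .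
    qed
    obtain Z0 where Z0: "Z0 \<in> carrier HS" "u = bal.cls Z0" using u(1) unfolding bal.carrier_Q by blast
    have "nrm TS (bal.cls Z0) < \<bar>K\<bar> + 1" using u(2) Z0(2) by simp
    then obtain Z where Z: "Z \<in> bal.cls Z0" "Z \<in> carrier HS" "nrm HS Z < \<bar>K\<bar> + 1"
      by (rule bal.nrm_cls_approx[OF Z0(1)])
    have uZ: "u = bal.cls Z" using bal.cls_of_mem[OF Z0(1) Z(1)] Z0(2) by simp
    obtain V where V: "V \<in> carrier hg.H0" "nrm HS (Z \<ominus>\<^bsub>HS\<^esub> to_completion hg.H0 V) < \<eta>"
      using hg.H0.to_completion_dense[OF Z(2)[unfolded haagerup_space_def] \<eta>(1)]
      unfolding haagerup_space_def by blast
    let ?V = "to_completion hg.H0 V"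
    have Vc: "?V \<in> carrier HS" unfolding haagerup_space_def by (rule hg.H0.to_completion_closed[OF V(1)])
    have "nrm HS ?V < t"
      using hs.n_diff_bound[OF Z(2) Vc] V(2) Z(3) \<eta>(2) by (simp add: t_def)
    then have "nrm hg.H0 V < t"
      using hg.H0.nrm_to_completion[OF V(1)] by (simp add: haagerup_space_def)
    then obtain p x y where r: "hg.rep V p x y" and rt: "hg.row_sq p x \<le> t" "hg.column_sq p y \<le> t"
      by (rule hg.rep_approx[OF V(1)])
    have xy: "x k \<in> carrier Q" "y k \<in> carrier Q" if "k < p" for k using r that by (simp_all add: hg.rep_def)
    define z where "z = bal.cls (toc (\<Sum>k<p. pair (x k) (y k)))"
    have zV: "z = bal.cls ?V" using r by (simp add: z_def toc_def hg.rep_def)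
    have zc: "z \<in> carrier TS" unfolding zV by (rule bal.cls_carrier[OF Vc])
    have zu: "nrm TS (z \<ominus>\<^bsub>TS\<^esub> u) \<le> \<eta>"
    proof -
      have "nrm TS (u \<ominus>\<^bsub>TS\<^esub> z) \<le> nrm HS (Z \<ominus>\<^bsub>HS\<^esub> ?V)"
        unfolding uZ zV bal.cls_minus[OF Z(2) Vc] by (rule bal.nrm_cls_self) (use Z(2) Vc in simp)
      then show ?thesis using V(2) ts.n_minus_commute[OF zc u(1)] by simp
    qed
    have close: "nrm TS (m z (b s) \<ominus>\<^bsub>TS\<^esub> b s) \<le> \<delta>" if s: "s \<in> S" for s
    proof -
      have mc: "m (z \<ominus>\<^bsub>TS\<^esub> u) (b s) \<in> carrier TS" "m u (b s) \<in> carrier TS"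
        using mlin[OF bc[of s]] zc u(1) unfolding linear_map_def by (auto simp: Pi_iff)
      have "m ((z \<ominus>\<^bsub>TS\<^esub> u) \<oplus>\<^bsub>TS\<^esub> u) (b s) = m (z \<ominus>\<^bsub>TS\<^esub> u) (b s) \<oplus>\<^bsub>TS\<^esub> m u (b s)"
        using mlin[OF bc[of s]] zc u(1) ts.minus_closed[OF zc u(1)] unfolding linear_map_def by blast
      then have "m z (b s) \<ominus>\<^bsub>TS\<^esub> b s = m (z \<ominus>\<^bsub>TS\<^esub> u) (b s) \<oplus>\<^bsub>TS\<^esub> (m u (b s) \<ominus>\<^bsub>TS\<^esub> b s)"
        using ts.minus_plus_cancel[OF zc u(1)] mc bc[of s] by (simp add: a_minus_def ts.a_assoc)
      then have "nrm TS (m z (b s) \<ominus>\<^bsub>TS\<^esub> b s) \<le> nrm TS (m (z \<ominus>\<^bsub>TS\<^esub> u) (b s)) + nrm TS (m u (b s) \<ominus>\<^bsub>TS\<^esub> b s)"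
        using ts.n_triangle[OF mc(1) ts.minus_closed[OF mc(2) bc[of s]]] by simp
      moreover have "nrm TS (m (z \<ominus>\<^bsub>TS\<^esub> u) (b s)) \<le> \<delta> / 2"
      proof -
        have "nrm TS (m (z \<ominus>\<^bsub>TS\<^esub> u) (b s)) \<le> K' * nrm TS (z \<ominus>\<^bsub>TS\<^esub> u) * nrm TS (b s)"
          by (rule K'[OF ts.minus_closed[OF zc u(1)] bc])
        also have "\<dots> \<le> \<bar>K'\<bar> * \<eta> * M"
          by (intro mult_mono zu bM[OF s] mult_nonneg_nonneg ts.n_nonneg bc ts.minus_closed zc u(1))
            (use \<eta> in auto)
        also have "\<dots> \<le> \<eta> * (\<bar>K'\<bar> * M + 1)" using \<eta>(1) by (simp add: distrib_left ac_simps)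
        finally show ?thesis using \<eta>(3) by simp
      qed
      ultimately show ?thesis using us[OF s] by simp
    qed
    show "\<exists>(P :: nat set) x y. norm (\<Sum>k\<in>P. x k * adj (x k)) * norm (\<Sum>k\<in>P. adj (y k) * y k) \<le> t * t \<and>
      (\<forall>(c, v)\<in>S. norm ((\<Sum>k\<in>P. x k * uleft (ueps (y k * c)) v) - c * v) \<le> \<delta>)"
    proof (intro exI conjI ballI)
      show "norm (\<Sum>k\<in>{..<p}. incl Q (x k) * adj (incl Q (x k))) * norm (\<Sum>k\<in>{..<p}. adj (incl Q (y k)) * incl Q (y k)) \<le> t * t"
        using rt unfolding hg.row_sq_def hg.column_sq_def by (intro mult_mono) (simp_all add: t_def)
      fix s assume s: "s \<in> S"
      obtain c0 where c0: "c0 \<in> carrier Q" "fst s = incl Q c0" using S(2) s by blast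
      define v0 where "v0 = component Q (snd s)"
      have v0: "v0 \<in> carrier Q" by (simp add: v0_def)
      obtain w where w: "w \<in> carrier Q"
        "incl Q w = (\<Sum>k<p. incl Q (right_mult C (x k) (eps C (y k \<otimes>\<^bsub>Q\<^esub> c0))))"
        "m z (FE c0 v0) = FE w v0"
        unfolding z_def by (rule product_elementary[OF m(1), where x=x and y=y and c=c0 and v=v0 and p=p]) (use xy c0 v0 in auto)
      have bs: "b s = FE c0 v0" using c0 by (simp add: b_def v0_def)
      have wm: "w \<ominus>\<^bsub>Q\<^esub> c0 \<in> carrier Q" using w(1) c0(1) by simp
      have "FE w v0 = FE (w \<ominus>\<^bsub>Q\<^esub> c0) v0 \<oplus>\<^bsub>TS\<^esub> FE c0 v0"
        using FE_add[OF wm c0(1) v0] C.minus_plus_cancel[OF w(1) c0(1)] by simp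
      then have "FE w v0 \<ominus>\<^bsub>TS\<^esub> FE c0 v0 = FE (w \<ominus>\<^bsub>Q\<^esub> c0) v0"
        using FE_closed[OF wm v0] FE_closed[OF c0(1) v0] by (simp add: a_minus_def ts.a_assoc ts.r_neg)
      then have "norm (incl Q (w \<ominus>\<^bsub>Q\<^esub> c0) * incl Q v0) \<le> \<delta>"
        using norm_product_le[OF wm v0] close[OF s] by (simp add: bs w(3))
      moreover have "incl Q (w \<ominus>\<^bsub>Q\<^esub> c0) * incl Q v0 = (\<Sum>k<p. incl Q (x k) * uleft (ueps (incl Q (y k) * fst s)) (snd s)) - fst s * snd s"
      proof -
        have "incl Q (x k) * uleft (ueps (incl Q (y k) * fst s)) (snd s)
            = incl Q (right_mult C (x k) (eps C (y k \<otimes>\<^bsub>Q\<^esub> c0))) * incl Q v0" if "k < p" for k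
          using xy[OF that] c0 v0
          by (simp add: uleft_def ueps_def uc centraliser flip: v0_def incl_mult[OF Q_cstar])
        moreover have "fst s * snd s = incl Q c0 * incl Q v0"
          using c0 by (simp add: incl_mult_component[OF Q_cstar] v0_def)
        ultimately show ?thesis
          using w(1) c0(1) by (simp add: incl_minus[OF Q_cstar] left_diff_distrib w(2) sum_distrib_right)
      qed
      ultimately show "case s of (c, v) \<Rightarrow> norm ((\<Sum>k\<in>{..<p}. incl Q (x k) * uleft (ueps (incl Q (y k) * c)) v) - c * v) \<le> \<delta>"
        by (simp add: split_beta)
    qed
  qed
  then show ?thesis by (rule that)
qed

end


section \<open>The local adjunction\<close>

lemma module_transfer:
  assumes V: "Module.module complex_ring (V :: (complex, 'v, 'm) module_scheme)"
    and W: "carrier W = carrier V" "\<zero>\<^bsub>W\<^esub> = \<zero>\<^bsub>V\<^esub>" "\<And>x y. x \<oplus>\<^bsub>W\<^esub> y = x \<oplus>\<^bsub>V\<^esub> y"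
      "\<And>c x. c \<odot>\<^bsub>W\<^esub> x = c \<odot>\<^bsub>V\<^esub> x"
  shows "Module.module complex_ring (W :: (complex, 'v, 'n) module_scheme)"
proof -
  interpret V: Module.module complex_ring V by (rule V)
  show ?thesis
  proof (rule complex_moduleI)
    fix x assume "x \<in> carrier W"
    then show "\<exists>y\<in>carrier W. y \<oplus>\<^bsub>W\<^esub> x = \<zero>\<^bsub>W\<^esub>"
      using V.l_neg[of x] by (auto simp: W intro!: bexI[of _ "\<ominus>\<^bsub>V\<^esub> x"])
  qed (use V.smult_l_distr V.smult_r_distr V.smult_assoc1 V.smult_one V.smult_closed in
      \<open>simp_all add: W V.a_ac\<close>)
qed

lemma minus_transfer:
  assumes "carrier W = carrier V" "\<zero>\<^bsub>W\<^esub> = \<zero>\<^bsub>V\<^esub>" "\<And>x y. x \<oplus>\<^bsub>W\<^esub> y = x \<oplus>\<^bsub>V\<^esub> y"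
  shows "x \<ominus>\<^bsub>W\<^esub> y = x \<ominus>\<^bsub>V\<^esub> y"
  by (simp add: a_minus_def a_inv_def m_inv_def assms)

lemma mat_bound_cong:
  assumes "\<And>i j. i \<in> I \<Longrightarrow> j \<in> J \<Longrightarrow> M i j = N i j"
  shows "mat_bound I J M t = mat_bound I J N t"
proof -
  have "(\<Sum>j\<in>J. M i j * v j) = (\<Sum>j\<in>J. N i j * v j)" if "i \<in> I" for i v
    by (rule sum.cong) (use that assms in auto)
  then have "col_sq I (\<lambda>i. \<Sum>j\<in>J. M i j * v j) = col_sq I (\<lambda>i. \<Sum>j\<in>J. N i j * v j)" for v
    unfolding col_sq_def by (intro arg_cong[where f=norm] sum.cong) auto
  then show ?thesis by (simp add: mat_bound_def)
qed

lemma (in hilbert_module) adjoint_unique: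
  assumes "adjoint_pair X X T S" "adjoint_pair X X T S'"
  shows "S = S'"
proof (rule PiE_ext)
  show "S \<in> carrier X \<rightarrow>\<^sub>E carrier X" "S' \<in> carrier X \<rightarrow>\<^sub>E carrier X"
    using assms by (auto simp: adjoint_pair_def)
  fix y assume y: "y \<in> carrier X"
  define u v where "u = S y" and "v = S' y"
  have uv: "u \<in> carrier X" "v \<in> carrier X"
    using assms y by (auto simp: adjoint_pair_def u_def v_def)
  define d where "d = u \<ominus>\<^bsub>X\<^esub> v"
  have d: "d \<in> carrier X" using uv by (simp add: d_def)
  have du: "d \<oplus>\<^bsub>X\<^esub> v = u" using uv by (simp add: d_def X.minus_eq X.a_assoc X.l_neg)
  have "ip X d u = ip X d v"
    using assms d y by (simp add: adjoint_pair_def u_def v_def)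
  moreover have "ip X d u = ip X d d \<oplus>\<^bsub>B\<^esub> ip X d v"
    unfolding du[symmetric] using ip_linear[OF d] d uv by (auto simp: linear_map_def)
  moreover have c: "ip X d d \<in> carrier B" "ip X d v \<in> carrier B"
    using ip_linear[OF d] d uv by (auto simp: linear_map_def)
  ultimately have e: "ip X d v = ip X d d \<oplus>\<^bsub>B\<^esub> ip X d v" by simp
  have "ip X d d = (ip X d d \<oplus>\<^bsub>B\<^esub> ip X d v) \<ominus>\<^bsub>B\<^esub> ip X d v"
    using c by (simp add: B.minus_eq B.a_assoc B.r_neg)
  then have "ip X d d = \<zero>\<^bsub>B\<^esub>" unfolding e[symmetric] using c by (simp add: B.minus_eq B.r_neg)
  then have "d = \<zero>\<^bsub>X\<^esub>" by (rule ip_definite[OF d])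
  then show "S y = S' y" using du uv by (simp add: u_def v_def)
qed

lemma (in hilbert_module) adjoint_the: "adjoint_pair X X T S \<Longrightarrow> (THE S. adjoint_pair X X T S) = S"
  by (rule the_equality) (auto intro: adjoint_unique)

section \<open>The two correspondences and the adjunction between them\<close>

context frobenius_data
begin

definition Fm :: "('a, 'c, 'c) corr"
  where "Fm = \<lparr>carrier = carrier Q, monoid.mult = undefined, one = undefined, zero = \<zero>\<^bsub>Q\<^esub>,
    add = (\<lambda>x y. x \<oplus>\<^bsub>Q\<^esub> y), module.smult = (\<lambda>c x. c \<odot>\<^bsub>Q\<^esub> x), ract = (\<lambda>x b. x \<otimes>\<^bsub>Q\<^esub> b),
    ip = (\<lambda>x y. star Q x \<otimes>\<^bsub>Q\<^esub> y), lact = (\<lambda>a. fst (eta C a))\<rparr>"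

text \<open>The left action is restricted to the carrier because adjointable operators are
  extensional; in \<open>Fm\<close> the components of a multiplier are extensional already.\<close>

definition Em :: "('c, 'a, 'c) corr"
  where "Em = \<lparr>carrier = carrier Q, monoid.mult = undefined, one = undefined, zero = \<zero>\<^bsub>Q\<^esub>,
    add = (\<lambda>x y. x \<oplus>\<^bsub>Q\<^esub> y), module.smult = (\<lambda>c x. c \<odot>\<^bsub>Q\<^esub> x), ract = (\<lambda>x a. right_mult C x a),
    ip = (\<lambda>x y. eps C (star Q x \<otimes>\<^bsub>Q\<^esub> y)), lact = (\<lambda>c. \<lambda>x\<in>carrier Q. c \<otimes>\<^bsub>Q\<^esub> x)\<rparr>"

lemma Fm_simps [simp]: "carrier Fm = carrier Q" "\<zero>\<^bsub>Fm\<^esub> = \<zero>\<^bsub>Q\<^esub>" "x \<oplus>\<^bsub>Fm\<^esub> y = x \<oplus>\<^bsub>Q\<^esub> y"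
  "c \<odot>\<^bsub>Fm\<^esub> x = c \<odot>\<^bsub>Q\<^esub> x" "ract Fm x b = x \<otimes>\<^bsub>Q\<^esub> b" "ip Fm x y = star Q x \<otimes>\<^bsub>Q\<^esub> y"
  "lact Fm a = fst (eta C a)"
  by (simp_all add: Fm_def)

lemma Em_simps [simp]: "carrier Em = carrier Q" "\<zero>\<^bsub>Em\<^esub> = \<zero>\<^bsub>Q\<^esub>" "x \<oplus>\<^bsub>Em\<^esub> y = x \<oplus>\<^bsub>Q\<^esub> y"
  "c \<odot>\<^bsub>Em\<^esub> x = c \<odot>\<^bsub>Q\<^esub> x" "ract Em x a = right_mult C x a" "ip Em x y = eps C (star Q x \<otimes>\<^bsub>Q\<^esub> y)"
  "lact Em d = (\<lambda>x\<in>carrier Q. d \<otimes>\<^bsub>Q\<^esub> x)"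
  by (simp_all add: Em_def)

lemma module_Fm: "Module.module complex_ring Fm"
  by (rule module_transfer[OF C.module_axioms]) simp_all

lemma module_Em: "Module.module complex_ring Em"
  by (rule module_transfer[OF C.module_axioms]) simp_all

lemma minus_Fm: "x \<ominus>\<^bsub>Fm\<^esub> y = x \<ominus>\<^bsub>Q\<^esub> y"
  by (rule minus_transfer) simp_all

lemma minus_Em: "x \<ominus>\<^bsub>Em\<^esub> y = x \<ominus>\<^bsub>Q\<^esub> y"
  by (rule minus_transfer) simp_all

lemmas smult_Q = C.smult_closed'

lemma hnorm_Fm: "x \<in> carrier Q \<Longrightarrow> hnorm Q Fm x = nrm Q x"
  by (simp add: hnorm_def C.cstar_identity C.nrm_nonneg)

lemma hilbert_Fm: "hilbert_module Q Fm"
proof (intro hilbert_module.intro hilbert_module_axioms.intro Q_cstar module_Fm)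
  show "norm_complete Fm (hnorm Q Fm)"
  proof -
    have "norm_dist Fm (hnorm Q Fm) = norm_dist Q (nrm Q)"
      by (intro ext) (simp add: norm_dist_def minus_Fm hnorm_Fm)
    then show ?thesis using C.complete by (simp add: norm_complete_def)
  qed
  show "ip Fm x x \<in> positive_cone Q" if "x \<in> carrier Fm" for x
    using that by (auto simp: positive_cone_def)
  show "x = \<zero>\<^bsub>Fm\<^esub>" if "x \<in> carrier Fm" "ip Fm x x = \<zero>\<^bsub>Q\<^esub>" for x
    using that C.cstar_identity[of x] C.nrm_eq_0_iff[of x] by simp
qed (auto simp: linear_map_def conj_linear_map_def C.mult_add_left C.mult_add_right C.smult_mult_left
    C.smult_mult_right C.mult_assoc C.star_add C.star_smult C.star_mult C.star_star smult_Q)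

sublocale F: hilbert_module Q Fm by (rule hilbert_Fm)

definition enorm :: "'c universal \<Rightarrow> real"
  where "enorm u = sqrt (norm (ueps (adj u * u)))"

lemma enorm_nonneg [simp]: "0 \<le> enorm u" by (simp add: enorm_def)

lemma enorm_sq: "(enorm u)\<^sup>2 = norm (ueps (adj u * u))" by (simp add: enorm_def)

lemma enorm_inner: "norm (ueps (adj u * v)) \<le> enorm u * enorm v"
proof -
  have "(norm (ueps (adj u * v)))\<^sup>2 \<le> norm (ueps (adj u * u)) * norm (ueps (adj v * v))"
    using U.e_cauchy_schwarz[of "\<lambda>_. u" "\<lambda>_. v" "{()}"] by simp
  also have "\<dots> = (enorm u * enorm v)\<^sup>2" by (simp add: power_mult_distrib enorm_sq)
  finally show ?thesis by (rule power2_le_imp_le) simp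
qed

lemma enorm_triangle: "enorm (u + v) \<le> enorm u + enorm v"
proof -
  have "ueps (adj (u + v) * (u + v)) = ueps (adj u * u) + ueps (adj u * v) + ueps (adj v * u) + ueps (adj v * v)"
    by (simp add: adj_add distrib_left distrib_right U.e_add)
  then have "norm (ueps (adj (u + v) * (u + v))) \<le> norm (ueps (adj u * u)) + norm (ueps (adj u * v))
      + norm (ueps (adj v * u)) + norm (ueps (adj v * v))"
    by (simp only:) (intro order_trans[OF norm_triangle_ineq] add_right_mono order_refl)
  also have "\<dots> \<le> (enorm u)\<^sup>2 + enorm u * enorm v + enorm v * enorm u + (enorm v)\<^sup>2"
    unfolding enorm_sq by (intro add_mono enorm_inner order_refl)
  also have "\<dots> = (enorm u + enorm v)\<^sup>2" by (simp add: power2_eq_square algebra_simps)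
  finally show ?thesis unfolding enorm_sq[symmetric] by (rule power2_le_imp_le) simp
qed

lemma incl_eps: "c \<in> carrier Q \<Longrightarrow> incl A (eps C c) = ueps (incl Q c)"
  by (simp add: ueps_def)

lemma incl_ip: "x \<in> carrier Q \<Longrightarrow> y \<in> carrier Q \<Longrightarrow>
    incl Q (star Q x \<otimes>\<^bsub>Q\<^esub> y) = adj (incl Q x) * incl Q y"
  by (simp add: incl_mult[OF Q_cstar] incl_star[OF Q_cstar])

lemma hnorm_Em: "x \<in> carrier Q \<Longrightarrow> hnorm A Em x = enorm (incl Q x)"
  unfolding hnorm_def enorm_def Em_simps
  by (subst norm_incl[OF A_cstar, symmetric]) (simp_all add: incl_eps incl_ip)

text \<open>The norm induced by \<epsilon> is equivalent to the norm of \<open>C\<close>; the lower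
  estimate is the 1 by 1 case of \<open>bound_of_gram_bound\<close>. Definiteness and completeness
  of \<open>Em\<close> rest on this.\<close>

lemma enorm_bounds:
  obtains \<kappa> K where "0 \<le> \<kappa>" "\<And>h. pos h \<Longrightarrow> norm (ueps h) \<le> \<kappa> * norm h" "0 \<le> K"
    "U.approximate_unit (incl Q ` carrier Q) K"
    "\<And>x. x \<in> carrier Q \<Longrightarrow> enorm (incl Q x) \<le> sqrt \<kappa> * nrm Q x"
    "\<And>x. x \<in> carrier Q \<Longrightarrow> nrm Q x \<le> sqrt (K * \<kappa>) * enorm (incl Q x)"
proof -
  obtain \<kappa> where \<kappa>: "0 \<le> \<kappa>" "\<And>h. pos h \<Longrightarrow> norm (ueps h) \<le> \<kappa> * norm h" by (rule U.e_bounded) blast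
  obtain K where K: "U.approximate_unit (incl Q ` carrier Q) K" by (rule approximate_unit)
  have K0: "0 \<le> K" using K by (simp add: U.approximate_unit_def)
  have 1: "enorm (incl Q x) \<le> sqrt \<kappa> * nrm Q x" if x: "x \<in> carrier Q" for x
  proof -
    have "norm (ueps (adj (incl Q x) * incl Q x)) \<le> \<kappa> * (norm (incl Q x))\<^sup>2"
      using \<kappa>(2)[OF pos_adj_mult[of "incl Q x"]] by (simp only: cstar_norm)
    then have "enorm (incl Q x) \<le> sqrt (\<kappa> * (norm (incl Q x))\<^sup>2)" by (simp only: enorm_def real_sqrt_le_iff)
    then show ?thesis using x by (simp add: real_sqrt_mult norm_incl[OF Q_cstar] C.nrm_nonneg)
  qed
  have 2: "nrm Q x \<le> sqrt (K * \<kappa>) * enorm (incl Q x)" if x: "x \<in> carrier Q" for x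
  proof -
    have "(norm (incl Q x))\<^sup>2 \<le> K * \<kappa> * norm (ueps (adj (incl Q x) * incl Q x))"
      by (rule U.norm_le_e[OF \<kappa>(1) _ K imageI[OF x]]) (rule \<kappa>(2))
    then have "norm (incl Q x) \<le> sqrt (K * \<kappa> * norm (ueps (adj (incl Q x) * incl Q x)))"
      by (rule real_le_rsqrt)
    then show ?thesis using x by (simp add: real_sqrt_mult norm_incl[OF Q_cstar] enorm_def)
  qed
  show ?thesis by (rule that[OF \<kappa>(1) _ K0 K]) (rule \<kappa>(2) 1 2, assumption)+
qed

lemma normed_Em: "normed_module Em (hnorm A Em)"
proof (intro normed_module.intro seminormed_moduleI module_Em normed_module_axioms.intro)
  fix x assume x: "x \<in> carrier Em"
  show "0 \<le> hnorm A Em x" using x by (simp add: hnorm_Em)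
  show "hnorm A Em (x \<oplus>\<^bsub>Em\<^esub> y) \<le> hnorm A Em x + hnorm A Em y" if "y \<in> carrier Em" for y
    using x that by (simp add: hnorm_Em incl_add[OF Q_cstar] enorm_triangle)
  show "hnorm A Em (c \<odot>\<^bsub>Em\<^esub> x) \<le> cmod c * hnorm A Em x" for c
    using x by (simp add: hnorm_Em smult_Q incl_csc[OF Q_cstar] enorm_def adj_csc_mult U.e_scaleR real_sqrt_mult)
  show "x = \<zero>\<^bsub>Em\<^esub>" if "hnorm A Em x = 0"
  proof -
    obtain \<kappa> K where "\<And>x. x \<in> carrier Q \<Longrightarrow> nrm Q x \<le> sqrt (K * \<kappa>) * enorm (incl Q x)"
      by (rule enorm_bounds) blast
    from this[of x] have "nrm Q x = 0" using that x C.nrm_nonneg[of x] by (simp add: hnorm_Em)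
    then show ?thesis using x by (simp add: C.nrm_eq_0_iff)
  qed
qed

lemma complete_Em: "norm_complete Em (hnorm A Em)"
proof -
  interpret E: normed_module Em "hnorm A Em" by (rule normed_Em)
  obtain \<kappa> K where \<kappa>: "0 \<le> \<kappa>" "0 \<le> K"
    and le1: "\<And>x. x \<in> carrier Q \<Longrightarrow> enorm (incl Q x) \<le> sqrt \<kappa> * nrm Q x"
    and le2: "\<And>x. x \<in> carrier Q \<Longrightarrow> nrm Q x \<le> sqrt (K * \<kappa>) * enorm (incl Q x)"
    by (rule enorm_bounds) blast
  show ?thesis unfolding E.norm_complete_iff
  proof (intro allI impI, elim conjE)
    fix s :: "nat \<Rightarrow> 'c"
    assume s: "\<forall>k. s k \<in> carrier Em" and cau: "\<forall>\<epsilon>>0. \<exists>N. \<forall>i\<ge>N. \<forall>j\<ge>N. hnorm A Em (s i \<ominus>\<^bsub>Em\<^esub> s j) < \<epsilon>"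
    have sc: "s k \<in> carrier Q" for k using s by simp
    have dc: "s i \<ominus>\<^bsub>Q\<^esub> s j \<in> carrier Q" for i j using sc by simp
    have "\<exists>x\<in>carrier Q. \<forall>\<epsilon>>0. \<exists>N. \<forall>k\<ge>N. nrm Q (s k \<ominus>\<^bsub>Q\<^esub> x) < \<epsilon>"
    proof (rule C.Cauchy_limit[OF sc])
      fix \<epsilon> :: real assume e: "\<epsilon> > 0"
      have p: "sqrt (K * \<kappa>) + 1 > 0" using \<kappa> by (simp add: add_nonneg_pos)
      then obtain N where N: "\<forall>i\<ge>N. \<forall>j\<ge>N. hnorm A Em (s i \<ominus>\<^bsub>Em\<^esub> s j) < \<epsilon> / (sqrt (K * \<kappa>) + 1)"
        using cau e by (meson divide_pos_pos)
      have "nrm Q (s i \<ominus>\<^bsub>Q\<^esub> s j) < \<epsilon>" if "i \<ge> N" "j \<ge> N" for i j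
      proof -
        let ?h = "enorm (incl Q (s i \<ominus>\<^bsub>Q\<^esub> s j))"
        have "?h < \<epsilon> / (sqrt (K * \<kappa>) + 1)" using N that by (simp add: minus_Em hnorm_Em dc)
        then have "(sqrt (K * \<kappa>) + 1) * ?h < \<epsilon>" using p by (simp add: pos_less_divide_eq mult.commute)
        moreover have "sqrt (K * \<kappa>) * ?h \<le> (sqrt (K * \<kappa>) + 1) * ?h" by (intro mult_right_mono) simp_all
        ultimately show ?thesis using le2[OF dc, of i j] by linarith
      qed
      then show "\<exists>N. \<forall>i\<ge>N. \<forall>j\<ge>N. nrm Q (s i \<ominus>\<^bsub>Q\<^esub> s j) < \<epsilon>" by blast
    qed
    then obtain x where x: "x \<in> carrier Q" "\<forall>\<epsilon>>0. \<exists>N. \<forall>k\<ge>N. nrm Q (s k \<ominus>\<^bsub>Q\<^esub> x) < \<epsilon>" by blast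
    have xc: "s k \<ominus>\<^bsub>Q\<^esub> x \<in> carrier Q" for k using sc x(1) by simp
    have "\<exists>N. \<forall>k\<ge>N. hnorm A Em (s k \<ominus>\<^bsub>Em\<^esub> x) < \<epsilon>" if e: "\<epsilon> > 0" for \<epsilon>
    proof -
      have p: "sqrt \<kappa> + 1 > 0" using \<kappa> by (simp add: add_nonneg_pos)
      then obtain N where N: "\<forall>k\<ge>N. nrm Q (s k \<ominus>\<^bsub>Q\<^esub> x) < \<epsilon> / (sqrt \<kappa> + 1)"
        using x(2) e by (meson divide_pos_pos)
      have "hnorm A Em (s k \<ominus>\<^bsub>Em\<^esub> x) < \<epsilon>" if "k \<ge> N" for k
      proof -
        let ?h = "nrm Q (s k \<ominus>\<^bsub>Q\<^esub> x)"
        have "(sqrt \<kappa> + 1) * ?h < \<epsilon>" using N that p by (simp add: pos_less_divide_eq mult.commute)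
        moreover have "sqrt \<kappa> * ?h \<le> (sqrt \<kappa> + 1) * ?h" by (intro mult_right_mono C.nrm_nonneg xc) simp
        ultimately show ?thesis using le1[OF xc, of k] by (simp add: minus_Em hnorm_Em xc)
      qed
      then show ?thesis by blast
    qed
    then show "\<exists>x\<in>carrier Em. \<forall>\<epsilon>>0. \<exists>N. \<forall>k\<ge>N. hnorm A Em (s k \<ominus>\<^bsub>Em\<^esub> x) < \<epsilon>" using x(1) by auto
  qed
qed

lemma hilbert_Em: "hilbert_module A Em"
proof (intro hilbert_module.intro hilbert_module_axioms.intro A_cstar module_Em complete_Em)
  interpret E: normed_module Em "hnorm A Em" by (rule normed_Em)
  show "ip Em x x \<in> positive_cone A" if "x \<in> carrier Em" for x
    using that eps_cone[of "star Q x \<otimes>\<^bsub>Q\<^esub> x"] by (auto simp: positive_cone_def)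
  show "x = \<zero>\<^bsub>Em\<^esub>" if "x \<in> carrier Em" "ip Em x x = \<zero>\<^bsub>A\<^esub>" for x
    using that A.nrm_eq_0_iff[of "\<zero>\<^bsub>A\<^esub>"] by (intro E.n_definite) (simp_all add: hnorm_def)
  show "star A (ip Em x y) = ip Em y x" if "x \<in> carrier Em" "y \<in> carrier Em" for x y
  proof (subst incl_inj[OF A_cstar, symmetric])
    show "incl A (star A (ip Em x y)) = incl A (ip Em y x)"
      using that by (simp add: incl_star[OF A_cstar] incl_eps incl_ip U.e_adj)
  qed (use that in simp_all)
qed (auto simp: linear_map_def conj_linear_map_def right_add_left right_add_right right_smult_left
    right_smult_right right_mult_right C.mult_add_left C.mult_add_right C.smult_mult_left C.smult_mult_right
    C.star_add C.star_smult eps_add eps_smult eps_right right_assoc[symmetric] smult_Q)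

sublocale E: hilbert_module A Em by (rule hilbert_Em)

lemma closure_subset: "norm_closure A S \<subseteq> carrier A"
  unfolding norm_closure_def by (auto simp: A.closure_iff)

lemma lact_Fm_adjoint: "a \<in> carrier A \<Longrightarrow> adjoint_pair Fm Fm (lact Fm a) (lact Fm (star A a))"
  using left_extensional[of a] left_extensional[of "star A a"]
  by (auto simp: adjoint_pair_def centraliser star_left simp flip: left_mult_def)

lemma correspondence_Fm: "correspondence A Q Fm"
proof (intro correspondence.intro A_cstar hilbert_Fm correspondence_axioms.intro)
  show "star_hom A (adjointable_algebra Q Fm) (lact Fm)"
    unfolding star_hom_def linear_map_def
  proof (intro conjI ballI allI)
    show "lact Fm \<in> carrier A \<rightarrow> carrier (adjointable_algebra Q Fm)"
      using lact_Fm_adjoint by (auto simp: adjointable_algebra_def simp del: Fm_simps(7))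
    fix a assume a: "a \<in> carrier A"
    show "lact Fm (star A a) = star (adjointable_algebra Q Fm) (lact Fm a)"
      using F.adjoint_the[OF lact_Fm_adjoint[OF a]] by (simp add: adjointable_algebra_def)
    show "lact Fm (c \<odot>\<^bsub>A\<^esub> a) = c \<odot>\<^bsub>adjointable_algebra Q Fm\<^esub> lact Fm a" for c
      using a by (simp add: eta_smult adjointable_algebra_def) (simp add: multiplier_algebra_def split_beta)
    fix b assume b: "b \<in> carrier A"
    show "lact Fm (a \<oplus>\<^bsub>A\<^esub> b) = lact Fm a \<oplus>\<^bsub>adjointable_algebra Q Fm\<^esub> lact Fm b"
      using a b by (simp add: eta_add adjointable_algebra_def) (simp add: multiplier_algebra_def split_beta)
    show "lact Fm (a \<otimes>\<^bsub>A\<^esub> b) = lact Fm a \<otimes>\<^bsub>adjointable_algebra Q Fm\<^esub> lact Fm b"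
      using a b by (simp add: eta_mult adjointable_algebra_def) (simp add: multiplier_algebra_def split_beta)
  qed
  \<comment> \<open>Condition (2) supplies a factor in the closure of the image of \<epsilon>, and
    this closure lies in \<open>A\<close>.\<close>
  show "carrier Fm = {lact Fm a f | a f. a \<in> carrier A \<and> f \<in> carrier Fm}"
  proof
    show "carrier Fm \<subseteq> {lact Fm a f | a f. a \<in> carrier A \<and> f \<in> carrier Fm}"
    proof
      fix x assume "x \<in> carrier Fm"
      then have "x \<in> {left_mult C a c | a c. a \<in> norm_closure A (eps C ` carrier Q) \<and> c \<in> carrier Q}"
        using nondegenerate by simp
      then show "x \<in> {lact Fm a f | a f. a \<in> carrier A \<and> f \<in> carrier Fm}"
        using closure_subset by (auto simp: left_mult_def)
    qed
    show "{lact Fm a f | a f. a \<in> carrier A \<and> f \<in> carrier Fm} \<subseteq> carrier Fm"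
      by (auto simp flip: left_mult_def)
  qed
qed

definition lm :: "'c \<Rightarrow> 'c \<Rightarrow> 'c" where "lm c = (\<lambda>z\<in>carrier Q. c \<otimes>\<^bsub>Q\<^esub> z)"

lemma lm_apply [simp]: "z \<in> carrier Q \<Longrightarrow> lm c z = c \<otimes>\<^bsub>Q\<^esub> z" by (simp add: lm_def)

lemma lm_PiE: "c \<in> carrier Q \<Longrightarrow> lm c \<in> carrier Q \<rightarrow>\<^sub>E carrier Q" by (auto simp: lm_def)

lemma lm_eqI: "f \<in> extensional (carrier Q) \<Longrightarrow> (\<And>z. z \<in> carrier Q \<Longrightarrow> f z = c \<otimes>\<^bsub>Q\<^esub> z) \<Longrightarrow> lm c = f"
  by (rule extensionalityI[of _ "carrier Q"]) (simp_all add: lm_def)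

lemma lact_Em_lm: "lact Em c = lm c" by (simp add: lm_def)

lemma lm_Em_adjoint: "c \<in> carrier Q \<Longrightarrow> adjoint_pair Em Em (lm c) (lm (star Q c))"
  using lm_PiE[of c] lm_PiE[of "star Q c"]
  by (auto simp: adjoint_pair_def C.star_mult C.star_star C.mult_assoc)

lemma lm_Fm_adjoint: "c \<in> carrier Q \<Longrightarrow> adjoint_pair Fm Fm (lm c) (lm (star Q c))"
  using lm_PiE[of c] lm_PiE[of "star Q c"]
  by (auto simp: adjoint_pair_def C.star_mult C.star_star C.mult_assoc)

lemma lm_add: "\<lbrakk>c \<in> carrier Q; d \<in> carrier Q\<rbrakk> \<Longrightarrow> lm (c \<oplus>\<^bsub>Q\<^esub> d) = (\<lambda>z\<in>carrier Q. lm c z \<oplus>\<^bsub>Q\<^esub> lm d z)"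
  by (rule lm_eqI) (simp_all add: C.mult_add_left)

lemma lm_smult: "c \<in> carrier Q \<Longrightarrow> lm (r \<odot>\<^bsub>Q\<^esub> c) = (\<lambda>z\<in>carrier Q. r \<odot>\<^bsub>Q\<^esub> lm c z)"
  by (rule lm_eqI) (simp_all add: C.smult_mult_left)

lemma lm_mult: "\<lbrakk>c \<in> carrier Q; d \<in> carrier Q\<rbrakk> \<Longrightarrow> lm (c \<otimes>\<^bsub>Q\<^esub> d) = compose (carrier Q) (lm c) (lm d)"
  by (rule lm_eqI) (simp_all add: compose_eq C.mult_assoc)

lemma correspondence_Em: "correspondence Q A Em"
proof (intro correspondence.intro Q_cstar hilbert_Em correspondence_axioms.intro)
  show "star_hom Q (adjointable_algebra A Em) (lact Em)"
    unfolding star_hom_def linear_map_def lact_Em_lm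
  proof (intro conjI ballI allI)
    show "lm \<in> carrier Q \<rightarrow> carrier (adjointable_algebra A Em)"
      using lm_Em_adjoint by (auto simp: adjointable_algebra_def)
    fix c assume c: "c \<in> carrier Q"
    show "lm (star Q c) = star (adjointable_algebra A Em) (lm c)"
      using E.adjoint_the[OF lm_Em_adjoint[OF c]] by (simp add: adjointable_algebra_def)
    show "lm (r \<odot>\<^bsub>Q\<^esub> c) = r \<odot>\<^bsub>adjointable_algebra A Em\<^esub> lm c" for r
      using c by (simp add: adjointable_algebra_def lm_smult cong: restrict_cong)
    fix d assume d: "d \<in> carrier Q"
    show "lm (c \<oplus>\<^bsub>Q\<^esub> d) = lm c \<oplus>\<^bsub>adjointable_algebra A Em\<^esub> lm d"
      using c d by (simp add: adjointable_algebra_def lm_add cong: restrict_cong)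
    show "lm (c \<otimes>\<^bsub>Q\<^esub> d) = lm c \<otimes>\<^bsub>adjointable_algebra A Em\<^esub> lm d"
      using c d by (simp add: adjointable_algebra_def lm_mult)
  qed
  \<comment> \<open>Nondegeneracy holds because every element of \<open>C\<close> is a product of
    two.\<close>
  show "carrier Em = {lact Em c f | c f. c \<in> carrier Q \<and> f \<in> carrier Em}"
  proof
    show "carrier Em \<subseteq> {lact Em c f | c f. c \<in> carrier Q \<and> f \<in> carrier Em}"
    proof
      fix x assume "x \<in> carrier Em"
      then obtain u s where "u \<in> carrier Q" "s \<in> carrier Q" "x = u \<otimes>\<^bsub>Q\<^esub> s"
        using carrier_factorization[OF Q_cstar, of x] by auto
      then show "x \<in> {lact Em c f | c f. c \<in> carrier Q \<and> f \<in> carrier Em}" by auto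
    qed
  qed auto
qed

text \<open>The module norm is the root of the matrix norm of the Gram matrix, and
  \<open>mat_bound\<close> measures squared norms: hence \<open>G\<^sup>2\<close> is the norm of the
  Gram matrix and its square is the bound.\<close>

lemma hnorm_matrix_Fm:
  assumes M: "\<And>i j. i < n \<Longrightarrow> j < n \<Longrightarrow> M i j \<in> carrier Q"
  defines "G \<equiv> hnorm (matrix_algebra n Q) (matrix_module n Q Fm) (mat n n (\<lambda>(i, j). M i j))"
    and "G' \<equiv> (\<lambda>j l. \<Sum>i<n. adj (incl Q (M i j)) * incl Q (M i l))"
  shows "0 \<le> G" "mat_bound {..<n} {..<n} G' ((G\<^sup>2)\<^sup>2)"
    "\<And>t. 0 \<le> t \<Longrightarrow> mat_bound {..<n} {..<n} G' (t\<^sup>2) \<Longrightarrow> G\<^sup>2 \<le> t"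
proof -
  define g where "g j l = (\<Oplus>\<^bsub>Q\<^esub>i\<in>{..<n}. star Q (M i j) \<otimes>\<^bsub>Q\<^esub> M i l)" for j l
  have gc: "g j l \<in> carrier Q" if "j < n" "l < n" for j l
    unfolding g_def using M that by (intro C.finsum_closed) auto
  have ig: "incl Q (g j l) = G' j l" if "j < n" "l < n" for j l
    unfolding g_def G'_def using M that by (subst incl_finsum[OF Q_cstar]) (auto simp: incl_ip)
  have "ip (matrix_module n Q Fm) (mat n n (\<lambda>(i, j). M i j)) (mat n n (\<lambda>(i, j). M i j)) = mat n n (\<lambda>(i, j). g i j)"
    unfolding matrix_module_def g_def using M by (auto intro!: eq_matI C.finsum_cong')
  then have G: "G = sqrt (matrix_norm Q (mat n n (\<lambda>(i, j). g i j)))"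
    by (simp add: G_def hnorm_def matrix_algebra_def)
  note mb = matrix_norm_bounds[OF Q_cstar, where r=n and s=n and M=g]
  have N0: "0 \<le> matrix_norm Q (mat n n (\<lambda>(i, j). g i j))" by (rule mb(1)) (rule gc)
  then show "0 \<le> G" by (simp add: G)
  have G2: "G\<^sup>2 = matrix_norm Q (mat n n (\<lambda>(i, j). g i j))" using N0 by (simp add: G)
  have eq: "mat_bound {..<n} {..<n} (\<lambda>i j. incl Q (g i j)) t = mat_bound {..<n} {..<n} G' t" for t
    by (rule mat_bound_cong) (simp add: ig)
  have "mat_bound {..<n} {..<n} (\<lambda>i j. incl Q (g i j)) ((G\<^sup>2)\<^sup>2)" unfolding G2 by (rule mb(2)) (rule gc)
  then show "mat_bound {..<n} {..<n} G' ((G\<^sup>2)\<^sup>2)" by (simp only: eq)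
  show "G\<^sup>2 \<le> t" if t: "0 \<le> t" "mat_bound {..<n} {..<n} G' (t\<^sup>2)" for t
    unfolding G2
  proof (rule mb(3)[OF _ t(1)])
    show "mat_bound {..<n} {..<n} (\<lambda>i j. incl Q (g i j)) (t\<^sup>2)" unfolding eq by (rule t(2))
  qed (rule gc)
qed

lemma hnorm_matrix_Em:
  assumes M: "\<And>i j. i < n \<Longrightarrow> j < n \<Longrightarrow> M i j \<in> carrier Q"
  defines "G \<equiv> hnorm (matrix_algebra n A) (matrix_module n A Em) (mat n n (\<lambda>(i, j). M i j))"
    and "G' \<equiv> U.gram {..<n} (\<lambda>i j. incl Q (M i j))"
  shows "0 \<le> G" "mat_bound {..<n} {..<n} G' ((G\<^sup>2)\<^sup>2)"
    "\<And>t. 0 \<le> t \<Longrightarrow> mat_bound {..<n} {..<n} G' (t\<^sup>2) \<Longrightarrow> G\<^sup>2 \<le> t"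
proof -
  define g where "g j l = (\<Oplus>\<^bsub>A\<^esub>i\<in>{..<n}. eps C (star Q (M i j) \<otimes>\<^bsub>Q\<^esub> M i l))" for j l
  have gc: "g j l \<in> carrier A" if "j < n" "l < n" for j l
    unfolding g_def using M that by (intro A.finsum_closed) auto
  have ig: "incl A (g j l) = G' j l" if "j < n" "l < n" for j l
    unfolding g_def G'_def U.gram_def using M that
    by (subst incl_finsum[OF A_cstar]) (auto simp: incl_ip incl_eps)
  have "ip (matrix_module n A Em) (mat n n (\<lambda>(i, j). M i j)) (mat n n (\<lambda>(i, j). M i j)) = mat n n (\<lambda>(i, j). g i j)"
    unfolding matrix_module_def g_def using M by (auto intro!: eq_matI A.finsum_cong')
  then have G: "G = sqrt (matrix_norm A (mat n n (\<lambda>(i, j). g i j)))"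
    by (simp add: G_def hnorm_def matrix_algebra_def)
  note mb = matrix_norm_bounds[OF A_cstar, where r=n and s=n and M=g]
  have N0: "0 \<le> matrix_norm A (mat n n (\<lambda>(i, j). g i j))" by (rule mb(1)) (rule gc)
  then show "0 \<le> G" by (simp add: G)
  have G2: "G\<^sup>2 = matrix_norm A (mat n n (\<lambda>(i, j). g i j))" using N0 by (simp add: G)
  have eq: "mat_bound {..<n} {..<n} (\<lambda>i j. incl A (g i j)) t = mat_bound {..<n} {..<n} G' t" for t
    by (rule mat_bound_cong) (simp add: ig)
  have "mat_bound {..<n} {..<n} (\<lambda>i j. incl A (g i j)) ((G\<^sup>2)\<^sup>2)" unfolding G2 by (rule mb(2)) (rule gc)
  then show "mat_bound {..<n} {..<n} G' ((G\<^sup>2)\<^sup>2)" by (simp only: eq)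
  show "G\<^sup>2 \<le> t" if t: "0 \<le> t" "mat_bound {..<n} {..<n} G' (t\<^sup>2)" for t
    unfolding G2
  proof (rule mb(3)[OF _ t(1)])
    show "mat_bound {..<n} {..<n} (\<lambda>i j. incl A (g i j)) (t\<^sup>2)" unfolding eq by (rule t(2))
  qed (rule gc)
qed

lemma matrices_transpose_star:
  assumes "M \<in> matrices n n (carrier Q)"
  shows "M = mat n n (\<lambda>(i, j). M $$ (i, j))"
    "map_mat (star Q) (transpose_mat M) = mat n n (\<lambda>(i, j). star Q (M $$ (j, i)))"
    "\<And>i j. i < n \<Longrightarrow> j < n \<Longrightarrow> M $$ (i, j) \<in> carrier Q"
  using assms by (auto simp: matrices_def elements_mat_def UN_subset_iff image_subset_iff intro!: eq_matI)

lemma conj_linear_star: "conj_linear_map Fm Em (star Q)" "conj_linear_map Em Fm (star Q)"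
  using C.star_conj_linear by (auto simp: conj_linear_map_def)

text \<open>Because of the transposition, the matrix extension of the involution sends M to its
  adjoint matrix, which obeys the same bound over \<open>C\<close>; \<open>gram_bound\<close> then
  compares with \<open>Em\<close>. The constant is the root of \<kappa> because it is
  \<open>hnorm\<close> squared that \<kappa> controls.\<close>

lemma cb_star: "cb_conj_linear_map Q Fm A Em (star Q)"
proof -
  obtain \<kappa> where \<kappa>: "0 \<le> \<kappa>" "\<And>h. pos h \<Longrightarrow> norm (ueps h) \<le> \<kappa> * norm h" by (rule U.e_bounded) blast
  have "hnorm (matrix_algebra n A) (matrix_module n A Em) (map_mat (star Q) (transpose_mat M))
        \<le> sqrt \<kappa> * hnorm (matrix_algebra n Q) (matrix_module n Q Fm) M"
    if M: "M \<in> matrices n n (carrier Q)" for n M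
  proof -
    note tr = matrices_transpose_star[OF M]
    let ?f = "hnorm (matrix_algebra n Q) (matrix_module n Q Fm) (mat n n (\<lambda>(i, j). M $$ (i, j)))"
    let ?e = "hnorm (matrix_algebra n A) (matrix_module n A Em) (mat n n (\<lambda>(i, j). star Q (M $$ (j, i))))"
    have f: "0 \<le> ?f"
      by (rule hnorm_matrix_Fm(1)[where M="\<lambda>i j. M $$ (i, j)" and n=n]) (rule tr(3); assumption)
    have fb: "mat_bound {..<n} {..<n} (\<lambda>j l. \<Sum>i<n. adj (incl Q (M $$ (i, j))) * incl Q (M $$ (i, l))) ((?f\<^sup>2)\<^sup>2)"
      by (rule hnorm_matrix_Fm(2)[where M="\<lambda>i j. M $$ (i, j)" and n=n]) (rule tr(3); assumption)
    have sc: "star Q (M $$ (j, i)) \<in> carrier Q" if "i < n" "j < n" for i j using tr(3) that by simp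
    have "mat_bound {..<n} {..<n} (\<lambda>i j. incl Q (M $$ (i, j))) (?f\<^sup>2)"
      by (rule mat_bound_of_gram[OF fb]) simp
    then have "mat_bound {..<n} {..<n} (\<lambda>j i. adj (incl Q (M $$ (i, j)))) (?f\<^sup>2)"
      by (rule mat_bound_adj) simp
    also have "?this = mat_bound {..<n} {..<n} (\<lambda>i j. incl Q (star Q (M $$ (j, i)))) (?f\<^sup>2)"
      by (rule mat_bound_cong) (use tr(3) in \<open>simp add: incl_star[OF Q_cstar]\<close>)
    finally have g: "mat_bound {..<n} {..<n} (\<lambda>i j. incl Q (star Q (M $$ (j, i)))) (?f\<^sup>2)" .
    have gb: "mat_bound {..<n} {..<n} (U.gram {..<n} (\<lambda>i j. incl Q (star Q (M $$ (j, i))))) ((\<kappa> * ?f\<^sup>2)\<^sup>2)"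
      by (rule U.gram_bound[OF \<kappa>(1) _ g]) (auto intro: \<kappa>(2))
    have "?e\<^sup>2 \<le> \<kappa> * ?f\<^sup>2"
      by (rule hnorm_matrix_Em(3)[where M="\<lambda>i j. star Q (M $$ (j, i))" and n=n, OF _ _ gb]) (use sc \<kappa>(1) in auto)
    then have "?e \<le> sqrt (\<kappa> * ?f\<^sup>2)" by (rule real_le_rsqrt)
    then have "?e \<le> sqrt \<kappa> * ?f" using f by (simp add: real_sqrt_mult)
    then show ?thesis by (simp only: tr(2) flip: tr(1))
  qed
  then show ?thesis unfolding cb_conj_linear_map_def using conj_linear_star(1) by auto
qed

text \<open>The Gram bound of a matrix over \<open>Em\<close> gives, by
  \<open>bound_of_gram_bound\<close>, a bound over \<open>C\<close> with the factor K \<kappa>;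
  passing to the adjoint matrix costs nothing.\<close>

lemma cb_star_inverse: "cb_conj_linear_map A Em Q Fm (star Q)"
proof -
  obtain \<kappa> K where \<kappa>: "0 \<le> \<kappa>" "\<And>h. pos h \<Longrightarrow> norm (ueps h) \<le> \<kappa> * norm h"
    and K: "0 \<le> K" "U.approximate_unit (incl Q ` carrier Q) K" by (rule enorm_bounds) blast
  have "hnorm (matrix_algebra n Q) (matrix_module n Q Fm) (map_mat (star Q) (transpose_mat M))
        \<le> sqrt (K * \<kappa>) * hnorm (matrix_algebra n A) (matrix_module n A Em) M"
    if M: "M \<in> matrices n n (carrier Q)" for n M
  proof -
    note tr = matrices_transpose_star[OF M]
    let ?e = "hnorm (matrix_algebra n A) (matrix_module n A Em) (mat n n (\<lambda>(i, j). M $$ (i, j)))"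
    let ?f = "hnorm (matrix_algebra n Q) (matrix_module n Q Fm) (mat n n (\<lambda>(i, j). star Q (M $$ (j, i))))"
    have e: "0 \<le> ?e"
      by (rule hnorm_matrix_Em(1)[where M="\<lambda>i j. M $$ (i, j)" and n=n]) (rule tr(3); assumption)
    have eb: "mat_bound {..<n} {..<n} (U.gram {..<n} (\<lambda>i j. incl Q (M $$ (i, j)))) ((?e\<^sup>2)\<^sup>2)"
      by (rule hnorm_matrix_Em(2)[where M="\<lambda>i j. M $$ (i, j)" and n=n]) (rule tr(3); assumption)
    have sc: "star Q (M $$ (j, i)) \<in> carrier Q" if "i < n" "j < n" for i j using tr(3) that by simp
    have t0: "0 \<le> K * \<kappa> * ?e\<^sup>2" using K \<kappa>(1) by simp
    have "mat_bound {..<n} {..<n} (\<lambda>i j. incl Q (M $$ (i, j))) (K * \<kappa> * ?e\<^sup>2)"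
      by (rule U.bound_of_gram_bound[OF \<kappa>(1) _ K(2) _ _ _ _ eb]) (use tr(3) in \<open>auto intro: \<kappa>(2)\<close>)
    then have "mat_bound {..<n} {..<n} (\<lambda>j i. adj (incl Q (M $$ (i, j)))) (K * \<kappa> * ?e\<^sup>2)"
      by (rule mat_bound_adj) (rule t0)
    also have "?this = mat_bound {..<n} {..<n} (\<lambda>i j. incl Q (star Q (M $$ (j, i)))) (K * \<kappa> * ?e\<^sup>2)"
      by (rule mat_bound_cong) (use tr(3) in \<open>simp add: incl_star[OF Q_cstar]\<close>)
    finally have g: "mat_bound {..<n} {..<n} (\<lambda>i j. incl Q (star Q (M $$ (j, i)))) (K * \<kappa> * ?e\<^sup>2)" .
    have "?f\<^sup>2 \<le> K * \<kappa> * ?e\<^sup>2"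
      by (rule hnorm_matrix_Fm(3)[where M="\<lambda>i j. star Q (M $$ (j, i))" and n=n, OF _ t0 mat_bound_gram[OF g t0]])
        (use sc in auto)
    then have "?f \<le> sqrt (K * \<kappa> * ?e\<^sup>2)" by (rule real_le_rsqrt)
    then have "?f \<le> sqrt (K * \<kappa>) * ?e" using e by (simp add: real_sqrt_mult)
    then show ?thesis by (simp only: tr(2) flip: tr(1))
  qed
  then show ?thesis unfolding cb_conj_linear_map_def using conj_linear_star(2) by auto
qed

theorem local_adjunction_star: "local_adjunction A Q Fm Em (star Q)"
proof (intro local_adjunction.intro correspondence_Fm correspondence_Em local_adjunction_axioms.intro cb_star)
  show "\<exists>\<psi>. cb_conj_linear_map A Em Q Fm \<psi> \<and> (\<forall>f\<in>carrier Fm. \<psi> (star Q f) = f) \<and>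
      (\<forall>e\<in>carrier Em. star Q (\<psi> e) = e)"
    using cb_star_inverse by (intro exI[of _ "star Q"]) (simp add: C.star_star)
  fix a b f assume "a \<in> carrier A" "b \<in> carrier Q" "f \<in> carrier Fm"
  then show "star Q (ract Fm (lact Fm a f) b) = ract Em (lact Em (star Q b) (star Q f)) (star A a)"
    by (simp add: C.star_mult star_left right_assoc flip: left_mult_def)
qed

end


section \<open>Compact operators and the isomorphism\<close>

context frobenius_data
begin

abbreviation "AA \<equiv> adjointable_algebra Q Fm"

lemma adjoint_pair_Fm: "adjoint_pair Fm Fm T S \<longleftrightarrow>
    T \<in> carrier Q \<rightarrow>\<^sub>E carrier Q \<and> S \<in> carrier Q \<rightarrow>\<^sub>E carrier Q \<and>
    (\<forall>x\<in>carrier Q. \<forall>y\<in>carrier Q. star Q (T x) \<otimes>\<^bsub>Q\<^esub> y = star Q x \<otimes>\<^bsub>Q\<^esub> S y)"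
  by (simp add: adjoint_pair_def)

lemma AA_simps [simp]: "\<zero>\<^bsub>AA\<^esub> = (\<lambda>x\<in>carrier Q. \<zero>\<^bsub>Q\<^esub>)"
  "T \<oplus>\<^bsub>AA\<^esub> S = (\<lambda>x\<in>carrier Q. T x \<oplus>\<^bsub>Q\<^esub> S x)" "c \<odot>\<^bsub>AA\<^esub> T = (\<lambda>x\<in>carrier Q. c \<odot>\<^bsub>Q\<^esub> T x)"
  by (simp_all add: adjointable_algebra_def)

lemma AA_carrier: "T \<in> carrier AA \<longleftrightarrow> (\<exists>S. adjoint_pair Fm Fm T S)"
  by (simp add: adjointable_algebra_def)

lemma AA_PiE: "T \<in> carrier AA \<Longrightarrow> T \<in> carrier Q \<rightarrow>\<^sub>E carrier Q"
  by (auto simp: AA_carrier adjoint_pair_Fm)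

lemma AA_apply [simp, intro]: "T \<in> carrier AA \<Longrightarrow> x \<in> carrier Q \<Longrightarrow> T x \<in> carrier Q"
  by (rule PiE_mem[OF AA_PiE])

lemma AA_eqI: "\<lbrakk>T \<in> carrier Q \<rightarrow>\<^sub>E carrier Q; T' \<in> carrier Q \<rightarrow>\<^sub>E carrier Q; \<And>x. x \<in> carrier Q \<Longrightarrow> T x = T' x\<rbrakk> \<Longrightarrow> T = T'"
  by (rule PiE_ext)

lemma AA_add: assumes T: "T \<in> carrier AA" and T': "T' \<in> carrier AA" shows "T \<oplus>\<^bsub>AA\<^esub> T' \<in> carrier AA"
proof -
  obtain S S' where S: "adjoint_pair Fm Fm T S" "adjoint_pair Fm Fm T' S'" using T T' AA_carrier by blast
  have c: "T x \<in> carrier Q" "T' x \<in> carrier Q" "S x \<in> carrier Q" "S' x \<in> carrier Q" if "x \<in> carrier Q" for x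
    using S that by (auto simp: adjoint_pair_Fm)
  have "adjoint_pair Fm Fm (T \<oplus>\<^bsub>AA\<^esub> T') (\<lambda>x\<in>carrier Q. S x \<oplus>\<^bsub>Q\<^esub> S' x)"
    using S c by (auto simp: adjoint_pair_Fm C.star_add C.mult_add_left C.mult_add_right)
  then show ?thesis unfolding AA_carrier by blast
qed

lemma AA_smult: assumes T: "T \<in> carrier AA" shows "r \<odot>\<^bsub>AA\<^esub> T \<in> carrier AA"
proof -
  obtain S where S: "adjoint_pair Fm Fm T S" using T AA_carrier by blast
  have c: "T x \<in> carrier Q" "S x \<in> carrier Q" if "x \<in> carrier Q" for x
    using S that by (auto simp: adjoint_pair_Fm)
  have "adjoint_pair Fm Fm (r \<odot>\<^bsub>AA\<^esub> T) (\<lambda>x\<in>carrier Q. cnj r \<odot>\<^bsub>Q\<^esub> S x)"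
    using S c by (auto simp: adjoint_pair_Fm C.star_smult C.smult_mult_left C.smult_mult_right smult_Q)
  then show ?thesis unfolding AA_carrier by blast
qed

lemma lm_AA: "c \<in> carrier Q \<Longrightarrow> lm c \<in> carrier AA"
  using lm_Fm_adjoint AA_carrier by blast

lemma lm_zero: "lm \<zero>\<^bsub>Q\<^esub> = \<zero>\<^bsub>AA\<^esub>"
  by (rule lm_eqI) simp_all

lemma AA_zero: "\<zero>\<^bsub>AA\<^esub> \<in> carrier AA"
  using lm_AA[of "\<zero>\<^bsub>Q\<^esub>"] lm_zero by simp

lemma module_AA: "Module.module complex_ring AA"
proof (rule complex_moduleI)
  fix T assume T: "T \<in> carrier AA"
  note TE = AA_PiE[OF T]
  show "\<zero>\<^bsub>AA\<^esub> \<oplus>\<^bsub>AA\<^esub> T = T" by (rule AA_eqI[OF _ TE]) (use T in auto)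
  show "\<exists>S\<in>carrier AA. S \<oplus>\<^bsub>AA\<^esub> T = \<zero>\<^bsub>AA\<^esub>"
  proof (rule bexI[OF _ AA_smult[OF T, of "- 1"]])
    have "(- 1) \<odot>\<^bsub>Q\<^esub> T x \<oplus>\<^bsub>Q\<^esub> T x = \<zero>\<^bsub>Q\<^esub>" if "x \<in> carrier Q" for x
      using C.minus_eq_smult[of "T x"] C.l_neg[of "T x"] T that by simp
    then show "((- 1) \<odot>\<^bsub>AA\<^esub> T) \<oplus>\<^bsub>AA\<^esub> T = \<zero>\<^bsub>AA\<^esub>" by (auto intro!: restrict_ext)
  qed
  show "1 \<odot>\<^bsub>AA\<^esub> T = T"
    by (rule AA_eqI[OF _ TE]) (use T C.smult_one in \<open>auto simp: smult_Q\<close>)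
  show "(c + d) \<odot>\<^bsub>AA\<^esub> T = c \<odot>\<^bsub>AA\<^esub> T \<oplus>\<^bsub>AA\<^esub> d \<odot>\<^bsub>AA\<^esub> T" for c d
    using T C.smult_l_distr[of c d] by (auto intro!: restrict_ext)
  show "(c * d) \<odot>\<^bsub>AA\<^esub> T = c \<odot>\<^bsub>AA\<^esub> (d \<odot>\<^bsub>AA\<^esub> T)" for c d
    using T C.smult_assoc1[of c d] by (auto intro!: restrict_ext)
  fix S assume S: "S \<in> carrier AA"
  show "T \<oplus>\<^bsub>AA\<^esub> S = S \<oplus>\<^bsub>AA\<^esub> T" using T S by (auto intro!: restrict_ext C.a_comm)
  show "c \<odot>\<^bsub>AA\<^esub> (T \<oplus>\<^bsub>AA\<^esub> S) = c \<odot>\<^bsub>AA\<^esub> T \<oplus>\<^bsub>AA\<^esub> c \<odot>\<^bsub>AA\<^esub> S" for c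
    using T S C.smult_r_distr[of c] by (auto intro!: restrict_ext)
  show "(T \<oplus>\<^bsub>AA\<^esub> S) \<oplus>\<^bsub>AA\<^esub> R = T \<oplus>\<^bsub>AA\<^esub> (S \<oplus>\<^bsub>AA\<^esub> R)" if "R \<in> carrier AA" for R
    using T S that by (auto intro!: restrict_ext C.a_assoc)
qed (rule AA_add AA_zero AA_smult; assumption)+

text \<open>Read through components, T and its adjoint become an adjoint pair on the product
  algebra, where \<open>adjointable_bounded\<close> applies. This is what makes the supremum
  defining the operator norm finite.\<close>

lemma AA_bounded:
  assumes T: "T \<in> carrier AA" obtains K where "\<And>x. x \<in> carrier Q \<Longrightarrow> nrm Q (T x) \<le> K * nrm Q x"
proof -
  obtain S where S: "adjoint_pair Fm Fm T S" using T AA_carrier by blast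
  have c: "T x \<in> carrier Q" "S x \<in> carrier Q" if "x \<in> carrier Q" for x
    using S that by (auto simp: adjoint_pair_Fm)
  define T' S' where "T' u = incl Q (T (component Q u))" and "S' u = incl Q (S (component Q u))" for u
  have TS: "adj (T' u) * v = adj u * S' v" for u v
    using S c by (simp add: T'_def S'_def uc uQ adjoint_pair_Fm)
  obtain K where K: "\<And>u. norm (T' u) \<le> K * norm u" by (rule adjointable_bounded[of T' S', OF TS]) blast
  have "nrm Q (T x) \<le> K * nrm Q x" if x: "x \<in> carrier Q" for x
    using K[of "incl Q x"] c[OF x] x by (simp add: T'_def norm_incl[OF Q_cstar])
  then show ?thesis by (rule that)
qed

text \<open>Adjointable operators are not linear by definition; homogeneity comes from moving T to
  the other side of the inner product.\<close>

lemma AA_smult_apply: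
  assumes T: "T \<in> carrier AA" and w: "w \<in> carrier Q" shows "T (r \<odot>\<^bsub>Q\<^esub> w) = r \<odot>\<^bsub>Q\<^esub> T w"
proof -
  obtain S where S: "adjoint_pair Fm Fm T S" using T AA_carrier by blast
  have c: "T x \<in> carrier Q" "S x \<in> carrier Q" if "x \<in> carrier Q" for x
    using S that by (auto simp: adjoint_pair_Fm)
  have m: "x \<otimes>\<^bsub>Q\<^esub> T v = star Q (S (star Q x)) \<otimes>\<^bsub>Q\<^esub> v" if "x \<in> carrier Q" "v \<in> carrier Q" for x v
  proof -
    have "star Q (T v) \<otimes>\<^bsub>Q\<^esub> star Q x = star Q v \<otimes>\<^bsub>Q\<^esub> S (star Q x)" using S that by (simp add: adjoint_pair_Fm)
    from arg_cong[OF this, of "star Q"] show ?thesis using that c by (simp add: C.star_mult C.star_star)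
  qed
  show ?thesis
    by (rule C.cancel_left) (use w c in \<open>simp_all add: smult_Q m C.smult_mult_right\<close>)
qed

lemma nrm_AA: "nrm AA T = (SUP x\<in>{x \<in> carrier Q. hnorm Q Fm x \<le> 1}. hnorm Q Fm (T x))"
  by (simp add: adjointable_algebra_def op_norm_def)

lemma nrm_AA_bdd: assumes T: "T \<in> carrier AA"
  shows "bdd_above ((\<lambda>x. hnorm Q Fm (T x)) ` {x \<in> carrier Q. hnorm Q Fm x \<le> 1})"
proof -
  obtain K where K: "\<And>x. x \<in> carrier Q \<Longrightarrow> nrm Q (T x) \<le> K * nrm Q x" by (rule AA_bounded[OF T]) blast
  show ?thesis
  proof (rule bdd_aboveI2)
    fix x assume x: "x \<in> {x \<in> carrier Q. hnorm Q Fm x \<le> 1}"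
    then have "K * nrm Q x \<le> \<bar>K\<bar> * 1"
      by (intro mult_mono) (auto simp: hnorm_Fm C.nrm_nonneg)
    then show "hnorm Q Fm (T x) \<le> \<bar>K\<bar>" using K[of x] x T by (simp add: hnorm_Fm)
  qed
qed

lemma nrm_AA_ge: "T \<in> carrier AA \<Longrightarrow> x \<in> carrier Q \<Longrightarrow> nrm Q x \<le> 1 \<Longrightarrow> nrm Q (T x) \<le> nrm AA T"
  unfolding nrm_AA using cSUP_upper[OF _ nrm_AA_bdd, of x T] by (simp add: hnorm_Fm)

lemma nrm_zero_Q: "nrm Q \<zero>\<^bsub>Q\<^esub> = 0" using C.nrm_eq_0_iff[of "\<zero>\<^bsub>Q\<^esub>"] by simp

lemma nrm_AA_le:
  assumes T: "T \<in> carrier AA" and t: "0 \<le> t" "\<And>x. x \<in> carrier Q \<Longrightarrow> nrm Q (T x) \<le> t * nrm Q x"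
  shows "nrm AA T \<le> t"
  unfolding nrm_AA
proof (rule cSUP_least)
  show "{x \<in> carrier Q. hnorm Q Fm x \<le> 1} \<noteq> {}"
    using hnorm_Fm[of "\<zero>\<^bsub>Q\<^esub>"] nrm_zero_Q by (auto intro!: exI[of _ "\<zero>\<^bsub>Q\<^esub>"])
  fix x assume x: "x \<in> {x \<in> carrier Q. hnorm Q Fm x \<le> 1}"
  then have "t * nrm Q x \<le> t * 1" using t(1) by (intro mult_left_mono) (auto simp: hnorm_Fm)
  then show "hnorm Q Fm (T x) \<le> t" using t(2)[of x] x T by (simp add: hnorm_Fm)
qed

lemma nrm_AA_nonneg: "T \<in> carrier AA \<Longrightarrow> 0 \<le> nrm AA T"
  using nrm_AA_ge[of T "\<zero>\<^bsub>Q\<^esub>"] C.nrm_nonneg[of "T \<zero>\<^bsub>Q\<^esub>"] nrm_zero_Q by simp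

lemma nrm_AA_apply:
  assumes T: "T \<in> carrier AA" and x: "x \<in> carrier Q" shows "nrm Q (T x) \<le> nrm AA T * nrm Q x"
proof (cases "nrm Q x = 0")
  case True
  then have "x = \<zero>\<^bsub>Q\<^esub>" using x C.nrm_eq_0_iff by simp
  then have "x = 0 \<odot>\<^bsub>Q\<^esub> x" using x by simp
  then have "T x = 0 \<odot>\<^bsub>Q\<^esub> T x" using AA_smult_apply[OF T x, of 0] by simp
  then have "T x = \<zero>\<^bsub>Q\<^esub>" using T x C.smult_zero_left[of "T x"] by simp
  then show ?thesis using nrm_AA_nonneg[OF T] C.nrm_nonneg[OF x] nrm_zero_Q by simp
next
  case False
  then have n: "nrm Q x > 0" using C.nrm_nonneg[OF x] by simp
  let ?r = "complex_of_real (1 / nrm Q x)"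
  have "nrm Q (T (?r \<odot>\<^bsub>Q\<^esub> x)) \<le> nrm AA T"
    by (rule nrm_AA_ge[OF T]) (use x n in \<open>simp_all add: smult_Q C.nrm_smult norm_divide\<close>)
  then have "nrm Q (T x) / nrm Q x \<le> nrm AA T"
    using T x n by (simp add: AA_smult_apply C.nrm_smult norm_divide)
  then show ?thesis using n by (simp add: pos_divide_le_eq)
qed

lemma normed_AA: "normed_module AA (nrm AA)"
proof (intro normed_module.intro seminormed_moduleI module_AA normed_module_axioms.intro)
  fix T assume T: "T \<in> carrier AA"
  show "0 \<le> nrm AA T" by (rule nrm_AA_nonneg[OF T])
  show "nrm AA (T \<oplus>\<^bsub>AA\<^esub> S) \<le> nrm AA T + nrm AA S" if S: "S \<in> carrier AA" for S
  proof (rule nrm_AA_le[OF AA_add[OF T S]])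
    fix x assume x: "x \<in> carrier Q"
    have "nrm Q (T x \<oplus>\<^bsub>Q\<^esub> S x) \<le> nrm Q (T x) + nrm Q (S x)" using T S x by (intro C.nrm_triangle) auto
    then show "nrm Q ((T \<oplus>\<^bsub>AA\<^esub> S) x) \<le> (nrm AA T + nrm AA S) * nrm Q x"
      using nrm_AA_apply[OF T x] nrm_AA_apply[OF S x] x by (simp add: distrib_right)
  qed (use nrm_AA_nonneg T S in simp)
  show "nrm AA (c \<odot>\<^bsub>AA\<^esub> T) \<le> cmod c * nrm AA T" for c
  proof (rule nrm_AA_le[OF AA_smult[OF T]])
    fix x assume x: "x \<in> carrier Q"
    have "cmod c * nrm Q (T x) \<le> cmod c * (nrm AA T * nrm Q x)"
      by (intro mult_left_mono nrm_AA_apply T x) simp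
    then show "nrm Q ((c \<odot>\<^bsub>AA\<^esub> T) x) \<le> cmod c * nrm AA T * nrm Q x"
      using T x by (simp add: C.nrm_smult mult.assoc)
  qed (use nrm_AA_nonneg T in simp)
  show "T = \<zero>\<^bsub>AA\<^esub>" if "nrm AA T = 0"
  proof (rule AA_eqI[OF AA_PiE[OF T] AA_PiE[OF AA_zero]])
    fix x assume x: "x \<in> carrier Q"
    have "nrm Q (T x) = 0" using nrm_AA_apply[OF T x] that C.nrm_nonneg[of "T x"] T x by simp
    then show "T x = \<zero>\<^bsub>AA\<^esub> x" using T x C.nrm_eq_0_iff by simp
  qed
qed

sublocale AA: normed_module AA "nrm AA" by (rule normed_AA)

lemma lm_minus:
  assumes c: "c \<in> carrier Q" and d: "d \<in> carrier Q" shows "lm (c \<ominus>\<^bsub>Q\<^esub> d) = lm c \<ominus>\<^bsub>AA\<^esub> lm d"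
proof -
  have "(c \<ominus>\<^bsub>Q\<^esub> d) \<oplus>\<^bsub>Q\<^esub> d = c" using c d by (rule C.minus_plus_cancel)
  then have "lm c = lm (c \<ominus>\<^bsub>Q\<^esub> d) \<oplus>\<^bsub>AA\<^esub> lm d" using lm_add[of "c \<ominus>\<^bsub>Q\<^esub> d" d] c d by simp
  then have "lm c \<ominus>\<^bsub>AA\<^esub> lm d = (lm (c \<ominus>\<^bsub>Q\<^esub> d) \<oplus>\<^bsub>AA\<^esub> lm d) \<ominus>\<^bsub>AA\<^esub> lm d" by simp
  also have "\<dots> = lm (c \<ominus>\<^bsub>Q\<^esub> d)"
    unfolding a_minus_def
    by (subst AA.a_assoc) (use c d lm_AA AA.r_neg[OF lm_AA[OF d]] AA.r_zero[OF lm_AA] in \<open>simp_all del: AA_simps\<close>)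
  finally show ?thesis ..
qed

text \<open>Tested on \<open>star Q c\<close>, where the C*-identity applies; with
  \<open>nrm_lm_le\<close>, left multiplication is isometric.\<close>

lemma nrm_lm_ge: assumes c: "c \<in> carrier Q" shows "nrm Q c \<le> nrm AA (lm c)"
proof -
  have "nrm Q (c \<otimes>\<^bsub>Q\<^esub> star Q c) = (nrm Q c)\<^sup>2"
    using C.cstar_identity[of "star Q c"] c by (simp add: C.star_star C.nrm_star)
  then have "(nrm Q c)\<^sup>2 \<le> nrm AA (lm c) * nrm Q c"
    using nrm_AA_apply[OF lm_AA[OF c], of "star Q c"] c by (simp add: C.nrm_star)
  then show ?thesis
    by (rule square_le_cancel) (use c C.nrm_nonneg nrm_AA_nonneg[OF lm_AA[OF c]] in auto)
qed

lemma nrm_lm_le: assumes c: "c \<in> carrier Q" shows "nrm AA (lm c) \<le> nrm Q c"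
  by (rule nrm_AA_le[OF lm_AA[OF c]]) (use c C.nrm_mult C.nrm_nonneg in auto)

lemma ketbra_lm: "\<lbrakk>x \<in> carrier Q; y \<in> carrier Q\<rbrakk> \<Longrightarrow> ketbra Q Fm y x = lm (y \<otimes>\<^bsub>Q\<^esub> star Q x)"
  by (rule lm_eqI[symmetric]) (simp_all add: ketbra_def ket_def bra_def compose_eq C.mult_assoc)

lemma product_star: assumes c: "c \<in> carrier Q"
  obtains x y where "x \<in> carrier Q" "y \<in> carrier Q" "c = y \<otimes>\<^bsub>Q\<^esub> star Q x"
proof -
  obtain u s where us: "u \<in> carrier Q" "s \<in> carrier Q" "c = u \<otimes>\<^bsub>Q\<^esub> s" by (rule carrier_factorization[OF Q_cstar c])
  then show ?thesis using that[of "star Q s" u] by (simp add: C.star_star)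
qed

text \<open>By \<open>product_star\<close> every element is y times the adjoint of some x, so the
  rank-one operators are already all the left multiplications.\<close>

lemma ketbras: "{ketbra Q Fm y x | x y. x \<in> carrier Fm \<and> y \<in> carrier Fm} = lm ` carrier Q"
proof
  show "{ketbra Q Fm y x | x y. x \<in> carrier Fm \<and> y \<in> carrier Fm} \<subseteq> lm ` carrier Q"
    by (auto simp: ketbra_lm)
  show "lm ` carrier Q \<subseteq> {ketbra Q Fm y x | x y. x \<in> carrier Fm \<and> y \<in> carrier Fm}"
  proof
    fix k assume "k \<in> lm ` carrier Q"
    then obtain c where c: "c \<in> carrier Q" "k = lm c" by blast
    obtain x y where "x \<in> carrier Q" "y \<in> carrier Q" "c = y \<otimes>\<^bsub>Q\<^esub> star Q x" by (rule product_star[OF c(1)])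
    then show "k \<in> {ketbra Q Fm y x | x y. x \<in> carrier Fm \<and> y \<in> carrier Fm}"
      using c by (auto simp: ketbra_lm[symmetric])
  qed
qed

lemma submodule_lm: "submodule (lm ` carrier Q) complex_ring AA"
proof (rule AA.submoduleI)
  have sm: "r \<odot>\<^bsub>AA\<^esub> k \<in> lm ` carrier Q" if "k \<in> lm ` carrier Q" for r k
  proof -
    obtain c where c: "c \<in> carrier Q" "k = lm c" using \<open>k \<in> lm ` carrier Q\<close> by blast
    have "r \<odot>\<^bsub>AA\<^esub> k = lm (r \<odot>\<^bsub>Q\<^esub> c)" using c by (simp add: lm_smult cong: restrict_cong)
    then show ?thesis using smult_Q[OF c(1)] by blast
  qed
  show "r \<odot>\<^bsub>AA\<^esub> k \<in> lm ` carrier Q" if "k \<in> lm ` carrier Q" for r k by (rule sm[OF that])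
  show "lm ` carrier Q \<subseteq> carrier AA" using lm_AA by blast
  show "\<zero>\<^bsub>AA\<^esub> \<in> lm ` carrier Q" unfolding lm_zero[symmetric] by (rule imageI[OF C.zero_closed])
  show "\<ominus>\<^bsub>AA\<^esub> k \<in> lm ` carrier Q" if k: "k \<in> lm ` carrier Q" for k
  proof -
    have "k \<in> carrier AA" using k lm_AA by blast
    then show ?thesis using sm[OF k, of "- 1"] by (simp only: AA.minus_eq_smult)
  qed
  fix k l assume "k \<in> lm ` carrier Q" "l \<in> lm ` carrier Q"
  then obtain c d where cd: "c \<in> carrier Q" "k = lm c" "d \<in> carrier Q" "l = lm d" by blast
  have "k \<oplus>\<^bsub>AA\<^esub> l = lm (c \<oplus>\<^bsub>Q\<^esub> d)" using cd by (simp add: lm_add cong: restrict_cong)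
  then show "k \<oplus>\<^bsub>AA\<^esub> l \<in> lm ` carrier Q" using C.a_closed[OF cd(1,3)] by blast
qed

text \<open>Left multiplications form a subspace, so taking the span adds nothing, and they are an
  isometric image of the complete space \<open>C\<close>, so taking the closure adds nothing
  either.\<close>

lemma compact_carrier: "carrier (compact_algebra Q Fm) = lm ` carrier Q"
proof -
  have span: "lin_span AA (lm ` carrier Q) = lm ` carrier Q"
    using submodule_lm by (auto simp: lin_span_def)
  have "AA.metric.mtopology closure_of (lm ` carrier Q) = lm ` carrier Q"
  proof
    show "lm ` carrier Q \<subseteq> AA.metric.mtopology closure_of (lm ` carrier Q)"
      by (rule closure_of_subset) (use lm_AA in auto)
    show "AA.metric.mtopology closure_of (lm ` carrier Q) \<subseteq> lm ` carrier Q"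
    proof
      fix T assume "T \<in> AA.metric.mtopology closure_of (lm ` carrier Q)"
      then have T: "T \<in> carrier AA" and ap: "\<And>\<epsilon>. \<epsilon> > 0 \<Longrightarrow> \<exists>c\<in>carrier Q. nrm AA (T \<ominus>\<^bsub>AA\<^esub> lm c) < \<epsilon>"
        unfolding AA.closure_iff by blast+
      have "\<exists>c. c \<in> carrier Q \<and> nrm AA (T \<ominus>\<^bsub>AA\<^esub> lm c) < 1 / (real n + 1)" for n :: nat
        using ap[of "1 / (real n + 1)"] by auto
      from choice[OF allI[OF this]] obtain c
        where "\<forall>n. c n \<in> carrier Q \<and> nrm AA (T \<ominus>\<^bsub>AA\<^esub> lm (c n)) < 1 / (real n + 1)" by (rule exE)
      then have c: "c n \<in> carrier Q" "nrm AA (T \<ominus>\<^bsub>AA\<^esub> lm (c n)) < 1 / (real n + 1)" for n by simp_all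
      have small: "\<exists>N. \<forall>n\<ge>N. 1 / (real n + 1) < \<epsilon>" if e: "\<epsilon> > 0" for \<epsilon> :: real
      proof -
        obtain N where N: "1 / (real N + 1) < \<epsilon>"
          using reals_Archimedean[OF e] by (auto simp: inverse_eq_divide add.commute)
        have "1 / (real n + 1) < \<epsilon>" if "n \<ge> N" for n
        proof -
          have "1 / (real n + 1) \<le> 1 / (real N + 1)" using that by (intro divide_left_mono) auto
          then show ?thesis using N by simp
        qed
        then show ?thesis by blast
      qed
      have "\<exists>x\<in>carrier Q. \<forall>\<epsilon>>0. \<exists>N. \<forall>k\<ge>N. nrm Q (c k \<ominus>\<^bsub>Q\<^esub> x) < \<epsilon>"
      proof (rule C.Cauchy_limit[OF c(1)])
        fix \<epsilon> :: real assume "\<epsilon> > 0"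
        then have "\<epsilon> / 2 > 0" by simp
        then obtain N where N: "\<forall>n\<ge>N. 1 / (real n + 1) < \<epsilon> / 2" using small by blast
        have "nrm Q (c i \<ominus>\<^bsub>Q\<^esub> c j) < \<epsilon>" if ij: "i \<ge> N" "j \<ge> N" for i j
        proof -
          have "nrm Q (c i \<ominus>\<^bsub>Q\<^esub> c j) \<le> nrm AA (lm (c i \<ominus>\<^bsub>Q\<^esub> c j))" by (rule nrm_lm_ge) (use c in simp)
          also have "\<dots> = nrm AA (lm (c i) \<ominus>\<^bsub>AA\<^esub> lm (c j))" using c by (simp only: lm_minus)
          also have "\<dots> \<le> nrm AA (lm (c i) \<ominus>\<^bsub>AA\<^esub> T) + nrm AA (T \<ominus>\<^bsub>AA\<^esub> lm (c j))"
            by (rule AA.n_minus_triangle) (use c lm_AA T in auto)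
          also have "\<dots> = nrm AA (T \<ominus>\<^bsub>AA\<^esub> lm (c i)) + nrm AA (T \<ominus>\<^bsub>AA\<^esub> lm (c j))"
            using AA.n_minus_commute[OF lm_AA[OF c(1)] T, of i] by simp
          finally show ?thesis using c(2)[of i] c(2)[of j] N[rule_format, OF ij(1)] N[rule_format, OF ij(2)] by linarith
        qed
        then show "\<exists>N. \<forall>i\<ge>N. \<forall>j\<ge>N. nrm Q (c i \<ominus>\<^bsub>Q\<^esub> c j) < \<epsilon>" by blast
      qed
      then obtain x where x: "x \<in> carrier Q" "\<forall>\<epsilon>>0. \<exists>N. \<forall>k\<ge>N. nrm Q (c k \<ominus>\<^bsub>Q\<^esub> x) < \<epsilon>" by blast
      have "nrm AA (T \<ominus>\<^bsub>AA\<^esub> lm x) \<le> 0 + \<epsilon>" if "\<epsilon> > 0" for \<epsilon>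
      proof -
        have e: "\<epsilon> / 2 > 0" using that by simp
        obtain N where N: "\<forall>n\<ge>N. 1 / (real n + 1) < \<epsilon> / 2" using small[OF e] by blast
        obtain N' where N': "\<forall>k\<ge>N'. nrm Q (c k \<ominus>\<^bsub>Q\<^esub> x) < \<epsilon> / 2" using x(2) e by blast
        define k where "k = max N N'"
        have k: "1 / (real k + 1) < \<epsilon> / 2" "nrm Q (c k \<ominus>\<^bsub>Q\<^esub> x) < \<epsilon> / 2"
          using N[rule_format, of k] N'[rule_format, of k] by (simp_all add: k_def)
        have "nrm AA (T \<ominus>\<^bsub>AA\<^esub> lm x) \<le> nrm AA (T \<ominus>\<^bsub>AA\<^esub> lm (c k)) + nrm AA (lm (c k) \<ominus>\<^bsub>AA\<^esub> lm x)"
          by (rule AA.n_minus_triangle) (use c x lm_AA T in auto)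
        also have "lm (c k) \<ominus>\<^bsub>AA\<^esub> lm x = lm (c k \<ominus>\<^bsub>Q\<^esub> x)" by (rule lm_minus[symmetric, OF c(1) x(1)])
        finally show ?thesis
          using nrm_lm_le[of "c k \<ominus>\<^bsub>Q\<^esub> x"] c(1)[of k] x(1) c(2)[of k] k C.minus_closed[OF c(1) x(1), of k] by linarith
      qed
      then have "nrm AA (T \<ominus>\<^bsub>AA\<^esub> lm x) \<le> 0" by (rule field_le_epsilon)
      moreover have d: "T \<ominus>\<^bsub>AA\<^esub> lm x \<in> carrier AA" by (rule AA.minus_closed[OF T lm_AA[OF x(1)]])
      ultimately have "T \<ominus>\<^bsub>AA\<^esub> lm x = \<zero>\<^bsub>AA\<^esub>"
        using AA.n_definite[OF d] nrm_AA_nonneg[OF d] by (simp del: AA_simps)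
      then show "T \<in> lm ` carrier Q" using AA.minus_eq_zero_iff[OF T lm_AA[OF x(1)]] x(1) by blast
    qed
  qed
  then show ?thesis
    by (simp only: compact_algebra_def closed_span_def norm_closure_def ketbras span
        partial_object.simps partial_object.update_convs) simp
qed

abbreviation "KK \<equiv> compact_algebra Q Fm"

lemma KK_simps: "k \<oplus>\<^bsub>KK\<^esub> l = (\<lambda>x\<in>carrier Q. k x \<oplus>\<^bsub>Q\<^esub> l x)" "r \<odot>\<^bsub>KK\<^esub> k = (\<lambda>x\<in>carrier Q. r \<odot>\<^bsub>Q\<^esub> k x)"
  "k \<otimes>\<^bsub>KK\<^esub> l = compose (carrier Q) k l" "star KK k = (THE S. adjoint_pair Fm Fm k S)"
  by (simp_all add: compact_algebra_def adjointable_algebra_def)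

lemma lm_KK: "\<lbrakk>c \<in> carrier Q; d \<in> carrier Q\<rbrakk> \<Longrightarrow> lm (c \<oplus>\<^bsub>Q\<^esub> d) = lm c \<oplus>\<^bsub>KK\<^esub> lm d"
  "c \<in> carrier Q \<Longrightarrow> lm (r \<odot>\<^bsub>Q\<^esub> c) = r \<odot>\<^bsub>KK\<^esub> lm c"
  "\<lbrakk>c \<in> carrier Q; d \<in> carrier Q\<rbrakk> \<Longrightarrow> lm (c \<otimes>\<^bsub>Q\<^esub> d) = lm c \<otimes>\<^bsub>KK\<^esub> lm d"
  "c \<in> carrier Q \<Longrightarrow> lm (star Q c) = star KK (lm c)"
  unfolding KK_simps by (rule lm_add lm_smult lm_mult F.adjoint_the[OF lm_Fm_adjoint, symmetric]; assumption)+

lemma lm_inj: "inj_on lm (carrier Q)"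
proof (rule inj_onI)
  fix c d assume cd: "c \<in> carrier Q" "d \<in> carrier Q" "lm c = lm d"
  have "star Q c = star Q d"
  proof (rule C.cancel_left)
    fix x assume x: "x \<in> carrier Q"
    have "c \<otimes>\<^bsub>Q\<^esub> star Q x = d \<otimes>\<^bsub>Q\<^esub> star Q x" using fun_cong[OF cd(3), of "star Q x"] x by simp
    from arg_cong[OF this, of "star Q"] show "x \<otimes>\<^bsub>Q\<^esub> star Q c = x \<otimes>\<^bsub>Q\<^esub> star Q d"
      using cd x by (simp add: C.star_mult C.star_star)
  qed (use cd in simp_all)
  from arg_cong[OF this, of "star Q"] show "c = d" using cd by (simp add: C.star_star)
qed

definition "hF a = adjointable_to_multiplier Q Fm (lact Fm a)"

lemma hF_lm: assumes a: "a \<in> carrier A" and c: "c \<in> carrier Q"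
  shows "fst (hF a) (lm c) = lm (left_mult C a c)" "snd (hF a) (lm c) = lm (right_mult C c a)"
proof -
  have k: "lm c \<in> carrier KK" using c compact_carrier by blast
  have "lm (left_mult C a c) = compose (carrier Q) (fst (eta C a)) (lm c)"
    by (rule lm_eqI) (use a c in \<open>simp_all add: compose_eq left_assoc flip: left_mult_def\<close>)
  then show "fst (hF a) (lm c) = lm (left_mult C a c)"
    using k by (simp add: hF_def adjointable_to_multiplier_def)
  have "lm (right_mult C c a) = compose (carrier Q) (lm c) (fst (eta C a))"
    by (rule lm_eqI) (use a c in \<open>simp_all add: compose_eq centraliser flip: left_mult_def\<close>)
  then show "snd (hF a) (lm c) = lm (right_mult C c a)"
    using k by (simp add: hF_def adjointable_to_multiplier_def)
qed

definition "lm_eps = (\<lambda>k\<in>carrier KK. eps C (the_inv_into (carrier Q) lm k))"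

lemma lm_eps_lm: "c \<in> carrier Q \<Longrightarrow> lm_eps (lm c) = eps C c"
  using the_inv_into_f_f[OF lm_inj, of c] by (simp add: lm_eps_def compact_carrier)

lemma positive_lm_eps: "positive_bimodule_map A KK hF lm_eps"
  unfolding positive_bimodule_map_def
proof (intro conjI ballI)
  show "linear_map KK A lm_eps"
    unfolding linear_map_def compact_carrier
    by (auto simp: lm_eps_lm eps_add eps_smult smult_Q simp flip: lm_KK)
  show "lm_eps ` positive_cone KK \<subseteq> positive_cone A"
  proof
    fix t assume "t \<in> lm_eps ` positive_cone KK"
    then obtain c where c: "c \<in> carrier Q" "t = lm_eps (star KK (lm c) \<otimes>\<^bsub>KK\<^esub> lm c)"
      by (auto simp: positive_cone_def compact_carrier)
    then have "t = eps C (star Q c \<otimes>\<^bsub>Q\<^esub> c)" by (simp add: lm_eps_lm flip: lm_KK)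
    then show "t \<in> positive_cone A" using c(1) eps_cone[of "star Q c \<otimes>\<^bsub>Q\<^esub> c"] by (auto simp: positive_cone_def)
  qed
  fix a k assume a: "a \<in> carrier A" and "k \<in> carrier KK"
  then obtain c where c: "c \<in> carrier Q" "k = lm c" unfolding compact_carrier by blast
  show "lm_eps (fst (hF a) k) = a \<otimes>\<^bsub>A\<^esub> lm_eps k" "lm_eps (snd (hF a) k) = lm_eps k \<otimes>\<^bsub>A\<^esub> a"
    using a c by (simp_all add: hF_lm lm_eps_lm eps_left eps_right)
qed

text \<open>Every compact operator is here a single rank-one operator, so the prescribed values on
  those determine e at every point of its domain.\<close>

lemma Frob_eps: "(THE e. e \<in> extensional (carrier KK) \<and> positive_bimodule_map A KK hF e \<and>
       (\<forall>f1\<in>carrier Fm. \<forall>f2\<in>carrier Fm. e (ketbra Q Fm f1 f2) = ip Em (star Q f1) (star Q f2))) = lm_eps"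
proof (rule the_equality)
  \<comment> \<open>The inner product of the images under \<phi> = \<open>star Q\<close> is
    \<epsilon> applied to the element whose left multiplication is the rank-one operator of f1 and
    f2.\<close>
  have v: "ip Em (star Q f1) (star Q f2) = eps C (f1 \<otimes>\<^bsub>Q\<^esub> star Q f2)" if "f1 \<in> carrier Q" "f2 \<in> carrier Q" for f1 f2
    using that by (simp add: C.star_star)
  show "lm_eps \<in> extensional (carrier KK) \<and> positive_bimodule_map A KK hF lm_eps \<and>
       (\<forall>f1\<in>carrier Fm. \<forall>f2\<in>carrier Fm. lm_eps (ketbra Q Fm f1 f2) = ip Em (star Q f1) (star Q f2))"
    using positive_lm_eps by (auto simp: lm_eps_def[symmetric] ketbra_lm lm_eps_lm v simp del: Em_simps(6))
      (simp add: lm_eps_def)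
  fix e assume e: "e \<in> extensional (carrier KK) \<and> positive_bimodule_map A KK hF e \<and>
       (\<forall>f1\<in>carrier Fm. \<forall>f2\<in>carrier Fm. e (ketbra Q Fm f1 f2) = ip Em (star Q f1) (star Q f2))"
  show "e = lm_eps"
  proof (rule extensionalityI[of _ "carrier KK"])
    fix k assume "k \<in> carrier KK"
    then obtain c where c: "c \<in> carrier Q" "k = lm c" unfolding compact_carrier by blast
    obtain x y where xy: "x \<in> carrier Q" "y \<in> carrier Q" "c = y \<otimes>\<^bsub>Q\<^esub> star Q x" by (rule product_star[OF c(1)])
    have "e (ketbra Q Fm y x) = ip Em (star Q y) (star Q x)" using e xy by simp
    then show "e k = lm_eps k" using c xy by (simp add: ketbra_lm v lm_eps_lm del: Em_simps(6))
  qed (use e in \<open>simp_all add: lm_eps_def\<close>)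
qed

theorem Frob_isomorphic: "frobenius_isomorphic A C (Frob A Q Fm Em (star Q))"
proof -
  let ?D = "Frob A Q Fm Em (star Q)"
  have "eps ?D = lm_eps"
    unfolding Frob_eps[symmetric] by (simp add: Frob_def Let_def hF_def[abs_def])
  moreover have "alg ?D = KK" "eta ?D = hF" by (simp_all add: Frob_def Let_def hF_def[abs_def])
  ultimately have D: "alg ?D = KK" "eta ?D = hF" "eps ?D = lm_eps" by simp_all
  show ?thesis unfolding frobenius_isomorphic_def
  proof (intro exI[of _ lm] conjI ballI)
    show "bij_betw lm (carrier Q) (carrier (alg ?D))"
      unfolding D compact_carrier using lm_inj by (rule inj_on_imp_bij_betw)
    show "star_hom Q (alg ?D) lm"
      unfolding D star_hom_def linear_map_def compact_carrier by (auto simp: lm_KK)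
    show "eps ?D (lm c) = eps C c" if "c \<in> carrier Q" for c unfolding D by (rule lm_eps_lm[OF that])
    fix a c assume "a \<in> carrier A" "c \<in> carrier Q"
    then show "lm (left_mult C a c) = left_mult ?D a (lm c)" "lm (right_mult C c a) = right_mult ?D (lm c) a"
      using hF_lm[of a c] D(2) by (simp_all add: left_mult_def[of ?D] right_mult_def[of ?D])
  qed
qed

end

theorem theorem4p2:
  fixes A :: "'a cstar" and C :: "('a, 'c) frobenius"
  assumes "cstar_algebra A" and "frobenius_cstar_algebra A C"
  shows "\<exists>(B :: 'c cstar) (F :: ('a, 'c, 'c) corr) (E :: ('c, 'a, 'c) corr) (\<phi> :: 'c \<Rightarrow> 'c).
    local_adjunction A B F E \<phi> \<and> frobenius_isomorphic A C (Frob A B F E \<phi>)"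
proof -
  interpret frobenius_data A C by (rule frobenius_data.intro) (rule assms(2))
  show ?thesis using local_adjunction_star Frob_isomorphic by blast
qed

end
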